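(* Let $(M,g)$ be a noncompact cohomogeneity-one fiberwise Kähler toric manifold defined on the interval $x\in[0,\infty)$ such that $b_i\ge0$ for all $i$ and only the $S^1$-fibre collapses at the special orbit $x=0$ (so that $M$ is a complex line bundle). Every such manifold admits a scalar-flat metric (scalar curvature $S=0$) as well as a negative scalar curvature metric ($S=-1$) for every value of $a_i>0$. That is, each such manifold admits an $m$-parameter family of scalar-flat metrics and an $m$-parameter family of metrics with scalar curvature equal to $-1$.
   Context: A fiberwise Kähler toric manifold of cohomogeneity one is a Kähler manifold $(M,g,J)$ of one of two kinds. (Construction One) $M$ is irreducible, not hyperkähler, and of cohomogeneity one (principal orbits of real codimension one) under an isometric action of a compact connected semisimple Lie group $G$ with principal isotropy group $K$; the moment map sends each principal orbit $G/K$ onto a coadjoint orbit $G/L$ with $L/K\cong S^1$, and the isotropy representation of $G/K$ is $\mathfrak t^1\oplus\mathfrak p_1\oplus\dots\oplus\mathfrak p_m$ with $\mathfrak t^1$ trivial one-dimensional and $\mathfrak p_i$ nontrivial, irreducible, pairwise inequivalent, of real dimension $d_i$; $g_i^*$ denotes an invariant background inner product on $\mathfrak p_i$ normalized so that the Ricci tensor $r^*$ of the induced Kähler metric on $G/L$ satisfies $r^*(Y,Y)=1$ for unit $Y\in\mathfrak p_i$. (Construction Two) $(M_i,g_i^* )$, $1\le i\le m$, are compact Kähler–Einstein manifolds of real dimension $d_i$ with Einstein constant $1$ and Kähler forms $\omega_i^*$, and each principal orbit is a principal $S^1$-bundle $\pi:P\to M_1\times\dots\times M_m$ with connection form $\theta$,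 $d\theta=\pi^*\sum_i b_i\omega_i^*$. In both cases, on the open dense union of principal orbits, parametrized by $x$ in an open interval (here $(0,\infty)$), $$g=\frac1{h}\,dx^2+h\,\theta\otimes\theta+\sum_{i=1}^m A_i\,g_i^*,\qquad h=h(x)>0,\quad A_i=b_ix+a_i>0,$$ with $\theta$ dual to the generator $\partial_\phi$ of the $S^1$-fibres, $J$ mapping the $x$-direction to the $\partial_\phi$-direction and restricting to the lifted complex structure of the base. The constants $b_i$ (not all zero) are determined by the principal orbit type, hence fixed for the given manifold, while the $a_i$ and $h$ vary with the metric. $M$ is obtained by adding a special orbit at $x=0$ where the $S^1$-fibre collapses and all $A_i(0)=a_i>0$; there $h(0)=0$, $h'(0)=2$. The metrics asserted are of this same form.
   Formalization: In Construction One the values a_i>0 are restricted to those with Σ a_i ω_i^* closed on G/L; otherwise no metric of the stated form is Kähler (for SU(3)/T² closedness forces 2a_3=a_1+a_2), so the family there can have fewer than m parameters. *)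

theory Defs
  imports "HOL-Analysis.Analysis" "HOL-Algebra.Group_Action"
begin

section \<open>Smooth manifolds\<close>

text \<open>Charts take values in \<open>Euclidean_space n\<close>, i.e. in sequences vanishing from index \<open>n\<close> on,
  so that the dimension is a term and may differ between members of a family of manifolds.\<close>

definition partial_deriv :: "nat \<Rightarrow> ((nat \<Rightarrow> real) \<Rightarrow> real) \<Rightarrow> (nat \<Rightarrow> real) \<Rightarrow> real" where
  "partial_deriv i f y = deriv (\<lambda>t. f (y(i := y i + t))) 0"

fun Ck_on :: "nat \<Rightarrow> nat \<Rightarrow> (nat \<Rightarrow> real) set \<Rightarrow> ((nat \<Rightarrow> real) \<Rightarrow> real) \<Rightarrow> bool" where
  "Ck_on n 0 S f \<longleftrightarrow> continuous_map (subtopology (Euclidean_space n) S) euclideanreal f"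
| "Ck_on n (Suc k) S f \<longleftrightarrow>
     continuous_map (subtopology (Euclidean_space n) S) euclideanreal f \<and>
     (\<forall>i<n. (\<forall>y\<in>S. (\<lambda>t. f (y(i := y i + t))) differentiable (at 0)) \<and>
            Ck_on n k S (partial_deriv i f))"

definition Cinf_on :: "nat \<Rightarrow> (nat \<Rightarrow> real) set \<Rightarrow> ((nat \<Rightarrow> real) \<Rightarrow> real) \<Rightarrow> bool" where
  "Cinf_on n S f \<longleftrightarrow> (\<forall>k. Ck_on n k S f)"

type_synonym 'a chart = "'a set \<times> ('a \<Rightarrow> nat \<Rightarrow> real)"

record 'a mfd =
  mtop :: "'a topology"
  mdim :: nat
  atlas :: "'a chart set"

abbreviation pts :: "'a mfd \<Rightarrow> 'a set" where
  "pts X \<equiv> topspace (mtop X)"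

definition chart_inv :: "'a chart \<Rightarrow> (nat \<Rightarrow> real) \<Rightarrow> 'a" where
  "chart_inv c = inv_into (fst c) (snd c)"

definition smooth_fun :: "'a mfd \<Rightarrow> 'a set \<Rightarrow> ('a \<Rightarrow> real) \<Rightarrow> bool" where
  "smooth_fun X W f \<longleftrightarrow>
     (\<forall>c\<in>atlas X. Cinf_on (mdim X) (snd c ` (W \<inter> fst c)) (\<lambda>y. f (chart_inv c y)))"

definition manifold :: "'a mfd \<Rightarrow> bool" where
  "manifold X \<longleftrightarrow>
     Hausdorff_space (mtop X) \<and> second_countable (mtop X) \<and>
     (\<Union>c\<in>atlas X. fst c) = pts X \<and>
     (\<forall>(U, \<phi>)\<in>atlas X.
        openin (mtop X) U \<and> openin (Euclidean_space (mdim X)) (\<phi> ` U) \<and>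
        homeomorphic_map (subtopology (mtop X) U)
          (subtopology (Euclidean_space (mdim X)) (\<phi> ` U)) \<phi> \<and>
        (\<forall>i<mdim X. smooth_fun X U (\<lambda>p. \<phi> p i)))"

definition smooth_at :: "'a mfd \<Rightarrow> 'a \<Rightarrow> ('a \<Rightarrow> real) \<Rightarrow> bool" where
  "smooth_at X p f \<longleftrightarrow> (\<exists>W. openin (mtop X) W \<and> p \<in> W \<and> smooth_fun X W f)"

definition smooth_map :: "'a mfd \<Rightarrow> 'b mfd \<Rightarrow> ('a \<Rightarrow> 'b) \<Rightarrow> bool" where
  "smooth_map X Y F \<longleftrightarrow>
     continuous_map (mtop X) (mtop Y) F \<and>
     (\<forall>(V, \<psi>)\<in>atlas Y. \<forall>i<mdim Y. smooth_fun X {p \<in> pts X. F p \<in> V} (\<lambda>p. \<psi> (F p) i))"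

definition real_mfd :: "real mfd" where
  "real_mfd = \<lparr>mtop = euclideanreal, mdim = 1,
               atlas = {(UNIV, \<lambda>t i. if i = 0 then t else 0)}\<rparr>"

definition prod_mfd :: "'a mfd \<Rightarrow> 'b mfd \<Rightarrow> ('a \<times> 'b) mfd" where
  "prod_mfd X Y = \<lparr>mtop = prod_topology (mtop X) (mtop Y), mdim = mdim X + mdim Y,
     atlas = (\<lambda>(c, e). (fst c \<times> fst e,
                \<lambda>(p, q) i. if i < mdim X then snd c p i else snd e q (i - mdim X)))
             ` (atlas X \<times> atlas Y)\<rparr>"


section \<open>Tangent vectors and tensors\<close>

text \<open>Tangent vectors are derivations of germs. Being functions on all of \<open>'a \<Rightarrow> real\<close>, they are
  normalised to vanish on functions that are not smooth near the point. In particular the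
  differential of a smooth real function \<open>f\<close>, applied to \<open>v\<close>, is \<open>v f\<close>.\<close>

type_synonym 'a vect = "('a \<Rightarrow> real) \<Rightarrow> real"

definition vadd :: "'a vect \<Rightarrow> 'a vect \<Rightarrow> 'a vect" where
  "vadd v w = (\<lambda>f. v f + w f)"

definition vscale :: "real \<Rightarrow> 'a vect \<Rightarrow> 'a vect" where
  "vscale r v = (\<lambda>f. r * v f)"

definition vzero :: "'a vect" where
  "vzero = (\<lambda>f. 0)"

definition vsum :: "nat \<Rightarrow> (nat \<Rightarrow> 'a vect) \<Rightarrow> 'a vect" where
  "vsum n w = (\<lambda>f. \<Sum>i<n. w i f)"

definition tangent :: "'a mfd \<Rightarrow> 'a \<Rightarrow> 'a vect set" where
  "tangent X p =
     {v. (\<forall>f. \<not> smooth_at X p f \<longrightarrow> v f = 0) \<and>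
         (\<forall>f g. smooth_at X p f \<longrightarrow> smooth_at X p g \<longrightarrow>
            v (\<lambda>q. f q + g q) = v f + v g \<and>
            v (\<lambda>q. f q * g q) = v f * g p + f p * v g) \<and>
         (\<forall>f r. smooth_at X p f \<longrightarrow> v (\<lambda>q. r * f q) = r * v f)}"

text \<open>\<open>push Y F p v\<close> is the image of \<open>v\<close> under the differential at \<open>p\<close> of a map \<open>F\<close> into \<open>Y\<close>.\<close>

definition push :: "'b mfd \<Rightarrow> ('a \<Rightarrow> 'b) \<Rightarrow> 'a \<Rightarrow> 'a vect \<Rightarrow> 'b vect" where
  "push Y F p v = (\<lambda>f. if smooth_at Y (F p) f then v (\<lambda>q. f (F q)) else 0)"

definition velocity :: "'a mfd \<Rightarrow> (real \<Rightarrow> 'a) \<Rightarrow> real \<Rightarrow> 'a vect" where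
  "velocity X c t = (\<lambda>f. if smooth_at X (c t) f then deriv (\<lambda>s. f (c s)) t else 0)"

definition coord_vect :: "'a mfd \<Rightarrow> 'a chart \<Rightarrow> nat \<Rightarrow> 'a \<Rightarrow> 'a vect" where
  "coord_vect X c i p =
     (\<lambda>f. if smooth_at X p f then partial_deriv i (\<lambda>y. f (chart_inv c y)) (snd c p) else 0)"

definition vcoord :: "'a chart \<Rightarrow> nat \<Rightarrow> 'a vect \<Rightarrow> real" where
  "vcoord c k v = v (\<lambda>q. snd c q k)"

definition subspace_of :: "'a vect set \<Rightarrow> 'a vect set \<Rightarrow> bool" where
  "subspace_of V W \<longleftrightarrow> W \<subseteq> V \<and> vzero \<in> W \<and>
     (\<forall>v\<in>W. \<forall>w\<in>W. vadd v w \<in> W) \<and> (\<forall>v\<in>W. \<forall>r. vscale r v \<in> W)"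

definition has_dim :: "'a vect set \<Rightarrow> nat \<Rightarrow> bool" where
  "has_dim V d \<longleftrightarrow>
     (\<exists>e. V = {vsum d (\<lambda>i. vscale (c i) (e i)) | c. True} \<and>
          (\<forall>c. vsum d (\<lambda>i. vscale (c i) (e i)) = vzero \<longrightarrow> (\<forall>i<d. c i = 0)))"

definition linear_fun :: "'a vect set \<Rightarrow> ('a vect \<Rightarrow> real) \<Rightarrow> bool" where
  "linear_fun V f \<longleftrightarrow> (\<forall>v\<in>V. \<forall>w\<in>V. f (vadd v w) = f v + f w) \<and> (\<forall>v\<in>V. \<forall>r. f (vscale r v) = r * f v)"

definition linear_vmap :: "'a vect set \<Rightarrow> 'b vect set \<Rightarrow> ('a vect \<Rightarrow> 'b vect) \<Rightarrow> bool" where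
  "linear_vmap V W F \<longleftrightarrow> F ` V \<subseteq> W \<and>
     (\<forall>v\<in>V. \<forall>w\<in>V. F (vadd v w) = vadd (F v) (F w)) \<and> (\<forall>v\<in>V. \<forall>r. F (vscale r v) = vscale r (F v))"

type_synonym 'a tensor2 = "'a \<Rightarrow> 'a vect \<Rightarrow> 'a vect \<Rightarrow> real"
type_synonym 'a endo = "'a \<Rightarrow> 'a vect \<Rightarrow> 'a vect"

definition comp2 :: "'a mfd \<Rightarrow> 'a tensor2 \<Rightarrow> 'a chart \<Rightarrow> nat \<Rightarrow> nat \<Rightarrow> (nat \<Rightarrow> real) \<Rightarrow> real" where
  "comp2 X w c i j y =
     (let p = chart_inv c y in w p (coord_vect X c i p) (coord_vect X c j p))"

definition endo_comp :: "'a mfd \<Rightarrow> 'a endo \<Rightarrow> 'a chart \<Rightarrow> nat \<Rightarrow> nat \<Rightarrow> (nat \<Rightarrow> real) \<Rightarrow> real" where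
  "endo_comp X E c k i y = (let p = chart_inv c y in vcoord c k (E p (coord_vect X c i p)))"

definition bilinear_tensor :: "'a mfd \<Rightarrow> 'a tensor2 \<Rightarrow> bool" where
  "bilinear_tensor X w \<longleftrightarrow>
     (\<forall>p\<in>pts X. \<forall>u\<in>tangent X p. linear_fun (tangent X p) (w p u) \<and>
                               linear_fun (tangent X p) (\<lambda>v. w p v u)) \<and>
     (\<forall>c\<in>atlas X. \<forall>i<mdim X. \<forall>j<mdim X. Cinf_on (mdim X) (snd c ` fst c) (comp2 X w c i j))"

definition symmetric_psd :: "'a mfd \<Rightarrow> 'a tensor2 \<Rightarrow> bool" where
  "symmetric_psd X w \<longleftrightarrow> bilinear_tensor X w \<and>
     (\<forall>p\<in>pts X. \<forall>u\<in>tangent X p. \<forall>v\<in>tangent X p. w p u v = w p v u \<and> 0 \<le> w p u u)"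

definition riemannian :: "'a mfd \<Rightarrow> 'a tensor2 \<Rightarrow> bool" where
  "riemannian X g \<longleftrightarrow> symmetric_psd X g \<and>
     (\<forall>p\<in>pts X. \<forall>v\<in>tangent X p. v \<noteq> vzero \<longrightarrow> 0 < g p v v)"

definition endo_tensor :: "'a mfd \<Rightarrow> 'a endo \<Rightarrow> bool" where
  "endo_tensor X E \<longleftrightarrow>
     (\<forall>p\<in>pts X. linear_vmap (tangent X p) (tangent X p) (E p)) \<and>
     (\<forall>c\<in>atlas X. \<forall>k<mdim X. \<forall>i<mdim X. Cinf_on (mdim X) (snd c ` fst c) (endo_comp X E c k i))"

definition almost_complex :: "'a mfd \<Rightarrow> 'a endo \<Rightarrow> bool" where
  "almost_complex X J \<longleftrightarrow> endo_tensor X J \<and>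
     (\<forall>p\<in>pts X. \<forall>v\<in>tangent X p. J p (J p v) = vscale (-1) v)"

definition orthogonal_endo :: "'a mfd \<Rightarrow> 'a tensor2 \<Rightarrow> 'a endo \<Rightarrow> bool" where
  "orthogonal_endo X g E \<longleftrightarrow>
     (\<forall>p\<in>pts X. \<forall>u\<in>tangent X p. \<forall>v\<in>tangent X p. g p (E p u) (E p v) = g p u v)"

definition closed_2form :: "'a mfd \<Rightarrow> 'a tensor2 \<Rightarrow> bool" where
  "closed_2form X w \<longleftrightarrow>
     (\<forall>c\<in>atlas X. \<forall>y\<in>snd c ` fst c. \<forall>i<mdim X. \<forall>j<mdim X. \<forall>k<mdim X.
        partial_deriv i (comp2 X w c j k) y + partial_deriv j (comp2 X w c k i) y
          + partial_deriv k (comp2 X w c i j) y = 0)"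


section \<open>Curvature\<close>

definition mat_inverse :: "nat \<Rightarrow> (nat \<Rightarrow> nat \<Rightarrow> real) \<Rightarrow> nat \<Rightarrow> nat \<Rightarrow> real" where
  "mat_inverse n A =
     (SOME B. \<forall>i<n. \<forall>j<n. (\<Sum>k<n. A i k * B k j) = (if i = j then 1 else 0))"

text \<open>\<open>christoffel X g c k i j\<close> is $\Gamma^k_{ij}$ in the chart \<open>c\<close>.\<close>

definition christoffel ::
  "'a mfd \<Rightarrow> 'a tensor2 \<Rightarrow> 'a chart \<Rightarrow> nat \<Rightarrow> nat \<Rightarrow> nat \<Rightarrow> (nat \<Rightarrow> real) \<Rightarrow> real" where
  "christoffel X g c k i j y =
     (\<Sum>l<mdim X. mat_inverse (mdim X) (\<lambda>a b. comp2 X g c a b y) k l *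
        (partial_deriv i (comp2 X g c j l) y + partial_deriv j (comp2 X g c i l) y
           - partial_deriv l (comp2 X g c i j) y)) / 2"

definition ricci_comp ::
  "'a mfd \<Rightarrow> 'a tensor2 \<Rightarrow> 'a chart \<Rightarrow> nat \<Rightarrow> nat \<Rightarrow> (nat \<Rightarrow> real) \<Rightarrow> real" where
  "ricci_comp X g c j k y =
     (let n = mdim X; \<Gamma> = christoffel X g c in
        \<Sum>i<n. partial_deriv i (\<Gamma> i j k) y - partial_deriv j (\<Gamma> i i k) y
              + (\<Sum>l<n. \<Gamma> i i l y * \<Gamma> l j k y - \<Gamma> i j l y * \<Gamma> l i k y))"

definition ricci :: "'a mfd \<Rightarrow> 'a tensor2 \<Rightarrow> 'a chart \<Rightarrow> 'a tensor2" where
  "ricci X g c p v w =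
     (\<Sum>j<mdim X. \<Sum>k<mdim X. ricci_comp X g c j k (snd c p) * vcoord c j v * vcoord c k w)"

definition scalar_curvature_is :: "'a mfd \<Rightarrow> 'a tensor2 \<Rightarrow> real \<Rightarrow> bool" where
  "scalar_curvature_is X g S \<longleftrightarrow>
     (\<forall>c\<in>atlas X. \<forall>y\<in>snd c ` fst c.
        (\<Sum>j<mdim X. \<Sum>k<mdim X.
           mat_inverse (mdim X) (\<lambda>a b. comp2 X g c a b y) j k * ricci_comp X g c j k y) = S)"

definition einstein :: "'a mfd \<Rightarrow> 'a tensor2 \<Rightarrow> real \<Rightarrow> bool" where
  "einstein X g lam \<longleftrightarrow>
     (\<forall>c\<in>atlas X. \<forall>p\<in>fst c. \<forall>v\<in>tangent X p. \<forall>w\<in>tangent X p. ricci X g c p v w = lam * g p v w)"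

definition parallel_endo :: "'a mfd \<Rightarrow> 'a tensor2 \<Rightarrow> 'a endo \<Rightarrow> bool" where
  "parallel_endo X g E \<longleftrightarrow>
     (\<forall>c\<in>atlas X. \<forall>y\<in>snd c ` fst c. \<forall>i<mdim X. \<forall>j<mdim X. \<forall>k<mdim X.
        partial_deriv i (endo_comp X E c k j) y
          + (\<Sum>l<mdim X. christoffel X g c k i l y * endo_comp X E c l j y
                        - christoffel X g c l i j y * endo_comp X E c k l y) = 0)"

definition kahler :: "'a mfd \<Rightarrow> 'a tensor2 \<Rightarrow> 'a endo \<Rightarrow> bool" where
  "kahler X g J \<longleftrightarrow> manifold X \<and> riemannian X g \<and>
     almost_complex X J \<and> orthogonal_endo X g J \<and> parallel_endo X g J"

text \<open>With this sign, $\omega(\partial_x,\partial_\phi)=1$ in the metrics considered below.\<close>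

definition kahler_form :: "'a tensor2 \<Rightarrow> 'a endo \<Rightarrow> 'a tensor2" where
  "kahler_form g J = (\<lambda>p u v. g p (J p u) v)"

definition hyperkahler :: "'a mfd \<Rightarrow> 'a tensor2 \<Rightarrow> bool" where
  "hyperkahler X g \<longleftrightarrow>
     (\<exists>I J K. kahler X g I \<and> kahler X g J \<and> kahler X g K \<and>
        (\<forall>p\<in>pts X. \<forall>v\<in>tangent X p. I p (J p v) = K p v \<and> J p (I p v) = vscale (-1) (K p v)))"

definition parallel_along :: "'a mfd \<Rightarrow> 'a tensor2 \<Rightarrow> (real \<Rightarrow> 'a) \<Rightarrow> (real \<Rightarrow> 'a vect) \<Rightarrow> bool" where
  "parallel_along X g \<gamma> V \<longleftrightarrow> smooth_map real_mfd X \<gamma> \<and>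
     (\<forall>t. V t \<in> tangent X (\<gamma> t)) \<and>
     (\<forall>c\<in>atlas X. \<forall>t. \<gamma> t \<in> fst c \<longrightarrow> (\<forall>k<mdim X.
        ((\<lambda>s. vcoord c k (V s)) has_real_derivative
           - (\<Sum>i<mdim X. \<Sum>j<mdim X. christoffel X g c k i j (snd c (\<gamma> t)) *
                vcoord c i (velocity X \<gamma> t) * vcoord c j (V t))) (at t)))"

text \<open>Parallel transport along piecewise smooth paths.\<close>

inductive par_transport :: "'a mfd \<Rightarrow> 'a tensor2 \<Rightarrow> 'a \<Rightarrow> 'a vect \<Rightarrow> 'a \<Rightarrow> 'a vect \<Rightarrow> bool"
  for X g where
  smooth_path: "parallel_along X g \<gamma> V \<Longrightarrow> par_transport X g (\<gamma> 0) (V 0) (\<gamma> 1) (V 1)"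
| concat: "par_transport X g p u q v \<Longrightarrow> par_transport X g q v r w \<Longrightarrow> par_transport X g p u r w"

definition holonomy_irreducible :: "'a mfd \<Rightarrow> 'a tensor2 \<Rightarrow> bool" where
  "holonomy_irreducible X g \<longleftrightarrow>
     (\<forall>p\<in>pts X. \<forall>W. subspace_of (tangent X p) W \<and>
        (\<forall>v\<in>W. \<forall>w. par_transport X g p v p w \<longrightarrow> w \<in> W) \<longrightarrow> W = {vzero} \<or> W = tangent X p)"


section \<open>Lie groups and smooth actions\<close>

definition lie_group :: "'g mfd \<Rightarrow> 'g monoid \<Rightarrow> bool" where
  "lie_group X G \<longleftrightarrow> manifold X \<and> group G \<and> carrier G = pts X \<and>
     smooth_map (prod_mfd X X) X (\<lambda>(a, b). a \<otimes>\<^bsub>G\<^esub> b) \<and> smooth_map X X (\<lambda>a. inv\<^bsub>G\<^esub> a)"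

text \<open>The commutator at the identity of the left-invariant extensions of \<open>u\<close> and \<open>v\<close>.\<close>

definition lie_bracket :: "'g mfd \<Rightarrow> 'g monoid \<Rightarrow> 'g vect \<Rightarrow> 'g vect \<Rightarrow> 'g vect" where
  "lie_bracket X G u v =
     (\<lambda>f. if smooth_at X \<one>\<^bsub>G\<^esub> f
          then u (\<lambda>a. v (\<lambda>b. f (a \<otimes>\<^bsub>G\<^esub> b))) - v (\<lambda>a. u (\<lambda>b. f (a \<otimes>\<^bsub>G\<^esub> b))) else 0)"

definition semisimple :: "'g mfd \<Rightarrow> 'g monoid \<Rightarrow> bool" where
  "semisimple X G \<longleftrightarrow>
     (\<forall>I. subspace_of (tangent X \<one>\<^bsub>G\<^esub>) I \<and>
          (\<forall>u\<in>tangent X \<one>\<^bsub>G\<^esub>. \<forall>v\<in>I. lie_bracket X G u v \<in> I) \<and>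
          (\<forall>u\<in>I. \<forall>v\<in>I. lie_bracket X G u v = vzero) \<longrightarrow> I = {vzero})"

definition Ad :: "'g mfd \<Rightarrow> 'g monoid \<Rightarrow> 'g \<Rightarrow> 'g vect \<Rightarrow> 'g vect" where
  "Ad X G k = push X (\<lambda>a. k \<otimes>\<^bsub>G\<^esub> a \<otimes>\<^bsub>G\<^esub> inv\<^bsub>G\<^esub> k) \<one>\<^bsub>G\<^esub>"

definition smooth_action :: "'g mfd \<Rightarrow> 'g monoid \<Rightarrow> 'a mfd \<Rightarrow> ('g \<Rightarrow> 'a \<Rightarrow> 'a) \<Rightarrow> bool" where
  "smooth_action X G Y act \<longleftrightarrow>
     group_action G (pts Y) act \<and> smooth_map (prod_mfd X Y) Y (\<lambda>(k, p). act k p)"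

definition fundamental :: "'g monoid \<Rightarrow> 'a mfd \<Rightarrow> ('g \<Rightarrow> 'a \<Rightarrow> 'a) \<Rightarrow> 'g vect \<Rightarrow> 'a \<Rightarrow> 'a vect" where
  "fundamental G Y act u p = push Y (\<lambda>k. act k p) \<one>\<^bsub>G\<^esub> u"

definition invariant_tensor :: "'g monoid \<Rightarrow> 'a mfd \<Rightarrow> ('g \<Rightarrow> 'a \<Rightarrow> 'a) \<Rightarrow> 'a tensor2 \<Rightarrow> bool" where
  "invariant_tensor G Y act g \<longleftrightarrow>
     (\<forall>k\<in>carrier G. \<forall>p\<in>pts Y. \<forall>v\<in>tangent Y p. \<forall>w\<in>tangent Y p.
        g (act k p) (push Y (act k) p v) (push Y (act k) p w) = g p v w)"

definition invariant_endo :: "'g monoid \<Rightarrow> 'a mfd \<Rightarrow> ('g \<Rightarrow> 'a \<Rightarrow> 'a) \<Rightarrow> 'a endo \<Rightarrow> bool" where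
  "invariant_endo G Y act E \<longleftrightarrow>
     (\<forall>k\<in>carrier G. \<forall>p\<in>pts Y. \<forall>v\<in>tangent Y p.
        E (act k p) (push Y (act k) p v) = push Y (act k) p (E p v))"


section \<open>Fiberwise Kaehler toric manifolds of cohomogeneity one\<close>

text \<open>
  The metric-independent data of a manifold in which the circle fibre, and nothing else, collapses
  at \<open>x = 0\<close>. The circle acts as $\mathbb R/2\pi\mathbb Z$ through \<open>rot\<close>; \<open>proj\<close> restricted to each
  principal orbit \<open>x = s\<close> is the principal circle bundle onto the base ($G/L$ or
  $M_1\times\dots\times M_m$), and restricted to the special orbit \<open>x = 0\<close> it is a bijection. The
  indices $1,\dots,m$ become \<open>0,\<dots>,m-1\<close>.
  \<open>bg i\<close> is $g_i^*$ as a semidefinite tensor on the base (zero on the other summands of the tangent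
  space), and \<open>base_J\<close> is the complex structure of the base.
\<close>

record ('m, 'b) toric_data =
  total :: "'m mfd"
  base :: "'b mfd"
  xcoord :: "'m \<Rightarrow> real"
  rot :: "real \<Rightarrow> 'm \<Rightarrow> 'm"
  proj :: "'m \<Rightarrow> 'b"
  conn :: "'m \<Rightarrow> 'm vect \<Rightarrow> real"
  num :: nat
  dims :: "nat \<Rightarrow> nat"
  slope :: "nat \<Rightarrow> real"
  bg :: "nat \<Rightarrow> 'b tensor2"
  base_J :: "'b endo"

definition principal_part :: "('m, 'b) toric_data \<Rightarrow> 'm set" where
  "principal_part D = {p \<in> pts (total D). 0 < xcoord D p}"

definition d_phi :: "('m, 'b) toric_data \<Rightarrow> 'm \<Rightarrow> 'm vect" where
  "d_phi D p = velocity (total D) (\<lambda>t. rot D t p) 0"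

definition d_proj :: "('m, 'b) toric_data \<Rightarrow> 'm \<Rightarrow> 'm vect \<Rightarrow> 'b vect" where
  "d_proj D p = push (base D) (proj D) p"

definition base_summand :: "('m, 'b) toric_data \<Rightarrow> nat \<Rightarrow> 'b \<Rightarrow> 'b vect set" where
  "base_summand D i q =
     {v \<in> tangent (base D) q. \<forall>j<num D. j \<noteq> i \<longrightarrow> bg D j q v v = 0}"

definition base_metric :: "('m, 'b) toric_data \<Rightarrow> (nat \<Rightarrow> real) \<Rightarrow> 'b tensor2" where
  "base_metric D A = (\<lambda>q v w. \<Sum>i<num D. A i * bg D i q v w)"

definition base_form :: "('m, 'b) toric_data \<Rightarrow> (nat \<Rightarrow> real) \<Rightarrow> 'b tensor2" where
  "base_form D A = kahler_form (base_metric D A) (base_J D)"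

definition base_structure :: "('m, 'b) toric_data \<Rightarrow> bool" where
  "base_structure D \<longleftrightarrow>
     manifold (base D) \<and> mdim (base D) = (\<Sum>i<num D. dims D i) \<and>
     almost_complex (base D) (base_J D) \<and>
     (\<forall>i<num D. 0 < dims D i \<and> symmetric_psd (base D) (bg D i) \<and>
                orthogonal_endo (base D) (bg D i) (base_J D)) \<and>
     (\<forall>q\<in>pts (base D).
        (\<forall>i<num D. has_dim (base_summand D i q) (dims D i)) \<and>
        (\<forall>v\<in>tangent (base D) q. (\<forall>i<num D. bg D i q v v = 0) \<longrightarrow> v = vzero) \<and>
        (\<forall>v\<in>tangent (base D) q. \<exists>w. (\<forall>i<num D. w i \<in> base_summand D i q) \<and> v = vsum (num D) w))"

definition circle_fibration :: "('m, 'b) toric_data \<Rightarrow> bool" where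
  "circle_fibration D \<longleftrightarrow>
     (let M = total D; x = xcoord D; R = rot D; \<pi> = proj D in
        manifold M \<and> connected_space (mtop M) \<and> mdim M = 2 + (\<Sum>i<num D. dims D i) \<and>
        smooth_fun M (pts M) x \<and> x ` pts M = {0..} \<and>
        mtop M closure_of principal_part D = pts M \<and>
        smooth_map (prod_mfd real_mfd M) M (\<lambda>(t, p). R t p) \<and>
        (\<forall>p\<in>pts M. R 0 p = p \<and>
           (\<forall>s t. R (s + t) p = R s (R t p) \<and> x (R t p) = x p \<and> \<pi> (R t p) = \<pi> p)) \<and>
        (\<forall>p\<in>principal_part D. \<forall>t. R t p = p \<longleftrightarrow> (\<exists>k::int. t = 2 * pi * of_int k)) \<and>
        (\<forall>p\<in>pts M. x p = 0 \<longrightarrow> (\<forall>t. R t p = p)) \<and>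
        smooth_map M (base D) \<pi> \<and>
        (\<forall>s\<ge>0. \<forall>q\<in>pts (base D). \<exists>p\<in>pts M. x p = s \<and> \<pi> p = q) \<and>
        (\<forall>p\<in>pts M. \<forall>p'\<in>pts M. x p = x p' \<and> \<pi> p = \<pi> p' \<longrightarrow> (\<exists>t. p' = R t p)))"

text \<open>The last clause is $d\theta=\pi^*\sum_i b_i\omega_i^*$.\<close>

definition connection_form :: "('m, 'b) toric_data \<Rightarrow> bool" where
  "connection_form D \<longleftrightarrow>
     (let M = total D; n = mdim M in
        (\<forall>p\<in>principal_part D. linear_fun (tangent M p) (conn D p) \<and> conn D p (d_phi D p) = 1) \<and>
        (\<forall>c\<in>atlas M.
           let S = snd c ` (fst c \<inter> principal_part D);
               \<theta> = (\<lambda>i y. conn D (chart_inv c y) (coord_vect M c i (chart_inv c y)))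
           in (\<forall>i<n. Cinf_on n S (\<theta> i)) \<and>
              (\<forall>y\<in>S. \<forall>i<n. \<forall>j<n.
                 partial_deriv i (\<theta> j) y - partial_deriv j (\<theta> i) y =
                 (let p = chart_inv c y in
                    base_form D (slope D) (proj D p)
                      (d_proj D p (coord_vect M c i p)) (d_proj D p (coord_vect M c j p))))))"

definition toric_bundle :: "('m, 'b) toric_data \<Rightarrow> bool" where
  "toric_bundle D \<longleftrightarrow> base_structure D \<and> circle_fibration D \<and> connection_form D \<and>
     (\<exists>i<num D. slope D i \<noteq> 0)"

definition warp :: "('m, 'b) toric_data \<Rightarrow> (nat \<Rightarrow> real) \<Rightarrow> real \<Rightarrow> nat \<Rightarrow> real" where
  "warp D a s i = slope D i * s + a i"

text \<open>
  The normal form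
  $g=\frac1h\,dx^2+h\,\theta^2+\sum_i A_i g_i^*$ on the principal part. Since $\partial_x$ and
  $\partial_\phi$ have lengths $h^{-1/2}$ and $h^{1/2}$, the complex structure has
  $J\partial_x=\frac1h\partial_\phi$; the three equations for \<open>J\<close> are the resulting ones for the
  components $dx$, $\theta$ and $d\pi$ of \<open>J v\<close>. Hence \<open>J\<close> depends on \<open>h\<close>.
\<close>

definition normal_form ::
  "('m, 'b) toric_data \<Rightarrow> (nat \<Rightarrow> real) \<Rightarrow> (real \<Rightarrow> real) \<Rightarrow> 'm tensor2 \<Rightarrow> 'm endo \<Rightarrow> bool" where
  "normal_form D a h g J \<longleftrightarrow>
     (\<exists>H. smooth_fun real_mfd UNIV H \<and> (\<forall>s\<ge>0. H s = h s)) \<and>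
     h 0 = 0 \<and> (h has_real_derivative 2) (at 0 within {0..}) \<and> (\<forall>s>0. 0 < h s) \<and>
     (\<forall>s\<ge>0. \<forall>i<num D. 0 < warp D a s i) \<and>
     (\<forall>p\<in>principal_part D. \<forall>v\<in>tangent (total D) p.
        let x = xcoord D; s = x p; \<theta> = conn D p; \<pi>' = d_proj D p; q = proj D p in
          (\<forall>w\<in>tangent (total D) p.
             g p v w = v x * w x / h s + h s * \<theta> v * \<theta> w
                        + base_metric D (warp D a s) q (\<pi>' v) (\<pi>' w)) \<and>
          (J p v) x = - h s * \<theta> v \<and> \<theta> (J p v) = v x / h s \<and>
          \<pi>' (J p v) = base_J D q (\<pi>' v))"


subsection \<open>Construction One\<close>

record ('g, 'm, 'b) group_data =
  lie_mfd :: "'g mfd"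
  grp :: "'g monoid"
  act :: "'g \<Rightarrow> 'm \<Rightarrow> 'm"
  base_act :: "'g \<Rightarrow> 'b \<Rightarrow> 'b"

text \<open>The summand $\mathfrak p_i$ of the isotropy representation, realised in the tangent space of
  the orbit $G/K$ through \<open>p\<close>, on which the isotropy group of \<open>p\<close> acts by differentials.\<close>

definition isotropy_summand :: "('m, 'b) toric_data \<Rightarrow> nat \<Rightarrow> 'm \<Rightarrow> 'm vect set" where
  "isotropy_summand D i p =
     {v \<in> tangent (total D) p. v (xcoord D) = 0 \<and> conn D p v = 0 \<and>
        d_proj D p v \<in> base_summand D i (proj D p)}"

definition isotropy_decomposition ::
  "('m, 'b) toric_data \<Rightarrow> ('g, 'm, 'b) group_data \<Rightarrow> bool" where
  "isotropy_decomposition D \<G> \<longleftrightarrow>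
     (\<forall>p\<in>principal_part D.
        let K = stabilizer (grp \<G>) (act \<G>) p;
            \<rho> = (\<lambda>k. push (total D) (act \<G> k) p);
            P = (\<lambda>i. isotropy_summand D i p)
        in (\<forall>k\<in>K. \<rho> k (d_phi D p) = d_phi D p) \<and>
           (\<forall>i<num D.
              has_dim (P i) (dims D i) \<and>
              (\<forall>k\<in>K. \<rho> k ` P i \<subseteq> P i) \<and>
              (\<exists>k\<in>K. \<exists>v\<in>P i. \<rho> k v \<noteq> v) \<and>
              (\<forall>W. subspace_of (P i) W \<and> (\<forall>k\<in>K. \<rho> k ` W \<subseteq> W) \<longrightarrow> W = {vzero} \<or> W = P i)) \<and>
           (\<forall>i<num D. \<forall>j<num D. i \<noteq> j \<longrightarrow>
              \<not> (\<exists>T. linear_vmap (P i) (P j) T \<and> bij_betw T (P i) (P j) \<and>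
                     (\<forall>k\<in>K. \<forall>v\<in>P i. T (\<rho> k v) = \<rho> k (T v)))))"

definition moment_map ::
  "'g mfd \<Rightarrow> 'g monoid \<Rightarrow> 'm mfd \<Rightarrow> ('g \<Rightarrow> 'm \<Rightarrow> 'm) \<Rightarrow> 'm tensor2 \<Rightarrow> ('m \<Rightarrow> 'g vect \<Rightarrow> real) \<Rightarrow> bool" where
  "moment_map X G M \<alpha> w \<mu> \<longleftrightarrow>
     (\<forall>p\<in>pts M. linear_fun (tangent X \<one>\<^bsub>G\<^esub>) (\<mu> p)) \<and>
     (\<forall>u\<in>tangent X \<one>\<^bsub>G\<^esub>. smooth_fun M (pts M) (\<lambda>p. \<mu> p u) \<and>
        (\<forall>p\<in>pts M. \<forall>v\<in>tangent M p. v (\<lambda>q. \<mu> q u) = w p (fundamental G M \<alpha> u p) v) \<and>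
        (\<forall>p\<in>pts M. \<forall>k\<in>carrier G. \<mu> (\<alpha> k p) (Ad X G k u) = \<mu> p u))"

definition coadjoint_stabilizer :: "'g mfd \<Rightarrow> 'g monoid \<Rightarrow> ('g vect \<Rightarrow> real) \<Rightarrow> 'g set" where
  "coadjoint_stabilizer X G \<xi> =
     {k \<in> carrier G. \<forall>u\<in>tangent X \<one>\<^bsub>G\<^esub>. \<xi> (Ad X G (inv\<^bsub>G\<^esub> k) u) = \<xi> u}"

text \<open>$L/K\cong S^1$ as topological groups ($L$ will be compact).\<close>

definition circle_quotient :: "'g mfd \<Rightarrow> 'g monoid \<Rightarrow> 'g set \<Rightarrow> 'g set \<Rightarrow> bool" where
  "circle_quotient X G L K \<longleftrightarrow>
     (\<exists>ch. continuous_map (subtopology (mtop X) L) euclidean ch \<and>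
          (\<forall>a\<in>L. \<forall>b\<in>L. ch (a \<otimes>\<^bsub>G\<^esub> b) = ch a * ch b) \<and>
          ch ` L = sphere (0::complex) 1 \<and> K = {a \<in> L. ch a = 1})"

text \<open>
  The base is the homogeneous space $G/L$. The clause on Ricci curvature is the normalisation
  $r^*(Y,Y)=1$ for the metric $\sum_i A_i(s)\,g_i^*$ induced on $G/L$ by the orbit \<open>x = s\<close>.
\<close>

definition construction_one ::
  "('m, 'b) toric_data \<Rightarrow> ('g, 'm, 'b) group_data \<Rightarrow> (nat \<Rightarrow> real) \<Rightarrow>
   'm tensor2 \<Rightarrow> 'm endo \<Rightarrow> bool" where
  "construction_one D \<G> a g J \<longleftrightarrow>
     (let X = lie_mfd \<G>; G = grp \<G>; M = total D; B = base D; \<alpha> = act \<G>; \<beta> = base_act \<G> in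
        holonomy_irreducible M g \<and> \<not> hyperkahler M g \<and>
        lie_group X G \<and> compact_space (mtop X) \<and> connected_space (mtop X) \<and> semisimple X G \<and>
        smooth_action X G M \<alpha> \<and> invariant_tensor G M \<alpha> g \<and>
        (\<forall>p\<in>pts M. orbit G \<alpha> p = {p' \<in> pts M. xcoord D p' = xcoord D p}) \<and>
        (\<exists>K. \<forall>s>0. \<exists>p\<in>pts M. xcoord D p = s \<and> stabilizer G \<alpha> p = K) \<and>
        (\<forall>k\<in>carrier G. \<forall>p\<in>pts M. (\<forall>t. \<alpha> k (rot D t p) = rot D t (\<alpha> k p)) \<and>
           proj D (\<alpha> k p) = \<beta> k (proj D p)) \<and>
        smooth_action X G B \<beta> \<and> (\<forall>q\<in>pts B. orbit G \<beta> q = pts B) \<and>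
        (\<forall>i<num D. invariant_tensor G B \<beta> (bg D i)) \<and> invariant_endo G B \<beta> (base_J D) \<and>
        (\<forall>p\<in>principal_part D.
           circle_quotient X G (stabilizer G \<beta> (proj D p)) (stabilizer G \<alpha> p)) \<and>
        (\<exists>\<mu>. moment_map X G M \<alpha> (kahler_form g J) \<mu> \<and>
           (\<forall>p\<in>principal_part D. coadjoint_stabilizer X G (\<mu> p) = stabilizer G \<beta> (proj D p))) \<and>
        isotropy_decomposition D \<G> \<and>
        (\<forall>s>0. kahler B (base_metric D (warp D a s)) (base_J D) \<and>
           (\<forall>c\<in>atlas B. \<forall>q\<in>fst c. \<forall>i<num D. \<forall>v\<in>base_summand D i q.
              bg D i q v v = 1 \<longrightarrow> ricci B (base_metric D (warp D a s)) c q v v = 1)))"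


subsection \<open>Construction Two\<close>

record ('n, 'b) product_data =
  factor :: "nat \<Rightarrow> 'n mfd"
  factor_g :: "nat \<Rightarrow> 'n tensor2"
  factor_J :: "nat \<Rightarrow> 'n endo"
  factor_proj :: "nat \<Rightarrow> 'b \<Rightarrow> 'n"

definition product_manifold :: "nat \<Rightarrow> (nat \<Rightarrow> 'n mfd) \<Rightarrow> 'b mfd \<Rightarrow> (nat \<Rightarrow> 'b \<Rightarrow> 'n) \<Rightarrow> bool" where
  "product_manifold m N B pr \<longleftrightarrow>
     (\<forall>i<m. smooth_map B (N i) (pr i)) \<and>
     homeomorphic_map (mtop B) (product_topology (\<lambda>i. mtop (N i)) {..<m})
       (\<lambda>q. \<lambda>i\<in>{..<m}. pr i q) \<and>
     (\<forall>q\<in>pts B. \<forall>u. (\<forall>i<m. u i \<in> tangent (N i) (pr i q)) \<longrightarrow>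
        (\<exists>!v. v \<in> tangent B q \<and> (\<forall>i<m. push (N i) (pr i) q v = u i)))"

definition construction_two :: "('m, 'b) toric_data \<Rightarrow> ('n, 'b) product_data \<Rightarrow> bool" where
  "construction_two D \<P> \<longleftrightarrow>
     (let N = factor \<P>; gN = factor_g \<P>; JN = factor_J \<P>; pr = factor_proj \<P>; B = base D in
        (\<forall>i<num D. compact_space (mtop (N i)) \<and> mdim (N i) = dims D i \<and>
           kahler (N i) (gN i) (JN i) \<and> einstein (N i) (gN i) 1) \<and>
        product_manifold (num D) N B pr \<and>
        (\<forall>q\<in>pts B. \<forall>i<num D. \<forall>v\<in>tangent B q.
           (\<forall>w\<in>tangent B q.
              bg D i q v w = gN i (pr i q) (push (N i) (pr i) q v) (push (N i) (pr i) q w)) \<and>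
           push (N i) (pr i) q (base_J D q v) = JN i (pr i q) (push (N i) (pr i) q v)))"

definition fiberwise_kahler_toric ::
  "('m, 'b) toric_data \<Rightarrow> ('g, 'm, 'b) group_data \<Rightarrow> ('n, 'b) product_data \<Rightarrow>
   (nat \<Rightarrow> real) \<Rightarrow> (real \<Rightarrow> real) \<Rightarrow> 'm tensor2 \<Rightarrow> 'm endo \<Rightarrow> bool" where
  "fiberwise_kahler_toric D \<G> \<P> a h g J \<longleftrightarrow>
     toric_bundle D \<and> kahler (total D) g J \<and> normal_form D a h g J \<and>
     (construction_one D \<G> a g J \<or> construction_two D \<P>)"

text \<open>
  The values of $(a_1,\dots,a_m)$ to be realised: all positive ones in Construction Two. In
  Construction One a metric in normal form can be Kaehler only if $\sum_i a_i\omega_i^*$ is closed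
  on $G/L$, which is a genuine restriction when $m$ exceeds the dimension of the centre of $L$: for
  $G/L=SU(3)/T^2$ it reads $2a_3=a_1+a_2$, where the third summand is the highest root space.
\<close>

definition metric_parameters ::
  "('m, 'b) toric_data \<Rightarrow> ('n, 'b) product_data \<Rightarrow> (nat \<Rightarrow> real) set" where
  "metric_parameters D \<P> =
     {a \<in> {..<num D} \<rightarrow>\<^sub>E {0<..}. construction_two D \<P> \<or> closed_2form (base D) (base_form D a)}"

end

theory Submission
  imports Defs "Jordan_Normal_Form.Determinant"
begin

type_synonym rfun = "(nat \<Rightarrow> real) \<Rightarrow> real"

abbreviation pd :: "nat \<Rightarrow> rfun \<Rightarrow> rfun" where "pd \<equiv> partial_deriv"

abbreviation eopen :: "nat \<Rightarrow> (nat \<Rightarrow> real) set \<Rightarrow> bool" where "eopen n \<equiv> openin (Euclidean_space n)"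

text \<open>With $P = \prod_i A_i^{d_i/2}$ and $h = q/P$, constant scalar curvature $S$ of the normal form becomes the linear
 equation $q'' = P (\sum_i d_i/A_i - S)$ with $q(0) = 0$, $q'(0) = 2 P(0)$; as $b_i \ge 0$ and $S \le 0$, its solution exists and
 is positive for all $x > 0$. The curvature of the normal form is found in the moving frame $dx, \theta, dY$.
 The new metric and complex structure differ from the given ones by terms with coefficients $1/h - 1/h_0$ and $(h - h_0)/h_0^2$,
 which are smooth up to $x = 0$; so both extend over the special orbit, and identities extend by density.
 On the base, $\sum_i A_i g_i^*$ must be Kaehler of scalar curvature $\sum_i d_i/A_i$. In Construction Two it is a local product. In
 Construction One the Ricci form is known for one choice of the $A_i$; the Levi-Civita connections of two choices
 differ by a traceless $J$-linear tensor, which does not affect the traces of the Ricci tensor.\<close>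

section \<open>Calculus on Euclidean space\<close>

lemma sum_rotate: "(\<Sum>i\<in>A. \<Sum>j\<in>B. \<Sum>k\<in>C. f i j k) = (\<Sum>j\<in>B. \<Sum>k\<in>C. \<Sum>i\<in>A. f i j k)"
 by (rule trans[OF sum.swap]) (intro sum.cong refl sum.swap)

lemma sum_swap22: "(\<Sum>i\<in>A. \<Sum>j\<in>B. \<Sum>k\<in>C. \<Sum>l\<in>D. f i j k l) = (\<Sum>k\<in>C. \<Sum>l\<in>D. \<Sum>i\<in>A. \<Sum>j\<in>B. f i j k l)"
 by (rule trans[OF sum.cong[OF refl sum_rotate] sum_rotate])

lemma eopen_iff: "eopen n S \<longleftrightarrow> (\<exists>T. open T & S = T \<inter> topspace (Euclidean_space n))"
 by (simp add: Euclidean_space_def openin_subtopology euclidean_product_topology Int_commute)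

lemma eopen_subset: "eopen n S ==> S \<subseteq> topspace (Euclidean_space n)" by (rule openin_subset)

lemma eopen_mem_zero: "eopen n S ==> y \<in> S ==> n <= i ==> y i = 0" using eopen_subset topspace_Euclidean_space by fastforce

lemma continuous_map_Euclidean_iff:
 assumes "S \<subseteq> topspace (Euclidean_space n)"
 shows "continuous_map (subtopology (Euclidean_space n) S) euclideanreal f \<longleftrightarrow> continuous_on S f"
proof -
 have "subtopology (Euclidean_space n) S = top_of_set S"
  using assms by (simp add: Euclidean_space_def subtopology_subtopology euclidean_product_topology topspace_Euclidean_space Int_absorb1)
 then show ?thesis by simp
qed

lemma fun_upd_in_Euclidean_space: "y \<in> topspace (Euclidean_space n) ==> i<n ==> y(i := t) \<in> topspace (Euclidean_space n)"
 by (auto simp: topspace_Euclidean_space)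

text \<open>Coordinates from \<open>n\<close> on vanish throughout \<open>Euclidean_space n\<close>,
  so only the first \<open>n\<close> of the infinitely many factor neighbourhoods of the product
  topology matter, and their radii have a minimum.\<close>

lemma eopen_box:
 assumes "eopen n S" "y \<in> S"
 obtains e where "e > 0" "!!z. z \<in> topspace (Euclidean_space n) ==> (!!i. i<n ==> \<bar>z i - y i\<bar><e) ==> z \<in> S"
proof -
 obtain T where T: "open T" "S = T \<inter> topspace (Euclidean_space n)" using assms eopen_iff by blast
 then have "openin (product_topology (%i. euclidean) UNIV) T" by (simp add: euclidean_product_topology)
 then obtain X where X: "y \<in> (\<Pi>\<^sub>E i\<in>UNIV. X i)" "!!i. openin euclidean (X i)" "(\<Pi>\<^sub>E i\<in>UNIV. X i) \<subseteq> T"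
  using product_topology_open_contains_basis[of "%i. euclidean" UNIV T y] assms T by blast
 have "\<forall>i. \<exists>e>0. ball (y i) e \<subseteq> X i" using X by (metis open_contains_ball open_openin PiE_mem UNIV_I)
 then obtain e where e: "!!i. e i > 0" "!!i. ball (y i) (e i) \<subseteq> X i" by metis
 \<comment> \<open>The entry 1 keeps the minimum defined when \<open>n = 0\<close>.\<close>
 define d where "d = Min (insert 1 (e ` {..<n}))"
 have "d > 0" using e by (simp add: d_def)
 moreover have "z \<in> S" if z: "z \<in> topspace (Euclidean_space n)" "!!i. i<n ==> \<bar>z i - y i\<bar><d" for z
 proof -
  have "z i \<in> X i" for i
  proof (cases "i<n")
   case True
   then have "d <= e i" by (auto simp: d_def)
   then have "z i \<in> ball (y i) (e i)" using z(2)[OF True] by (simp add: dist_real_def abs_minus_commute)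
   then show ?thesis using e by blast
  next
   case False
   then have "z i = y i" using z(1) assms eopen_mem_zero by (auto simp: topspace_Euclidean_space)
   then show ?thesis using X(1) by auto
  qed
  then have "z \<in> T" using X(3) by (auto simp: PiE_UNIV_domain)
  then show ?thesis using T z by blast
 qed
 ultimately show ?thesis using that by blast
qed

lemma eopen_Collect_less:
 assumes "finite I" "!!i. i \<in> I ==> continuous_on UNIV (f i)" "!!i. i \<in> I ==> continuous_on UNIV (g i)"
 shows "eopen n {z \<in> topspace (Euclidean_space n). \<forall>i\<in>I. f i z<(g i z :: real)}"
proof -
 have "{z. \<forall>i\<in>I. f i z<g i z} = (\<Inter>i\<in>I. {z. f i z<g i z})" by auto
 then have "open {z. \<forall>i\<in>I. f i z<g i z}" using assms by (auto intro!: open_INT open_Collect_less)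
 then show ?thesis unfolding eopen_iff by blast
qed

lemma eopen_box_open: "eopen n {z \<in> topspace (Euclidean_space n). \<forall>i\<in>{..<n}. \<bar>z i - y i\<bar><(e::real)}"
 by (rule eopen_Collect_less) (auto intro!: continuous_intros)

lemma tendsto_fun_upd_line:
 fixes w :: "'x => nat => real"
 assumes "!!i. ((%t. w t i) \<longlongrightarrow> l i) F"
 shows "(w \<longlongrightarrow> l) F"
proof -
 have "limitin (product_topology (%i. euclidean) UNIV) w l F" using assms by (simp add: limitin_componentwise)
 then show ?thesis by (simp add: euclidean_product_topology)
qed

lemma eventually_in_eopen:
 assumes S: "eopen n S" "l \<in> S"
  and w: "!!i. ((%t. w t i) \<longlongrightarrow> l i) F" "\<forall>\<^sub>F t in F. w t \<in> topspace (Euclidean_space n)"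
 shows "\<forall>\<^sub>F t in F. w t \<in> S"
proof -
 obtain T where T: "open T" "S = T \<inter> topspace (Euclidean_space n)" using assms eopen_iff by blast
 have "(w \<longlongrightarrow> l) F" using w by (intro tendsto_fun_upd_line)
 then have "\<forall>\<^sub>F t in F. w t \<in> T" using topological_tendstoD[of w l F T] T S(2) by blast
 then show ?thesis using w(2) by eventually_elim (use T in auto)
qed

text \<open>Makes partial derivatives local: near 0 the coordinate line stays in the open set, so
  \<open>partial_deriv\<close> depends only on the values of the function in
  \<open>S\<close>.\<close>

lemma eventually_line_in:
 assumes "eopen n S" "y \<in> S" "i<n"
 shows "\<forall>\<^sub>F t in nhds 0. y(i := y i + t) \<in> S"
proof (rule eventually_in_eopen[OF assms(1,2)])
 show "\<forall>\<^sub>F t in nhds 0. y(i := y i + t) \<in> topspace (Euclidean_space n)"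
  using assms eopen_subset fun_upd_in_Euclidean_space by (intro always_eventually) blast
 fix j
 have "((%t. y i + t) \<longlongrightarrow> y i + 0) (nhds 0)" by (intro tendsto_intros filterlim_ident)
 then show "((%t. (y(i := y i + t)) j) \<longlongrightarrow> y j) (nhds 0)" by (cases "j = i") auto
qed

lemma partial_deriv_cong:
 assumes "eopen n S" "!!z. z \<in> S ==> f z = g z" "y \<in> S" "i<n"
 shows "pd i f y = pd i g y" unfolding partial_deriv_def using eventually_line_in[OF assms(1,3,4)] assms(2)
 by (intro deriv_cong_ev) (auto elim: eventually_mono)

lemma differentiable_line_cong:
 assumes "eopen n S" "!!z. z \<in> S ==> f z = g z" "y \<in> S" "i<n" "(%t. f (y(i := y i + t)) :: real) differentiable (at 0)"
 shows "(%t. g (y(i := y i + t))) differentiable (at 0)"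
proof -
 obtain D where "((%t. f (y(i := y i + t))) has_real_derivative D) (at 0)" using assms(5) real_differentiable_def by blast
 moreover have "\<forall>\<^sub>F t in nhds 0. f (y(i := y i + t)) = g (y(i := y i + t))"
  using eventually_line_in[OF assms(1,3,4)] assms(2) by (auto elim: eventually_mono)
 ultimately have "((%t. g (y(i := y i + t))) has_real_derivative D) (at 0)" by (subst (asm) DERIV_cong_ev[OF refl _ refl]) auto
 then show ?thesis using real_differentiable_def by blast
qed

lemma Ck_on_Suc_iff:
 assumes "eopen n S"
 shows "Ck_on n (Suc k) S f \<longleftrightarrow> continuous_on S f & (\<forall>i<n. (\<forall>y\<in>S. (%t. f (y(i := y i + t))) differentiable (at 0)) & Ck_on n k S (pd i f))"
 using assms by (simp add: continuous_map_Euclidean_iff eopen_subset)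

lemma Ck_on_cong:
 assumes "eopen n S"
 shows "(!!z. z \<in> S ==> f z = g z) ==> Ck_on n k S f ==> Ck_on n k S g"
proof (induction k arbitrary: f g)
 case 0
 then show ?case using assms eopen_subset by (auto simp: continuous_map_Euclidean_iff cong: continuous_on_cong)
next
 case (Suc k)
 have "continuous_on S g" using Suc.prems assms eopen_subset by (auto simp: continuous_map_Euclidean_iff cong: continuous_on_cong)
 moreover have "Ck_on n k S (pd i g)" if "i<n" for i using Suc.IH[of "pd i f"] Suc.prems that partial_deriv_cong[OF assms Suc.prems(1)] by auto
 moreover have "(%t. g (y(i := y i + t))) differentiable (at 0)" if "i<n" "y \<in> S" for i y
  by (rule differentiable_line_cong[OF assms, of f g]) (use Suc.prems that in auto)
 ultimately show ?case using Ck_on_Suc_iff[OF assms] by blast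
qed

lemma Ck_on_Suc_D: "Ck_on n (Suc k) S f ==> Ck_on n k S f" by (induction k arbitrary: f) auto

lemma Ck_on_subset: "S' \<subseteq> S ==> Ck_on n k S f ==> Ck_on n k S' f"
proof (induction k arbitrary: f)
 case 0 then show ?case by simp (metis continuous_map_from_subtopology inf.absorb_iff2 subtopology_subtopology)
next
 case (Suc k)
 then have "continuous_map (subtopology (Euclidean_space n) S') euclideanreal f"
  by simp (metis continuous_map_from_subtopology inf.absorb_iff2 subtopology_subtopology)
 then show ?case using Suc by auto
qed

lemma Ck_on_continuous_on: "eopen n S ==> Ck_on n k S f ==> continuous_on S f"
 by (cases k) (auto simp: continuous_map_Euclidean_iff dest: eopen_subset)

text \<open>Unfolds smoothness once without naming an order of differentiability, so later arguments
  need not count derivatives.\<close>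

lemma Cinf_on_iff:
 assumes "eopen n S"
 shows "Cinf_on n S f \<longleftrightarrow> continuous_on S f & (\<forall>i<n. (\<forall>y\<in>S. (%t. f (y(i := y i + t))) differentiable (at 0)) & Cinf_on n S (pd i f))" (is "?L \<longleftrightarrow> ?R")
proof
 assume ?L
 then have "\<forall>k. Ck_on n (Suc k) S f" by (auto simp: Cinf_on_def simp del: Ck_on.simps)
 then show ?R using Ck_on_Suc_iff[OF assms] by (auto simp: Cinf_on_def simp del: Ck_on.simps)
next
 assume R: ?R
 have "Ck_on n k S f" for k
 proof (cases k)
  case 0 then show ?thesis using R assms by (simp add: continuous_map_Euclidean_iff eopen_subset)
 next
  case (Suc j) then show ?thesis using R Ck_on_Suc_iff[OF assms] by (auto simp: Cinf_on_def simp del: Ck_on.simps)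
 qed
 then show ?L by (simp add: Cinf_on_def)
qed

lemma Cinf_on_partial_deriv: "eopen n S ==> Cinf_on n S f ==> i<n ==> Cinf_on n S (pd i f)" using Cinf_on_iff by blast

lemma Cinf_on_continuous_on: "eopen n S ==> Cinf_on n S f ==> continuous_on S f" using Cinf_on_iff by blast

lemma Cinf_on_cong: "eopen n S ==> (!!z. z \<in> S ==> f z = g z) ==> Cinf_on n S f ==> Cinf_on n S g" unfolding Cinf_on_def by (metis Ck_on_cong)

lemma Cinf_on_subset: "S' \<subseteq> S ==> Cinf_on n S f ==> Cinf_on n S' f" unfolding Cinf_on_def using Ck_on_subset by blast

lemma Ck_on_has_partial:
 assumes "eopen n S" "Ck_on n (Suc k) S f" "y \<in> S" "i<n"
 shows "((%t. f (y(i := y i + t))) has_real_derivative pd i f y) (at 0)"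
 using assms unfolding partial_deriv_def by (simp add: DERIV_deriv_iff_real_differentiable)

lemma Cinf_on_has_partial:
 assumes "eopen n S" "Cinf_on n S f" "y \<in> S" "i<n"
 shows "((%t. f (y(i := y i + t))) has_real_derivative pd i f y) (at 0)"
 using Ck_on_has_partial[OF assms(1) _ assms(3,4)] assms(2) unfolding Cinf_on_def by blast

lemma partial_derivI: "((%t. f (y(i := y i + t))) has_real_derivative D) (at 0) ==> pd i f y = D"
 unfolding partial_deriv_def by (rule DERIV_imp_deriv)

lemma Ck_on_has_partial_line:
 assumes "eopen n S" "Ck_on n (Suc k) S f" "y(i := s) \<in> S" "i<n"
 shows "((%s. f (y(i := s))) has_real_derivative pd i f (y(i := s))) (at s)"
 using Ck_on_has_partial[OF assms] DERIV_shift[of "%s. f (y(i := s))" _ 0 s] by (simp add: add.commute)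

lemma continuous_on_eopen_local:
 assumes S: "eopen n S"
  and loc: "!!y. y \<in> S ==> \<exists>T. eopen n T & y \<in> T & continuous_on (T \<inter> S) f"
 shows "continuous_on S f" unfolding continuous_on_eq_continuous_within
proof
 fix y assume y: "y \<in> S"
 then obtain T where T: "eopen n T" "y \<in> T" "continuous_on (T \<inter> S) f" using loc by blast
 then have c: "continuous (at y within T \<inter> S) f" using y by (simp add: continuous_on_eq_continuous_within)
 obtain U where U: "open U" "T = U \<inter> topspace (Euclidean_space n)" using T eopen_iff by blast
 then have "T \<inter> S = S \<inter> U" using eopen_subset[OF S] by blast
 moreover have "at y within S \<inter> U = at y within S" using U T(2) y by (intro at_within_nhd[of _ U]) auto
 ultimately show "continuous (at y within S) f" using c by (simp add: continuous_within)
qed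

text \<open>Serves functions whose smoothness is visible only in a neighbourhood depending on the
  point, such as those computed in a chart of the base chosen there.\<close>

lemma Cinf_on_local:
 assumes S: "eopen n S"
  and loc: "!!y. y \<in> S ==> \<exists>T. eopen n T & y \<in> T & Cinf_on n (T \<inter> S) f"
 shows "Cinf_on n S f"
proof -
 have "Ck_on n k S f" if "!!y. y \<in> S ==> \<exists>T. eopen n T & y \<in> T & Ck_on n k (T \<inter> S) f" for k f using that
 proof (induction k arbitrary: f)
  case 0
  have "continuous_on S f" using 0 S by (intro continuous_on_eopen_local[OF S]) (metis Ck_on_continuous_on openin_Int)
  then show ?case using S by (simp add: continuous_map_Euclidean_iff eopen_subset)
 next
  case (Suc k)
  have "continuous_on S f" using Suc.prems S by (intro continuous_on_eopen_local[OF S]) (metis Ck_on_continuous_on openin_Int)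
  moreover have "Ck_on n k S (pd i f)" if "i<n" for i
  proof (rule Suc.IH)
   fix y assume "y \<in> S"
   with Suc.prems show "\<exists>T. eopen n T & y \<in> T & Ck_on n k (T \<inter> S) (pd i f)" using that by (metis Ck_on.simps(2))
  qed
  moreover have "(%t. f (y(i := y i + t))) differentiable (at 0)" if "i<n" "y \<in> S" for i y using Suc.prems[OF that(2)] that by auto
  ultimately show ?case using Ck_on_Suc_iff[OF S] by blast
 qed
 then show ?thesis using loc unfolding Cinf_on_def by meson
qed

declare Ck_on.simps [simp del]

section \<open>Chain rule and symmetry of second derivatives\<close>

lemma DERIV_transform_ev:
 assumes "(f has_real_derivative D) (at x)" "\<forall>\<^sub>F t in nhds x. f t = g t"
 shows "(g has_real_derivative D) (at x)" using DERIV_cong_ev[OF refl assms(2) refl] assms(1) by (rule iffD1)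

lemma Ck_on_0_iff: "eopen n S ==> Ck_on n 0 S f \<longleftrightarrow> continuous_on S f" by (simp add: continuous_map_Euclidean_iff eopen_subset Ck_on.simps)

lemma Ck_on_mono: "j <= k ==> Ck_on n k S f ==> Ck_on n j S f" by (induction k rule: dec_induct) (auto dest: Ck_on_Suc_D)

text \<open>One term of the telescoping sum behind the chain rule. The mean value theorem writes the
  increment in coordinate \<open>j\<close> as a t - a 0 times \<open>pd j f\<close> at an
  intermediate point; continuity of \<open>pd j f\<close> moves that point to
  \<open>y\<close>.\<close>

lemma C1_increment:
 assumes S: "eopen n S" "y \<in> S" "j<n" and f: "Ck_on n (Suc 0) S f"
  and w: "!!i. ((%t. w t i) \<longlongrightarrow> y i) (at (0::real))" "!!t. w t \<in> topspace (Euclidean_space n)"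
  and a: "a 0 = y j" "(a has_real_derivative v) (at 0)"
 shows "((%t. (f ((w t)(j := a t)) - f ((w t)(j := a 0)))/t) \<longlongrightarrow> v * pd j f y) (at 0)"
proof -
 obtain e where e: "e > 0" "!!z. z \<in> topspace (Euclidean_space n) ==> (!!i. i<n ==> \<bar>z i - y i\<bar><e) ==> z \<in> S" using eopen_box[OF S(1,2)] by blast
 have at: "(a \<longlongrightarrow> y j) (at 0)" using DERIV_isCont[OF a(2)] a(1) by (simp add: isCont_def)
 have "\<forall>\<^sub>F t in at 0. \<forall>i\<in>{..<n}. \<bar>w t i - y i\<bar><e" using w(1) e(1) by (intro eventually_ball_finite) (auto simp: tendsto_iff dist_real_def)
 moreover have "\<forall>\<^sub>F t in at 0. \<bar>a t - y j\<bar><e" using at e(1) by (auto simp: tendsto_iff dist_real_def)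
 ultimately have ev: "\<forall>\<^sub>F t in at 0. \<forall>s\<in>closed_segment (a 0) (a t). (w t)(j := s) \<in> S"
 proof eventually_elim
  case (elim t)
  show ?case
  proof
   fix s assume s: "s \<in> closed_segment (a 0) (a t)"
   have "\<bar>s - y j\<bar> <= \<bar>a t - y j\<bar>" using s a(1) by (auto simp: closed_segment_eq_real_ivl split: if_splits)
   then show "(w t)(j := s) \<in> S" using elim w(2) S(3) by (intro e(2) fun_upd_in_Euclidean_space) auto
  qed
 qed
 have "\<forall>\<^sub>F t in at 0. \<exists>s\<in>closed_segment (a 0) (a t). f ((w t)(j := a t)) - f ((w t)(j := a 0)) = (a t - a 0)*pd j f ((w t)(j := s))" using ev
 proof eventually_elim
  case (elim t)
  let ?g = "%s. f ((w t)(j := s))"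
  have D: "(?g has_real_derivative pd j f ((w t)(j := s))) (at s)" if "s \<in> closed_segment (a 0) (a t)" for s
   using Ck_on_has_partial_line[OF S(1) f _ S(3)] elim that by blast
  consider "a t = a 0" | "a 0<a t" | "a t<a 0" by linarith
  then show ?case
  proof cases
   case 1 then show ?thesis by auto
  next
   case 2
   then obtain z where "a 0<z" "z<a t" "?g (a t) - ?g (a 0) = (a t - a 0)*pd j f ((w t)(j := z))"
    using MVT2[OF 2, of ?g "%s. pd j f ((w t)(j := s))"] D 2 by (auto simp: closed_segment_eq_real_ivl)
   then show ?thesis using 2 by (intro bexI[of _ z]) (auto simp: closed_segment_eq_real_ivl)
  next
   case 3
   then obtain z where "a t<z" "z<a 0" "?g (a 0) - ?g (a t) = (a 0 - a t)*pd j f ((w t)(j := z))"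
    using MVT2[OF 3, of ?g "%s. pd j f ((w t)(j := s))"] D 3 by (auto simp: closed_segment_eq_real_ivl)
   then show ?thesis using 3 by (intro bexI[of _ z]) (auto simp: closed_segment_eq_real_ivl algebra_simps)
  qed
 qed
 \<comment> \<open>Selects the intermediate points as a function of \<open>t\<close>, so that one
   can speak of their limit.\<close>
 then have "\<exists>s. \<forall>\<^sub>F t in at 0. s t \<in> closed_segment (a 0) (a t) & f ((w t)(j := a t)) - f ((w t)(j := a 0)) = (a t - a 0)*pd j f ((w t)(j := s t))"
  by (intro exI[of _ "%t. SOME s. s \<in> closed_segment (a 0) (a t) & f ((w t)(j := a t)) - f ((w t)(j := a 0)) = (a t - a 0)*pd j f ((w t)(j := s))"])
   (erule eventually_mono, rule someI_ex, blast)
 then obtain s where s: "\<forall>\<^sub>F t in at 0. s t \<in> closed_segment (a 0) (a t) &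
   f ((w t)(j := a t)) - f ((w t)(j := a 0)) = (a t - a 0)*pd j f ((w t)(j := s t))" by blast
 have "(s \<longlongrightarrow> y j) (at 0)"
 proof (rule tendstoI)
  fix d :: real assume "d > 0"
  then have "\<forall>\<^sub>F t in at 0. dist (a t) (y j)<d" using at tendstoD by blast
  then show "\<forall>\<^sub>F t in at 0. dist (s t) (y j)<d"
   using s by eventually_elim (auto simp: closed_segment_eq_real_ivl dist_real_def a(1) split: if_splits)
 qed
 then have ws: "((%t. ((w t)(j := s t)) i) \<longlongrightarrow> y i) (at 0)" for i using w(1) by (cases "i = j") auto
 have cont: "continuous_on S (pd j f)" using f S Ck_on_continuous_on[OF S(1)] by (auto simp: Ck_on_Suc_iff)
 have "((%t. pd j f ((w t)(j := s t))) \<longlongrightarrow> pd j f y) (at 0)"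
 proof (rule continuous_on_tendsto_compose[OF cont tendsto_fun_upd_line[OF ws] S(2)])
  show "\<forall>\<^sub>F t in at 0. (w t)(j := s t) \<in> S" using ev s by eventually_elim auto
 qed
 moreover have "((%t. (a t - a 0)/t) \<longlongrightarrow> v) (at 0)" using a(2) by (simp add: has_field_derivative_iff)
 ultimately have "((%t. (a t - a 0)/t*pd j f ((w t)(j := s t))) \<longlongrightarrow> v * pd j f y) (at 0)" by (intro tendsto_mult)
 then show ?thesis by (rule Lim_transform_eventually) (use s in eventually_elim, auto)
qed

text \<open>Smoothness is defined through coordinate lines, so the derivative along a curve has to
  be assembled from them: the coordinates are released one at a time, each contributing one term by
  \<open>C1_increment\<close>.\<close>

lemma C1_curve_derivative:
 assumes S: "eopen n S" "\<gamma> 0 \<in> S" and f: "Ck_on n (Suc 0) S f"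
  and \<gamma>: "!!k. k<n ==> ((%t. \<gamma> t k) has_real_derivative v k) (at 0)" "!!t. \<gamma> t \<in> topspace (Euclidean_space n)"
 shows "((%t. f (\<gamma> t)) has_real_derivative (\<Sum>k<n. v k*pd k f (\<gamma> 0))) (at (0::real))"
proof -
 \<comment> \<open>\<open>z j t\<close> follows the curve in the coordinates below \<open>j\<close>
   and keeps the others at their initial values: \<open>z 0\<close> is constant and
   \<open>z n\<close> is the curve.\<close>
 define z where "z = (%j t i. if i<j then \<gamma> t i else \<gamma> 0 i)"
 have z0: "z j 0 = \<gamma> 0" for j by (auto simp: z_def)
 have ztop: "z j t \<in> topspace (Euclidean_space n)" for j t using \<gamma>(2) by (auto simp: z_def topspace_Euclidean_space)
 have cts: "((%t. \<gamma> t i) \<longlongrightarrow> \<gamma> 0 i) (at 0)" for i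
 proof (cases "i<n")
  case True then show ?thesis using DERIV_isCont[OF \<gamma>(1)] by (simp add: isCont_def)
 next
  case False
  then have "\<gamma> t i = 0" for t using \<gamma>(2) by (simp add: topspace_Euclidean_space)
  then show ?thesis by simp
 qed
 have zlim: "((%t. z j t i) \<longlongrightarrow> \<gamma> 0 i) (at 0)" for i j using cts by (cases "i<j") (auto simp: z_def)
 have "((%t. f (z j t)) has_real_derivative (\<Sum>k<j. v k*pd k f (\<gamma> 0))) (at 0)" if "j <= n" for j using that
 proof (induction j)
  case 0
  have "z 0 t = \<gamma> 0" for t by (auto simp: z_def)
  then show ?case by simp
 next
  case (Suc j)
  have zs: "(z j t)(j := \<gamma> t j) = z (Suc j) t" "(z j t)(j := \<gamma> 0 j) = z j t" for t by (auto simp: z_def)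
  have "((%t. (f ((z j t)(j := \<gamma> t j)) - f ((z j t)(j := \<gamma> 0 j)))/t) \<longlongrightarrow> v j*pd j f (\<gamma> 0)) (at 0)"
   using Suc.prems \<gamma>(1) by (intro C1_increment[OF S _ f zlim ztop, where a="%t. \<gamma> t j"]) auto
  then have "((%t. (f (z (Suc j) t) - f (z j t))/t) \<longlongrightarrow> v j*pd j f (\<gamma> 0)) (at 0)" by (simp only: zs)
  moreover have "((%t. (f (z j t) - f (\<gamma> 0))/t) \<longlongrightarrow> (\<Sum>k<j. v k*pd k f (\<gamma> 0))) (at 0)" using Suc by (simp add: has_field_derivative_iff z0)
  ultimately have "((%t. (f (z (Suc j) t) - f (z j t))/t + (f (z j t) - f (\<gamma> 0))/t) \<longlongrightarrow> (\<Sum>k<Suc j. v k*pd k f (\<gamma> 0))) (at 0)"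
   by (simp only: lessThan_Suc sum.insert finite_lessThan lessThan_iff less_irrefl not_False_eq_True tendsto_add)
  then have "((%t. (f (z (Suc j) t) - f (\<gamma> 0))/t) \<longlongrightarrow> (\<Sum>k<Suc j. v k*pd k f (\<gamma> 0))) (at 0)" by (simp add: diff_divide_distrib)
  then show ?case by (simp add: has_field_derivative_iff z0)
 qed
 from this[of n] have "((%t. f (z n t)) has_real_derivative (\<Sum>k<n. v k*pd k f (\<gamma> 0))) (at 0)" by simp
 moreover have "z n t = \<gamma> t" for t
 proof
  fix i show "z n t i = \<gamma> t i" using \<gamma>(2)[of t] \<gamma>(2)[of 0] by (cases "i<n") (simp_all add: z_def topspace_Euclidean_space)
 qed
 ultimately show ?thesis by simp
qed

lemma Ck_on_Suc_I:
 assumes "eopen n S"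
  and c: "continuous_on S f"
  and D: "!!i y. i<n ==> y \<in> S ==> ((%t. f (y(i := y i + t))) has_real_derivative f' i y) (at 0)"
  and f': "!!i. i<n ==> Ck_on n k S (f' i)"
 shows "Ck_on n (Suc k) S f" unfolding Ck_on_Suc_iff[OF assms(1)]
proof (intro conjI allI impI ballI c)
 fix i assume i: "i<n"
 show "Ck_on n k S (pd i f)" by (rule Ck_on_cong[OF assms(1) _ f'[OF i]]) (simp add: partial_derivI[OF D[OF i]])
 fix y assume "y \<in> S"
 then show "(%t. f (y(i := y i + t))) differentiable (at 0)" using D[OF i] real_differentiable_def by blast
qed

lemma Ck_on_const: "eopen n S ==> Ck_on n k S (%y. c)"
proof (induction k arbitrary: c)
 case 0 then show ?case by (simp add: Ck_on_0_iff)
next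
 case (Suc k)
 then show ?case by (intro Ck_on_Suc_I[where f'="%i y. 0"]) auto
qed

lemma Ck_on_add: "eopen n S ==> Ck_on n k S f ==> Ck_on n k S g ==> Ck_on n k S (%y. f y + g y)"
proof (induction k arbitrary: f g)
 case 0 then show ?case by (simp add: Ck_on_0_iff continuous_on_add)
next
 case (Suc k)
 note S = Suc.prems(1)
 show ?case
 proof (rule Ck_on_Suc_I[where f'="%i y. pd i f y + pd i g y"])
  fix i y assume "i<n" "y \<in> S"
  then show "((%t. f (y(i := y i + t)) + g (y(i := y i + t))) has_real_derivative pd i f y + pd i g y) (at 0)"
   by (intro DERIV_add Ck_on_has_partial[OF S Suc.prems(2)] Ck_on_has_partial[OF S Suc.prems(3)])
 next
  fix i assume "i<n"
  then show "Ck_on n k S (%y. pd i f y + pd i g y)" using Suc by (simp add: Ck_on_Suc_iff)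
 qed (use Suc in "simp_all add: Ck_on_Suc_iff continuous_on_add")
qed

lemma Ck_on_mult: "eopen n S ==> Ck_on n k S f ==> Ck_on n k S g ==> Ck_on n k S (%y. f y*g y)"
proof (induction k arbitrary: f g)
 case 0 then show ?case by (simp add: Ck_on_0_iff continuous_on_mult)
next
 case (Suc k)
 note S = Suc.prems(1)
 show ?case
 proof (rule Ck_on_Suc_I[where f'="%i y. pd i f y*g y + pd i g y*f y"])
  fix i y assume "i<n" "y \<in> S"
  note h = this(2,1)
  show "((%t. f (y(i := y i + t))*g (y(i := y i + t))) has_real_derivative pd i f y*g y + pd i g y*f y) (at 0)"
   using DERIV_mult[OF Ck_on_has_partial[OF S Suc.prems(2) h] Ck_on_has_partial[OF S Suc.prems(3) h]] by (simp only: add_0_right fun_upd_triv)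
 next
  fix i assume "i<n"
  then show "Ck_on n k S (%y. pd i f y*g y + pd i g y*f y)"
   using Suc.prems Ck_on_Suc_D by (intro Ck_on_add[OF S] Suc.IH) (simp_all add: Ck_on_Suc_iff[OF S] Ck_on_Suc_D)
 qed (use Suc in "simp_all add: Ck_on_Suc_iff continuous_on_mult")
qed

lemma Ck_on_coord:
 assumes S: "eopen n S"
 shows "Ck_on n k S (%y. y j)"
proof -
 have c: "continuous_on S (%y. y j)" by (rule continuous_on_subset[OF continuous_on_product_coordinates]) simp
 show ?thesis
 proof (cases k)
  case 0 then show ?thesis using S c by (simp add: Ck_on_0_iff)
 next
  case (Suc k)
  have "((%t. (y(i := y i + t)) j) has_real_derivative (if i = j then 1 else 0)) (at 0)" for i y
   by (cases "i = j") (auto intro!: derivative_eq_intros)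
  then show ?thesis unfolding Suc by (intro Ck_on_Suc_I[OF S c, where f'="%i y. if i = j then 1 else 0"] Ck_on_const S)
 qed
qed

lemma Ck_on_sum:
 assumes "eopen n S" "finite I" "!!i. i \<in> I ==> Ck_on n k S (f i)"
 shows "Ck_on n k S (%y. \<Sum>i\<in>I. f i y)" using assms(2,3) by (induction I rule: finite_induct) (simp_all add: Ck_on_const Ck_on_add assms(1))

lemma partial_deriv_compose:
 assumes S: "eopen n S" and T: "eopen m T" "!!y. y \<in> S ==> \<Phi> y \<in> T"
  and f: "Ck_on m (Suc 0) T f" and \<Phi>: "!!k. k<m ==> Ck_on n (Suc 0) S (%y. \<Phi> y k)"
  and y: "y \<in> S" "i<n"
 shows "((%t. f (\<Phi> (y(i := y i + t)))) has_real_derivative (\<Sum>k<m. pd k f (\<Phi> y)*pd i (%y. \<Phi> y k) y)) (at 0)"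
proof -
 \<comment> \<open>Outside \<open>S\<close> nothing is known of \<open>\<Phi>\<close>. The constant
   value there keeps the whole curve in the model space and leaves its germ at 0 unchanged.\<close>
 define \<gamma> where "\<gamma> t = (if y(i := y i + t) \<in> S then \<Phi> (y(i := y i + t)) else \<Phi> y)" for t
 have ev: "\<forall>\<^sub>F t in nhds 0. \<gamma> t = \<Phi> (y(i := y i + t))" using eventually_line_in[OF S y] by eventually_elim (simp add: \<gamma>_def)
 have "\<forall>\<^sub>F t in nhds 0. \<Phi> (y(i := y i + t)) k = \<gamma> t k" for k using ev by eventually_elim simp
 then have "((%t. \<gamma> t k) has_real_derivative pd i (%y. \<Phi> y k) y) (at 0)" if "k<m" for k
  using DERIV_transform_ev[OF Ck_on_has_partial[OF S \<Phi>[OF that] y], of "%t. \<gamma> t k"] by blast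
 moreover have "\<gamma> t \<in> topspace (Euclidean_space m)" for t using subsetD[OF eopen_subset[OF T(1)]] T(2) y(1) by (simp add: \<gamma>_def)
 moreover have "\<gamma> 0 = \<Phi> y" using y by (simp add: \<gamma>_def)
 ultimately have "((%t. f (\<gamma> t)) has_real_derivative (\<Sum>k<m. pd i (%y. \<Phi> y k) y*pd k f (\<Phi> y))) (at 0)"
  using C1_curve_derivative[OF T(1) _ f, of \<gamma> "%k. pd i (%y. \<Phi> y k) y"] T(2) y by simp
 then have "((%t. f (\<gamma> t)) has_real_derivative (\<Sum>k<m. pd k f (\<Phi> y)*pd i (%y. \<Phi> y k) y)) (at 0)" by (simp add: mult.commute)
 moreover have "\<forall>\<^sub>F t in nhds 0. f (\<gamma> t) = f (\<Phi> (y(i := y i + t)))" using ev by eventually_elim simp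
 ultimately show ?thesis by (rule DERIV_transform_ev)
qed

text \<open>By the chain rule the partials of the composite are sums of products of composites of
  one order less; hence the induction keeps \<open>\<Phi>\<close> and varies
  \<open>f\<close>.\<close>

lemma Ck_on_compose:
 assumes S: "eopen n S" and T: "eopen m T" "!!y. y \<in> S ==> \<Phi> y \<in> T"
  and \<Phi>: "!!j. j<m ==> Ck_on n k S (%y. \<Phi> y j)"
 shows "Ck_on m k T f ==> Ck_on n k S (%y. f (\<Phi> y))" using \<Phi>
proof (induction k arbitrary: f)
 case 0
 have "continuous_on S (%y. \<Phi> y j)" for j
 proof (cases "j<m")
  case True then show ?thesis using 0 S Ck_on_0_iff by blast
 next
  case False
  then have "\<Phi> y j = 0" if "y \<in> S" for y using T that eopen_mem_zero by (metis not_less)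
  then show ?thesis by (simp cong: continuous_on_cong)
 qed
 then have "continuous_on S \<Phi>" by (rule continuous_on_coordinatewise_then_product)
 then have "continuous_on S (%y. f (\<Phi> y))" using 0 T by (intro continuous_on_compose2[of T f S \<Phi>]) (auto simp: Ck_on_0_iff)
 then show ?case using Ck_on_0_iff[OF S] by blast
next
 case (Suc k)
 have lower: "Ck_on n' (Suc 0) S' f'" "Ck_on n' k S' f'" if "Ck_on n' (Suc k) S' f'" for n' S' f' using Ck_on_mono[OF _ that] by auto
 have cf: "Ck_on n k S (%y. f (\<Phi> y))" using Suc.IH lower Suc.prems by blast
 show ?case
 proof (rule Ck_on_Suc_I[OF S, where f'="%i y. \<Sum>k<m. pd k f (\<Phi> y)*pd i (%y. \<Phi> y k) y"])
  show "((%t. f (\<Phi> (y(i := y i + t)))) has_real_derivative (\<Sum>k<m. pd k f (\<Phi> y)*pd i (%y. \<Phi> y k) y)) (at 0)" if "i<n" "y \<in> S" for i y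
   using that lower Suc.prems by (intro partial_deriv_compose[OF S T]) auto
  show "Ck_on n k S (%y. \<Sum>k<m. pd k f (\<Phi> y)*pd i (%y. \<Phi> y k) y)" if i: "i<n" for i
  proof (intro Ck_on_sum Ck_on_mult S)
   fix l assume "l \<in> {..<m}"
   then show "Ck_on n k S (%y. pd l f (\<Phi> y))" "Ck_on n k S (pd i (%y. \<Phi> y l))" using Suc i lower T by (auto simp: Ck_on_Suc_iff S)
  qed auto
 qed (use cf S Ck_on_continuous_on in blast)+
qed

lemma eopen_continuous_preimage:
 assumes S: "eopen n S" and F: "continuous_on S F" and U: "open U"
 shows "eopen n {z \<in> S. F z \<in> U}"
proof -
 obtain T where T: "open T" "S \<inter> F -` U = S \<inter> T" using continuous_openin_preimage_gen[OF F U] by (auto simp: openin_open)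
 obtain V where "open V" "S = V \<inter> topspace (Euclidean_space n)" using S eopen_iff by blast
 then have "open (V \<inter> T)" "{z \<in> S. F z \<in> U} = (V \<inter> T) \<inter> topspace (Euclidean_space n)" using T by auto
 then show ?thesis unfolding eopen_iff by blast
qed

text \<open>Two applications of the mean value theorem, in direction \<open>i\<close> and then in
  direction \<open>j\<close>, turn the second difference into h^2 times \<open>pd j (pd i f)\<close>
  at a point in between, and this partial is continuous.\<close>

lemma mixed_difference_limit:
 assumes S: "eopen n S" and f: "Ck_on n 2 S f" and y: "y \<in> S"
  and ij: "i<n" "j<n" "i ~= j"
 shows "((%h. (f (y(i := y i + h, j := y j + h)) - f (y(i := y i + h)) - f (y(j := y j + h)) + f y)/h\<^sup>2) \<longlongrightarrow> pd j (pd i f) y) (at_right 0)"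
proof (rule tendstoI)
 fix e :: real assume e: "e > 0"
 let ?F = "pd j (pd i f)"
 define p where "p s t = y(i := y i + s, j := y j + t)" for s t
 have f2: "Ck_on n (Suc (Suc 0)) S f" using f by (simp add: numeral_2_eq_2)
 have f1: "Ck_on n (Suc 0) S (pd i f)" using f2 ij S by (simp add: Ck_on_Suc_iff[OF S])
 then have F: "continuous_on S ?F" using ij by (simp add: Ck_on_Suc_iff[OF S] Ck_on_0_iff[OF S])
 have "eopen n {z \<in> S. ?F z \<in> ball (?F y) e}" by (rule eopen_continuous_preimage[OF S F open_ball])
 moreover have "y \<in> {z \<in> S. ?F z \<in> ball (?F y) e}" using y e by simp
 ultimately obtain d where d: "d > 0" "!!z. z \<in> topspace (Euclidean_space n) ==> 
   (!!i. i<n ==> \<bar>z i - y i\<bar><d) ==> z \<in> {z \<in> S. ?F z \<in> ball (?F y) e}" using eopen_box by blast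
 have pS: "p s t \<in> S" "dist (?F (p s t)) (?F y)<e" if "\<bar>s\<bar><d" "\<bar>t\<bar><d" for s t
 proof -
  have "y \<in> topspace (Euclidean_space n)" using y eopen_subset[OF S] by blast
  then have "p s t \<in> {z \<in> S. ?F z \<in> ball (?F y) e}" using that ij d(1) by (intro d(2)) (auto simp: p_def intro!: fun_upd_in_Euclidean_space)
  then show "p s t \<in> S" "dist (?F (p s t)) (?F y)<e" by (auto simp: dist_commute)
 qed
 have D1: "((%s. f (p s t)) has_real_derivative pd i f (p s t)) (at s)" if "\<bar>s\<bar><d" "\<bar>t\<bar><d" for s t
 proof -
  have eq: "(p s t)(i := s' + y i) = p s' t" for s' using ij by (auto simp: p_def)
  have "((%u. f ((p s t)(i := u))) has_real_derivative pd i f (p s t)) (at (s + y i))"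
   using Ck_on_has_partial_line[OF S f2, of "p s t" i "s + y i"] pS(1)[OF that] ij by (simp add: eq)
  then show ?thesis unfolding DERIV_shift by (simp only: eq)
 qed
 have D2: "((%t. pd i f (p s t)) has_real_derivative ?F (p s t)) (at t)" if "\<bar>s\<bar><d" "\<bar>t\<bar><d" for s t
 proof -
  have eq: "(p s t)(j := t' + y j) = p s t'" for t' using ij by (auto simp: p_def)
  have "((%u. pd i f ((p s t)(j := u))) has_real_derivative ?F (p s t)) (at (t + y j))"
   using Ck_on_has_partial_line[OF S f1, of "p s t" j "t + y j"] pS(1)[OF that] ij by (simp add: eq)
  then show ?thesis unfolding DERIV_shift by (simp only: eq)
 qed
 have "\<forall>\<^sub>F h in at_right 0. 0<h & h<d" using eventually_at_right_field d(1) by blast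
 then show "\<forall>\<^sub>F h in at_right 0. dist ((f (y(i := y i + h, j := y j + h)) - f (y(i := y i + h)) - f (y(j := y j + h)) + f y)/h\<^sup>2) (?F y)<e"
 proof eventually_elim
  case (elim h)
  have pe: "p h h = y(i := y i + h, j := y j + h)" "p h 0 = y(i := y i + h)" "p 0 h = y(j := y j + h)" "p 0 0 = y" using ij by (auto simp: p_def)
  have "\<exists>x>0. x<h & (f (p h h) - f (p h 0)) - (f (p 0 h) - f (p 0 0)) = (h - 0)*(pd i f (p x h) - pd i f (p x 0))"
   by (rule MVT2) (use elim d(1) in "auto intro!: DERIV_diff D1")
  then obtain x where x: "0<x" "x<h" "(f (p h h) - f (p h 0)) - (f (p 0 h) - f (p 0 0)) = h*(pd i f (p x h) - pd i f (p x 0))" by auto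
  have "\<exists>z>0. z<h & pd i f (p x h) - pd i f (p x 0) = (h - 0)*?F (p x z)" by (rule MVT2) (use elim x in "auto intro!: D2")
  then obtain z where z: "0<z" "z<h" "pd i f (p x h) - pd i f (p x 0) = h*?F (p x z)" by auto
  have "f (p h h) - f (p h 0) - f (p 0 h) + f (p 0 0) = h\<^sup>2*?F (p x z)" using x(3) z(3) by (simp add: power2_eq_square)
  then have "(f (p h h) - f (p h 0) - f (p 0 h) + f (p 0 0))/h\<^sup>2 = ?F (p x z)" using elim by simp
  then show ?case using pS(2)[of x z] x z elim by (simp add: pe)
 qed
qed

text \<open>The second difference is symmetric in the two directions, so both mixed derivatives are
  its limit.\<close>

lemma partial_deriv_commute:
 assumes S: "eopen n S" and f: "Ck_on n 2 S f" and y: "y \<in> S" and ij: "i<n" "j<n"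
 shows "pd i (pd j f) y = pd j (pd i f) y"
proof (cases "i = j")
 case False
 have "((%h. (f (y(i := y i + h, j := y j + h)) - f (y(i := y i + h)) - f (y(j := y j + h)) + f y)/h\<^sup>2) \<longlongrightarrow> pd i (pd j f) y) (at_right 0)"
 proof -
  have sw: "y(j := a, i := b) = y(i := b, j := a)" for a b using False by (auto simp: fun_upd_twist)
  show ?thesis using mixed_difference_limit[OF S f y ij(2,1)] False unfolding sw by (simp add: algebra_simps)
 qed
 with mixed_difference_limit[OF S f y ij False] show ?thesis using tendsto_unique trivial_limit_at_right_real by blast
qed simp

lemma Cinf_on_partial_commute:
 assumes "eopen n S" "Cinf_on n S f" "y \<in> S" "i<n" "j<n"
 shows "pd i (pd j f) y = pd j (pd i f) y" using partial_deriv_commute[OF assms(1) _ assms(3-5)] assms(2) by (simp add: Cinf_on_def)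

section \<open>Averages along segments and Hadamard's expansion\<close>

definition star_avg :: "(nat => real) => nat => rfun => rfun" where
 "star_avg y0 k f y = integral {0..1} (%t. t ^ k*f (%i. y0 i + t*(y i - y0 i)))"

lemma star_avg_integrand_continuous:
 fixes y0 :: "nat => real" and f :: "rfun"
 assumes f: "continuous_on S f" and c: "!!i. continuous_on U (%u. c u i)"
  and m: "!!u t. u \<in> U ==> t \<in> {0..1} ==> (%i. y0 i + t*(c u i - y0 i)) \<in> S"
 shows "continuous_on (U \<times> cbox 0 1) (%(u, t). t ^ k*f (%i. y0 i + t*(c u i - y0 i)))"
proof -
 have c': "continuous_on (U \<times> cbox 0 1) (%x. c (fst x) i)" for i by (rule continuous_on_compose2[OF c continuous_on_fst[OF continuous_on_id]]) auto
 have "continuous_on (U \<times> cbox 0 1) (%x i. y0 i + snd x*(c (fst x) i - y0 i))"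
  by (intro continuous_on_coordinatewise_then_product continuous_intros c')
 then have "continuous_on (U \<times> cbox 0 1) (%x. f (%i. y0 i + snd x*(c (fst x) i - y0 i)))" by (rule continuous_on_compose2[OF f]) (use m in auto)
 then show ?thesis by (simp add: case_prod_beta) (intro continuous_intros)
qed

text \<open>Differentiation under the integral. The chain rule along the segment brings out a factor
  \<open>t\<close> each time, which is why \<open>star_avg\<close> carries a power of
  \<open>t\<close>: its partial in direction \<open>i\<close> is the average of
  \<open>pd i f\<close> with exponent \<open>Suc l\<close>.\<close>

lemma star_avg_Ck:
 assumes S: "eopen n S"
  and star: "!!y t. y \<in> S ==> t \<in> {0..1} ==> (%i. y0 i + t*(y i - y0 i)) \<in> S"
 shows "Ck_on n k S f ==> Ck_on n k S (star_avg y0 l f)"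
proof (induction k arbitrary: f l)
 have cts: "continuous_on S (star_avg y0 l f)" if "continuous_on S f" for f l
 proof -
  have "continuous_on (S \<times> cbox 0 1) (%(y, t). t ^ l*f (%i. y0 i + t*(y i - y0 i)))"
   by (rule star_avg_integrand_continuous[OF that, where c="%y. y"])
    (rule continuous_on_subset[OF continuous_on_product_coordinates subset_UNIV], rule star)
  then have "continuous_on S (%y. integral (cbox 0 1) (%t. t ^ l*f (%i. y0 i + t*(y i - y0 i))))" by (rule integral_continuous_on_param)
  then show ?thesis by (simp add: star_avg_def[abs_def])
 qed
 {
  case 0
  then show ?case using cts by (simp add: Ck_on_0_iff S)
 next
  case (Suc k)
  show ?case
  proof (rule Ck_on_Suc_I[OF S, where f'="%i. star_avg y0 (Suc l) (pd i f)"])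
   show "continuous_on S (star_avg y0 l f)" using cts Suc.prems Ck_on_continuous_on[OF S] by blast
   show "Ck_on n k S (star_avg y0 (Suc l) (pd i f))" if "i<n" for i using Suc that by (simp add: Ck_on_Suc_iff[OF S])
   fix i y assume i: "i<n" and y: "y \<in> S"
   obtain e where e: "e > 0" "!!z. z \<in> topspace (Euclidean_space n) ==>  (!!i. i<n ==> \<bar>z i - y i\<bar><e) ==> z \<in> S" using eopen_box[OF S y] by blast
   have yS: "y(i := y i + u) \<in> S" if "u \<in> {-e<..<e}" for u using that i y eopen_subset[OF S] e(1) by (intro e(2) fun_upd_in_Euclidean_space) auto
   define c where "c u = y(i := y i + u)" for u
   have cS: "(%j. y0 j + t*(c u j - y0 j)) \<in> S" if "u \<in> {-e<..<e}" "t \<in> {0..1}" for u t using star[OF yS[OF that(1)] that(2)] by (simp add: c_def)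
   have cc: "continuous_on U (%u. c u j)" for j U by (cases "j = i") (auto simp: c_def intro!: continuous_intros)
   have "((%u. integral (cbox 0 1) (%t. t ^ l*f (%j. y0 j + t*(c u j - y0 j))))
     has_field_derivative integral (cbox 0 1) (%t. t ^ Suc l*pd i f (%j. y0 j + t*(c 0 j - y0 j)))) (at 0 within {-e<..<e})"
   proof (rule leibniz_rule_field_derivative)
    fix u t :: real assume u: "u \<in> {-e<..<e}" and t: "t \<in> cbox 0 1"
    define w where "w u = (%j. y0 j + t*(c u j - y0 j))" for u
    have w: "(w u)(i := y0 i + t*(y i + u' - y0 i)) = w u'" for u' by (auto simp: c_def w_def)
    have "w u \<in> S" using cS[OF u] t by (simp add: w_def)
    then have "((%s. f ((w u)(i := s))) has_real_derivative pd i f (w u)) (at (y0 i + t*(y i + u - y0 i)))"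
     using Ck_on_has_partial_line[OF S Suc.prems, of "w u" i "y0 i + t*(y i + u - y0 i)"] i by (simp only: w)
    moreover have "((%u'. y0 i + t*(y i + u' - y0 i)) has_real_derivative t) (at u)" by (auto intro!: derivative_eq_intros)
    ultimately have "((%u'. f ((w u)(i := y0 i + t*(y i + u' - y0 i)))) has_real_derivative pd i f (w u)*t) (at u)" by (rule DERIV_chain2)
    then have "((%u'. f (w u')) has_real_derivative pd i f (w u)*t) (at u)" by (simp only: w)
    then have "((%u'. t ^ l*f (w u')) has_real_derivative t ^ l*(pd i f (w u)*t)) (at u within {-e<..<e})"
     using DERIV_subset[OF DERIV_cmult] by blast
    then show "((%u. t ^ l*f (%j. y0 j + t*(c u j - y0 j))) has_real_derivative
       t ^ Suc l*pd i f (%j. y0 j + t*(c u j - y0 j))) (at u within {-e<..<e})" unfolding w_def by (simp add: algebra_simps)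
   next
    fix u assume u: "u \<in> {-e<..<e}"
    have "continuous_on ({u} \<times> cbox 0 1) (%(u, t). t ^ l*f (%j. y0 j + t*(c u j - y0 j)))"
     by (rule star_avg_integrand_continuous[OF Ck_on_continuous_on[OF S Suc.prems] cc]) (simp add: cS[OF u])
    moreover have "continuous_on (cbox 0 1) (%t::real. (u, t))" by (intro continuous_intros)
    ultimately have "continuous_on (cbox 0 1) (%t. (%(u, t). t ^ l*f (%j. y0 j + t*(c u j - y0 j))) (u, t))" by (rule continuous_on_compose2) auto
    then show "(%t. t ^ l*f (%j. y0 j + t*(c u j - y0 j))) integrable_on cbox 0 1" by (intro integrable_continuous) simp
   next
    have "continuous_on S (pd i f)" using Suc.prems i Ck_on_continuous_on[OF S] by (auto simp: Ck_on_Suc_iff[OF S])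
    then show "continuous_on ({-e<..<e} \<times> cbox 0 1) (%(u, t). t ^ Suc l*pd i f (%j. y0 j + t*(c u j - y0 j)))"
     by (rule star_avg_integrand_continuous[OF _ cc cS])
   qed (use e in auto)
   then have "((%u. integral (cbox 0 1) (%t. t ^ l*f (%j. y0 j + t*(c u j - y0 j))))
     has_field_derivative integral (cbox 0 1) (%t. t ^ Suc l*pd i f (%j. y0 j + t*(c 0 j - y0 j)))) (at 0)"
    using at_within_open[of 0 "{-e<..<e}"] e(1) by simp
   moreover have "c 0 = y" by (simp add: c_def)
   ultimately show "((%t. star_avg y0 l f (y(i := y i + t))) has_real_derivative star_avg y0 (Suc l) (pd i f) y) (at 0)"
    unfolding star_avg_def by (simp only: c_def[symmetric] box_real)
  qed
 }
qed

text \<open>The increment of \<open>f\<close> is the integral of its derivative along the segment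
  from \<open>y0\<close>; the factors y i - y0 i leave the integral and the averages of the partials
  remain.\<close>

lemma Hadamard_expansion:
 assumes S: "eopen n S"
  and star: "!!y t. y \<in> S ==> t \<in> {0..1} ==> (%i. y0 i + t*(y i - y0 i)) \<in> S"
  and f: "Cinf_on n S f"
 obtains g where "!!i. i<n ==> Cinf_on n S (g i)" "!!y. y \<in> S ==> f y = f y0 + (\<Sum>i<n. (y i - y0 i)*g i y)"
proof
 show "Cinf_on n S (star_avg y0 0 (pd i f))" if "i<n" for i
  using star_avg_Ck[OF S star] Cinf_on_partial_deriv[OF S f that] by (simp add: Cinf_on_def)
 fix y assume y: "y \<in> S"
 define \<gamma> where "\<gamma> t = (%i. y0 i + t*(y i - y0 i))" for t
 have \<gamma>S: "\<gamma> t \<in> S" if "t \<in> {0..1}" for t using star[OF y that] by (simp add: \<gamma>_def)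
 have \<gamma>top: "\<gamma> t \<in> topspace (Euclidean_space n)" for t
 proof -
  have "\<gamma> 0 \<in> topspace (Euclidean_space n)" "y \<in> topspace (Euclidean_space n)" using \<gamma>S[of 0] y eopen_subset[OF S] by auto
  then show ?thesis by (auto simp: \<gamma>_def topspace_Euclidean_space)
 qed
 have D: "((%t. f (\<gamma> t)) has_real_derivative (\<Sum>i<n. (y i - y0 i)*pd i f (\<gamma> t))) (at t)" if t: "t \<in> {0..1}" for t
 proof -
  have "((%s. f (\<gamma> (t + s))) has_real_derivative (\<Sum>i<n. (y i - y0 i)*pd i f (\<gamma> (t + 0)))) (at 0)"
  proof (rule C1_curve_derivative[OF S])
   show "\<gamma> (t + 0) \<in> S" using \<gamma>S[OF t] by simp
   show "Ck_on n (Suc 0) S f" using f by (simp add: Cinf_on_def)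
   show "((%s. \<gamma> (t + s) i) has_real_derivative y i - y0 i) (at 0)" for i unfolding \<gamma>_def by (auto intro!: derivative_eq_intros)
  qed (rule \<gamma>top)
  then show ?thesis using DERIV_shift[of "%t. f (\<gamma> t)" _ 0 t] by (simp add: add.commute)
 qed
 have "((%t. \<Sum>i<n. (y i - y0 i)*pd i f (\<gamma> t)) has_integral (f (\<gamma> 1) - f (\<gamma> 0))) {0..1}" by (rule fundamental_theorem_of_calculus)
   (auto intro!: has_vector_derivative_at_within D[THEN has_real_derivative_iff_has_vector_derivative[THEN iffD1]])
 then have "f (\<gamma> 1) - f (\<gamma> 0) = integral {0..1} (%t. \<Sum>i<n. (y i - y0 i)*pd i f (\<gamma> t))" by (simp add: integral_unique)
 also have "... = (\<Sum>i<n. integral {0..1} (%t. (y i - y0 i)*pd i f (\<gamma> t)))"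
 proof (rule integral_sum)
  fix i assume "i \<in> {..<n}"
  then have c: "continuous_on S (pd i f)" using Cinf_on_continuous_on[OF S Cinf_on_partial_deriv[OF S f]] by simp
  have "continuous_on {0..1} \<gamma>" unfolding \<gamma>_def by (intro continuous_on_coordinatewise_then_product continuous_intros)
  then have "continuous_on {0..1} (%t. pd i f (\<gamma> t))" by (rule continuous_on_compose2[OF c]) (use \<gamma>S in auto)
  then show "(%t. (y i - y0 i)*pd i f (\<gamma> t)) integrable_on {0..1}" by (intro integrable_continuous_interval continuous_intros)
 qed simp
 also have "... = (\<Sum>i<n. (y i - y0 i) * star_avg y0 0 (pd i f) y)" by (simp add: star_avg_def \<gamma>_def)
 finally show "f y = f y0 + (\<Sum>i<n. (y i - y0 i) * star_avg y0 0 (pd i f) y)" by (simp add: \<gamma>_def)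
qed

lemma Cinf_on_const: "eopen n S ==> Cinf_on n S (%y. c)" by (simp add: Cinf_on_def Ck_on_const)

lemma Cinf_on_coord: "eopen n S ==> Cinf_on n S (%y. y j)" by (simp add: Cinf_on_def Ck_on_coord)

lemma Cinf_on_add: "eopen n S ==> Cinf_on n S f ==> Cinf_on n S g ==> Cinf_on n S (%y. f y + g y)" by (simp add: Cinf_on_def Ck_on_add)

lemma Cinf_on_mult: "eopen n S ==> Cinf_on n S f ==> Cinf_on n S g ==> Cinf_on n S (%y. f y*g y)" by (simp add: Cinf_on_def Ck_on_mult)

lemma Cinf_on_sum: "eopen n S ==> (!!i. i \<in> I ==> Cinf_on n S (f i)) ==> Cinf_on n S (%y. \<Sum>i\<in>I. f i y)"
 by (induction I rule: infinite_finite_induct) (simp_all add: Cinf_on_const Cinf_on_add)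

lemma Cinf_on_prod: "eopen n S ==> (!!i. i \<in> I ==> Cinf_on n S (f i)) ==> Cinf_on n S (%y. \<Prod>i\<in>I. f i y)"
 by (induction I rule: infinite_finite_induct) (simp_all add: Cinf_on_const Cinf_on_mult)

lemma Cinf_on_uminus: "eopen n S ==> Cinf_on n S f ==> Cinf_on n S (%y. - f y)" using Cinf_on_mult[of n S "%y. -1" f] by (simp add: Cinf_on_const)

lemma Cinf_on_diff: "eopen n S ==> Cinf_on n S f ==> Cinf_on n S g ==> Cinf_on n S (%y. f y - g y)"
 using Cinf_on_add[of n S f "%y. - g y"] by (simp add: Cinf_on_uminus)

lemma Cinf_on_divide_const: "eopen n S ==> Cinf_on n S f ==> Cinf_on n S (%y. f y/c)"
 using Cinf_on_mult[of n S f "%y. inverse c"] by (simp add: Cinf_on_const divide_inverse)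

lemma Cinf_on_compose:
 assumes "eopen n S" "eopen m T" "!!y. y \<in> S ==> \<Phi> y \<in> T" "!!j. j<m ==> Cinf_on n S (%y. \<Phi> y j)" "Cinf_on m T f"
 shows "Cinf_on n S (%y. f (\<Phi> y))" unfolding Cinf_on_def
proof
 fix k show "Ck_on n k S (%y. f (\<Phi> y))" by (rule Ck_on_compose[OF assms(1-3)]) (use assms(4,5) in "simp_all add: Cinf_on_def")
qed

lemma partial_deriv_const: "pd i (%y. c) y = 0" by (rule partial_derivI) simp

lemma partial_deriv_coord: "pd i (%y. y j) y = (if i = j then 1 else 0)" by (rule partial_derivI) (cases "i = j"; auto intro!: derivative_eq_intros)

context
 fixes n S i and y :: "nat => real"
 assumes S: "eopen n S" and i: "i<n" and y: "y \<in> S"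
begin

lemma partial_deriv_add: "Cinf_on n S f ==> Cinf_on n S g ==>  pd i (%y. f y + g y) y = pd i f y + pd i g y"
 by (intro partial_derivI DERIV_add Cinf_on_has_partial[OF S _ y i])

lemma partial_deriv_diff: "Cinf_on n S f ==> Cinf_on n S g ==>  pd i (%y. f y - g y) y = pd i f y - pd i g y"
 by (intro partial_derivI DERIV_diff Cinf_on_has_partial[OF S _ y i])

lemma partial_deriv_uminus: "Cinf_on n S f ==> pd i (%y. - f y) y = - pd i f y" by (intro partial_derivI DERIV_minus Cinf_on_has_partial[OF S _ y i])

lemma partial_deriv_mult:
 assumes "Cinf_on n S f" "Cinf_on n S g"
 shows "pd i (%y. f y*g y) y = pd i f y*g y + f y*pd i g y"
proof (rule partial_derivI)
 show "((%t. f (y(i := y i + t))*g (y(i := y i + t))) has_real_derivative pd i f y*g y + f y*pd i g y) (at 0)"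
  using DERIV_mult[OF Cinf_on_has_partial[OF S assms(1) y i] Cinf_on_has_partial[OF S assms(2) y i]]
  by (simp only: add_0_right fun_upd_triv mult.commute[of _ "f y"])
qed

lemma partial_deriv_cmult: "Cinf_on n S f ==> pd i (%y. c*f y) y = c*pd i f y"
 by (intro partial_derivI DERIV_cmult Cinf_on_has_partial[OF S _ y i])

lemma partial_deriv_sum: "(!!j. j \<in> I ==> Cinf_on n S (f j)) ==>  pd i (%y. \<Sum>j\<in>I. f j y) y = (\<Sum>j\<in>I. pd i (f j) y)"
 by (intro partial_derivI DERIV_sum Cinf_on_has_partial[OF S _ y i])

lemma partial_deriv_chain:
 assumes "eopen m T" "!!y. y \<in> S ==> \<Phi> y \<in> T" "!!j. j<m ==> Cinf_on n S (%y. \<Phi> y j)" "Cinf_on m T f"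
 shows "pd i (%y. f (\<Phi> y)) y = (\<Sum>k<m. pd k f (\<Phi> y)*pd i (%y. \<Phi> y k) y)"
 using assms by (intro partial_derivI partial_deriv_compose[OF S assms(1,2) _ _ y i]) (auto simp: Cinf_on_def)

end

declare One_nat_def [simp del]

text \<open>Smoothness of functions of one real variable, through the model space \<open>Euclidean_space 1\<close>.\<close>

definition line_set :: "real set => (nat => real) set" where "line_set T = {y \<in> topspace (Euclidean_space 1). y 0 \<in> T}"

definition smooth1 :: "real set => (real => real) => bool" where "smooth1 T u \<longleftrightarrow> Cinf_on 1 (line_set T) (%y. u (y 0))"

lemma eopen_line_set: "open T ==> eopen 1 (line_set T)" unfolding line_set_def by (rule eopen_continuous_preimage[OF openin_topspace])
  (rule continuous_on_subset[OF continuous_on_product_coordinates subset_UNIV])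

lemma line_set_point: "s \<in> T ==> (%i::nat. if i = 0 then s else 0) \<in> line_set T" by (auto simp: line_set_def topspace_Euclidean_space)

lemma Ck_on_line_Suc_I:
 assumes T: "open T" and D: "!!s. s \<in> T ==> (u has_real_derivative u' s) (at s)"
  and u': "Ck_on 1 k (line_set T) (%y. u' (y 0))"
 shows "Ck_on 1 (Suc k) (line_set T) (%y. u (y 0))"
proof (rule Ck_on_Suc_I[OF eopen_line_set[OF T], where f'="%i y. u' (y 0)"])
 have "continuous_on T u" using D DERIV_isCont continuous_at_imp_continuous_on by blast
 then show "continuous_on (line_set T) (%y. u (y 0))" by (rule continuous_on_compose2)
   (auto simp: line_set_def intro: continuous_on_subset[OF continuous_on_product_coordinates subset_UNIV])
 fix i :: nat and y assume "i<1" "y \<in> line_set T"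
 then have "(u has_real_derivative u' (y 0)) (at (0 + y 0))" and i: "i = 0" using D by (auto simp: line_set_def)
 then show "((%t. u ((y(i := y i + t)) 0)) has_real_derivative u' (y 0)) (at 0)" unfolding DERIV_shift i by (simp add: add.commute)
qed (rule u')

lemma smooth1_I:
 assumes "open T" "!!s. s \<in> T ==> (u has_real_derivative u' s) (at s)" "smooth1 T u'"
 shows "smooth1 T u" using Ck_on_line_Suc_I[OF assms(1,2)] assms(3) unfolding smooth1_def Cinf_on_def by (metis Ck_on_Suc_D)

lemma smooth1_deriv:
 assumes T: "open T" and u: "smooth1 T u"
 shows "!!s. s \<in> T ==> (u has_real_derivative deriv u s) (at s)" "smooth1 T (deriv u)"
proof -
 have D: "(u has_real_derivative pd 0 (%y. u (y 0)) y) (at (y 0))" if "y \<in> line_set T" for y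
 proof -
  have "((%t. u (y 0 + t)) has_real_derivative pd 0 (%y. u (y 0)) y) (at 0)"
   using Cinf_on_has_partial[OF eopen_line_set[OF T] u[unfolded smooth1_def] that, of 0] by simp
  then show ?thesis using DERIV_shift[of u _ 0 "y 0"] by (simp add: add.commute)
 qed
 then have eq: "pd 0 (%y. u (y 0)) y = deriv u (y 0)" if "y \<in> line_set T" for y using DERIV_imp_deriv[OF D[OF that]] by simp
 show "(u has_real_derivative deriv u s) (at s)" if "s \<in> T" for s using D[OF line_set_point[OF that]] eq[OF line_set_point[OF that]] by simp
 show "smooth1 T (deriv u)" unfolding smooth1_def using Cinf_on_cong[OF eopen_line_set[OF T] eq
    Cinf_on_partial_deriv[OF eopen_line_set[OF T] u[unfolded smooth1_def]]] by simp
qed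

lemma smooth1_subset: "T' \<subseteq> T ==> smooth1 T u ==> smooth1 T' u" unfolding smooth1_def by (erule Cinf_on_subset[rotated]) (auto simp: line_set_def)

text \<open>A function of one variable is a function on \<open>Euclidean_space 1\<close>, so the
  chain rule of several variables applies with a single inner coordinate.\<close>

lemma Cinf_on_smooth1:
 assumes S: "eopen n S" and T: "open T" "!!y. y \<in> S ==> f y \<in> T"
  and u: "smooth1 T u" and f: "Cinf_on n S f"
 shows "Cinf_on n S (%y. u (f y))"
  and "!!i y. i<n ==> y \<in> S ==> pd i (%y. u (f y)) y = deriv u (f y)*pd i f y"
proof -
 let ?\<Phi> = "%y (i::nat). if i = 0 then f y else 0 :: real"
 have \<Phi>: "?\<Phi> y \<in> line_set T" if "y \<in> S" for y using T(2)[OF that] by (rule line_set_point)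
 have c: "Cinf_on n S (%y. ?\<Phi> y j)" if "j<1" for j using f that by (cases "j = 0") simp_all
 show "Cinf_on n S (%y. u (f y))" using Cinf_on_compose[OF S eopen_line_set[OF T(1)] \<Phi> c u[unfolded smooth1_def]] by simp
 fix i y assume i: "i<n" "y \<in> S"
 have "{..<1} = {0::nat}" by auto
 then have "pd i (%y. u (?\<Phi> y 0)) y = pd 0 (%y. u (y 0)) (?\<Phi> y)*pd i f y"
  using partial_deriv_chain[OF S i eopen_line_set[OF T(1)] \<Phi> c u[unfolded smooth1_def]] by simp
 moreover have "pd 0 (%y. u (y 0)) (?\<Phi> y) = deriv u (f y)"
 proof (rule partial_derivI)
  have "((%t. u (t + f y)) has_real_derivative deriv u (f y)) (at 0)"
   using smooth1_deriv(1)[OF T(1) u T(2)[OF i(2)]] DERIV_shift[of u _ 0 "f y"] by simp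
  then show "((%t. u (((?\<Phi> y)(0 := ?\<Phi> y 0 + t)) 0)) has_real_derivative deriv u (f y)) (at 0)" by (simp add: add.commute)
 qed
 ultimately show "pd i (%y. u (f y)) y = deriv u (f y)*pd i f y" by simp
qed

context
 fixes T :: "real set" assumes T: "open T"
begin

lemma smooth1_const: "smooth1 T (%s. c)" unfolding smooth1_def by (rule Cinf_on_const[OF eopen_line_set[OF T]])

lemma smooth1_id: "smooth1 T (%s. s)" unfolding smooth1_def by (rule Cinf_on_coord[OF eopen_line_set[OF T]])

lemma smooth1_add: "smooth1 T u ==> smooth1 T v ==> smooth1 T (%s. u s + v s)" unfolding smooth1_def by (rule Cinf_on_add[OF eopen_line_set[OF T]])

lemma smooth1_mult: "smooth1 T u ==> smooth1 T v ==> smooth1 T (%s. u s * v s)" unfolding smooth1_def by (rule Cinf_on_mult[OF eopen_line_set[OF T]])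

lemma smooth1_diff: "smooth1 T u ==> smooth1 T v ==> smooth1 T (%s. u s - v s)" unfolding smooth1_def by (rule Cinf_on_diff[OF eopen_line_set[OF T]])

lemma smooth1_sum: "(!!i. i \<in> I ==> smooth1 T (u i)) ==> smooth1 T (%s. \<Sum>i\<in>I. u i s)"
 unfolding smooth1_def by (rule Cinf_on_sum[OF eopen_line_set[OF T]])

lemma smooth1_compose: "open T' ==> (!!s. s \<in> T ==> v s \<in> T') ==> smooth1 T' u ==> smooth1 T v ==> smooth1 T (%s. u (v s))" unfolding smooth1_def
 by (rule Cinf_on_smooth1(1)[OF eopen_line_set[OF T], of T']) (auto simp: line_set_def smooth1_def)

end

text \<open>The derivative of \<open>inverse\<close> is minus its square, so each order of
  differentiability yields the next.\<close>

lemma smooth1_inverse: "smooth1 (- {0}) inverse"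
proof -
 have "Ck_on 1 k (line_set (- {0})) (%y. inverse (y 0))" for k
 proof (induction k)
  case 0
  have "continuous_on (line_set (- {0})) (%y. inverse (y 0))"
   by (intro continuous_intros continuous_on_subset[OF continuous_on_product_coordinates subset_UNIV]) (auto simp: line_set_def)
  then show ?case by (simp add: Ck_on_0_iff eopen_line_set open_Compl)
 next
  case (Suc k)
  have o: "open (- {0 :: real})" by (simp add: open_Compl)
  have "Ck_on 1 k (line_set (- {0})) (%y. (- 1)*(inverse (y 0)*inverse (y 0)))" by (intro Ck_on_mult Ck_on_const Suc eopen_line_set o)
  then show ?case by (intro Ck_on_line_Suc_I[OF o, where u'="%s. (- 1)*(inverse s * inverse s)"])
    (auto intro!: derivative_eq_intros simp: power2_eq_square)
 qed
 then show ?thesis by (simp add: smooth1_def Cinf_on_def)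
qed

lemma Cinf_on_inverse:
 assumes "eopen n S" "Cinf_on n S f" "!!y. y \<in> S ==> f y ~= 0"
 shows "Cinf_on n S (%y. inverse (f y))" by (rule Cinf_on_smooth1(1)[OF assms(1) _ _ smooth1_inverse assms(2)]) (use assms(3) in auto)

lemma Cinf_on_divide: "eopen n S ==> Cinf_on n S f ==> Cinf_on n S g ==> (!!y. y \<in> S ==> g y ~= 0) ==>  Cinf_on n S (%y. f y/g y)"
 by (simp add: divide_inverse Cinf_on_mult Cinf_on_inverse)

lemma smooth1_divide:
 assumes "open T" "smooth1 T u" "smooth1 T v" "!!s. s \<in> T ==> v s ~= 0"
 shows "smooth1 T (%s. u s/v s)" using assms unfolding smooth1_def by (intro Cinf_on_divide eopen_line_set) (auto simp: line_set_def)

lemma smooth1_integral: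
 assumes "smooth1 UNIV r"
 shows "\<exists>q. smooth1 UNIV q & q 0 = 0 & (\<forall>s. (q has_real_derivative r s) (at s))"
proof -
 have "continuous_on UNIV r" using smooth1_deriv(1)[OF open_UNIV assms] DERIV_isCont continuous_at_imp_continuous_on by blast
 then obtain q where q: "!!s. (q has_real_derivative r s) (at s)"
 proof -
  assume c: "continuous_on UNIV r" and k: "!!q. (!!s. (q has_real_derivative r s) (at s)) ==> thesis"
  obtain q where "\<forall>s. (q has_vector_derivative r s) (at s)" using einterval_antiderivative[of "-\<infinity>" "\<infinity>" r] c
   by (auto simp: continuous_on_eq_continuous_at)
  then show thesis using k by (auto simp: has_real_derivative_iff_has_vector_derivative)
 qed
 have D: "((%s. q s - q 0) has_real_derivative r s) (at s)" for s using q by (auto intro!: derivative_eq_intros)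
 moreover have "smooth1 UNIV (%s. q s - q 0)" by (rule smooth1_I[OF open_UNIV D assms])
 ultimately show ?thesis by (intro exI[of _ "%s. q s - q 0"]) simp
qed

text \<open>Division by the coordinate. It later removes the simple zero at 0 of the profile
  functions.\<close>

lemma smooth1_Hadamard:
 assumes "smooth1 UNIV f" "f 0 = 0"
 obtains g where "smooth1 UNIV g" "!!s. f s = s * g s"
proof -
 have S: "eopen 1 (line_set UNIV)" by (simp add: eopen_line_set)
 have st: "(%i. 0 + t*(y i - 0)) \<in> line_set UNIV" if "y \<in> line_set UNIV" for y and t :: real
  using that by (auto simp: line_set_def topspace_Euclidean_space)
 obtain g where g: "!!i. i<1 ==> Cinf_on 1 (line_set UNIV) (g i)" "!!y. y \<in> line_set UNIV ==> f (y 0) = f 0 + (\<Sum>i<1. (y i - 0)*g i y)"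
  using Hadamard_expansion[OF S st assms(1)[unfolded smooth1_def]] by blast
 define G where "G s = g 0 (%i. if i = 0 then s else 0)" for s
 have "y = (%i. if i = 0 then y 0 else 0)" if "y \<in> line_set UNIV" for y using that by (auto simp: line_set_def topspace_Euclidean_space)
 then have "smooth1 UNIV G" unfolding smooth1_def by (intro Cinf_on_cong[OF S _ g(1)[of 0]]) (simp_all add: G_def)
 moreover have "f s = s * G s" for s using g(2)[OF line_set_point[of s]] assms(2) by (simp add: G_def One_nat_def)
 ultimately show ?thesis using that by blast
qed

section \<open>A flat function and a one-sided cut-off\<close>

definition flat :: "nat => real => real" where "flat m s = (if s<0 then (1/s) ^ m*exp (1/s) else 0)"

lemma flat_tendsto_0: "((%s. (1/s) ^ m*exp (1/s)) \<longlongrightarrow> 0) (at_left (0::real))"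
proof -
 have "((%t::real. t ^ m/exp t) \<longlongrightarrow> 0) at_top" by (rule tendsto_power_div_exp_0)
 moreover have "filterlim (%s::real. - (1/s)) at_top (at_left 0)"
  using filterlim_inverse_at_bot_neg by (simp add: filterlim_uminus_at_top inverse_eq_divide)
 ultimately have "((%s::real. (- (1/s)) ^ m/exp (- (1/s))) \<longlongrightarrow> 0) (at_left 0)" by (rule filterlim_compose)
 then have "((%s::real. (-1) ^ m*((- (1/s)) ^ m/exp (- (1/s)))) \<longlongrightarrow> (-1) ^ m*0) (at_left 0)" by (intro tendsto_mult tendsto_const)
 moreover have "(-1) ^ m*((- (1/s)) ^ m/exp (- (1/s))) = (1/s) ^ m*exp (1/s)" for s :: real
  by (simp add: exp_minus divide_inverse power_mult_distrib[symmetric])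
 ultimately show ?thesis by simp
qed

text \<open>Differentiating exp (1/s) produces powers of 1/s. With these included the family
  \<open>flat\<close> is closed under differentiation, also at 0, where all its members are
  flat.\<close>

lemma flat_deriv: "(flat m has_real_derivative - real m*flat (Suc m) s - flat (Suc (Suc m)) s) (at s)"
proof -
 consider "s<0" | "s > 0" | "s = 0" by linarith
 then show ?thesis
 proof cases
  case 1
  have "((%s. (1/s) ^ m*exp (1/s)) has_real_derivative - real m*flat (Suc m) s - flat (Suc (Suc m)) s) (at s)"
  proof -
   have D: "((%s. 1/s) has_real_derivative - ((1/s)\<^sup>2)) (at s)" using 1 by (auto intro!: derivative_eq_intros simp: power2_eq_square)
   \<comment> \<open>The case split on \<open>m\<close> is due to the truncated exponent
     \<open>m - Suc 0\<close> in the rule for powers.\<close>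
   have E: "of_nat m*(- q\<^sup>2*q ^ (m - Suc 0))*E + E*(- q\<^sup>2)*q ^ m = - real m*(q ^ Suc m*E) - q ^ Suc (Suc m)*E" for q E :: real
    by (cases m) (simp_all add: power2_eq_square algebra_simps)
   have "flat k s = (1/s) ^ k*exp (1/s)" for k using 1 by (simp add: flat_def)
   then show ?thesis using DERIV_cong[OF DERIV_mult[OF DERIV_power[OF D, of m] DERIV_fun_exp[OF D]] E] by simp
  qed
  moreover have "\<forall>\<^sub>F t in nhds s. (1/t) ^ m*exp (1/t) = flat m t"
   using eventually_nhds_in_open[of "{..<0}" s] 1 by (auto simp: flat_def elim: eventually_mono)
  ultimately show ?thesis by (rule DERIV_transform_ev)
 next
  case 2
  have "\<forall>\<^sub>F t in nhds s. 0 = flat m t" using eventually_nhds_in_open[of "{0<..}" s] 2 by (auto simp: flat_def elim: eventually_mono)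
  then have "(flat m has_real_derivative 0) (at s)" using DERIV_transform_ev[of "%_. 0"] by simp
  then show ?thesis using 2 by (simp add: flat_def)
 next
  case 3
  \<comment> \<open>For t < 0 the difference quotient at 0 is the function of
    \<open>flat_tendsto_0\<close> with exponent m + 1.\<close>
  have "((%t. flat m t/t) \<longlongrightarrow> 0) (at_left 0)" by (rule Lim_transform_eventually[OF flat_tendsto_0[of "Suc m"]])
    (auto simp: eventually_at_left_field flat_def intro!: exI[of _ "-1"])
  moreover have "((%t. flat m t/t) \<longlongrightarrow> 0) (at_right 0)" by (rule Lim_transform_eventually[OF tendsto_const])
    (auto simp: eventually_at_right_field flat_def intro!: exI[of _ 1])
  ultimately have "((%t. flat m t/t) \<longlongrightarrow> 0) (at 0)" by (rule filterlim_split_at)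
  then show ?thesis using 3 by (simp add: has_field_derivative_iff flat_def)
 qed
qed

lemma smooth1_flat: "smooth1 UNIV (flat m)"
proof -
 have S: "eopen 1 (line_set UNIV)" by (simp add: eopen_line_set)
 have "Ck_on 1 k (line_set UNIV) (%y. flat m (y 0))" for k
 proof (induction k arbitrary: m)
  case 0
  have "continuous_on UNIV (flat m)" using flat_deriv DERIV_isCont continuous_at_imp_continuous_on by blast
  then have "continuous_on (line_set UNIV) (%y. flat m (y 0))" by (rule continuous_on_compose2)
    (auto intro: continuous_on_subset[OF continuous_on_product_coordinates subset_UNIV])
  then show ?case by (simp add: Ck_on_0_iff S)
 next
  case (Suc k)
  have "Ck_on 1 k (line_set UNIV) (%y. - real m*flat (Suc m) (y 0) + (-1)*flat (Suc (Suc m)) (y 0))"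
   by (intro Ck_on_add Ck_on_mult Ck_on_const Suc S)
  then show ?case by (intro Ck_on_line_Suc_I[where u'="%s. - real m*flat (Suc m) s - flat (Suc (Suc m)) s"]) (simp_all add: flat_deriv[simplified])
 qed
 then show ?thesis by (simp add: smooth1_def Cinf_on_def)
qed

text \<open>Profiles have to be smooth on the whole line, although A_i = b_i s + a_i may vanish for
  negative s. Replacing s by \<open>\<tau> s\<close> changes nothing for s >= 0 and never lets the
  argument fall below -e. For s < 0 the function is s (1 - exp (e/s)), and exp u >= 1 + u gives the
  bound.\<close>

lemma smooth_cutoff:
 assumes "(e::real) > 0"
 obtains \<tau> where "smooth1 UNIV \<tau>" "!!s. s \<ge> 0 ==> \<tau> s = s" "!!s. \<tau> s \<ge> - e"
proof
 define \<tau> where "\<tau> s = s - s * flat 0 (s/e)" for s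
 show "smooth1 UNIV \<tau>" unfolding \<tau>_def by (intro smooth1_diff smooth1_mult smooth1_id open_UNIV
    smooth1_compose[OF open_UNIV open_UNIV UNIV_I smooth1_flat] smooth1_divide smooth1_const) (use assms in auto)
 show "\<tau> s = s" if "s \<ge> 0" for s 
 proof -
  have "\<not> s/e<0" using that assms by (simp add: not_less)
  then show ?thesis by (simp add: \<tau>_def flat_def)
 qed
 show "\<tau> s \<ge> - e" for s
 proof (cases "s<0")
  case True
  then have "s/e<0" using assms by (simp add: divide_neg_pos)
  then have t: "\<tau> s = s * (1 - exp (e/s))" by (simp add: \<tau>_def flat_def algebra_simps)
  have "1 - exp (e/s) <= - (e/s)" using exp_ge_add_one_self[of "e/s"] by linarith
  then have "s * (- (e/s)) <= s * (1 - exp (e/s))" using True by (intro mult_left_mono_neg) auto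
  then show ?thesis using t True by (simp only:) simp
 next
  case False
  then have "\<not> s/e<0" using assms by (simp add: not_less)
  then show ?thesis using False assms by (simp add: \<tau>_def flat_def)
 qed
qed

declare One_nat_def [simp]

section \<open>Linear algebra: inverse matrices, coframes and traces of projectors\<close>

hide_const (open) Gauss_Jordan_Elimination.mat_inverse

definition is_inverse :: "nat => (nat => nat => real) => (nat => nat => real) => bool" where
 "is_inverse n A B \<longleftrightarrow> (\<forall>i<n. \<forall>j<n. (\<Sum>k<n. A i k*B k j) = (if i = j then 1 else 0))"

definition nondegenerate :: "nat => (nat => nat => real) => bool" where "nondegenerate n A \<longleftrightarrow> (\<forall>v. (\<forall>i<n. (\<Sum>k<n. A i k * v k) = 0) --> (\<forall>k<n. v k = 0))"

text \<open>Matrices are plain functions, since their size is a term and their entries vary with a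
  point. Determinants enter through Cramer's rule, which gives both the inverse and its smooth
  dependence on the entries.\<close>

definition det_n :: "nat => (nat => nat => real) => real" where "det_n n A = Determinant.det (Matrix.mat n n (%(i, j). A i j))"

definition cof_n :: "nat => (nat => nat => real) => nat => nat => real" where "cof_n n A i j = (-1) ^ (i + j) *
  det_n (n - 1) (%a b. A (if a<i then a else Suc a) (if b<j then b else Suc b))"

lemma det_n_expand: "det_n n A = (\<Sum>p\<in>{p. p permutes {0..<n}}. signof p*(\<Prod>i=0..<n. A i (p i)))"
proof -
 have "det_n n A = (\<Sum>p\<in>{p. p permutes {0..<n}}. signof p*(\<Prod>i=0..<n. Matrix.mat n n (%(i, j). A i j) $$ (i, p i)))"
  unfolding det_n_def by (rule det_def') simp
 also have "... = (\<Sum>p\<in>{p. p permutes {0..<n}}. signof p*(\<Prod>i=0..<n. A i (p i)))"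
 proof (rule sum.cong)
  fix p assume "p \<in> {p. p permutes {0..<n}}"
  then have "p i<n" if "i<n" for i using that permutes_in_image[of p "{0..<n}" i] by auto
  then show "signof p*(\<Prod>i=0..<n. Matrix.mat n n (%(i, j). A i j) $$ (i, p i)) = signof p*(\<Prod>i=0..<n. A i (p i))" by simp
 qed simp
 finally show ?thesis .
qed

lemma adj_n:
 assumes "i<n" "j<n"
 shows "(\<Sum>k<n. A i k*cof_n n A j k) = (if i = j then det_n n A else 0)"
  and "(\<Sum>k<n. cof_n n A k i*A k j) = (if i = j then det_n n A else 0)"
proof -
 let ?M = "Matrix.mat n n (%(i, j). A i j)"
 have M: "?M \<in> carrier_mat n n" by simp
 have cof: "adj_mat ?M $$ (k, j) = cof_n n A j k" if "k<n" "j<n" for j k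
 proof -
  have "mat_delete ?M j k = Matrix.mat (n - 1) (n - 1) (%(a, b). A (if a<j then a else Suc a) (if b<k then b else Suc b))"
   using that by (intro eq_matI) (auto simp: mat_delete_def)
  then show ?thesis using that by (simp add: adj_mat_def cofactor_def cof_n_def det_n_def)
 qed
 have "(?M*adj_mat ?M) $$ (i, j) = (\<Sum>k<n. A i k*cof_n n A j k)" using assms adj_mat(1)[OF M] cof by (simp add: scalar_prod_def lessThan_atLeast0)
 then show "(\<Sum>k<n. A i k*cof_n n A j k) = (if i = j then det_n n A else 0)"
  using assms unfolding adj_mat(2)[OF M] by (cases "i = j") (simp_all add: det_n_def)
 have "(adj_mat ?M*?M) $$ (i, j) = (\<Sum>k<n. cof_n n A k i*A k j)" using assms adj_mat(1)[OF M] cof by (simp add: scalar_prod_def lessThan_atLeast0)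
 then show "(\<Sum>k<n. cof_n n A k i*A k j) = (if i = j then det_n n A else 0)"
  using assms unfolding adj_mat(3)[OF M] by (cases "i = j") (simp_all add: det_n_def)
qed

lemma det_n_nonzero:
 assumes "nondegenerate n A"
 shows "det_n n A ~= 0"
proof
 let ?M = "Matrix.mat n n (%(i, j). A i j)"
 assume "det_n n A = 0"
 then obtain v where v: "v \<in> carrier_vec n" "v ~= 0\<^sub>v n" "?M *\<^sub>v v = 0\<^sub>v n" using det_0_iff_vec_prod_zero_field[of ?M n] by (auto simp: det_n_def)
 have "(\<Sum>k<n. A i k * vec_index v k) = 0" if "i<n" for i
 proof -
  have "vec_index (?M *\<^sub>v v) i = (\<Sum>k<n. A i k * vec_index v k)" using that v(1) by (simp add: scalar_prod_def lessThan_atLeast0)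
  then show ?thesis using v(3) that by simp
 qed
 then have "\<forall>k<n. vec_index v k = 0" using assms unfolding nondegenerate_def by blast
 then have "v = 0\<^sub>v n" using v(1) by auto
 then show False using v(2) by simp
qed

lemma nondegenerate_inverse:
 assumes "nondegenerate n A"
 shows "is_inverse n A (%i j. cof_n n A j i/det_n n A)"
  and "is_inverse n (%i j. cof_n n A j i/det_n n A) A" using adj_n[of _ n _ A] det_n_nonzero[OF assms]
 by (simp_all add: is_inverse_def sum_divide_distrib[symmetric])

text \<open>B = (C A) B = C (A B) = C. As \<open>mat_inverse\<close> is chosen among right inverses,
  this is what fixes its entries below \<open>n\<close>.\<close>

lemma is_inverse_unique:
 assumes AB: "is_inverse n A B" and CA: "is_inverse n C A" and ij: "i<n" "j<n"
 shows "B i j = C i j"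
proof -
 have "C i j = (\<Sum>k<n. C i k*(if k = j then 1 else 0))" using ij by (simp add: if_distrib cong: if_cong)
 also have "... = (\<Sum>k<n. C i k*(\<Sum>l<n. A k l*B l j))" using AB ij by (intro sum.cong) (auto simp: is_inverse_def)
 also have "... = (\<Sum>l<n. (\<Sum>k<n. C i k*A k l)*B l j)" unfolding sum_distrib_left sum_distrib_right by (subst sum.swap) (simp add: mult.assoc)
 also have "... = (\<Sum>l<n. (if i = l then 1 else 0)*B l j)" using CA ij by (intro sum.cong) (auto simp: is_inverse_def)
 also have "... = B i j" using ij by (simp add: if_distrib[of "%x. x*_"] cong: if_cong)
 finally show ?thesis by simp
qed

lemma mat_inverse_right: "is_inverse n A B ==> is_inverse n A (mat_inverse n A)" unfolding Defs.mat_inverse_def is_inverse_def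
 by (rule someI[of "%B. \<forall>i<n. \<forall>j<n. (\<Sum>k<n. A i k*B k j) = (if i = j then 1 else 0)"])

lemma mat_inverse_nondegenerate:
 assumes "nondegenerate n A"
 shows "is_inverse n A (mat_inverse n A)" "is_inverse n (mat_inverse n A) A"
  and "!!i j. i<n ==> j<n ==> mat_inverse n A i j = cof_n n A j i/det_n n A"
proof -
 note N = nondegenerate_inverse[OF assms]
 show R: "is_inverse n A (mat_inverse n A)" by (rule mat_inverse_right[OF N(1)])
 show E: "mat_inverse n A i j = cof_n n A j i/det_n n A" if "i<n" "j<n" for i j using is_inverse_unique[OF R N(2) that] .
 show "is_inverse n (mat_inverse n A) A" using N(2) E by (simp add: is_inverse_def)
qed

lemma mat_inverse_unique:
 assumes "is_inverse n A B" "is_inverse n B A" "i<n" "j<n"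
 shows "mat_inverse n A i j = B i j" using is_inverse_unique[OF mat_inverse_right[OF assms(1)] assms(2-4)] .

lemma mat_inverse_symmetric:
 assumes "nondegenerate n A" "!!i j. i<n ==> j<n ==> A i j = A j i" "i<n" "j<n"
 shows "mat_inverse n A i j = mat_inverse n A j i"
proof -
 have "is_inverse n (%i j. mat_inverse n A j i) A"
  using mat_inverse_nondegenerate(1)[OF assms(1)] assms(2) by (fastforce simp: is_inverse_def mult.commute intro: sum.cong)
 from is_inverse_unique[OF mat_inverse_nondegenerate(1)[OF assms(1)] this assms(3,4)] show ?thesis by simp
qed

lemma mat_inverse_Cinf:
 assumes S: "eopen N S"
  and A: "!!a b. a<n ==> b<n ==> Cinf_on N S (A a b)"
  and nd: "!!y. y \<in> S ==> nondegenerate n (%a b. A a b y)"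
  and ij: "i<n" "j<n"
 shows "Cinf_on N S (%y. mat_inverse n (%a b. A a b y) i j)"
proof -
 have det: "Cinf_on N S (%y. det_n m (%a b. B a b y))" if "!!a b. a<m ==> b<m ==> Cinf_on N S (B a b)" for m B unfolding det_n_expand
 proof (intro Cinf_on_sum[OF S] Cinf_on_mult[OF S] Cinf_on_const[OF S] Cinf_on_prod[OF S])
  fix p a assume "p \<in> {p. p permutes {0..<m}}" "a \<in> {0..<m}"
  then have "a<m" "p a<m" using permutes_in_image[of p "{0..<m}" a] by auto
  then show "Cinf_on N S (B a (p a))" by (rule that)
 qed
 have "Cinf_on N S (%y. cof_n n (%a b. A a b y) j i/det_n n (%a b. A a b y))" unfolding cof_n_def
  by (intro Cinf_on_divide[OF S] Cinf_on_mult[OF S] Cinf_on_const[OF S] det) (use A ij det_n_nonzero[OF nd] in auto)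
 then show ?thesis by (rule Cinf_on_cong[OF S, rotated]) (simp add: mat_inverse_nondegenerate(3)[OF nd ij])
qed

text \<open>Rows are indexed by any set of size \<open>n\<close>, because frames of products are
  indexed by pairs. An enumeration of \<open>I\<close> reduces this to square matrices, for which a
  trivial kernel suffices.\<close>

lemma square_frame_inverse:
 fixes P :: "'i => nat => real"
 assumes I: "finite I" "card I = n"
  and ker: "!!v. (!!a. a \<in> I ==> (\<Sum>k<n. P a k * v k) = 0) ==> (\<forall>k<n. v k = 0)"
 obtains V where "!!k l. k<n ==> l<n ==> (\<Sum>a\<in>I. V k a*P a l) = (if k = l then 1 else 0)"
  "!!a b. a \<in> I ==> b \<in> I ==> (\<Sum>k<n. P a k*V k b) = (if a = b then 1 else 0)"
proof -
 obtain f where f: "bij_betw f {..<n} I" using I by (metis bij_betw_iff_card card_lessThan finite_lessThan)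
 define A where "A i k = P (f i) k" for i k
 have "nondegenerate n A" unfolding nondegenerate_def
 proof (intro allI impI)
  fix v k assume v: "\<forall>i<n. (\<Sum>k<n. A i k * v k) = 0" and k: "k<n"
  have "(\<Sum>k<n. P a k * v k) = 0" if "a \<in> I" for a using f that v unfolding A_def bij_betw_def by (auto simp: image_iff)
  then show "v k = 0" using ker k by blast
 qed
 note inv = mat_inverse_nondegenerate[OF this]
 define g where "g = inv_into {..<n} f"
 have g: "g a<n" "f (g a) = a" if "a \<in> I" for a
  using f that bij_betw_inv_into_right[OF f that] bij_betwE[OF bij_betw_inv_into[OF f]] by (auto simp: g_def)
 have gf: "g (f i) = i" if "i<n" for i using f that by (simp add: g_def bij_betw_inv_into_left)
 define V where "V k a = mat_inverse n A k (g a)" for k a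
 have "(\<Sum>a\<in>I. V k a*P a l) = (if k = l then 1 else 0)" if "k<n" "l<n" for k l
 proof -
  have "(\<Sum>a\<in>I. V k a*P a l) = (\<Sum>i<n. V k (f i)*P (f i) l)" by (rule sum.reindex_bij_betw[OF f, symmetric])
  also have "... = (\<Sum>i<n. mat_inverse n A k i*A i l)" by (simp add: V_def gf A_def)
  finally show ?thesis using inv(2) that by (simp add: is_inverse_def)
 qed
 moreover have "(\<Sum>k<n. P a k*V k b) = (if a = b then 1 else 0)" if "a \<in> I" "b \<in> I" for a b
 proof -
  have "(\<Sum>k<n. P a k*V k b) = (\<Sum>k<n. A (g a) k*mat_inverse n A k (g b))" using g that by (simp add: V_def A_def)
  also have "... = (if g a = g b then 1 else 0)" using inv(1) g that by (simp add: is_inverse_def)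
  also have "(g a = g b) = (a = b)" using g that by metis
  finally show ?thesis .
 qed
 ultimately show ?thesis using that by blast
qed

text \<open>Factor the projector as \<open>E L\<close> through a basis \<open>E\<close> of its image; then \<open>L E = 1\<close>.\<close>

lemma trace_projector:
 fixes \<pi> :: "nat => nat => real" and E :: "nat => nat => real"
 assumes fix_im: "!!k a. k<n ==> a<d ==> (\<Sum>l<n. \<pi> k l*E l a) = E k a"
  and span: "!!l. l<n ==> \<exists>c. \<forall>k<n. \<pi> k l = (\<Sum>a<d. E k a*c a)"
  and indep: "!!c. (!!k. k<n ==> (\<Sum>a<d. E k a*c a) = 0) ==> (\<forall>a<d. c a = 0)"
 shows "(\<Sum>k<n. \<pi> k k) = real d"
proof -
 obtain L where L: "!!k l. k<n ==> l<n ==> \<pi> k l = (\<Sum>a<d. E k a*L a l)"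
 proof -
  have "\<forall>l\<in>{..<n}. \<exists>c. \<forall>k<n. \<pi> k l = (\<Sum>a<d. E k a*c a)" using span by simp
  then obtain c where "\<forall>l\<in>{..<n}. \<forall>k<n. \<pi> k l = (\<Sum>a<d. E k a*c l a)" by (rule bchoice[THEN exE])
  then show thesis by (intro that[of "%a l. c l a"]) auto
 qed
 have LE: "(\<Sum>l<n. L a l*E l b) = (if a = b then 1 else 0)" if ab: "a<d" "b<d" for a b
 proof -
  have "\<forall>a<d. (\<Sum>l<n. L a l*E l b) - (if a = b then 1 else 0) = 0"
  proof (rule indep)
   fix k assume k: "k<n"
   have "(\<Sum>a<d. E k a*(\<Sum>l<n. L a l*E l b)) = (\<Sum>l<n. \<pi> k l*E l b)" unfolding sum_distrib_left using k
    by (subst sum.swap) (simp add: L sum_distrib_right mult.assoc)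
   then have "(\<Sum>a<d. E k a*(\<Sum>l<n. L a l*E l b)) = E k b" using fix_im[OF k ab(2)] by simp
   moreover have "(\<Sum>a<d. E k a*(if a = b then 1 else 0)) = E k b" using ab by (simp add: if_distrib cong: if_cong)
   ultimately show "(\<Sum>a<d. E k a*((\<Sum>l<n. L a l*E l b) - (if a = b then 1 else 0))) = 0" by (simp add: right_diff_distrib sum_subtractf)
  qed
  then show ?thesis using ab by simp
 qed
 have "(\<Sum>k<n. \<pi> k k) = (\<Sum>k<n. \<Sum>a<d. E k a*L a k)" by (simp add: L)
 also have "... = (\<Sum>a<d. \<Sum>k<n. L a k*E k a)" by (subst sum.swap) (simp add: mult.commute)
 also have "... = real d" by (simp add: LE)
 finally show ?thesis .
qed

lemma sum_delta_left: "finite K ==> a \<in> K ==> (\<Sum>k\<in>K. (if a = k then 1 else 0)*f k) = (f a :: real)"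
 by (simp add: if_distrib[of "%x. x*_"] cong: if_cong)

lemma sum_delta_right: "finite K ==> a \<in> K ==> (\<Sum>k\<in>K. f k*(if k = a then 1 else 0)) = (f a :: real)" by (simp add: if_distrib cong: if_cong)

lemma sum_mult_assoc: "(\<Sum>k\<in>K. (\<Sum>l\<in>L. A l*B l k)*C k) = (\<Sum>l\<in>L. A l*(\<Sum>k\<in>K. B l k*(C k :: real)))"
 unfolding sum_distrib_left sum_distrib_right by (subst sum.swap) (simp add: mult.assoc)

section \<open>Curvature in moving frames\<close>

text \<open>Versions of the curvature expressions for arbitrary component functions, without
  manifold or chart. They apply equally to the family of base metrics at a frozen value of
  x.\<close>

definition christoffel_loc :: "nat => (nat => nat => rfun) => nat => nat => nat => rfun" where "christoffel_loc n G k i j y =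
  (\<Sum>l<n. mat_inverse n (%a b. G a b y) k l*(pd i (G j l) y + pd j (G i l) y - pd l (G i j) y))/2"

text \<open>\<open>riemann_loc n \<Gamma> i j a b\<close> is the component R^a_{b i j} of the
  curvature tensor; the first argument of \<open>\<Gamma>\<close> is the upper index.\<close>

definition riemann_loc :: "nat => (nat => nat => nat => rfun) => nat => nat => nat => nat => rfun" where
 "riemann_loc n \<Gamma> i j a b y = pd i (\<Gamma> a j b) y - pd j (\<Gamma> a i b) y + (\<Sum>l<n. \<Gamma> a i l y*\<Gamma> l j b y - \<Gamma> a j l y*\<Gamma> l i b y)"

definition ricci_loc :: "nat => (nat => nat => nat => rfun) => nat => nat => rfun" where "ricci_loc n \<Gamma> j k y = (\<Sum>i<n. riemann_loc n \<Gamma> i j i k y)"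

definition scalar_loc :: "nat => (nat => nat => rfun) => rfun" where
 "scalar_loc n G y = (\<Sum>j<n. \<Sum>k<n. mat_inverse n (%a b. G a b y) j k*ricci_loc n (christoffel_loc n G) j k y)"

text \<open>The components nabla_i J^k_j of the covariant derivative of an endomorphism
  field.\<close>

definition parallel_loc :: "nat => (nat => nat => nat => rfun) => (nat => nat => rfun) =>  nat => nat => nat => rfun" where
 "parallel_loc n \<Gamma> J i k j y = pd i (J k j) y + (\<Sum>l<n. \<Gamma> k i l y*J l j y - \<Gamma> l i j y*J k l y)"

lemma christoffel_eq_loc: "christoffel X g c = christoffel_loc (mdim X) (comp2 X g c)" by (intro ext) (simp add: christoffel_def christoffel_loc_def)

lemma ricci_comp_eq_loc: "ricci_comp X g c j k y = ricci_loc (mdim X) (christoffel_loc (mdim X) (comp2 X g c)) j k y"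
 by (simp add: ricci_comp_def ricci_loc_def riemann_loc_def Let_def christoffel_eq_loc)

lemma scalar_curvature_is_loc: "scalar_curvature_is X g s \<longleftrightarrow> (\<forall>c\<in>atlas X. \<forall>y\<in>snd c ` fst c. scalar_loc (mdim X) (comp2 X g c) y = s)"
 by (simp add: scalar_curvature_is_def scalar_loc_def ricci_comp_eq_loc)

lemma parallel_endo_loc: "parallel_endo X g E \<longleftrightarrow> (\<forall>c\<in>atlas X. \<forall>y\<in>snd c ` fst c. \<forall>i<mdim X. \<forall>j<mdim X. \<forall>k<mdim X.
    parallel_loc (mdim X) (christoffel_loc (mdim X) (comp2 X g c)) (endo_comp X E c) i k j y = 0)"
 by (simp add: parallel_endo_def parallel_loc_def christoffel_eq_loc)

context
 fixes n S and G :: "nat => nat => rfun"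
 assumes S: "eopen n S"
  and G: "!!i j. i<n ==> j<n ==> Cinf_on n S (G i j)"
  and sym: "!!i j y. i<n ==> j<n ==> y \<in> S ==> G i j y = G j i y"
  and nd: "!!y. y \<in> S ==> nondegenerate n (%a b. G a b y)"
begin

lemma partial_metric_sym: "i<n ==> j<n ==> l<n ==> y \<in> S ==> pd l (G i j) y = pd l (G j i) y" by (rule partial_deriv_cong[OF S sym])

lemma Cinf_christoffel_loc:
 assumes "i<n" "j<n" "k<n"
 shows "Cinf_on n S (christoffel_loc n G k i j)" unfolding christoffel_loc_def[abs_def] using assms
 by (intro Cinf_on_divide_const[OF S] Cinf_on_sum[OF S] Cinf_on_mult[OF S] Cinf_on_diff[OF S]
   Cinf_on_add[OF S] Cinf_on_partial_deriv[OF S] mat_inverse_Cinf[OF S G nd] G) auto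

lemma Cinf_riemann_loc:
 assumes "i<n" "j<n" "a<n" "b<n"
 shows "Cinf_on n S (riemann_loc n (christoffel_loc n G) i j a b)" unfolding riemann_loc_def[abs_def] using assms
 by (intro Cinf_on_sum[OF S] Cinf_on_mult[OF S] Cinf_on_diff[OF S] Cinf_on_add[OF S] Cinf_on_partial_deriv[OF S] Cinf_christoffel_loc) auto

text \<open>Smoothness of the scalar curvature, and of \<open>parallel_loc\<close> below, is what
  allows equations to be extended from the dense principal part.\<close>

lemma Cinf_scalar_loc: "Cinf_on n S (scalar_loc n G)" unfolding scalar_loc_def[abs_def] ricci_loc_def
 by (intro Cinf_on_sum[OF S] Cinf_on_mult[OF S] Cinf_riemann_loc mat_inverse_Cinf[OF S G nd]) auto

lemma Cinf_parallel_loc: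
 assumes "!!k j. k<n ==> j<n ==> Cinf_on n S (J k j)" "i<n" "j<n" "k<n"
 shows "Cinf_on n S (parallel_loc n (christoffel_loc n G) J i k j)" unfolding parallel_loc_def[abs_def] using assms
 by (intro Cinf_on_sum[OF S] Cinf_on_mult[OF S] Cinf_on_diff[OF S] Cinf_on_add[OF S] Cinf_on_partial_deriv[OF S] Cinf_christoffel_loc) auto

lemma christoffel_loc_sym: "i<n ==> j<n ==> y \<in> S ==> christoffel_loc n G k i j y = christoffel_loc n G k j i y"
 unfolding christoffel_loc_def by (intro arg_cong2[of _ _ _ _ "(/)"] sum.cong) (auto simp: partial_metric_sym)

lemma christoffel_loc_lower:
 assumes "i<n" "j<n" "k<n" "y \<in> S"
 shows "(\<Sum>l<n. G k l y*christoffel_loc n G l i j y) = (pd i (G j k) y + pd j (G i k) y - pd k (G i j) y)/2"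
proof -
 let ?B = "mat_inverse n (%a b. G a b y)"
 let ?D = "%m. pd i (G j m) y + pd j (G i m) y - pd m (G i j) y"
 have "(\<Sum>l<n. G k l y*christoffel_loc n G l i j y) = (\<Sum>l<n. G k l y*(\<Sum>m<n. ?B l m*?D m))/2"
  by (simp add: christoffel_loc_def flip: sum_divide_distrib)
 also have "(\<Sum>l<n. G k l y*(\<Sum>m<n. ?B l m*?D m)) = (\<Sum>m<n. (\<Sum>l<n. G k l y*?B l m)*?D m)" by (rule sum_mult_assoc[symmetric])
 also have "... = (\<Sum>m<n. (if k = m then 1 else 0)*?D m)"
  using mat_inverse_nondegenerate(1)[OF nd[OF assms(4)]] assms by (intro sum.cong) (auto simp: is_inverse_def)
 also have "... = ?D k" using assms by (intro sum_delta_left) auto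
 finally show ?thesis .
qed

lemma christoffel_loc_compatible:
 assumes "i<n" "j<n" "k<n" "y \<in> S"
 shows "pd k (G i j) y = (\<Sum>l<n. christoffel_loc n G l k i y*G l j y + christoffel_loc n G l k j y*G i l y)"
proof -
 have "(\<Sum>l<n. christoffel_loc n G l k i y*G l j y + christoffel_loc n G l k j y*G i l y) =
   (\<Sum>l<n. G j l y*christoffel_loc n G l k i y) + (\<Sum>l<n. G i l y*christoffel_loc n G l k j y)"
  using assms by (simp add: sum.distrib sym[of j] mult.commute)
 then show ?thesis using assms
  by (simp add: christoffel_loc_lower partial_metric_sym[of j i] partial_metric_sym[of k j] partial_metric_sym[of i k] field_simps)
qed

text \<open>Koszul's argument: the combination of compatibility conditions that defines the
  Christoffel symbols leaves, by symmetry of \<open>\<Gamma>\<close>, twice \<open>\<Gamma>\<close>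
  with its upper index lowered.\<close>

lemma christoffel_loc_unique:
 assumes y: "y \<in> S"
  and tf: "!!l i j. l<n ==> i<n ==> j<n ==> \<Gamma> l i j = \<Gamma> l j i"
  and compat: "!!i j k. i<n ==> j<n ==> k<n ==>  pd k (G i j) y = (\<Sum>l<n. \<Gamma> l k i*G l j y + \<Gamma> l k j*G i l y)"
  and ij: "k<n" "i<n" "j<n"
 shows "christoffel_loc n G k i j y = \<Gamma> k i j"
proof -
 let ?B = "mat_inverse n (%a b. G a b y)"
 have "pd i (G j m) y + pd j (G i m) y - pd m (G i j) y = 2*(\<Sum>p<n. G m p y*\<Gamma> p i j)" if m: "m<n" for m
 proof -
  have "(\<Sum>p<n. \<Gamma> p i j*G p m y + \<Gamma> p i m*G j p y) + (\<Sum>p<n. \<Gamma> p j i*G p m y + \<Gamma> p j m*G i p y)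
    - (\<Sum>p<n. \<Gamma> p m i*G p j y + \<Gamma> p m j*G i p y) = (\<Sum>p<n. 2*(G m p y*\<Gamma> p i j))" unfolding sum.distrib[symmetric] sum_subtractf[symmetric]
   by (intro sum.cong) (auto simp: tf[of _ m i] tf[of _ m j] tf[of _ j i] sym[of _ m] sym[of _ j] sym[of _ i] ij m y)
  then show ?thesis using compat ij m by (simp add: sum_distrib_left)
 qed
 then have "christoffel_loc n G k i j y = (\<Sum>m<n. ?B k m*(\<Sum>p<n. G m p y*\<Gamma> p i j))" by (simp add: christoffel_loc_def sum_divide_distrib)
 also have "... = (\<Sum>p<n. (\<Sum>m<n. ?B k m*G m p y)*\<Gamma> p i j)" by (rule sum_mult_assoc[symmetric])
 also have "... = (\<Sum>p<n. (if k = p then 1 else 0)*\<Gamma> p i j)"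
  using mat_inverse_nondegenerate(2)[OF nd[OF y]] ij by (intro sum.cong) (auto simp: is_inverse_def)
 also have "... = \<Gamma> k i j" using ij by (intro sum_delta_left) auto
 finally show ?thesis .
qed

end

text \<open>The pointwise algebra behind the gauge covariance of curvature.\<close>

lemma gauge_algebra:
 fixes wi wj dw :: "'i => 'i => real" and P Qi Qj :: "'i => nat => real"
 assumes Qi: "!!b k. b \<in> I ==> k<n ==> Qi b k = (\<Sum>l<n. P b l*gi l k) - (\<Sum>c\<in>I. wi b c*P c k)"
  and Qj: "!!b k. b \<in> I ==> k<n ==> Qj b k = (\<Sum>l<n. P b l*gj l k) - (\<Sum>c\<in>I. wj b c*P c k)"
  and D: "(\<Sum>b\<in>I. dw a b*P b k + wj a b*Qi b k - wi a b*Qj b k) = (\<Sum>l<n. Qi a l*gj l k - Qj a l*gi l k + P a l*dg l k)"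
  and a: "a \<in> I" and k: "k<n"
 shows "(\<Sum>b\<in>I. (dw a b + (\<Sum>c\<in>I. wi a c*wj c b - wj a c*wi c b))*P b k) = (\<Sum>l<n. P a l*(dg l k + (\<Sum>m<n. gi l m*gj m k - gj l m*gi m k)))"
proof -
 have e1: "(\<Sum>b\<in>I. wj a b*Qi b k) = (\<Sum>l<n. (\<Sum>b\<in>I. wj a b*P b l)*gi l k) - (\<Sum>c\<in>I. (\<Sum>b\<in>I. wj a b*wi b c)*P c k)"
  using k by (simp add: Qi right_diff_distrib sum_subtractf sum_mult_assoc)
 have e2: "(\<Sum>b\<in>I. wi a b*Qj b k) = (\<Sum>l<n. (\<Sum>b\<in>I. wi a b*P b l)*gj l k) - (\<Sum>c\<in>I. (\<Sum>b\<in>I. wi a b*wj b c)*P c k)"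
  using k by (simp add: Qj right_diff_distrib sum_subtractf sum_mult_assoc)
 have e3: "(\<Sum>l<n. Qi a l*gj l k) = (\<Sum>m<n. P a m*(\<Sum>l<n. gi m l*gj l k)) - (\<Sum>l<n. (\<Sum>c\<in>I. wi a c*P c l)*gj l k)"
  using a by (simp add: Qi left_diff_distrib sum_subtractf sum_mult_assoc)
 have e4: "(\<Sum>l<n. Qj a l*gi l k) = (\<Sum>m<n. P a m*(\<Sum>l<n. gj m l*gi l k)) - (\<Sum>l<n. (\<Sum>c\<in>I. wj a c*P c l)*gi l k)"
  using a by (simp add: Qj left_diff_distrib sum_subtractf sum_mult_assoc)
 show ?thesis using D e1 e2 e3 e4 by (simp add: sum.distrib sum_subtractf distrib_right distrib_left left_diff_distrib right_diff_distrib)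
qed

text \<open>The components of the curvature form dw + w wedge w of a matrix \<open>w\<close> of
  connection forms.\<close>

definition curv :: "'i set => (nat => 'i => 'i => rfun) => nat => nat => 'i => 'i => rfun" where
 "curv I w i j a b y = pd i (w j a b) y - pd j (w i a b) y + (\<Sum>c\<in>I. w i a c y*w j c b y - w j a c y*w i c b y)"

text \<open>\<open>gauge\<close> says that \<open>P\<close> carries one connection into the other.
  Differentiating it once more and antisymmetrising removes the second derivatives of
  \<open>P\<close>; what is left is the algebra of \<open>gauge_algebra\<close>.\<close>

lemma gauge_curvature:
 assumes S: "eopen n S" and I: "finite I"
  and P: "!!a k. a \<in> I ==> k<n ==> Cinf_on n S (P a k)"
  and w: "!!i a b. i<n ==> a \<in> I ==> b \<in> I ==> Cinf_on n S (w i a b)"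
  and \<Gamma>: "!!l i k. l<n ==> i<n ==> k<n ==> Cinf_on n S (\<Gamma> l i k)"
  and gauge: "!!y i k a. y \<in> S ==> i<n ==> k<n ==> a \<in> I ==>  pd i (P a k) y + (\<Sum>b\<in>I. w i a b y*P b k y) = (\<Sum>l<n. P a l y*\<Gamma> l i k y)"
  and y: "y \<in> S" and ijk: "i<n" "j<n" "k<n" and a: "a \<in> I"
 shows "(\<Sum>b\<in>I. curv I w i j a b y*P b k y) = (\<Sum>l<n. P a l y*riemann_loc n \<Gamma> i j l k y)"
proof -
 have dg: "pd i (pd j (P a k)) y + (\<Sum>b\<in>I. pd i (w j a b) y*P b k y + w j a b y*pd i (P b k) y)
   = (\<Sum>l<n. pd i (P a l) y*\<Gamma> l j k y + P a l y*pd i (\<Gamma> l j k) y)" if "i<n" "j<n" for i j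
 proof -
  have "pd i (%y. pd j (P a k) y + (\<Sum>b\<in>I. w j a b y*P b k y)) y = pd i (%y. \<Sum>l<n. P a l y*\<Gamma> l j k y) y"
   by (rule partial_deriv_cong[OF S _ y that(1)]) (use gauge that ijk a in auto)
  also have "pd i (%y. \<Sum>l<n. P a l y*\<Gamma> l j k y) y = (\<Sum>l<n. pd i (P a l) y*\<Gamma> l j k y + P a l y*pd i (\<Gamma> l j k) y)" using that ijk a
   by (subst partial_deriv_sum[OF S that(1) y]) (auto intro!: Cinf_on_mult[OF S] P \<Gamma> sum.cong partial_deriv_mult[OF S that(1) y])
  also have "pd i (%y. pd j (P a k) y + (\<Sum>b\<in>I. w j a b y*P b k y)) y =
    pd i (pd j (P a k)) y + (\<Sum>b\<in>I. pd i (w j a b) y*P b k y + w j a b y*pd i (P b k) y)" using that ijk a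
   by (subst partial_deriv_add[OF S that(1) y])
    (auto intro!: Cinf_on_partial_deriv[OF S] Cinf_on_sum[OF S] Cinf_on_mult[OF S] P w sum.cong partial_deriv_mult[OF S that(1) y]
     simp: partial_deriv_sum[OF S that(1) y] Cinf_on_mult[OF S] P w)
  finally show ?thesis .
 qed
 have comm: "pd i (pd j (P a k)) y = pd j (pd i (P a k)) y" by (rule Cinf_on_partial_commute[OF S P[OF a ijk(3)] y ijk(1,2)])
 have "(\<Sum>b\<in>I. ((pd i (w j a b) y - pd j (w i a b) y) + (\<Sum>c\<in>I. w i a c y*w j c b y - w j a c y*w i c b y))*P b k y) =
  (\<Sum>l<n. P a l y*((pd i (\<Gamma> l j k) y - pd j (\<Gamma> l i k) y) + (\<Sum>m<n. \<Gamma> l i m y*\<Gamma> m j k y - \<Gamma> l j m y*\<Gamma> m i k y)))"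
 proof (rule gauge_algebra[where Qi="%b k. pd i (P b k) y" and Qj="%b k. pd j (P b k) y"])
  show "(\<Sum>b\<in>I. (pd i (w j a b) y - pd j (w i a b) y)*P b k y + w j a b y*pd i (P b k) y - w i a b y*pd j (P b k) y) =
   (\<Sum>l<n. pd i (P a l) y*\<Gamma> l j k y - pd j (P a l) y*\<Gamma> l i k y + P a l y*(pd i (\<Gamma> l j k) y - pd j (\<Gamma> l i k) y))"
   using dg[OF ijk(1,2)] dg[OF ijk(2,1)] comm by (simp add: sum.distrib sum_subtractf left_diff_distrib right_diff_distrib)
 qed (use gauge[OF y] ijk a in "auto simp: algebra_simps")
 then show ?thesis by (simp add: curv_def riemann_loc_def)
qed

text \<open>The rows of \<open>P\<close> are a coframe, \<open>w\<close> its connection forms and \<open>\<eta>\<close> the metric in the frame.\<close>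

locale moving_frame =
 fixes n :: nat and S :: "(nat => real) set" and I :: "'i set"
  and P :: "'i => nat => rfun"
  and w :: "nat => 'i => 'i => rfun"
  and \<eta> \<eta>' :: "'i => 'i => rfun"
  and G :: "nat => nat => rfun"
 assumes S: "eopen n S"
  and I: "finite I" "card I = n"
  and P: "!!a k. a \<in> I ==> k<n ==> Cinf_on n S (P a k)"
  and w: "!!i a b. i<n ==> a \<in> I ==> b \<in> I ==> Cinf_on n S (w i a b)"
  and \<eta>: "!!a b. a \<in> I ==> b \<in> I ==> Cinf_on n S (\<eta> a b)"
  and P_ker: "!!y v. y \<in> S ==> (!!a. a \<in> I ==> (\<Sum>k<n. P a k y * v k) = 0) ==> (\<forall>k<n. v k = 0)"
  and \<eta>_sym: "!!a b y. a \<in> I ==> b \<in> I ==> y \<in> S ==> \<eta> a b y = \<eta> b a y"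
  and \<eta>'_sym: "!!a b y. a \<in> I ==> b \<in> I ==> y \<in> S ==> \<eta>' a b y = \<eta>' b a y"
  and \<eta>_inv: "!!a c y. a \<in> I ==> c \<in> I ==> y \<in> S ==> (\<Sum>b\<in>I. \<eta> a b y*\<eta>' b c y) = (if a = c then 1 else 0)"
  and G: "!!i j y. i<n ==> j<n ==> y \<in> S ==> G i j y = (\<Sum>a\<in>I. P a i y*(\<Sum>b\<in>I. \<eta> a b y*P b j y))"
  and torsion: "!!a i j y. a \<in> I ==> i<n ==> j<n ==> y \<in> S ==>  pd i (P a j) y + (\<Sum>b\<in>I. w i a b y*P b j y) =
   pd j (P a i) y + (\<Sum>b\<in>I. w j a b y*P b i y)"
  and compat: "!!a b i y. a \<in> I ==> b \<in> I ==> i<n ==> y \<in> S ==>  pd i (\<eta> a b) y = (\<Sum>c\<in>I. w i c a y*\<eta> c b y) + (\<Sum>c\<in>I. \<eta> a c y*w i c b y)"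
begin

lemma frame_inverse:
 assumes "y \<in> S"
 obtains V where "!!k l. k<n ==> l<n ==> (\<Sum>a\<in>I. V k a*P a l y) = (if k = l then 1 else 0)"
  "!!a b. a \<in> I ==> b \<in> I ==> (\<Sum>k<n. P a k y*V k b) = (if a = b then 1 else 0)"
 by (rule square_frame_inverse[OF I, of "%a k. P a k y"]) (use P_ker[OF assms] in blast, rule that)

lemma frame_metric_smooth: "i<n ==> j<n ==> Cinf_on n S (G i j)" by (rule Cinf_on_cong[OF S, of "%y. \<Sum>a\<in>I. P a i y*(\<Sum>b\<in>I. \<eta> a b y*P b j y)"])
  (auto simp: G intro!: Cinf_on_sum[OF S] Cinf_on_mult[OF S] P \<eta>)

lemma frame_metric_sym: "i<n ==> j<n ==> y \<in> S ==> G i j y = G j i y"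
 by (simp add: G sum_distrib_left, subst sum.swap) (auto intro!: sum.cong simp: \<eta>_sym)

text \<open>With \<open>V\<close> the inverse of the coframe matrix \<open>P\<close>, the inverse of
  the metric P^T \<eta> P is V \<eta>' V^T; contracting it twice with \<open>P\<close> returns
  \<open>\<eta>'\<close>.\<close>

lemma frame_metric_inverse:
 assumes y: "y \<in> S"
 shows "nondegenerate n (%a b. G a b y)"
  and "!!d b. d \<in> I ==> b \<in> I ==>  (\<Sum>j<n. \<Sum>k<n. mat_inverse n (%a b. G a b y) j k*(P d j y*P b k y)) = \<eta>' d b y"
proof -
 obtain V where V: "!!k l. k<n ==> l<n ==> (\<Sum>a\<in>I. V k a*P a l y) = (if k = l then 1 else 0)"
  "!!a b. a \<in> I ==> b \<in> I ==> (\<Sum>k<n. P a k y*V k b) = (if a = b then 1 else 0)" using frame_inverse[OF y] by blast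
 define X where "X k j = (\<Sum>c\<in>I. V k c*(\<Sum>d\<in>I. \<eta>' c d y*V j d))" for k j
 have PX: "(\<Sum>k<n. P b k y*X k j) = (\<Sum>d\<in>I. \<eta>' b d y*V j d)" if "b \<in> I" for b j
 proof -
  have "(\<Sum>k<n. P b k y*X k j) = (\<Sum>c\<in>I. (\<Sum>k<n. P b k y*V k c)*(\<Sum>d\<in>I. \<eta>' c d y*V j d))" unfolding X_def by (rule sum_mult_assoc[symmetric])
  also have "... = (\<Sum>c\<in>I. (if b = c then 1 else 0)*(\<Sum>d\<in>I. \<eta>' c d y*V j d))" using V(2) that by (intro sum.cong) auto
  finally show ?thesis using sum_delta_left[OF I(1) that] by simp
 qed
 have inv: "is_inverse n (%a b. G a b y) X" unfolding is_inverse_def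
 proof (intro allI impI)
  fix i j assume ij: "i<n" "j<n"
  have "(\<Sum>k<n. G i k y*X k j) = (\<Sum>k<n. (\<Sum>a\<in>I. P a i y*(\<Sum>b\<in>I. \<eta> a b y*P b k y))*X k j)" using ij y by (intro sum.cong) (auto simp: G)
  also have "... = (\<Sum>a\<in>I. P a i y*(\<Sum>b\<in>I. \<eta> a b y*(\<Sum>k<n. P b k y*X k j)))" by (simp add: sum_mult_assoc)
  also have "... = (\<Sum>a\<in>I. P a i y*(\<Sum>b\<in>I. \<eta> a b y*(\<Sum>d\<in>I. \<eta>' b d y*V j d)))" by (intro sum.cong refl arg_cong2[of _ _ _ _ "(*)"]) (simp add: PX)
  also have "... = (\<Sum>a\<in>I. P a i y*(\<Sum>d\<in>I. (\<Sum>b\<in>I. \<eta> a b y*\<eta>' b d y)*V j d))" by (simp add: sum_mult_assoc)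
  also have "... = (\<Sum>a\<in>I. P a i y*(\<Sum>d\<in>I. (if a = d then 1 else 0)*V j d))"
   using y by (intro sum.cong refl arg_cong2[of _ _ _ _ "(*)"]) (simp add: \<eta>_inv)
  also have "... = (\<Sum>a\<in>I. V j a*P a i y)" by (intro sum.cong refl) (subst sum_delta_left[OF I(1)], simp_all add: mult.commute)
  finally show "(\<Sum>k<n. G i k y*X k j) = (if i = j then 1 else 0)" using V(1) ij by auto
 qed
 have Xs: "X k j = X j k" for k j unfolding X_def sum_distrib_left by (subst sum.swap) (auto intro!: sum.cong simp: \<eta>'_sym y)
 have inv': "is_inverse n X (%a b. G a b y)" unfolding is_inverse_def
 proof (intro allI impI)
  fix i j assume ij: "i<n" "j<n"
  have "(\<Sum>k<n. X i k*G k j y) = (\<Sum>k<n. G j k y*X k i)" using ij y by (intro sum.cong) (auto simp: Xs[of i] frame_metric_sym[of j])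
  then show "(\<Sum>k<n. X i k*G k j y) = (if i = j then 1 else 0)" using inv ij by (auto simp: is_inverse_def)
 qed
 show "nondegenerate n (%a b. G a b y)" unfolding nondegenerate_def
 proof (intro allI impI)
  fix v k assume v: "\<forall>i<n. (\<Sum>k<n. G i k y * v k) = 0" and k: "k<n"
  have "v k = (\<Sum>j<n. (if k = j then 1 else 0) * v j)" using k by (intro sum_delta_left[symmetric]) auto
  also have "... = (\<Sum>j<n. (\<Sum>i<n. X k i*G i j y) * v j)" using inv' k by (intro sum.cong) (auto simp: is_inverse_def)
  also have "... = (\<Sum>i<n. X k i*(\<Sum>j<n. G i j y * v j))" by (rule sum_mult_assoc)
  finally show "v k = 0" using v by simp
 qed
 fix d b assume db: "d \<in> I" "b \<in> I"
 have "(\<Sum>j<n. \<Sum>k<n. mat_inverse n (%a b. G a b y) j k*(P d j y*P b k y)) = (\<Sum>j<n. P d j y*(\<Sum>k<n. P b k y*X k j))" unfolding sum_distrib_left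
  by (intro sum.cong) (auto simp: mat_inverse_unique[OF inv inv'] Xs mult_ac)
 also have "... = (\<Sum>j<n. P d j y*(\<Sum>e\<in>I. V j e*\<eta>' e b y))" using db y by (simp add: PX) (auto intro!: sum.cong simp: mult.commute \<eta>'_sym[of b])
 also have "... = (\<Sum>e\<in>I. (\<Sum>j<n. P d j y*V j e)*\<eta>' e b y)" by (rule sum_mult_assoc[symmetric])
 also have "... = (\<Sum>e\<in>I. (if d = e then 1 else 0)*\<eta>' e b y)" using V(2) db by (intro sum.cong) auto
 also have "... = \<eta>' d b y" using sum_delta_left[OF I(1) db(1)] .
 finally show "(\<Sum>j<n. \<Sum>k<n. mat_inverse n (%a b. G a b y) j k*(P d j y*P b k y)) = \<eta>' d b y" .
qed

lemmas frame_metric = S frame_metric_smooth frame_metric_sym frame_metric_inverse(1)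

text \<open>The gauge relation is taken as the definition of symbols \<open>\<Gamma>\<close>. Then
  \<open>torsion\<close> makes them symmetric and \<open>compat\<close> makes them metric, so by
  uniqueness they are the Christoffel symbols.\<close>

lemma frame_christoffel:
 assumes y: "y \<in> S" and ik: "i<n" "k<n" and a: "a \<in> I"
 shows "pd i (P a k) y + (\<Sum>b\<in>I. w i a b y*P b k y) = (\<Sum>l<n. P a l y*christoffel_loc n G l i k y)"
proof -
 obtain V where V: "!!k l. k<n ==> l<n ==> (\<Sum>a\<in>I. V k a*P a l y) = (if k = l then 1 else 0)"
  "!!a b. a \<in> I ==> b \<in> I ==> (\<Sum>k<n. P a k y*V k b) = (if a = b then 1 else 0)" using frame_inverse[OF y] by blast
 define R where "R a i k = pd i (P a k) y + (\<Sum>b\<in>I. w i a b y*P b k y)" for a i k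
 define \<Gamma> where "\<Gamma> l i k = (\<Sum>a\<in>I. V l a*R a i k)" for l i k
 have P\<Gamma>: "(\<Sum>l<n. P a l y*\<Gamma> l i k) = R a i k" if "a \<in> I" for a i k
 proof -
  have "(\<Sum>l<n. P a l y*\<Gamma> l i k) = (\<Sum>b\<in>I. (\<Sum>l<n. P a l y*V l b)*R b i k)" unfolding \<Gamma>_def by (rule sum_mult_assoc[symmetric])
  also have "... = (\<Sum>b\<in>I. (if a = b then 1 else 0)*R b i k)" using V(2) that by (intro sum.cong) auto
  finally show ?thesis using sum_delta_left[OF I(1) that] by simp
 qed
 have tf: "\<Gamma> l i j = \<Gamma> l j i" if "l<n" "i<n" "j<n" for l i j unfolding \<Gamma>_def R_def using torsion[OF _ that(2,3) y] by (intro sum.cong) auto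
 have dP: "pd k (P a i) y = (\<Sum>l<n. P a l y*\<Gamma> l k i) - (\<Sum>b\<in>I. w k a b y*P b i y)" if "a \<in> I" for a k i using P\<Gamma>[OF that] by (simp add: R_def)
 have cp: "pd k (G i j) y = (\<Sum>l<n. \<Gamma> l k i*G l j y + \<Gamma> l k j*G i l y)" if ijk: "i<n" "j<n" "k<n" for i j k
 proof -
  define E where "E b j = (\<Sum>c\<in>I. \<eta> b c y*P c j y)" for b j
  have "pd k (G i j) y = pd k (%y. \<Sum>a\<in>I. P a i y*(\<Sum>b\<in>I. \<eta> a b y*P b j y)) y" by (rule partial_deriv_cong[OF S _ y ijk(3)]) (simp add: G ijk)
  also have "... = (\<Sum>a\<in>I. pd k (P a i) y*(\<Sum>b\<in>I. \<eta> a b y*P b j y) + P a i y*(\<Sum>b\<in>I. pd k (\<eta> a b) y*P b j y + \<eta> a b y*pd k (P b j) y))"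
  proof -
   have "pd k (%y. P a i y*(\<Sum>b\<in>I. \<eta> a b y*P b j y)) y = pd k (P a i) y*(\<Sum>b\<in>I. \<eta> a b y*P b j y) +
    P a i y*(\<Sum>b\<in>I. pd k (\<eta> a b) y*P b j y + \<eta> a b y*pd k (P b j) y)" if a: "a \<in> I" for a
   proof -
    have "pd k (%y. \<Sum>b\<in>I. \<eta> a b y*P b j y) y = (\<Sum>b\<in>I. pd k (\<eta> a b) y*P b j y + \<eta> a b y*pd k (P b j) y)"
     using a ijk by (subst partial_deriv_sum[OF S ijk(3) y]) (auto intro!: Cinf_on_mult[OF S] \<eta> P sum.cong partial_deriv_mult[OF S ijk(3) y])
    then show ?thesis using a ijk by (subst partial_deriv_mult[OF S ijk(3) y]) (auto intro!: Cinf_on_sum[OF S] Cinf_on_mult[OF S] \<eta> P)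
   qed
   then show ?thesis using ijk by (subst partial_deriv_sum[OF S ijk(3) y]) (auto intro!: Cinf_on_sum[OF S] Cinf_on_mult[OF S] \<eta> P)
  qed
  also have "... = (\<Sum>a\<in>I. pd k (P a i) y*E a j) + (\<Sum>a\<in>I. P a i y*(\<Sum>b\<in>I. pd k (\<eta> a b) y*P b j y)) +
    (\<Sum>a\<in>I. P a i y*(\<Sum>b\<in>I. \<eta> a b y*pd k (P b j) y))" by (simp add: sum.distrib distrib_left E_def)
  also have "(\<Sum>a\<in>I. pd k (P a i) y*E a j) = (\<Sum>l<n. \<Gamma> l k i*G l j y) - (\<Sum>a\<in>I. (\<Sum>b\<in>I. w k a b y*P b i y)*E a j)"
  proof -
   have "(\<Sum>a\<in>I. (\<Sum>l<n. P a l y*\<Gamma> l k i)*E a j) = (\<Sum>l<n. \<Gamma> l k i*(\<Sum>a\<in>I. P a l y*E a j))"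
    by (simp add: mult.commute[of "P _ _ _" "\<Gamma> _ _ _"] sum_mult_assoc)
   also have "... = (\<Sum>l<n. \<Gamma> l k i*G l j y)" using ijk y by (intro sum.cong) (auto simp: G E_def)
   finally show ?thesis by (simp add: dP left_diff_distrib sum_subtractf)
  qed
  also have "(\<Sum>a\<in>I. P a i y*(\<Sum>b\<in>I. \<eta> a b y*pd k (P b j) y)) =
    (\<Sum>l<n. \<Gamma> l k j*G i l y) - (\<Sum>a\<in>I. P a i y*(\<Sum>b\<in>I. \<eta> a b y*(\<Sum>c\<in>I. w k b c y*P c j y)))"
  proof -
   have "(\<Sum>a\<in>I. P a i y*(\<Sum>b\<in>I. \<eta> a b y*(\<Sum>l<n. P b l y*\<Gamma> l k j))) = (\<Sum>l<n. (\<Sum>a\<in>I. P a i y*(\<Sum>b\<in>I. \<eta> a b y*P b l y))*\<Gamma> l k j)"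
    by (simp add: sum_mult_assoc)
   also have "... = (\<Sum>l<n. \<Gamma> l k j*G i l y)" using ijk y by (intro sum.cong) (auto simp: G)
   finally show ?thesis by (simp add: dP right_diff_distrib sum_subtractf)
  qed
  also have "(\<Sum>a\<in>I. P a i y*(\<Sum>b\<in>I. pd k (\<eta> a b) y*P b j y)) = (\<Sum>a\<in>I. (\<Sum>b\<in>I. w k a b y*P b i y)*E a j) +
    (\<Sum>a\<in>I. P a i y*(\<Sum>b\<in>I. \<eta> a b y*(\<Sum>c\<in>I. w k b c y*P c j y)))"
  proof -
   have "(\<Sum>a\<in>I. P a i y*(\<Sum>b\<in>I. pd k (\<eta> a b) y*P b j y)) = (\<Sum>a\<in>I. P a i y*(\<Sum>b\<in>I. (\<Sum>c\<in>I. w k c a y*\<eta> c b y)*P b j y)) +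
    (\<Sum>a\<in>I. P a i y*(\<Sum>b\<in>I. (\<Sum>c\<in>I. \<eta> a c y*w k c b y)*P b j y))" unfolding sum.distrib[symmetric] distrib_left[symmetric] distrib_right[symmetric]
    using ijk y by (intro sum.cong refl arg_cong2[of _ _ _ _ "(*)"]) (simp add: compat sum.distrib)
   moreover have "(\<Sum>a\<in>I. P a i y*(\<Sum>b\<in>I. (\<Sum>c\<in>I. w k c a y*\<eta> c b y)*P b j y)) = (\<Sum>a\<in>I. P a i y*(\<Sum>c\<in>I. w k c a y*E c j))"
    by (simp add: sum_mult_assoc E_def)
   moreover have "(\<Sum>a\<in>I. P a i y*(\<Sum>c\<in>I. w k c a y*E c j)) = (\<Sum>a\<in>I. (\<Sum>b\<in>I. w k a b y*P b i y)*E a j)"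
    unfolding sum_distrib_left sum_distrib_right by (subst sum.swap) (simp add: mult_ac)
   ultimately show ?thesis by (simp add: sum_mult_assoc)
  qed
  finally show ?thesis by (simp add: sum.distrib)
 qed
 have "(\<Sum>l<n. P a l y*christoffel_loc n G l i k y) = (\<Sum>l<n. P a l y*\<Gamma> l i k)" using ik by (intro sum.cong refl arg_cong2[of _ _ _ _ "(*)"])
   (auto intro!: christoffel_loc_unique[OF frame_metric y] tf cp)
 then show ?thesis using P\<Gamma>[OF a] by (simp add: R_def)
qed

lemma frame_curvature:
 assumes "y \<in> S" "i<n" "j<n" "k<n" "a \<in> I"
 shows "(\<Sum>b\<in>I. curv I w i j a b y*P b k y) = (\<Sum>l<n. P a l y*riemann_loc n (christoffel_loc n G) i j l k y)"
 by (rule gauge_curvature[OF S I(1) P w Cinf_christoffel_loc[OF frame_metric] frame_christoffel]) (use assms in auto)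

text \<open>\<open>F\<close> is the matrix of \<open>J\<close> in the frame. Differentiating P J = F
  P and inserting \<open>frame_christoffel\<close> turns the covariant derivative of
  \<open>J\<close> into that of \<open>F\<close>, which is zero by \<open>F0\<close>.\<close>

lemma frame_parallel:
 assumes J: "!!k j. k<n ==> j<n ==> Cinf_on n S (J k j)"
  and F: "!!a b. a \<in> I ==> b \<in> I ==> Cinf_on n S (F a b)"
  and PJ: "!!a j y. a \<in> I ==> j<n ==> y \<in> S ==> (\<Sum>l<n. P a l y*J l j y) = (\<Sum>b\<in>I. F a b y*P b j y)"
  and y: "y \<in> S" and ij: "i<n" "j<n" "k<n"
  and F0: "!!a b. a \<in> I ==> b \<in> I ==>  pd i (F a b) y + (\<Sum>c\<in>I. w i a c y*F c b y) - (\<Sum>c\<in>I. F a c y*w i c b y) = 0"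
 shows "parallel_loc n (christoffel_loc n G) J i k j y = 0"
proof -
 let ?\<Gamma> = "%l i k. christoffel_loc n G l i k y"
 let ?N = "%k. parallel_loc n (christoffel_loc n G) J i k j y"
 have "(\<Sum>l<n. P a l y*?N l) = 0" if a: "a \<in> I" for a
 proof -
  have "pd i (%y. \<Sum>l<n. P a l y*J l j y) y = pd i (%y. \<Sum>b\<in>I. F a b y*P b j y) y" by (rule partial_deriv_cong[OF S _ y ij(1)]) (simp add: PJ a ij)
  moreover have "pd i (%y. \<Sum>l<n. P a l y*J l j y) y = (\<Sum>l<n. pd i (P a l) y*J l j y + P a l y*pd i (J l j) y)"
   using a ij by (subst partial_deriv_sum[OF S ij(1) y]) (auto intro!: Cinf_on_mult[OF S] J P sum.cong partial_deriv_mult[OF S ij(1) y])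
  moreover have "pd i (%y. \<Sum>b\<in>I. F a b y*P b j y) y = (\<Sum>b\<in>I. pd i (F a b) y*P b j y + F a b y*pd i (P b j) y)"
   using a ij by (subst partial_deriv_sum[OF S ij(1) y]) (auto intro!: Cinf_on_mult[OF S] F P sum.cong partial_deriv_mult[OF S ij(1) y])
  ultimately have d: "(\<Sum>l<n. pd i (P a l) y*J l j y) + (\<Sum>l<n. P a l y*pd i (J l j) y) =
    (\<Sum>b\<in>I. pd i (F a b) y*P b j y) + (\<Sum>b\<in>I. F a b y*pd i (P b j) y)" by (simp add: sum.distrib)
  have dP: "pd i (P b k) y = (\<Sum>l<n. P b l y*?\<Gamma> l i k) - (\<Sum>c\<in>I. w i b c y*P c k y)"
   if "b \<in> I" "k<n" for b k using frame_christoffel[OF y ij(1) that(2,1)] by simp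
  have e1: "(\<Sum>l<n. pd i (P a l) y*J l j y) = (\<Sum>m<n. P a m y*(\<Sum>l<n. ?\<Gamma> m i l*J l j y)) - (\<Sum>c\<in>I. w i a c y*(\<Sum>b\<in>I. F c b y*P b j y))"
  proof -
   have "(\<Sum>l<n. pd i (P a l) y*J l j y) = (\<Sum>m<n. P a m y*(\<Sum>l<n. ?\<Gamma> m i l*J l j y)) - (\<Sum>c\<in>I. w i a c y*(\<Sum>l<n. P c l y*J l j y))"
    using a by (simp add: dP left_diff_distrib sum_subtractf sum_mult_assoc)
   then show ?thesis by (simp add: PJ ij y)
  qed
  have e2: "(\<Sum>b\<in>I. F a b y*pd i (P b j) y) = (\<Sum>l<n. (\<Sum>m<n. P a m y*J m l y)*?\<Gamma> l i j) - (\<Sum>b\<in>I. F a b y*(\<Sum>c\<in>I. w i b c y*P c j y))"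
  proof -
   have "(\<Sum>b\<in>I. F a b y*pd i (P b j) y) = (\<Sum>l<n. (\<Sum>b\<in>I. F a b y*P b l y)*?\<Gamma> l i j) - (\<Sum>b\<in>I. F a b y*(\<Sum>c\<in>I. w i b c y*P c j y))"
    using ij by (simp add: dP right_diff_distrib sum_subtractf sum_mult_assoc)
   moreover have "(\<Sum>l<n. (\<Sum>b\<in>I. F a b y*P b l y)*?\<Gamma> l i j) = (\<Sum>l<n. (\<Sum>m<n. P a m y*J m l y)*?\<Gamma> l i j)" by (intro sum.cong) (auto simp: PJ a y)
   ultimately show ?thesis by simp
  qed
  have e3: "(\<Sum>b\<in>I. pd i (F a b) y*P b j y) = (\<Sum>b\<in>I. F a b y*(\<Sum>c\<in>I. w i b c y*P c j y)) - (\<Sum>c\<in>I. w i a c y*(\<Sum>b\<in>I. F c b y*P b j y))"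
  proof -
   have "(\<Sum>b\<in>I. pd i (F a b) y*P b j y) = (\<Sum>b\<in>I. ((\<Sum>c\<in>I. F a c y*w i c b y) - (\<Sum>c\<in>I. w i a c y*F c b y))*P b j y)"
   proof (intro sum.cong refl arg_cong2[of _ _ _ _ "(*)"])
    fix b assume "b \<in> I"
    then show "pd i (F a b) y = (\<Sum>c\<in>I. F a c y*w i c b y) - (\<Sum>c\<in>I. w i a c y*F c b y)" using F0[OF a] by force
   qed
   then show ?thesis by (simp add: left_diff_distrib sum_subtractf sum_mult_assoc)
  qed
  have "(\<Sum>l<n. P a l y*?N l) = (\<Sum>l<n. P a l y*pd i (J l j) y)
    + (\<Sum>m<n. P a m y*(\<Sum>l<n. ?\<Gamma> m i l*J l j y)) - (\<Sum>m<n. P a m y*(\<Sum>l<n. J m l y*?\<Gamma> l i j))"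
   by (simp add: parallel_loc_def distrib_left right_diff_distrib sum.distrib sum_subtractf mult.commute[of "?\<Gamma> _ i j"])
  also have "(\<Sum>m<n. P a m y*(\<Sum>l<n. J m l y*?\<Gamma> l i j)) = (\<Sum>l<n. (\<Sum>m<n. P a m y*J m l y)*?\<Gamma> l i j)" by (rule sum_mult_assoc[symmetric])
  finally show ?thesis using d e1 e2 e3 by linarith
 qed
 then show ?thesis using P_ker[OF y, of ?N] ij by blast
qed

text \<open>Curvature when the connection forms are expanded in the coframe; \<open>\<Phi>\<close> are the structure functions.\<close>

definition frame_curv :: "('i => 'i => 'i => rfun) => 
  ('i => 'i => 'i => 'i => rfun) => ('i => 'i => 'i => rfun) => 'i => 'i => 'i => 'i => rfun" where
 "frame_curv W DW \<Phi> e f a b y = DW e f a b y - DW f e a b y + (\<Sum>c\<in>I. W c a b y*\<Phi> c e f y)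
  + ((\<Sum>c\<in>I. W e a c y*W f c b y) - (\<Sum>c\<in>I. W f a c y*W e c b y))"

context
 fixes W :: "'i => 'i => 'i => rfun" and DW :: "'i => 'i => 'i => 'i => rfun"
  and \<Phi> :: "'i => 'i => 'i => rfun"
 assumes W: "!!c a b. c \<in> I ==> a \<in> I ==> b \<in> I ==> Cinf_on n S (W c a b)"
  and wW: "!!i a b y. i<n ==> a \<in> I ==> b \<in> I ==> y \<in> S ==> w i a b y = (\<Sum>c\<in>I. W c a b y*P c i y)"
  and DW: "!!i c a b y. i<n ==> a \<in> I ==> b \<in> I ==> c \<in> I ==> y \<in> S ==>  pd i (W c a b) y = (\<Sum>e\<in>I. DW e c a b y*P e i y)"
  and \<Phi>: "!!c i j y. c \<in> I ==> i<n ==> j<n ==> y \<in> S ==>  pd i (P c j) y - pd j (P c i) y = (\<Sum>e\<in>I. \<Sum>f\<in>I. \<Phi> c e f y*(P e i y*P f j y))"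
begin

text \<open>The product rule on w = W P: derivatives of \<open>W\<close> give \<open>DW\<close>,
  derivatives of \<open>P\<close> give the structure functions, and the quadratic part is expanded
  termwise.\<close>

lemma curv_frame:
 assumes ij: "i<n" "j<n" and ab: "a \<in> I" "b \<in> I" and y: "y \<in> S"
 shows "curv I w i j a b y = (\<Sum>e\<in>I. \<Sum>f\<in>I. frame_curv W DW \<Phi> e f a b y*(P e i y*P f j y))"
proof -
 have dw: "pd i (w j a b) y = (\<Sum>e\<in>I. \<Sum>f\<in>I. DW e f a b y*(P e i y*P f j y)) + (\<Sum>c\<in>I. W c a b y*pd i (P c j) y)" if "i<n" "j<n" for i j
 proof -
  have "pd i (w j a b) y = pd i (%y. \<Sum>c\<in>I. W c a b y*P c j y) y" by (rule partial_deriv_cong[OF S _ y that(1)]) (simp add: wW that ab)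
  also have "... = (\<Sum>c\<in>I. pd i (W c a b) y*P c j y + W c a b y*pd i (P c j) y)" using that ab by (subst partial_deriv_sum[OF S that(1) y])
    (auto intro!: Cinf_on_mult[OF S] W P sum.cong partial_deriv_mult[OF S that(1) y])
  also have "... = (\<Sum>c\<in>I. \<Sum>e\<in>I. DW e c a b y*(P e i y*P c j y)) + (\<Sum>c\<in>I. W c a b y*pd i (P c j) y)"
   using that ab y by (simp add: sum.distrib DW sum_distrib_right mult.assoc)
  finally show ?thesis by (subst sum.swap)
 qed
 have sw: "(\<Sum>e\<in>I. \<Sum>f\<in>I. DW e f a b y*(P e j y*P f i y)) = (\<Sum>e\<in>I. \<Sum>f\<in>I. DW f e a b y*(P e i y*P f j y))"
  by (subst sum.swap) (simp add: mult_ac)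
 have d: "(\<Sum>c\<in>I. W c a b y*pd i (P c j) y) - (\<Sum>c\<in>I. W c a b y*pd j (P c i) y) = (\<Sum>e\<in>I. \<Sum>f\<in>I. (\<Sum>c\<in>I. W c a b y*\<Phi> c e f y)*(P e i y*P f j y))"
 proof -
  have "(\<Sum>c\<in>I. W c a b y*pd i (P c j) y) - (\<Sum>c\<in>I. W c a b y*pd j (P c i) y) = (\<Sum>c\<in>I. \<Sum>e\<in>I. \<Sum>f\<in>I. W c a b y*\<Phi> c e f y*(P e i y*P f j y))"
   unfolding sum_subtractf[symmetric] right_diff_distrib[symmetric] using ij y by (simp add: \<Phi> sum_distrib_left mult.assoc)
  also have "... = (\<Sum>e\<in>I. \<Sum>f\<in>I. \<Sum>c\<in>I. W c a b y*\<Phi> c e f y*(P e i y*P f j y))" by (rule sum_rotate)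
  finally show ?thesis by (simp add: sum_distrib_right)
 qed
 have q: "(\<Sum>c\<in>I. w i a c y*w j c b y) = (\<Sum>e\<in>I. \<Sum>f\<in>I. (\<Sum>c\<in>I. W e a c y*W f c b y)*(P e i y*P f j y))" if "i<n" "j<n" for i j
 proof -
  have "(\<Sum>c\<in>I. w i a c y*w j c b y) = (\<Sum>c\<in>I. \<Sum>e\<in>I. \<Sum>f\<in>I. (W e a c y*W f c b y)*(P e i y*P f j y))"
   using that ab y by (simp add: wW sum_product mult_ac)
  also have "... = (\<Sum>e\<in>I. \<Sum>f\<in>I. \<Sum>c\<in>I. (W e a c y*W f c b y)*(P e i y*P f j y))" by (rule sum_rotate)
  finally show ?thesis by (simp add: sum_distrib_right)
 qed
 have q': "(\<Sum>c\<in>I. w j a c y*w i c b y) = (\<Sum>e\<in>I. \<Sum>f\<in>I. (\<Sum>c\<in>I. W f a c y*W e c b y)*(P e i y*P f j y))"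
  unfolding q[OF ij(2,1)] by (subst sum.swap) (simp add: mult_ac)
 show ?thesis unfolding curv_def frame_curv_def sum_subtractf dw[OF ij] dw[OF ij(2,1)] sw q[OF ij] q' distrib_right left_diff_distrib
  using d by (simp add: sum.distrib sum_subtractf)
qed

text \<open>Inserting the dual frame \<open>V\<close> into the trace over coordinates turns it into
  a trace over the frame index.\<close>

lemma frame_ricci:
 assumes y: "y \<in> S" and jk: "j<n" "k<n"
 shows "ricci_loc n (christoffel_loc n G) j k y = (\<Sum>f\<in>I. \<Sum>b\<in>I. (\<Sum>a\<in>I. frame_curv W DW \<Phi> a f a b y)*(P f j y*P b k y))"
proof -
 obtain V where V: "!!k l. k<n ==> l<n ==> (\<Sum>a\<in>I. V k a*P a l y) = (if k = l then 1 else 0)"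
  "!!a b. a \<in> I ==> b \<in> I ==> (\<Sum>k<n. P a k y*V k b) = (if a = b then 1 else 0)" using frame_inverse[OF y] by blast
 let ?R = "%i l. riemann_loc n (christoffel_loc n G) i j l k y"
 define Q where "Q e a = (\<Sum>f\<in>I. \<Sum>b\<in>I. frame_curv W DW \<Phi> e f a b y*(P f j y*P b k y))" for e a
 have "?R i i = (\<Sum>a\<in>I. \<Sum>e\<in>I. V i a*P e i y*Q e a)" if i: "i<n" for i
 proof -
  have "?R i i = (\<Sum>l<n. (if i = l then 1 else 0)*?R i l)" using i by (intro sum_delta_left[symmetric]) auto
  also have "... = (\<Sum>l<n. (\<Sum>a\<in>I. V i a*P a l y)*?R i l)" using V(1) i by (intro sum.cong) auto
  also have "... = (\<Sum>a\<in>I. V i a*(\<Sum>l<n. P a l y*?R i l))" by (rule sum_mult_assoc)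
  also have "... = (\<Sum>a\<in>I. V i a*(\<Sum>b\<in>I. curv I w i j a b y*P b k y))" using i jk y by (simp add: frame_curvature)
  also have "... = (\<Sum>a\<in>I. \<Sum>e\<in>I. V i a*P e i y*Q e a)"
  proof (intro sum.cong refl)
   fix a assume a: "a \<in> I"
   have "(\<Sum>b\<in>I. curv I w i j a b y*P b k y) = (\<Sum>b\<in>I. \<Sum>e\<in>I. \<Sum>f\<in>I. P e i y*(frame_curv W DW \<Phi> e f a b y*(P f j y*P b k y)))"
    using a i jk y by (simp add: curv_frame sum_distrib_right sum_distrib_left mult_ac)
   also have "... = (\<Sum>e\<in>I. \<Sum>f\<in>I. \<Sum>b\<in>I. P e i y*(frame_curv W DW \<Phi> e f a b y*(P f j y*P b k y)))" by (rule sum_rotate)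
   finally have c: "(\<Sum>b\<in>I. curv I w i j a b y*P b k y) = (\<Sum>e\<in>I. P e i y*Q e a)" by (simp add: Q_def sum_distrib_left)
   show "V i a*(\<Sum>b\<in>I. curv I w i j a b y*P b k y) = (\<Sum>e\<in>I. V i a*P e i y*Q e a)" unfolding c by (simp add: sum_distrib_left mult.assoc)
  qed
  finally show ?thesis .
 qed
 then have "ricci_loc n (christoffel_loc n G) j k y = (\<Sum>i<n. \<Sum>a\<in>I. \<Sum>e\<in>I. V i a*P e i y*Q e a)" by (simp add: ricci_loc_def)
 also have "... = (\<Sum>a\<in>I. \<Sum>e\<in>I. \<Sum>i<n. V i a*P e i y*Q e a)" by (rule sum_rotate)
 also have "... = (\<Sum>a\<in>I. \<Sum>e\<in>I. (if a = e then 1 else 0)*Q e a)"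
 proof (intro sum.cong refl)
  fix a e assume "a \<in> I" "e \<in> I"
  then have "(\<Sum>i<n. P e i y*V i a) = (if a = e then 1 else 0)" using V(2)[of e a] by auto
  then show "(\<Sum>i<n. V i a*P e i y*Q e a) = (if a = e then 1 else 0)*Q e a" unfolding sum_distrib_right[symmetric] by (simp add: mult.commute)
 qed
 also have "... = (\<Sum>a\<in>I. Q a a)" using I(1) by (intro sum.cong refl sum_delta_left)
 also have "... = (\<Sum>f\<in>I. \<Sum>a\<in>I. \<Sum>b\<in>I. frame_curv W DW \<Phi> a f a b y*(P f j y*P b k y))" unfolding Q_def by (rule sum.swap)
 also have "... = (\<Sum>f\<in>I. \<Sum>b\<in>I. \<Sum>a\<in>I. frame_curv W DW \<Phi> a f a b y*(P f j y*P b k y))" by (intro sum.cong refl sum.swap)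
 finally show ?thesis by (simp add: sum_distrib_right)
qed

lemma frame_scalar:
 assumes y: "y \<in> S"
 shows "scalar_loc n G y = (\<Sum>f\<in>I. \<Sum>b\<in>I. \<eta>' f b y*(\<Sum>a\<in>I. frame_curv W DW \<Phi> a f a b y))"
proof -
 let ?B = "mat_inverse n (%a b. G a b y)" and ?K = "%f b. \<Sum>a\<in>I. frame_curv W DW \<Phi> a f a b y"
 have "scalar_loc n G y = (\<Sum>j<n. \<Sum>k<n. \<Sum>f\<in>I. \<Sum>b\<in>I. ?K f b*(?B j k*(P f j y*P b k y)))"
  unfolding scalar_loc_def using y by (intro sum.cong refl) (simp add: frame_ricci sum_distrib_left mult_ac)
 also have "... = (\<Sum>f\<in>I. \<Sum>b\<in>I. \<Sum>j<n. \<Sum>k<n. ?K f b*(?B j k*(P f j y*P b k y)))" by (rule sum_swap22)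
 also have "... = (\<Sum>f\<in>I. \<Sum>b\<in>I. ?K f b*\<eta>' f b y)" using y by (intro sum.cong refl) (simp add: frame_metric_inverse(2) flip: sum_distrib_left)
 finally show ?thesis by (simp add: mult.commute)
qed

end

end

section \<open>Functions of x and a base point\<close>

definition shift :: "(nat => real) => nat => real" where "shift w = (%i. w (Suc i))"

lemma shift_upd: "shift (w(Suc k := t)) = (shift w)(k := t)" "shift (w(0 := t)) = shift w" by (auto simp: shift_def)

lemma partial_deriv_shift_Suc: "pd (Suc k) (%w. f (w 0) (shift w)) w = pd k (f (w 0)) (shift w)"
 by (simp add: partial_deriv_def shift_upd) (simp add: shift_def)

lemma partial_deriv_shift_0: "pd 0 (%w. f (shift w)) w = 0" by (simp add: partial_deriv_def shift_upd)

lemma sum_Suc_Suc: "(\<Sum>c<Suc (Suc d). f c) = f 0 + f (Suc 0) + (\<Sum>k<d. f (Suc (Suc k)) :: real)" by (simp only: sum.lessThan_Suc_shift add.assoc)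

text \<open>Coordinate 0 of \<open>w\<close> plays the role of x and \<open>shift w\<close> that of
  the base point, so functions of (x, Y) become functions on an open set of dimension d + 1.\<close>

definition half_space :: "nat => (nat => real) set => (nat => real) set" where
 "half_space d T = {w \<in> topspace (Euclidean_space (Suc d)). 0<w 0 & shift w \<in> T}"

lemma continuous_on_coord: "continuous_on S (%w. w i :: real)" by (rule continuous_on_subset[OF continuous_on_product_coordinates subset_UNIV])

lemma eopen_half_space:
 assumes "eopen d T"
 shows "eopen (Suc d) (half_space d T)"
proof -
 obtain U where U: "open U" "T = U \<inter> topspace (Euclidean_space d)" using assms eopen_iff by blast
 have c: "continuous_on UNIV shift" unfolding shift_def by (intro continuous_on_coordinatewise_then_product continuous_on_coord)
 have "open {w. 0<w 0 & shift w \<in> U}" using open_Int[OF open_Collect_less[OF continuous_on_const continuous_on_coord[of UNIV 0]]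
    open_vimage[OF U(1) c]] by (simp add: vimage_def Int_def)
 moreover have "half_space d T = {w. 0<w 0 & shift w \<in> U} \<inter> topspace (Euclidean_space (Suc d))"
  by (auto simp: half_space_def U topspace_Euclidean_space shift_def)
 ultimately show ?thesis unfolding eopen_iff by blast
qed

lemma Cinf_on_shift:
 assumes "eopen d T" "Cinf_on d T f"
 shows "Cinf_on (Suc d) (half_space d T) (%w. f (shift w))" by (rule Cinf_on_compose[OF eopen_half_space[OF assms(1)] assms(1) _ _ assms(2)])
  (simp add: half_space_def, simp add: shift_def Cinf_on_coord[OF eopen_half_space[OF assms(1)]])

text \<open>Local data of the principal part: \<open>x\<close>, the connection form \<open>\<theta>\<close>, the coordinates \<open>Y\<close> of the base
 point, and the family \<open>B0 + s B1\<close> of base metrics.\<close>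

locale total_frame =
 fixes d :: nat and S T :: "(nat => real) set"
  and x :: "rfun" and \<theta> Y :: "nat => rfun"
  and h :: "real => real"
  and B0 B1 J :: "nat => nat => rfun"
  and t1 SB :: "real => real"
  and g Jt :: "nat => nat => rfun"
 assumes S: "eopen (Suc (Suc d)) S" and T: "eopen d T"
  and x: "Cinf_on (Suc (Suc d)) S x" "!!y. y \<in> S ==> 0<x y"
  and \<theta>: "!!i. i<Suc (Suc d) ==> Cinf_on (Suc (Suc d)) S (\<theta> i)"
  and Y: "!!k. k<d ==> Cinf_on (Suc (Suc d)) S (Y k)"
  and YT: "!!y. y \<in> S ==> (%k. if k<d then Y k y else 0) \<in> T"
  and h: "smooth1 {0<..} h" "!!s. 0<s ==> 0<h s"
  and B0: "!!k l. k<d ==> l<d ==> Cinf_on d T (B0 k l)"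
  and B1: "!!k l. k<d ==> l<d ==> Cinf_on d T (B1 k l)"
  and J: "!!k l. k<d ==> l<d ==> Cinf_on d T (J k l)"
  and B0_sym: "!!k l z. k<d ==> l<d ==> z \<in> T ==> B0 k l z = B0 l k z"
  and B1_sym: "!!k l z. k<d ==> l<d ==> z \<in> T ==> B1 k l z = B1 l k z"
  and B0_J: "!!k l z. k<d ==> l<d ==> z \<in> T ==> (\<Sum>r<d. J r k z*B0 r l z) = - (\<Sum>r<d. J r l z*B0 r k z)"
  and B1_J: "!!k l z. k<d ==> l<d ==> z \<in> T ==> (\<Sum>r<d. J r k z*B1 r l z) = - (\<Sum>r<d. J r l z*B1 r k z)"
  and JJ: "!!k l z. k<d ==> l<d ==> z \<in> T ==> (\<Sum>r<d. J k r z*J r l z) = (if k = l then -1 else 0)"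
  and base_nd: "!!s z. 0<s ==> z \<in> T ==> nondegenerate d (%k l. B0 k l z + s * B1 k l z)"
  and base_parallel: "!!s z i j k. 0<s ==> z \<in> T ==> i<d ==> j<d ==> k<d ==> 
   parallel_loc d (christoffel_loc d (%k l z. B0 k l z + s * B1 k l z)) J i k j z = 0"
  and base_scalar: "!!s z. 0<s ==> z \<in> T ==> scalar_loc d (%k l z. B0 k l z + s * B1 k l z) z = SB s"
  and base_trace: "!!s z. 0<s ==> z \<in> T ==>  (\<Sum>k<d. \<Sum>l<d. mat_inverse d (%k l. B0 k l z + s * B1 k l z) k l*B1 l k z) = t1 s"
  and d\<theta>: "!!i j y. i<Suc (Suc d) ==> j<Suc (Suc d) ==> y \<in> S ==>  pd i (\<theta> j) y - pd j (\<theta> i) y =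
   (\<Sum>k<d. \<Sum>l<d. (\<Sum>r<d. J r k (%k. if k<d then Y k y else 0)*B1 r l (%k. if k<d then Y k y else 0))*(pd i (Y k) y*pd j (Y l) y))"
  and ker: "!!y v. y \<in> S ==> (\<Sum>i<Suc (Suc d). pd i x y * v i) = 0 ==>  (\<Sum>i<Suc (Suc d). \<theta> i y * v i) = 0 ==> 
   (!!k. k<d ==> (\<Sum>i<Suc (Suc d). pd i (Y k) y * v i) = 0) ==> (\<forall>i<Suc (Suc d). v i = 0)"
  and g: "!!i j y. i<Suc (Suc d) ==> j<Suc (Suc d) ==> y \<in> S ==>  g i j y = pd i x y*pd j x y/h (x y) + h (x y)*\<theta> i y*\<theta> j y
    + (\<Sum>k<d. \<Sum>l<d. (B0 k l (%k. if k<d then Y k y else 0) + x y*B1 k l (%k. if k<d then Y k y else 0))*(pd i (Y k) y*pd j (Y l) y))"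
  and Jt: "!!i j. i<Suc (Suc d) ==> j<Suc (Suc d) ==> Cinf_on (Suc (Suc d)) S (Jt i j)"
  and Jt_x: "!!j y. j<Suc (Suc d) ==> y \<in> S ==>  (\<Sum>i<Suc (Suc d). pd i x y*Jt i j y) = - h (x y)*\<theta> j y"
  and Jt_\<theta>: "!!j y. j<Suc (Suc d) ==> y \<in> S ==>  (\<Sum>i<Suc (Suc d). \<theta> i y*Jt i j y) = pd j x y/h (x y)"
  and Jt_Y: "!!j k y. j<Suc (Suc d) ==> k<d ==> y \<in> S ==>  (\<Sum>i<Suc (Suc d). pd i (Y k) y*Jt i j y) =
   (\<Sum>l<d. J k l (%k. if k<d then Y k y else 0)*pd j (Y l) y)"
begin

abbreviation "n \<equiv> Suc (Suc d)"
abbreviation "H \<equiv> half_space d T"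

definition Yv :: "(nat => real) => nat => real" where "Yv y = (%k. if k<d then Y k y else 0)"

definition \<Psi> :: "(nat => real) => nat => real" where "\<Psi> y = (%i. case i of 0 => x y | Suc k => Yv y k)"

definition Gs :: "real => nat => nat => rfun" where "Gs s k l z = B0 k l z + s * B1 k l z"

definition Gi :: "nat => nat => rfun" where "Gi k l w = mat_inverse d (%k l. Gs (w 0) k l (shift w)) k l"

text \<open>G^{-1} G', the logarithmic derivative of the base metric in x: the family is affine in
  x, so its derivative is \<open>B1\<close>.\<close>

definition L :: "nat => nat => rfun" where "L k i w = (\<Sum>l<d. Gi k l w*B1 l i (shift w))"

text \<open>The product L J. By \<open>GiF\<close> it is also \<open>F\<close> with its second index
  raised.\<close>

definition N :: "nat => nat => rfun" where "N k i w = (\<Sum>l<d. L k l w*J l i (shift w))"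

text \<open>The components of d\<theta> on the base: \<open>F k l\<close> is the value on the k-th
  and l-th coordinate vectors.\<close>

definition F :: "nat => nat => rfun" where "F k l w = (\<Sum>r<d. J r k (shift w)*B1 r l (shift w))"

definition \<Gamma> :: "nat => nat => nat => rfun" where "\<Gamma> k i j w = christoffel_loc d (Gs (w 0)) k i j (shift w)"

lemma H: "eopen (Suc d) H" by (rule eopen_half_space[OF T])

lemma HD: "w \<in> H ==> 0<w 0" "w \<in> H ==> shift w \<in> T" by (auto simp: half_space_def)

lemma shift_\<Psi>: "shift (\<Psi> y) = Yv y" "\<Psi> y 0 = x y" by (auto simp: shift_def \<Psi>_def)

lemma \<Psi>_H: "y \<in> S ==> \<Psi> y \<in> H" using YT[of y] x(2)[of y] eopen_mem_zero[OF T]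
 by (auto simp: half_space_def shift_\<Psi> Yv_def[symmetric]) (auto simp: topspace_Euclidean_space \<Psi>_def Yv_def split: nat.splits)

lemma Cinf_Gs: "k<d ==> l<d ==> Cinf_on d T (Gs s k l)"
 unfolding Gs_def[abs_def] by (intro Cinf_on_add[OF T] Cinf_on_mult[OF T] Cinf_on_const[OF T] B0 B1)

lemma Gs_sym: "k<d ==> l<d ==> z \<in> T ==> Gs s k l z = Gs s l k z" by (simp add: Gs_def B0_sym[of k] B1_sym[of k])

lemma Gs_nd: "0<s ==> z \<in> T ==> nondegenerate d (%k l. Gs s k l z)" unfolding Gs_def by (rule base_nd)

lemma Cinf_H_Gs: "k<d ==> l<d ==> Cinf_on (Suc d) H (%w. Gs (w 0) k l (shift w))"
 unfolding Gs_def by (intro Cinf_on_add[OF H] Cinf_on_mult[OF H] Cinf_on_coord[OF H] Cinf_on_shift[OF T] B0 B1)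

lemma Cinf_Gi: "k<d ==> l<d ==> Cinf_on (Suc d) H (Gi k l)"
 unfolding Gi_def[abs_def] by (rule mat_inverse_Cinf[OF H Cinf_H_Gs Gs_nd]) (auto dest: HD)

lemma Cinf_L: "k<d ==> l<d ==> Cinf_on (Suc d) H (L k l)"
 unfolding L_def[abs_def] by (intro Cinf_on_sum[OF H] Cinf_on_mult[OF H] Cinf_Gi Cinf_on_shift[OF T] B1) auto

lemma Cinf_N: "k<d ==> l<d ==> Cinf_on (Suc d) H (N k l)"
 unfolding N_def[abs_def] by (intro Cinf_on_sum[OF H] Cinf_on_mult[OF H] Cinf_L Cinf_on_shift[OF T] J) auto

lemma Cinf_F: "k<d ==> l<d ==> Cinf_on (Suc d) H (F k l)"
 unfolding F_def[abs_def] by (intro Cinf_on_sum[OF H] Cinf_on_mult[OF H] Cinf_on_shift[OF T] J B1) auto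

text \<open>Smoothness is meant jointly in x and the base point. The partials of \<open>Gs s\<close>
  are affine in \<open>s\<close>, so every ingredient of the Christoffel symbols depends smoothly on
  all variables.\<close>

lemma Cinf_\<Gamma>:
 assumes "k<d" "i<d" "j<d"
 shows "Cinf_on (Suc d) H (\<Gamma> k i j)"
proof -
 have p: "pd a (Gs s b c) z = pd a (B0 b c) z + s * pd a (B1 b c) z" if "a<d" "b<d" "c<d" "z \<in> T" for a b c s z
 proof -
  have c: "Cinf_on d T (%z. s * B1 b c z)" by (intro Cinf_on_mult[OF T] Cinf_on_const[OF T] B1 that)
  show ?thesis unfolding Gs_def[abs_def]
   by (simp add: partial_deriv_add[OF T that(1,4) B0[OF that(2,3)] c] partial_deriv_cmult[OF T that(1,4) B1[OF that(2,3)]])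
 qed
 have "Cinf_on (Suc d) H (%w. pd a (Gs (w 0) b c) (shift w))" if "a<d" "b<d" "c<d" for a b c
 proof (rule Cinf_on_cong[OF H, of "%w. pd a (B0 b c) (shift w) + w 0*pd a (B1 b c) (shift w)"])
  show "Cinf_on (Suc d) H (%w. pd a (B0 b c) (shift w) + w 0*pd a (B1 b c) (shift w))"
   by (intro Cinf_on_add[OF H] Cinf_on_mult[OF H] Cinf_on_coord[OF H] Cinf_on_shift[OF T] Cinf_on_partial_deriv[OF T] B0 B1 that)
 qed (simp add: p that HD)
 then show ?thesis unfolding \<Gamma>_def[abs_def] christoffel_loc_def using assms
  by (intro Cinf_on_divide_const[OF H] Cinf_on_sum[OF H] Cinf_on_mult[OF H] Cinf_on_diff[OF H] Cinf_on_add[OF H]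
    Cinf_Gi[unfolded Gi_def[abs_def]]) auto
qed

lemma Gi_inv:
 assumes "w \<in> H" "k<d" "l<d"
 shows "(\<Sum>r<d. Gs (w 0) k r (shift w)*Gi r l w) = (if k = l then 1 else 0)"
  and "(\<Sum>r<d. Gi k r w*Gs (w 0) r l (shift w)) = (if k = l then 1 else 0)"
 using mat_inverse_nondegenerate(1,2)[OF Gs_nd[OF HD[OF assms(1)]]] assms(2,3) by (simp_all add: is_inverse_def Gi_def)

lemma Gi_sym: "w \<in> H ==> k<d ==> l<d ==> Gi k l w = Gi l k w"
 unfolding Gi_def by (rule mat_inverse_symmetric[OF Gs_nd[OF HD]]) (auto intro: Gs_sym HD)

lemma GL: 
 assumes "w \<in> H" "k<d" "i<d"
 shows "(\<Sum>l<d. Gs (w 0) k l (shift w)*L l i w) = B1 k i (shift w)"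
proof -
 have "(\<Sum>l<d. Gs (w 0) k l (shift w)*L l i w) = (\<Sum>r<d. (\<Sum>l<d. Gs (w 0) k l (shift w)*Gi l r w)*B1 r i (shift w))"
  unfolding L_def by (rule sum_mult_assoc[symmetric])
 also have "... = (\<Sum>r<d. (if k = r then 1 else 0)*B1 r i (shift w))" using assms by (intro sum.cong) (auto simp: Gi_inv)
 also have "... = B1 k i (shift w)" using assms by (intro sum_delta_left) auto
 finally show ?thesis .
qed

text \<open>Identities between components with an upper index are proved after lowering it, where
  \<open>GL\<close> removes the inverse metric.\<close>

lemma G_cancel:
 assumes "w \<in> H" "!!k. k<d ==> (\<Sum>l<d. Gs (w 0) k l (shift w)*u l) = (\<Sum>l<d. Gs (w 0) k l (shift w) * v l)" "k<d"
 shows "u k = v k"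
proof -
 have "\<forall>i<d. (\<Sum>k<d. Gs (w 0) i k (shift w)*(u k - v k)) = 0" using assms(2) by (simp add: right_diff_distrib sum_subtractf)
 then have "\<forall>k<d. u k - v k = 0" using Gs_nd[OF HD[OF assms(1)], unfolded nondegenerate_def, THEN spec[of _ "%k. u k - v k"]] by blast
 then show ?thesis using assms(3) by simp
qed

lemma G_J: "k<d ==> l<d ==> z \<in> T ==> (\<Sum>r<d. J r k z*Gs s r l z) = - (\<Sum>r<d. J r l z*Gs s r k z)" using B0_J[of k l z] B1_J[of k l z]
 by (simp add: Gs_def distrib_left sum.distrib mult.left_commute[of "J _ _ _" s] flip: sum_distrib_left)

lemma G_J': "k<d ==> l<d ==> z \<in> T ==> (\<Sum>r<d. Gs s k r z*J r l z) = - (\<Sum>r<d. J r k z*Gs s r l z)"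
 using G_J[of k l z s] by (simp add: Gs_sym[of k] mult.commute)

lemma B1_J': "k<d ==> l<d ==> z \<in> T ==> (\<Sum>r<d. B1 k r z*J r l z) = - (\<Sum>r<d. J r k z*B1 r l z)"
 using B1_J[of k l z] by (simp add: B1_sym[of k] mult.commute)

text \<open>The metric and \<open>B1\<close> are both compatible with \<open>J\<close>, hence G^{-1}
  B1 commutes with \<open>J\<close>.\<close>

lemma LJ_comm:
 assumes w: "w \<in> H" and ki: "k<d" "i<d"
 shows "(\<Sum>l<d. J k l (shift w)*L l i w) = N k i w"
proof (rule G_cancel[OF w _ ki(1)])
 fix k assume k: "k<d"
 let ?z = "shift w" and ?G = "Gs (w 0)"
 have "(\<Sum>l<d. ?G k l ?z*(\<Sum>m<d. J l m ?z*L m i w)) = (\<Sum>m<d. (\<Sum>l<d. ?G k l ?z*J l m ?z)*L m i w)" by (rule sum_mult_assoc[symmetric])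
 also have "... = - (\<Sum>m<d. (\<Sum>l<d. J l k ?z*?G l m ?z)*L m i w)" using k w by (simp add: G_J' HD sum_negf)
 also have "... = - (\<Sum>l<d. J l k ?z*B1 l i ?z)" using w ki by (simp add: sum_mult_assoc GL)
 also have "... = (\<Sum>m<d. B1 k m ?z*J m i ?z)" using k ki w by (simp add: B1_J' HD)
 also have "... = (\<Sum>m<d. (\<Sum>l<d. ?G k l ?z*L l m w)*J m i ?z)" using k w by (simp add: GL)
 also have "... = (\<Sum>l<d. ?G k l ?z*N l i w)" unfolding N_def by (rule sum_mult_assoc)
 finally show "(\<Sum>l<d. ?G k l ?z*(\<Sum>m<d. J l m ?z*L m i w)) = (\<Sum>l<d. ?G k l ?z*N l i w)" .
qed

lemma NJ: 
 assumes w: "w \<in> H" and ki: "k<d" "i<d"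
 shows "(\<Sum>l<d. N k l w*J l i (shift w)) = - L k i w"
  and "(\<Sum>l<d. J k l (shift w)*N l i w) = - L k i w"
proof -
 have "(\<Sum>l<d. N k l w*J l i (shift w)) = (\<Sum>r<d. L k r w*(\<Sum>l<d. J r l (shift w)*J l i (shift w)))" unfolding N_def by (rule sum_mult_assoc)
 also have "... = (\<Sum>r<d. - (L k r w*(if r = i then 1 else 0)))" using w ki by (intro sum.cong) (auto simp: JJ HD)
 finally show 1: "(\<Sum>l<d. N k l w*J l i (shift w)) = - L k i w" using ki sum_delta_right[of "{..<d}" i "%r. L k r w"] by (simp add: sum_negf)
 have "(\<Sum>l<d. J k l (shift w)*N l i w) = (\<Sum>r<d. (\<Sum>l<d. J k l (shift w)*L l r w)*J r i (shift w))"
  unfolding N_def by (rule sum_mult_assoc[symmetric])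
 also have "... = (\<Sum>r<d. N k r w*J r i (shift w))" using w ki by (simp add: LJ_comm)
 finally show "(\<Sum>l<d. J k l (shift w)*N l i w) = - L k i w" using 1 by simp
qed

lemma F_antisym: "w \<in> H ==> k<d ==> l<d ==> F k l w = - F l k w" unfolding F_def using B1_J HD by blast

lemma FJ:
 assumes "w \<in> H" "j<d" "i<d"
 shows "(\<Sum>k<d. F j k w*J k i (shift w)) = B1 j i (shift w)"
proof -
 have "(\<Sum>k<d. F j k w*J k i (shift w)) = (\<Sum>k<d. - F k j w*J k i (shift w))" using assms by (intro sum.cong) (auto simp: F_antisym[of w j])
 also have "... = - (\<Sum>k<d. (\<Sum>r<d. B1 j r (shift w)*J r k (shift w))*J k i (shift w))"
  unfolding F_def using assms by (simp add: sum_negf B1_sym[of j] HD mult.commute)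
 also have "... = - (\<Sum>r<d. B1 j r (shift w)*(\<Sum>k<d. J r k (shift w)*J k i (shift w)))" by (simp add: sum_mult_assoc)
 also have "... = (\<Sum>r<d. B1 j r (shift w)*(if r = i then 1 else 0))"
  unfolding sum_negf[symmetric] using assms by (intro sum.cong) (auto simp: JJ HD)
 finally show ?thesis using assms sum_delta_right[of "{..<d}" i] by simp
qed

lemma GiF:
 assumes "w \<in> H" "j<d" "i<d"
 shows "(\<Sum>r<d. Gi j r w*F i r w) = N j i w"
proof (rule G_cancel[OF assms(1) _ assms(2)])
 fix k assume k: "k<d"
 let ?z = "shift w" and ?G = "Gs (w 0)"
 have "(\<Sum>l<d. ?G k l ?z*(\<Sum>r<d. Gi l r w*F i r w)) = (\<Sum>r<d. (\<Sum>l<d. ?G k l ?z*Gi l r w)*F i r w)" by (rule sum_mult_assoc[symmetric])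
 also have "... = (\<Sum>r<d. (if k = r then 1 else 0)*F i r w)" using k assms by (intro sum.cong) (auto simp: Gi_inv)
 also have "... = F i k w" using k by (intro sum_delta_left) auto
 also have "... = (\<Sum>r<d. B1 k r ?z*J r i ?z)" unfolding F_def using k assms by (simp add: B1_sym[of k] HD mult.commute)
 also have "... = (\<Sum>m<d. (\<Sum>l<d. ?G k l ?z*L l m w)*J m i ?z)" using k assms by (simp add: GL)
 also have "... = (\<Sum>l<d. ?G k l ?z*N l i w)" unfolding N_def by (rule sum_mult_assoc)
 finally show "(\<Sum>l<d. ?G k l ?z*(\<Sum>r<d. Gi l r w*F i r w)) = (\<Sum>l<d. ?G k l ?z*N l i w)" .
qed

text \<open>Differentiate G L = B1 in x. Since G' = B1 and \<open>B1\<close> does not depend on x,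
  one has B1 L + G L' = 0, that is L' = - L^2.\<close>

lemma partial_0_L:
 assumes w: "w \<in> H" and ki: "k<d" "i<d"
 shows "pd 0 (L k i) w = - (\<Sum>l<d. L k l w*L l i w)"
proof -
 let ?z = "shift w" and ?G = "Gs (w 0)"
 have "pd 0 (L k i) w = (%k. - (\<Sum>l<d. L k l w*L l i w)) k"
 proof (rule G_cancel[OF w _ ki(1), of "%k. pd 0 (L k i) w"])
  fix k assume k: "k<d"
  have "pd 0 (%w. \<Sum>l<d. Gs (w 0) k l (shift w)*L l i w) w = pd 0 (%w. B1 k i (shift w)) w"
   by (rule partial_deriv_cong[OF H _ w]) (auto simp: GL k ki)
  moreover have "pd 0 (%w. Gs (w 0) k l (shift w)) w = B1 k l ?z" for l
   by (rule partial_derivI) (auto simp: Gs_def shift_upd intro!: derivative_eq_intros)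
  then have "pd 0 (%w. \<Sum>l<d. Gs (w 0) k l (shift w)*L l i w) w = (\<Sum>l<d. B1 k l ?z*L l i w + ?G k l ?z*pd 0 (L l i) w)"
   using k ki by (subst partial_deriv_sum[OF H zero_less_Suc w])
    (auto intro!: Cinf_on_mult[OF H] Cinf_H_Gs Cinf_L sum.cong simp: partial_deriv_mult[OF H zero_less_Suc w Cinf_H_Gs Cinf_L])
  ultimately have "(\<Sum>l<d. ?G k l ?z*pd 0 (L l i) w) = - (\<Sum>l<d. B1 k l ?z*L l i w)" by (simp add: sum.distrib partial_deriv_shift_0)
  also have "... = - (\<Sum>l<d. (\<Sum>m<d. ?G k m ?z*L m l w)*L l i w)" using k w by (simp add: GL)
  also have "... = (\<Sum>m<d. ?G k m ?z*- (\<Sum>l<d. L m l w*L l i w))" by (simp add: sum_mult_assoc sum_negf)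
  finally show "(\<Sum>l<d. ?G k l ?z*pd 0 (L l i) w) = (\<Sum>m<d. ?G k m ?z*- (\<Sum>l<d. L m l w*L l i w))" .
 qed
 then show ?thesis .
qed

end

declare sum.lessThan_Suc [simp del]

section \<open>The Levi-Civita connection in the frame dual to dx, \<theta>, dY\<close>

context total_frame
begin

text \<open>\<open>fconn c a b\<close> is the coefficient of the frame vector \<open>a\<close> in the derivative of \<open>b\<close> along \<open>c\<close>; the frame
 is dual to \<open>dx\<close>, \<open>\<theta>\<close>, \<open>dY\<^sub>0\<close>, \<open>dY\<^sub>1\<close>, \<open>...\<close>\<close>

fun fconn :: "nat => nat => nat => rfun" where "fconn 0 0 0 = (%w. - (deriv h (w 0)/(2*h (w 0))))"
| "fconn 0 (Suc 0) (Suc 0) = (%w. deriv h (w 0)/(2*h (w 0)))" | "fconn 0 (Suc (Suc k)) (Suc (Suc i)) = (%w. L k i w/2)"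
| "fconn (Suc 0) (Suc 0) 0 = (%w. deriv h (w 0)/(2*h (w 0)))" | "fconn (Suc 0) 0 (Suc 0) = (%w. - (h (w 0)*deriv h (w 0))/2)"
| "fconn (Suc 0) (Suc (Suc k)) (Suc (Suc i)) = (%w. h (w 0)*N k i w/2)" | "fconn (Suc (Suc i)) (Suc (Suc k)) 0 = (%w. L k i w/2)"
| "fconn (Suc (Suc i)) (Suc (Suc k)) (Suc 0) = (%w. h (w 0)*N k i w/2)"
| "fconn (Suc (Suc j)) 0 (Suc (Suc i)) = (%w. - (h (w 0)*B1 i j (shift w))/2)" | "fconn (Suc (Suc j)) (Suc 0) (Suc (Suc i)) = (%w. - F j i w/2)"
| "fconn (Suc (Suc j)) (Suc (Suc k)) (Suc (Suc i)) = \<Gamma> k j i" | "fconn _ _ _ = (%w. 0)"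

fun coframe :: "nat => nat => rfun" where "coframe 0 i = pd i x" | "coframe (Suc 0) i = \<theta> i" | "coframe (Suc (Suc k)) i = pd i (Y k)"

fun fmetric :: "nat => nat => rfun" where "fmetric 0 0 = (%w. 1/h (w 0))" | "fmetric (Suc 0) (Suc 0) = (%w. h (w 0))"
| "fmetric (Suc (Suc k)) (Suc (Suc l)) = (%w. Gs (w 0) k l (shift w))" | "fmetric _ _ = (%w. 0)"

fun fmetric_inv :: "nat => nat => rfun" where "fmetric_inv 0 0 = (%w. h (w 0))" | "fmetric_inv (Suc 0) (Suc 0) = (%w. 1/h (w 0))"
| "fmetric_inv (Suc (Suc k)) (Suc (Suc l)) = Gi k l" | "fmetric_inv _ _ = (%w. 0)"

fun fJ :: "nat => nat => rfun" where "fJ 0 (Suc 0) = (%w. - h (w 0))" | "fJ (Suc 0) 0 = (%w. 1/h (w 0))"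
| "fJ (Suc (Suc k)) (Suc (Suc l)) = (%w. J k l (shift w))" | "fJ _ _ = (%w. 0)"

text \<open>dx and the dY are exact, so the only structure functions are those of d\<theta>.\<close>

fun struct :: "nat => nat => nat => rfun" where "struct (Suc 0) (Suc (Suc k)) (Suc (Suc l)) = F k l" | "struct _ _ _ = (%w. 0)"

text \<open>Derivative along the frame of a function of \<open>(x, Y)\<close>\<close>

fun fderiv :: "nat => rfun => rfun" where "fderiv 0 f = pd 0 f" | "fderiv (Suc 0) f = (%w. 0)" | "fderiv (Suc (Suc k)) f = pd (Suc k) f"

lemma idx_cases:
 assumes "a<n" obtains "a = 0" | "a = Suc 0" | k where "a = Suc (Suc k)" "k<d" using assms by (cases a; cases "a - 1") auto

lemma Cinf_H_u: "smooth1 {0<..} u ==> Cinf_on (Suc d) H (%w. u (w 0))"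
 by (rule Cinf_on_smooth1(1)[OF H open_greaterThan]) (auto intro: Cinf_on_coord[OF H] HD)

lemma h': "0<s ==> (h has_real_derivative deriv h s) (at s)" "smooth1 {0<..} (deriv h)"
 "0<s ==> (deriv h has_real_derivative deriv (deriv h) s) (at s)"
 using smooth1_deriv[OF open_greaterThan h(1)] smooth1_deriv(1)[OF open_greaterThan smooth1_deriv(2)[OF open_greaterThan h(1)]] by auto

lemma h_nz: "w \<in> H ==> h (w 0) ~= 0" using h(2)[OF HD(1), of w] by simp

lemma Cinf_conn:
 assumes "c<n" "a<n" "b<n"
 shows "Cinf_on (Suc d) H (fconn c a b)" using assms
 by (elim idx_cases; simp; intro Cinf_on_const[OF H] Cinf_on_uminus[OF H] Cinf_on_divide[OF H] Cinf_on_mult[OF H]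
   Cinf_H_u h h' Cinf_L Cinf_N Cinf_F Cinf_\<Gamma> Cinf_on_shift[OF T] B1; simp add: h_nz)

lemma Cinf_fmetric: "a<n ==> b<n ==> Cinf_on (Suc d) H (fmetric a b)"
 by (elim idx_cases; simp; intro Cinf_on_const[OF H] Cinf_on_divide[OF H] Cinf_H_u h Cinf_H_Gs; simp add: h_nz)

lemma Cinf_fJ: "a<n ==> b<n ==> Cinf_on (Suc d) H (fJ a b)"
 by (elim idx_cases; simp; intro Cinf_on_const[OF H] Cinf_on_uminus[OF H] Cinf_on_divide[OF H] Cinf_H_u h Cinf_on_shift[OF T] J; simp add: h_nz)

lemma Cinf_coframe: "a<n ==> i<n ==> Cinf_on n S (coframe a i)" by (elim idx_cases) (auto intro!: Cinf_on_partial_deriv[OF S] x Y \<theta>)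

lemma \<Psi>_coord: "j<Suc d ==> Cinf_on n S (%y. \<Psi> y j)" by (cases j) (auto simp: \<Psi>_def Yv_def intro: x Y)

lemma Cinf_\<Psi>: "Cinf_on (Suc d) H f ==> Cinf_on n S (%y. f (\<Psi> y))" by (rule Cinf_on_compose[OF S H \<Psi>_H \<Psi>_coord])

lemma partial_\<Psi>:
 assumes f: "Cinf_on (Suc d) H f" and i: "i<n" and y: "y \<in> S"
 shows "pd i (%y. f (\<Psi> y)) y = (\<Sum>e<n. fderiv e f (\<Psi> y)*coframe e i y)"
proof -
 have "pd i (%y. f (\<Psi> y)) y = (\<Sum>k<Suc d. pd k f (\<Psi> y)*pd i (%y. \<Psi> y k) y)" by (rule partial_deriv_chain[OF S i y H \<Psi>_H \<Psi>_coord f])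
 also have "... = pd 0 f (\<Psi> y)*pd i x y + (\<Sum>k<d. pd (Suc k) f (\<Psi> y)*pd i (Y k) y)" unfolding sum.lessThan_Suc_shift by (simp add: \<Psi>_def Yv_def)
 finally show ?thesis by (simp add: sum_Suc_Suc)
qed

lemma partial_coframe:
 assumes c: "c<n" and ij: "i<n" "j<n" and y: "y \<in> S"
 shows "pd i (coframe c j) y - pd j (coframe c i) y = (\<Sum>e<n. \<Sum>f<n. struct c e f (\<Psi> y)*(coframe e i y*coframe f j y))" using c
proof (cases rule: idx_cases)
 case 1 then show ?thesis using Cinf_on_partial_commute[OF S x(1) y ij] by simp
next
 case 2 then show ?thesis using d\<theta>[OF ij y] by (simp add: sum_Suc_Suc F_def shift_\<Psi> Yv_def)
next
 case (3 k) then show ?thesis using Cinf_on_partial_commute[OF S Y y ij] by simp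
qed

definition wf :: "nat => nat => nat => rfun" where "wf i a b y = (\<Sum>c<n. fconn c a b (\<Psi> y)*coframe c i y)"

lemma Cinf_wf: "i<n ==> a<n ==> b<n ==> Cinf_on n S (wf i a b)"
 unfolding wf_def[abs_def] by (intro Cinf_on_sum[OF S] Cinf_on_mult[OF S] Cinf_\<Psi> Cinf_conn Cinf_coframe) auto

lemma \<Gamma>_sym: "w \<in> H ==> i<d ==> j<d ==> \<Gamma> k i j w = \<Gamma> k j i w"
 unfolding \<Gamma>_def by (rule christoffel_loc_sym[OF T Cinf_Gs Gs_sym Gs_nd]) (auto dest: HD)

text \<open>The algebraic form of vanishing torsion: the part of the connection coefficients
  antisymmetric in the two frame directions cancels the structure functions.\<close>

lemma conn_torsion:
 assumes w: "w \<in> H" and ab: "a<n" "b<n" "c<n"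
 shows "fconn c a b w - fconn b a c w + struct a c b w = 0"
\<comment> \<open>This case alone needs the antisymmetry of \<open>F\<close>, which would loop as a
  rewriting rule.\<close>
proof (cases "a = Suc 0 & (\<exists>k<d. b = Suc (Suc k)) & (\<exists>l<d. c = Suc (Suc l))")
 case True
 then obtain k l where "a = Suc 0" "b = Suc (Suc k)" "c = Suc (Suc l)" "k<d" "l<d" by blast
 then show ?thesis using F_antisym[OF w, of k l] by simp
next
 case False
 have B: "B1 k l (shift w) = B1 l k (shift w)" if "k<d" "l<d" for k l using B1_sym[OF that HD(2)[OF w]] .
 show ?thesis by (rule idx_cases[OF ab(1)]; rule idx_cases[OF ab(2)]; rule idx_cases[OF ab(3)]; use False in "simp add: B \<Gamma>_sym[OF w]")
qed

text \<open>\<open>conn_torsion\<close> contracted with the coframe; the structure functions are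
  supplied by the derivatives of the coframe.\<close>

lemma wf_torsion:
 assumes a: "a<n" and ij: "i<n" "j<n" and y: "y \<in> S"
 shows "pd i (coframe a j) y + (\<Sum>b<n. wf i a b y*coframe b j y) = pd j (coframe a i) y + (\<Sum>b<n. wf j a b y*coframe b i y)"
proof -
 have "(\<Sum>b<n. wf i a b y*coframe b j y) = (\<Sum>c<n. \<Sum>b<n. fconn c a b (\<Psi> y)*(coframe c i y*coframe b j y))" for i j
  unfolding wf_def sum_distrib_right by (subst sum.swap) (simp add: mult.assoc)
 note e = this
 have "(\<Sum>c<n. \<Sum>b<n. fconn c a b (\<Psi> y)*(coframe c j y*coframe b i y)) = (\<Sum>c<n. \<Sum>b<n. fconn b a c (\<Psi> y)*(coframe c i y*coframe b j y))"
  by (subst sum.swap) (simp add: mult_ac)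
 moreover have "(\<Sum>c<n. \<Sum>b<n. fconn c a b (\<Psi> y)*(coframe c i y*coframe b j y)) -
   (\<Sum>c<n. \<Sum>b<n. fconn b a c (\<Psi> y)*(coframe c i y*coframe b j y)) = (\<Sum>c<n. \<Sum>b<n. - struct a c b (\<Psi> y)*(coframe c i y*coframe b j y))"
  unfolding sum_subtractf[symmetric] left_diff_distrib[symmetric]
 proof (intro sum.cong refl arg_cong2[of _ _ _ _ "(*)"])
  fix c b assume "c \<in> {..<n}" "b \<in> {..<n}"
  then show "fconn c a b (\<Psi> y) - fconn b a c (\<Psi> y) = - struct a c b (\<Psi> y)" using conn_torsion[OF \<Psi>_H[OF y] a, of b c] by simp
 qed
 ultimately show ?thesis using partial_coframe[OF a ij y] unfolding e by (simp add: sum_negf)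
qed

end

context total_frame
begin

lemma fderiv_u:
 assumes "w \<in> H" "(u has_real_derivative u') (at (w 0))"
 shows "pd 0 (%w. u (w 0)) w = u'" "pd (Suc k) (%w. u (w 0)) w = 0"
proof -
 show "pd 0 (%w. u (w 0)) w = u'" using assms(2) DERIV_shift[of u u' 0 "w 0"] by (intro partial_derivI) (simp add: add.commute)
qed (simp add: partial_deriv_def)

lemma partial_Gs:
 assumes "w \<in> H" "k<d" "l<d"
 shows "pd 0 (%w. Gs (w 0) k l (shift w)) w = B1 k l (shift w)"
  and "m<d ==> pd (Suc m) (%w. Gs (w 0) k l (shift w)) w = (\<Sum>r<d. \<Gamma> r m k w*Gs (w 0) r l (shift w) + \<Gamma> r m l w*Gs (w 0) k r (shift w))"
proof -
 show "pd 0 (%w. Gs (w 0) k l (shift w)) w = B1 k l (shift w)" by (rule partial_derivI) (auto simp: Gs_def shift_upd intro!: derivative_eq_intros)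
 assume "m<d"
 then show "pd (Suc m) (%w. Gs (w 0) k l (shift w)) w = (\<Sum>r<d. \<Gamma> r m k w*Gs (w 0) r l (shift w) + \<Gamma> r m l w*Gs (w 0) k r (shift w))"
  using christoffel_loc_compatible[OF T Cinf_Gs Gs_sym Gs_nd, of "w 0" k l m "shift w"] assms HD
  by (simp add: partial_deriv_shift_Suc[of m "%s. Gs s k l"] \<Gamma>_def)
qed

lemma sum_L_Gs: "w \<in> H ==> k<d ==> i<d ==> (\<Sum>c<d. L c k w*Gs (w 0) c i (shift w)) = B1 k i (shift w)"
 "w \<in> H ==> k<d ==> i<d ==> (\<Sum>c<d. Gs (w 0) i c (shift w)*L c k w) = B1 k i (shift w)"
proof -
 assume a: "w \<in> H" "k<d" "i<d"
 show 2: "(\<Sum>c<d. Gs (w 0) i c (shift w)*L c k w) = B1 k i (shift w)" using GL[OF a(1,3,2)] B1_sym[OF a(3,2) HD(2)[OF a(1)]] by simp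
 show "(\<Sum>c<d. L c k w*Gs (w 0) c i (shift w)) = B1 k i (shift w)" using 2 a by (simp add: Gs_sym[of i] HD mult.commute)
qed

lemma sum_N_Gs: "w \<in> H ==> k<d ==> i<d ==> (\<Sum>c<d. N c k w*Gs (w 0) c i (shift w)) = F k i w"
 "w \<in> H ==> k<d ==> i<d ==> (\<Sum>c<d. Gs (w 0) i c (shift w)*N c k w) = F k i w"
proof -
 assume a: "w \<in> H" "k<d" "i<d"
 have "(\<Sum>c<d. Gs (w 0) i c (shift w)*N c k w) = (\<Sum>m<d. (\<Sum>l<d. Gs (w 0) i l (shift w)*L l m w)*J m k (shift w))"
  unfolding N_def by (rule sum_mult_assoc[symmetric])
 also have "... = F k i w" unfolding F_def using a by (intro sum.cong) (auto simp: GL B1_sym[of i] HD)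
 finally show 2: "(\<Sum>c<d. Gs (w 0) i c (shift w)*N c k w) = F k i w" .
 show "(\<Sum>c<d. N c k w*Gs (w 0) c i (shift w)) = F k i w" using 2 a by (simp add: Gs_sym[of i] HD mult.commute)
qed

text \<open>Checked by index type. Among base indices this is the metric compatibility of the base
  connection. In the direction dual to dx it holds because \<open>L\<close> lowers to
  \<open>B1\<close>, in the direction dual to \<theta> because \<open>N\<close> lowers to the
  antisymmetric \<open>F\<close>.\<close>

lemma conn_compat:
 assumes w: "w \<in> H" and ab: "a<n" "b<n" "c<n"
 shows "fderiv c (fmetric a b) w = (\<Sum>e<n. fconn c e a w*fmetric e b w) + (\<Sum>e<n. fmetric a e w*fconn c e b w)"
proof -
 have hh: "(h has_real_derivative deriv h (w 0)) (at (w 0))" using h'(1) HD(1)[OF w] .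
 have hi: "((%s. 1/h s) has_real_derivative - (deriv h (w 0)/(h (w 0))\<^sup>2)) (at (w 0))"
  using h_nz[OF w] hh by (auto intro!: derivative_eq_intros simp: power2_eq_square)
 have e: "(\<Sum>c<d. L c k w*Gs (w 0) c i (shift w)/2) = B1 k i (shift w)/2" "(\<Sum>c<d. Gs (w 0) i c (shift w)*L c k w/2) = B1 k i (shift w)/2"
  "(\<Sum>c<d. h (w 0)*N c k w*Gs (w 0) c i (shift w)/2) = h (w 0)*F k i w/2"
  "(\<Sum>c<d. Gs (w 0) i c (shift w)*(h (w 0)*N c k w)/2) = h (w 0)*F k i w/2" if "k<d" "i<d" for k i
  using sum_L_Gs[OF w that] sum_N_Gs[OF w that] by (simp_all add: mult.assoc mult.left_commute[of _ "h _"] flip: sum_divide_distrib sum_distrib_left)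
 have z: "h (w 0)*F i k w + h (w 0)*F k i w = 0" if "k<d" "i<d" for k i using F_antisym[OF w that] by simp
 have B: "B1 k i (shift w) = B1 i k (shift w)" if "k<d" "i<d" for k i using B1_sym[OF that HD(2)[OF w]] .
 show ?thesis by (rule idx_cases[OF ab(1)]; rule idx_cases[OF ab(2)]; rule idx_cases[OF ab(3)];
   simp add: sum_Suc_Suc fderiv_u[OF w hh] fderiv_u[OF w hi] partial_deriv_const partial_Gs[OF w] h_nz[OF w]
    e B power2_eq_square sum.distrib z mult.commute[of "\<Gamma> _ _ _ _" "Gs _ _ _ _"] flip: add_divide_distrib)
qed

text \<open>With all indices in the base this is the parallel \<open>J\<close> of the base metrics.
  The mixed cases hold because L J = J L = N and because \<open>F\<close> and \<open>B1\<close>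
  determine each other through \<open>J\<close>.\<close>

lemma fJ_parallel:
 assumes w: "w \<in> H" and ab: "a<n" "b<n" "c<n"
 shows "fderiv c (fJ a b) w + (\<Sum>e<n. fconn c a e w*fJ e b w) - (\<Sum>e<n. fJ a e w*fconn c e b w) = 0"
proof -
 have hh: "((%s. - h s) has_real_derivative - deriv h (w 0)) (at (w 0))" using h'(1) HD(1)[OF w] by (auto intro: DERIV_minus)
 have hi: "((%s. 1/h s) has_real_derivative - (deriv h (w 0)/(h (w 0))\<^sup>2)) (at (w 0))"
  using h_nz[OF w] h'(1) HD(1)[OF w] by (auto intro!: derivative_eq_intros simp: power2_eq_square)
 have B: "B1 k i (shift w) = B1 i k (shift w)" if "k<d" "i<d" for k i using B1_sym[OF that HD(2)[OF w]] .
 have e1: "(\<Sum>c<d. - (h (w 0)*B1 c i (shift w)*J c k (shift w)/2)) = h (w 0)*F i k w/2" if "k<d" "i<d" for k i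
 proof -
  have "(\<Sum>c<d. - (h (w 0)*B1 c i (shift w)*J c k (shift w)/2)) = - (h (w 0)/2)*F k i w"
   by (simp add: F_def sum_distrib_left mult_ac sum_negf)
  then show ?thesis using F_antisym[OF w that] by simp
 qed
 have e2: "(\<Sum>c<d. - (h (w 0)*B1 i c (shift w)*J c k (shift w)/2)) = h (w 0)*F i k w/2" if "k<d" "i<d" for k i
  unfolding e1[OF that, symmetric] using that by (intro sum.cong) (auto simp: B[of i])
 have e: "(\<Sum>c<d. - (F k c w*J c i (shift w)/2)) = - B1 k i (shift w)/2" "(\<Sum>c<d. J k c (shift w)*L c i w/2) = N k i w/2"
  "(\<Sum>c<d. J k c (shift w)*(h (w 0)*N c i w)/2) = - (L k i w*h (w 0))/2" "(\<Sum>c<d. L k c w*J c i (shift w)/2) = N k i w/2"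
  "(\<Sum>c<d. h (w 0)*N k c w*J c i (shift w)/2) = - (L k i w*h (w 0))/2" if "k<d" "i<d" for k i
  using FJ[OF w that] LJ_comm[OF w that] NJ[OF w that] by (simp_all add: mult.assoc mult.left_commute[of _ "h _"] N_def sum_negf
    flip: sum_divide_distrib sum_distrib_left)
 have p: "pd j (J k i) (shift w) + (\<Sum>c<d. \<Gamma> k j c w*J c i (shift w)) = (\<Sum>c<d. J k c (shift w)*\<Gamma> c j i w)" if "k<d" "i<d" "j<d" for k i j
  using base_parallel[OF HD(1)[OF w] HD(2)[OF w] that(3,2,1)] by (simp add: parallel_loc_def \<Gamma>_def Gs_def[abs_def] sum_subtractf mult.commute)
 show ?thesis by (rule idx_cases[OF ab(1)]; rule idx_cases[OF ab(2)]; rule idx_cases[OF ab(3)];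
   simp add: sum_Suc_Suc fderiv_u[OF w hh] fderiv_u[OF w hi] partial_deriv_const h_nz[OF w]
    power2_eq_square sum.distrib e1 e2 partial_deriv_shift_0 partial_deriv_shift_Suc[of _ "%s. f" for f] e p B)
qed

sublocale frame: moving_frame n S "{..<n}" coframe wf "%a b y. fmetric a b (\<Psi> y)" "%a b y. fmetric_inv a b (\<Psi> y)" g
proof
 show "eopen n S" "finite {..<n}" "card {..<n} = n" using S by auto
 show "Cinf_on n S (coframe a k)" if "a \<in> {..<n}" "k<n" for a k using that Cinf_coframe by simp
 show "Cinf_on n S (wf i a b)" if "i<n" "a \<in> {..<n}" "b \<in> {..<n}" for i a b using that Cinf_wf by simp
 show "Cinf_on n S (%y. fmetric a b (\<Psi> y))" if "a \<in> {..<n}" "b \<in> {..<n}" for a b using that Cinf_\<Psi> Cinf_fmetric by simp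
 show "\<forall>k<n. v k = 0" if y: "y \<in> S" and z: "!!a. a \<in> {..<n} ==> (\<Sum>k<n. coframe a k y * v k) = 0" for y v
 proof (rule ker[OF y])
  show "(\<Sum>i<n. pd i x y * v i) = 0" using z[of 0] by simp
  show "(\<Sum>i<n. \<theta> i y * v i) = 0" using z[of "Suc 0"] by simp
  show "(\<Sum>i<n. pd i (Y k) y * v i) = 0" if "k<d" for k using z[of "Suc (Suc k)"] that by simp
 qed
 show "fmetric a b (\<Psi> y) = fmetric b a (\<Psi> y)" if "a \<in> {..<n}" "b \<in> {..<n}" "y \<in> S" for a b y
 proof -
  have "a<n" "b<n" using that by auto
  then show ?thesis by (elim idx_cases) (simp_all add: Gs_sym HD(2)[OF \<Psi>_H[OF that(3)]])
 qed
 show "fmetric_inv a b (\<Psi> y) = fmetric_inv b a (\<Psi> y)" if "a \<in> {..<n}" "b \<in> {..<n}" "y \<in> S" for a b y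
 proof -
  have "a<n" "b<n" using that by auto
  then show ?thesis by (elim idx_cases) (simp_all add: Gi_sym[OF \<Psi>_H[OF that(3)]])
 qed
 show "(\<Sum>b<n. fmetric a b (\<Psi> y)*fmetric_inv b c (\<Psi> y)) = (if a = c then 1 else 0)" if "a \<in> {..<n}" "c \<in> {..<n}" "y \<in> S" for a c y
 proof -
  have "a<n" "c<n" using that by auto
  then show ?thesis by (elim idx_cases) (simp_all add: sum_Suc_Suc Gi_inv(1)[OF \<Psi>_H[OF that(3)]] h_nz[OF \<Psi>_H[OF that(3)]])
 qed
 show "g i j y = (\<Sum>a<n. coframe a i y*(\<Sum>b<n. fmetric a b (\<Psi> y)*coframe b j y))" if "i<n" "j<n" "y \<in> S" for i j y
  unfolding g[OF that] Yv_def[symmetric] Gs_def[symmetric] by (simp add: sum_Suc_Suc shift_\<Psi> sum_distrib_left mult_ac)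
 show "pd i (coframe a j) y + (\<Sum>b<n. wf i a b y*coframe b j y) = pd j (coframe a i) y + (\<Sum>b<n. wf j a b y*coframe b i y)"
  if "a \<in> {..<n}" "i<n" "j<n" "y \<in> S" for a i j y using wf_torsion that by simp
 show "pd i (%y. fmetric a b (\<Psi> y)) y = (\<Sum>c<n. wf i c a y*fmetric c b (\<Psi> y)) + (\<Sum>c<n. fmetric a c (\<Psi> y)*wf i c b y)"
  if "a \<in> {..<n}" "b \<in> {..<n}" "i<n" "y \<in> S" for a b i y
 proof -
  have "pd i (%y. fmetric a b (\<Psi> y)) y = (\<Sum>c<n. ((\<Sum>e<n. fconn c e a (\<Psi> y)*fmetric e b (\<Psi> y))
    + (\<Sum>e<n. fmetric a e (\<Psi> y)*fconn c e b (\<Psi> y)))*coframe c i y)"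
   using that conn_compat[OF \<Psi>_H[OF that(4)]] by (simp add: partial_\<Psi> Cinf_fmetric)
  also have "... = (\<Sum>c<n. \<Sum>e<n. fconn c e a (\<Psi> y)*coframe c i y*fmetric e b (\<Psi> y)) +
    (\<Sum>c<n. \<Sum>e<n. fmetric a e (\<Psi> y)*(fconn c e b (\<Psi> y)*coframe c i y))"
   by (simp add: distrib_right distrib_left sum.distrib sum_distrib_right sum_distrib_left mult_ac)
  also have "(\<Sum>c<n. \<Sum>e<n. fconn c e a (\<Psi> y)*coframe c i y*fmetric e b (\<Psi> y)) = (\<Sum>c<n. wf i c a y*fmetric c b (\<Psi> y))"
   unfolding wf_def sum_distrib_right by (rule sum.swap)
  also have "(\<Sum>c<n. \<Sum>e<n. fmetric a e (\<Psi> y)*(fconn c e b (\<Psi> y)*coframe c i y)) = (\<Sum>c<n. fmetric a c (\<Psi> y)*wf i c b y)"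
   unfolding wf_def sum_distrib_left by (rule sum.swap)
  finally show ?thesis .
 qed
qed

text \<open>\<open>fJ_parallel\<close> contracted with the coframe: coordinate derivatives of
  functions of (x, Y) become derivatives along the frame by \<open>partial_\<Psi>\<close>.\<close>

theorem total_parallel:
 assumes y: "y \<in> S" and ijk: "i<n" "j<n" "k<n"
 shows "parallel_loc n (christoffel_loc n g) Jt i k j y = 0"
proof (rule frame.frame_parallel[where F="%a b y. fJ a b (\<Psi> y)"])
 show "Cinf_on n S (Jt k j)" if "k<n" "j<n" for k j by (rule Jt[OF that])
 show "Cinf_on n S (%y. fJ a b (\<Psi> y))" if "a \<in> {..<n}" "b \<in> {..<n}" for a b using that Cinf_\<Psi> Cinf_fJ by simp
 show "(\<Sum>l<n. coframe a l y*Jt l j y) = (\<Sum>b<n. fJ a b (\<Psi> y)*coframe b j y)" if "a \<in> {..<n}" "j<n" "y \<in> S" for a j y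
 proof -
  have "a<n" using that by auto
  then show ?thesis using Jt_x[OF that(2,3)] Jt_\<theta>[OF that(2,3)] Jt_Y[OF that(2) _ that(3)]
   by (elim idx_cases) (simp_all add: sum_Suc_Suc[of _ d] shift_\<Psi> Yv_def[symmetric])
 qed
 show "pd i (%y. fJ a b (\<Psi> y)) y + (\<Sum>c<n. wf i a c y*fJ c b (\<Psi> y)) - (\<Sum>c<n. fJ a c (\<Psi> y)*wf i c b y) = 0" if ab: "a \<in> {..<n}" "b \<in> {..<n}" for a b
 proof -
  have "(\<Sum>c<n. wf i a c y*fJ c b (\<Psi> y)) = (\<Sum>c<n. \<Sum>e<n. fconn c a e (\<Psi> y)*coframe c i y*fJ e b (\<Psi> y))"
   unfolding wf_def sum_distrib_right by (rule sum.swap)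
  moreover have "(\<Sum>c<n. fJ a c (\<Psi> y)*wf i c b y) = (\<Sum>c<n. \<Sum>e<n. fJ a e (\<Psi> y)*(fconn c e b (\<Psi> y)*coframe c i y))"
   unfolding wf_def sum_distrib_left by (rule sum.swap)
  moreover have "pd i (%y. fJ a b (\<Psi> y)) y = (\<Sum>c<n. fderiv c (fJ a b) (\<Psi> y)*coframe c i y)" using ab ijk y by (simp add: partial_\<Psi> Cinf_fJ)
  ultimately have "pd i (%y. fJ a b (\<Psi> y)) y + (\<Sum>c<n. wf i a c y*fJ c b (\<Psi> y)) - (\<Sum>c<n. fJ a c (\<Psi> y)*wf i c b y)
   = (\<Sum>c<n. (fderiv c (fJ a b) (\<Psi> y) + (\<Sum>e<n. fconn c a e (\<Psi> y)*fJ e b (\<Psi> y)) - (\<Sum>e<n. fJ a e (\<Psi> y)*fconn c e b (\<Psi> y)))*coframe c i y)"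
   by (simp add: distrib_right left_diff_distrib distrib_left right_diff_distrib sum.distrib sum_subtractf sum_distrib_right sum_distrib_left mult_ac)
  then show ?thesis using fJ_parallel[OF \<Psi>_H[OF y]] ab by simp
 qed
qed (use y ijk in auto)

end

section \<open>Ricci and scalar curvature of the total space\<close>

context total_frame
begin

text \<open>\<open>frame_curv\<close> transported to the half space: all coefficients are functions
  of (x, Y), so the curvature can be computed there.\<close>

definition fcurv :: "nat => nat => nat => nat => rfun" where
 "fcurv e f a b w = fderiv e (fconn f a b) w - fderiv f (fconn e a b) w + (\<Sum>c<n. fconn c a b w * struct c e f w)
  + ((\<Sum>c<n. fconn e a c w*fconn f c b w) - (\<Sum>c<n. fconn f a c w*fconn e c b w))"

lemma scalar_fcurv:
 assumes y: "y \<in> S"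
 shows "scalar_loc n g y = (\<Sum>f<n. \<Sum>b<n. fmetric_inv f b (\<Psi> y)*(\<Sum>a<n. fcurv a f a b (\<Psi> y)))"
proof -
 have "scalar_loc n g y = (\<Sum>f<n. \<Sum>b<n. fmetric_inv f b (\<Psi> y) *
  (\<Sum>a<n. frame.frame_curv (%c a b y. fconn c a b (\<Psi> y)) (%e c a b y. fderiv e (fconn c a b) (\<Psi> y)) (%c e f y. struct c e f (\<Psi> y)) a f a b y))"
 proof (rule frame.frame_scalar)
  show "Cinf_on n S (%y. fconn c a b (\<Psi> y))" if "c \<in> {..<n}" "a \<in> {..<n}" "b \<in> {..<n}" for c a b using that Cinf_\<Psi> Cinf_conn by simp
  show "wf i a b y = (\<Sum>c<n. fconn c a b (\<Psi> y)*coframe c i y)" for i a b y by (rule wf_def)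
  show "pd i (%y. fconn c a b (\<Psi> y)) y = (\<Sum>e<n. fderiv e (fconn c a b) (\<Psi> y)*coframe e i y)"
   if "i<n" "a \<in> {..<n}" "b \<in> {..<n}" "c \<in> {..<n}" "y \<in> S" for i a b c y using that by (simp add: partial_\<Psi> Cinf_conn)
  show "pd i (coframe c j) y - pd j (coframe c i) y = (\<Sum>e<n. \<Sum>f<n. struct c e f (\<Psi> y)*(coframe e i y*coframe f j y))"
   if "c \<in> {..<n}" "i<n" "j<n" "y \<in> S" for c i j y using that by (simp add: partial_coframe)
 qed (rule y)
 then show ?thesis unfolding frame.frame_curv_def fcurv_def .
qed

definition trL where "trL w = (\<Sum>k<d. L k k w)"
definition trLL where "trLL w = (\<Sum>k<d. \<Sum>l<d. L k l w*L l k w)"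

lemma trL: "w \<in> H ==> trL w = t1 (w 0)" using base_trace[of "w 0" "shift w"] HD[of w] by (simp add: trL_def L_def Gi_def Gs_def)

text \<open>The trace of L' = - L^2.\<close>

lemma trLL: 
 assumes w: "w \<in> H"
 shows "trLL w = - deriv t1 (w 0)"
proof -
 have "pd 0 (%w. \<Sum>k<d. L k k w) w = pd 0 (%w. t1 (w 0)) w" by (rule partial_deriv_cong[OF H _ w]) (use trL in "auto simp: trL_def")
 moreover have "pd 0 (%w. t1 (w 0)) w = deriv t1 (w 0)"
  unfolding partial_deriv_def deriv_def using DERIV_shift[of t1 _ 0 "w 0"] by (simp add: add.commute)
 moreover have "pd 0 (%w. \<Sum>k<d. L k k w) w = - trLL w"
  by (subst partial_deriv_sum[OF H zero_less_Suc w]) (auto simp: Cinf_L partial_0_L[OF w] trLL_def sum_negf)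
 ultimately show ?thesis by simp
qed

text \<open>N^2 = (L J)(J L) = - L^2.\<close>

lemma trNN:
 assumes w: "w \<in> H"
 shows "(\<Sum>k<d. \<Sum>l<d. N k l w*N l k w) = - trLL w"
proof -
 have "(\<Sum>k<d. \<Sum>l<d. N k l w*N l k w) = (\<Sum>k<d. \<Sum>l<d. N k l w*(\<Sum>r<d. J l r (shift w)*L r k w))" using w by (intro sum.cong) (auto simp: LJ_comm)
 also have "... = (\<Sum>k<d. \<Sum>r<d. (\<Sum>l<d. N k l w*J l r (shift w))*L r k w)" by (simp add: sum_mult_assoc)
 also have "... = (\<Sum>k<d. \<Sum>r<d. - L k r w*L r k w)" using w by (intro sum.cong) (auto simp: NJ)
 finally show ?thesis by (simp add: trLL_def sum_negf)
qed

context
 fixes w :: "nat => real" and h0 h1 h2 :: real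
 assumes w: "w \<in> H" and hs: "h0 = h (w 0)" "h1 = deriv h (w 0)" "h2 = deriv (deriv h) (w 0)"
begin

lemma hD: "(h has_real_derivative h1) (at (w 0))" "(deriv h has_real_derivative h2) (at (w 0))" "h0 ~= 0"
 using h' HD[OF w] h_nz[OF w] by (auto simp: hs)

lemma qD: "((%s. deriv h s/(2*h s)) has_real_derivative h2/(2*h0) - h1\<^sup>2/(2*h0\<^sup>2)) (at (w 0))"
 "((%s. - (h s * deriv h s/2)) has_real_derivative - (h1\<^sup>2 + h0*h2)/2) (at (w 0))"
proof -
 show "((%s. deriv h s/(2*h s)) has_real_derivative h2/(2*h0) - h1\<^sup>2/(2*h0\<^sup>2)) (at (w 0))" using hD h_nz[OF w]
  by (auto intro!: derivative_eq_intros simp: hs power2_eq_square field_simps)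
 show "((%s. - (h s * deriv h s/2)) has_real_derivative - (h1\<^sup>2 + h0*h2)/2) (at (w 0))"
  using hD by (auto intro!: derivative_eq_intros simp: hs power2_eq_square algebra_simps)
qed

lemma partial_0_half_L: "k<d ==> i<d ==> pd 0 (%w. L k i w/2) w = - (\<Sum>l<d. L k l w*L l i w)/2"
 using partial_deriv_cmult[OF H zero_less_Suc w Cinf_L, of k i "1/2"] partial_0_L[OF w, of k i] by simp

text \<open>Contributions of the fibre (\<open>a1\<close>) and of the base (\<open>ak\<close>). The
  frame is not orthonormal: its first two vectors have squared lengths 1/h and h, so in the scalar
  curvature this entry is weighted by h and the next one by 1/h.\<close>

lemma ricci_00: "(\<Sum>a<n. fcurv a 0 a 0 w) = - h2/(2*h0) - h1/(4*h0)*trL w + trLL w/4"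
proof -
 have a0: "fcurv 0 0 0 0 w = 0" by (simp add: fcurv_def)
 have a1: "fcurv (Suc 0) 0 (Suc 0) 0 w = - (h2/(2*h0))"
  using hD by (simp add: fcurv_def sum_Suc_Suc fderiv_u[OF w qD(1)] hs[symmetric] field_simps power2_eq_square)
 have ak: "fcurv (Suc (Suc k)) 0 (Suc (Suc k)) 0 w = (\<Sum>l<d. L k l w*L l k w)/4 - h1/(4*h0)*L k k w" if "k<d" for k using hD that
  by (simp add: fcurv_def sum_Suc_Suc partial_0_half_L hs[symmetric] partial_deriv_const mult.assoc flip: sum_divide_distrib)
 show ?thesis by (simp add: sum_Suc_Suc a0 a1 ak sum_subtractf trL_def trLL_def flip: sum_divide_distrib sum_distrib_left)
qed

lemma ricci_11: "(\<Sum>a<n. fcurv a (Suc 0) a (Suc 0) w) = - (h0*h2)/2 - h0*h1/4*trL w + h0\<^sup>2/4*trLL w"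
proof -
 have a0: "fcurv 0 (Suc 0) 0 (Suc 0) w = - (h0*h2)/2"
  using hD by (simp add: fcurv_def sum_Suc_Suc fderiv_u[OF w qD(2)] hs[symmetric] field_simps power2_eq_square)
 have a1: "fcurv (Suc 0) (Suc 0) (Suc 0) (Suc 0) w = 0" by (simp add: fcurv_def)
 have ak: "fcurv (Suc (Suc k)) (Suc 0) (Suc (Suc k)) (Suc 0) w = - (h0\<^sup>2/4*(\<Sum>l<d. N k l w*N l k w)) - h0*h1/4*L k k w" if "k<d" for k
  using hD that by (simp add: fcurv_def sum_Suc_Suc hs[symmetric] partial_deriv_const sum_distrib_left power2_eq_square mult_ac sum_negf)
 show ?thesis using trNN[OF w] by (simp add: sum_Suc_Suc a0 a1 ak sum_subtractf sum_negf trL_def flip: sum_divide_distrib sum_distrib_left)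
qed

text \<open>The Ricci tensor of the base at frozen x, corrected by the change of the base metric in
  x (terms with \<open>L\<close> and \<open>B1\<close>) and by the curvature of the connection form
  (terms with \<open>N\<close> and \<open>F\<close>).\<close>

lemma ricci_base:
 assumes ji: "j<d" "i<d"
 shows "(\<Sum>a<n. fcurv a (Suc (Suc j)) a (Suc (Suc i)) w) = ricci_loc d (christoffel_loc d (Gs (w 0))) j i (shift w)
  - h1/2*B1 i j (shift w) + h0/4*(\<Sum>k<d. B1 k j (shift w)*L k i w) + h0/4*(\<Sum>k<d. F j k w*N k i w) + h0/2*(\<Sum>k<d. N k i w*F k j w)
  - h0/4*trL w*B1 i j (shift w) - h0/4*(\<Sum>k<d. N k k w)*F j i w
  + h0/4*(\<Sum>k<d. L k j w*B1 i k (shift w)) + h0/4*(\<Sum>k<d. N k j w*F k i w)"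
proof -
 have hB: "pd 0 (%w. - (h (w 0)*B1 i j (shift w)/2)) w = - h1*B1 i j (shift w)/2"
 proof (rule partial_derivI)
  have "((%t. h (w 0 + t)) has_real_derivative h1) (at 0)" using hD(1) DERIV_shift[of h h1 0 "w 0"] by (simp add: add.commute)
  then show "((%t. - (h ((w(0 := w 0 + t)) 0)*B1 i j (shift (w(0 := w 0 + t)))/2)) has_real_derivative - h1*B1 i j (shift w)/2) (at 0)"
   unfolding shift_upd by (auto intro!: derivative_eq_intros)
 qed
 have \<Gamma>d: "pd (Suc m) (\<Gamma> a b c) w = pd m (christoffel_loc d (Gs (w 0)) a b c) (shift w)" for m a b c
  unfolding \<Gamma>_def[abs_def] by (rule partial_deriv_shift_Suc[of m "%s. christoffel_loc d (Gs s) a b c"])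
 have a0: "fcurv 0 (Suc (Suc j)) 0 (Suc (Suc i)) w = - h1/4*B1 i j (shift w) + h0/4*(\<Sum>k<d. B1 k j (shift w)*L k i w)"
  using hD(3) by (simp add: fcurv_def sum_Suc_Suc hB hs[symmetric] partial_deriv_const sum_distrib_left mult_ac sum_negf)
 have a1: "fcurv (Suc 0) (Suc (Suc j)) (Suc 0) (Suc (Suc i)) w = - h1/4*B1 i j (shift w) + h0/4*(\<Sum>k<d. F j k w*N k i w)"
  using hD(3) by (simp add: fcurv_def sum_Suc_Suc hs[symmetric] partial_deriv_const sum_distrib_left mult_ac sum_negf)
 have ak: "fcurv (Suc (Suc k)) (Suc (Suc j)) (Suc (Suc k)) (Suc (Suc i)) w =
  riemann_loc d (christoffel_loc d (Gs (w 0))) k j k i (shift w) + h0/2*(N k i w*F k j w)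
  - h0/4*L k k w*B1 i j (shift w) - h0/4*N k k w*F j i w + h0/4*(L k j w*B1 i k (shift w))
  + h0/4*(N k j w*F k i w)" if "k<d" for k
  using that by (simp add: fcurv_def sum_Suc_Suc hs[symmetric] \<Gamma>d riemann_loc_def \<Gamma>_def sum_subtractf algebra_simps)
 show ?thesis by (simp add: sum_Suc_Suc a0 a1 ak sum.distrib sum_subtractf ricci_loc_def trL_def
    sum_distrib_left sum_distrib_right sum_divide_distrib mult_ac)
qed

text \<open>Traces of the terms of \<open>ricci_base\<close>. Contraction with the inverse metric
  turns \<open>B1\<close> into \<open>L\<close> and \<open>F\<close> into \<open>N\<close>, so
  everything reduces to tr L and tr L^2, with signs from tr N^2 = - tr L^2 and from the antisymmetry
  of \<open>F\<close>.\<close>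

lemma contractions: "(\<Sum>j<d. \<Sum>i<d. Gi j i w*B1 i j (shift w)) = trL w" "(\<Sum>j<d. \<Sum>i<d. Gi j i w*(\<Sum>k<d. B1 k j (shift w)*L k i w)) = trLL w"
 "(\<Sum>j<d. \<Sum>i<d. Gi j i w*(\<Sum>k<d. F j k w*N k i w)) = trLL w" "(\<Sum>j<d. \<Sum>i<d. Gi j i w*(\<Sum>k<d. N k i w*F k j w)) = - trLL w"
 "(\<Sum>j<d. \<Sum>i<d. Gi j i w*F j i w) = 0" "(\<Sum>j<d. \<Sum>i<d. Gi j i w*(\<Sum>k<d. L k j w*B1 i k (shift w))) = trLL w"
 "(\<Sum>j<d. \<Sum>i<d. Gi j i w*(\<Sum>k<d. N k j w*F k i w)) = - trLL w"
proof -
 have B: "B1 k i (shift w) = B1 i k (shift w)" if "k<d" "i<d" for k i using B1_sym[OF that HD(2)[OF w]] .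
 show "(\<Sum>j<d. \<Sum>i<d. Gi j i w*B1 i j (shift w)) = trL w" by (simp add: trL_def L_def)
 show "(\<Sum>j<d. \<Sum>i<d. Gi j i w*F j i w) = 0"
 proof -
  have "(\<Sum>j<d. \<Sum>i<d. Gi j i w*F j i w) = (\<Sum>j<d. \<Sum>i<d. Gi i j w*F i j w)" by (rule sum.swap)
  also have "... = (\<Sum>j<d. \<Sum>i<d. - (Gi j i w*F j i w))"
  proof (intro sum.cong refl)
   fix j i assume "j \<in> {..<d}" "i \<in> {..<d}"
   then show "Gi i j w*F i j w = - (Gi j i w*F j i w)" using F_antisym[OF w, of i j] Gi_sym[OF w, of i j] by simp
  qed
  finally show ?thesis by (simp add: sum_negf)
 qed
 show "(\<Sum>j<d. \<Sum>i<d. Gi j i w*(\<Sum>k<d. L k j w*B1 i k (shift w))) = trLL w"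
 proof -
  have "(\<Sum>j<d. \<Sum>i<d. Gi j i w*(\<Sum>k<d. L k j w*B1 i k (shift w))) =
    (\<Sum>j<d. \<Sum>i<d. \<Sum>k<d. L k j w*(Gi j i w*B1 i k (shift w)))" by (simp add: sum_distrib_left mult_ac)
  also have "... = (\<Sum>j<d. \<Sum>k<d. \<Sum>i<d. L k j w*(Gi j i w*B1 i k (shift w)))" by (intro sum.cong refl sum.swap)
  also have "... = (\<Sum>j<d. \<Sum>k<d. L k j w*L j k w)" by (simp only: sum_distrib_left[symmetric] L_def[symmetric])
  finally show ?thesis by (simp add: trLL_def mult.commute)
 qed
 show *: "(\<Sum>j<d. \<Sum>i<d. Gi j i w*(\<Sum>k<d. B1 k j (shift w)*L k i w)) = trLL w"
 proof -
  have "(\<Sum>j<d. \<Sum>i<d. Gi j i w*(\<Sum>k<d. B1 k j (shift w)*L k i w)) = (\<Sum>i<d. \<Sum>j<d. Gi j i w*(\<Sum>k<d. B1 k j (shift w)*L k i w))" by (rule sum.swap)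
  also have "... = (\<Sum>i<d. \<Sum>j<d. Gi i j w*(\<Sum>k<d. L k i w*B1 j k (shift w)))"
  proof (intro sum.cong refl)
   fix i j assume ij: "i \<in> {..<d}" "j \<in> {..<d}"
   then have "(\<Sum>k<d. B1 k j (shift w)*L k i w) = (\<Sum>k<d. L k i w*B1 j k (shift w))" by (intro sum.cong) (auto simp: B[of _ j])
   then show "Gi j i w*(\<Sum>k<d. B1 k j (shift w)*L k i w) = Gi i j w*(\<Sum>k<d. L k i w*B1 j k (shift w))" using Gi_sym[OF w, of j i] ij by simp
  qed
  finally have "(\<Sum>j<d. \<Sum>i<d. Gi j i w*(\<Sum>k<d. B1 k j (shift w)*L k i w)) = (\<Sum>i<d. \<Sum>j<d. Gi i j w*(\<Sum>k<d. L k i w*B1 j k (shift w)))" .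
  then show ?thesis using `(\<Sum>j<d. \<Sum>i<d. Gi j i w*(\<Sum>k<d. L k j w*B1 i k (shift w))) = trLL w` by simp
 qed
 show N2: "(\<Sum>j<d. \<Sum>i<d. Gi j i w*(\<Sum>k<d. N k j w*F k i w)) = - trLL w"
 proof -
  have "(\<Sum>j<d. \<Sum>i<d. Gi j i w*(\<Sum>k<d. N k j w*F k i w)) =
    (\<Sum>j<d. \<Sum>i<d. \<Sum>k<d. N k j w*(Gi j i w*F k i w))" by (simp add: sum_distrib_left mult_ac)
  also have "... = (\<Sum>j<d. \<Sum>k<d. \<Sum>i<d. N k j w*(Gi j i w*F k i w))" by (intro sum.cong refl sum.swap)
  also have "... = (\<Sum>j<d. \<Sum>k<d. N k j w*N j k w)" using w by (simp add: GiF flip: sum_distrib_left)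
  finally show ?thesis using trNN[OF w] by (simp add: mult.commute)
 qed
 show N1: "(\<Sum>j<d. \<Sum>i<d. Gi j i w*(\<Sum>k<d. N k i w*F k j w)) = - trLL w"
 proof -
  have "(\<Sum>j<d. \<Sum>i<d. Gi j i w*(\<Sum>k<d. N k i w*F k j w)) = (\<Sum>i<d. \<Sum>j<d. Gi j i w*(\<Sum>k<d. N k i w*F k j w))" by (rule sum.swap)
  also have "... = (\<Sum>i<d. \<Sum>j<d. Gi i j w*(\<Sum>k<d. N k i w*F k j w))" using Gi_sym[OF w] by (intro sum.cong refl) auto
  finally have "(\<Sum>j<d. \<Sum>i<d. Gi j i w*(\<Sum>k<d. N k i w*F k j w)) = (\<Sum>i<d. \<Sum>j<d. Gi i j w*(\<Sum>k<d. N k i w*F k j w))" .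
  then show ?thesis using N2 by simp
 qed
 show "(\<Sum>j<d. \<Sum>i<d. Gi j i w*(\<Sum>k<d. F j k w*N k i w)) = trLL w"
 proof -
  have "(\<Sum>j<d. \<Sum>i<d. Gi j i w*(\<Sum>k<d. F j k w*N k i w)) = (\<Sum>j<d. \<Sum>i<d. Gi j i w*- (\<Sum>k<d. N k i w*F k j w))"
  proof (intro sum.cong refl arg_cong2[of _ _ _ _ "(*)"])
   fix j i assume j: "j \<in> {..<d}"
   show "(\<Sum>k<d. F j k w*N k i w) = - (\<Sum>k<d. N k i w*F k j w)" unfolding sum_negf[symmetric]
   proof (intro sum.cong refl)
    fix k assume "k \<in> {..<d}"
    then show "F j k w*N k i w = - (N k i w*F k j w)" using F_antisym[OF w, of j k] j by simp
   qed
  qed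
  then show ?thesis using N1 by (simp add: sum_negf)
 qed
qed

text \<open>The two terms with tr L^2 from the directions dual to dx and \<theta> give h/2 tr L^2.
  Those of the base cancel: they have the coefficients 1/4, 1/4, -1/2, 1/4, -1/4 times h.\<close>

lemma fcurv_scalar: "(\<Sum>f<n. \<Sum>b<n. fmetric_inv f b w*(\<Sum>a<n. fcurv a f a b w)) = SB (w 0) - h2 - h1*trL w - h0*((trL w)\<^sup>2/4 - trLL w/2)"
proof -
 let ?R = "%f b. \<Sum>a<n. fcurv a f a b w"
 have "(\<Sum>f<n. \<Sum>b<n. fmetric_inv f b w*R f b) =
   h0*R 0 0 + 1/h0*R (Suc 0) (Suc 0) + (\<Sum>j<d. \<Sum>i<d. Gi j i w*R (Suc (Suc j)) (Suc (Suc i)))" for R unfolding hs by (simp add: sum_Suc_Suc)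
 then have "(\<Sum>f<n. \<Sum>b<n. fmetric_inv f b w*?R f b) =
   h0*?R 0 0 + 1/h0*?R (Suc 0) (Suc 0) + (\<Sum>j<d. \<Sum>i<d. Gi j i w*?R (Suc (Suc j)) (Suc (Suc i)))" .
 also have "(\<Sum>j<d. \<Sum>i<d. Gi j i w*?R (Suc (Suc j)) (Suc (Suc i))) = SB (w 0) - h1/2*trL w - h0/4*(trL w)\<^sup>2"
 proof -
  have s: "(\<Sum>j<d. \<Sum>i<d. Gi j i w*ricci_loc d (christoffel_loc d (Gs (w 0))) j i (shift w)) = SB (w 0)"
   using base_scalar[OF HD[OF w]] by (simp add: scalar_loc_def Gi_def Gs_def[abs_def])
  have c: "(\<Sum>j<d. \<Sum>i<d. Gi j i w*(c*f j i)) = c*(\<Sum>j<d. \<Sum>i<d. Gi j i w*f j i)" for c f by (simp add: sum_distrib_left mult_ac)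
  have "(\<Sum>j<d. \<Sum>i<d. Gi j i w*?R (Suc (Suc j)) (Suc (Suc i))) = (\<Sum>j<d. \<Sum>i<d. Gi j i w*ricci_loc d (christoffel_loc d (Gs (w 0))) j i (shift w))
   - (\<Sum>j<d. \<Sum>i<d. Gi j i w*(h1/2*B1 i j (shift w))) + (\<Sum>j<d. \<Sum>i<d. Gi j i w*(h0/4*(\<Sum>k<d. B1 k j (shift w)*L k i w)))
   + (\<Sum>j<d. \<Sum>i<d. Gi j i w*(h0/4*(\<Sum>k<d. F j k w*N k i w))) + (\<Sum>j<d. \<Sum>i<d. Gi j i w*(h0/2*(\<Sum>k<d. N k i w*F k j w)))
   - (\<Sum>j<d. \<Sum>i<d. Gi j i w*(h0/4*trL w*B1 i j (shift w))) - (\<Sum>j<d. \<Sum>i<d. Gi j i w*(h0/4*(\<Sum>k<d. N k k w)*F j i w))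
   + (\<Sum>j<d. \<Sum>i<d. Gi j i w*(h0/4*(\<Sum>k<d. L k j w*B1 i k (shift w)))) + (\<Sum>j<d. \<Sum>i<d. Gi j i w*(h0/4*(\<Sum>k<d. N k j w*F k i w)))"
   unfolding sum.distrib[symmetric] sum_subtractf[symmetric] distrib_left[symmetric] right_diff_distrib[symmetric]
   by (intro sum.cong refl arg_cong2[of _ _ _ _ "(*)"]) (simp add: ricci_base)
  also have "... = SB (w 0) - h1/2*trL w - h0/4*(trL w)\<^sup>2" unfolding s c contractions by (simp add: power2_eq_square)
  finally show ?thesis .
 qed
 also have "h0*?R 0 0 + 1/h0*?R (Suc 0) (Suc 0) + (SB (w 0) - h1/2*trL w - h0/4*(trL w)\<^sup>2) =
   SB (w 0) - h2 - h1*trL w - h0*((trL w)\<^sup>2/4 - trLL w/2)" unfolding ricci_00 ricci_11 using hD(3) by (simp add: field_simps power2_eq_square)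
 finally show ?thesis .
qed

end

text \<open>If P'/P = t1/2, then P''/P = t1'/2 + t1^2/4 and the terms in h add up to (h P)''/P. This
  is the origin of the linear equation for h P.\<close>

theorem total_scalar:
 assumes y: "y \<in> S"
 shows "scalar_loc n g y = SB (x y) - deriv (deriv h) (x y) - deriv h (x y)*t1 (x y) - h (x y)*((t1 (x y))\<^sup>2/4 + deriv t1 (x y)/2)"
 using scalar_fcurv[OF y] fcurv_scalar[OF \<Psi>_H[OF y] refl refl refl] trL[OF \<Psi>_H[OF y]] trLL[OF \<Psi>_H[OF y]] by (simp add: shift_\<Psi>)

end

declare sum.lessThan_Suc [simp]

section \<open>Charts and tangent vectors\<close>

locale smooth_mfd =
 fixes X :: "'a mfd"
 assumes manifold: "manifold X"
begin

abbreviation "dm \<equiv> mdim X"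

definition cimg :: "'a chart => (nat => real) set" where "cimg c = snd c ` fst c"

context
 fixes c assumes c: "c \<in> atlas X"
begin

lemma chart_props: "openin (mtop X) (fst c)" "eopen dm (cimg c)"
 "homeomorphic_map (subtopology (mtop X) (fst c)) (subtopology (Euclidean_space dm) (cimg c)) (snd c)"
 "!!k. k<dm ==> smooth_fun X (fst c) (%p. snd c p k)"
proof -
 obtain U \<phi> where e: "c = (U, \<phi>)" by (cases c)
 have "\<forall>(U, \<phi>)\<in>atlas X. openin (mtop X) U & eopen dm (\<phi> ` U) &
    homeomorphic_map (subtopology (mtop X) U) (subtopology (Euclidean_space dm) (\<phi> ` U)) \<phi> & (\<forall>i<dm. smooth_fun X U (%p. \<phi> p i))"
  using manifold unfolding manifold_def by (elim conjE)
 then have "openin (mtop X) U & eopen dm (\<phi> ` U) & homeomorphic_map (subtopology (mtop X) U) (subtopology (Euclidean_space dm) (\<phi> ` U)) \<phi> &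
    (\<forall>i<dm. smooth_fun X U (%p. \<phi> p i))" using c e by (auto dest!: bspec)
 then show "openin (mtop X) (fst c)" "eopen dm (cimg c)"
  "homeomorphic_map (subtopology (mtop X) (fst c)) (subtopology (Euclidean_space dm) (cimg c)) (snd c)"
  "!!k. k<dm ==> smooth_fun X (fst c) (%p. snd c p k)" by (simp_all add: e cimg_def)
qed

lemma chart_pts: "fst c \<subseteq> pts X" using chart_props(1) by (rule openin_subset)

lemma chart_inj: "inj_on (snd c) (fst c)" using homeomorphic_imp_injective_map[OF chart_props(3)] chart_pts by (simp add: Int_absorb1)

lemma chart_inv_left: "p \<in> fst c ==> chart_inv c (snd c p) = p" unfolding chart_inv_def by (rule inv_into_f_f[OF chart_inj])

lemma chart_inv_right: "y \<in> cimg c ==> snd c (chart_inv c y) = y" "y \<in> cimg c ==> chart_inv c y \<in> fst c"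
 unfolding chart_inv_def cimg_def by (auto intro: f_inv_into_f inv_into_into)

lemma chart_in: "p \<in> fst c ==> snd c p \<in> cimg c" by (simp add: cimg_def)

lemma chart_open_image:
 assumes "openin (mtop X) V" "V \<subseteq> fst c"
 shows "eopen dm (snd c ` V)"
proof -
 have "openin (subtopology (mtop X) (fst c)) V" using assms by (simp add: openin_subset_topspace_eq openin_open_subtopology chart_props(1))
 then have "openin (subtopology (Euclidean_space dm) (cimg c)) (snd c ` V)"
  using homeomorphic_imp_open_map[OF chart_props(3)] unfolding open_map_def by blast
 then show ?thesis using openin_trans_full chart_props(2) by blast
qed

lemma chart_open_preimage:
 assumes "eopen dm T"
 shows "openin (mtop X) {p \<in> fst c. snd c p \<in> T}"
proof -
 have "continuous_map (subtopology (mtop X) (fst c)) (subtopology (Euclidean_space dm) (cimg c)) (snd c)"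
  by (rule homeomorphic_imp_continuous_map[OF chart_props(3)])
 then have "continuous_map (subtopology (mtop X) (fst c)) (Euclidean_space dm) (snd c)" by (rule continuous_map_into_fulltopology)
 then have "openin (subtopology (mtop X) (fst c)) {p \<in> topspace (subtopology (mtop X) (fst c)). snd c p \<in> T}"
  using assms by (rule openin_continuous_map_preimage)
 then have "openin (mtop X) {p \<in> topspace (subtopology (mtop X) (fst c)). snd c p \<in> T}" using openin_trans_full chart_props(1) by blast
 then show ?thesis using chart_pts by (simp add: Int_absorb1)
qed

lemma mem_chart_image: "V \<subseteq> fst c ==> y \<in> snd c ` V \<longleftrightarrow> y \<in> cimg c & chart_inv c y \<in> V" using chart_inv_left chart_inv_right by (auto simp: cimg_def)

end

lemma ex_chart: "p \<in> pts X ==> \<exists>c\<in>atlas X. p \<in> fst c" using manifold unfolding manifold_def by blast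

lemma smooth_fun_D: "smooth_fun X W f ==> c \<in> atlas X ==> Cinf_on dm (snd c ` (W \<inter> fst c)) (%y. f (chart_inv c y))" by (simp add: smooth_fun_def)

text \<open>One chart suffices: \<open>manifold\<close> requires the coordinates of \<open>c\<close>
  to be smooth functions, which is smoothness of the transition maps from every other chart into
  \<open>c\<close>.\<close>

lemma smooth_fun_chart_I:
 assumes c: "c \<in> atlas X" and W: "openin (mtop X) W" "W \<subseteq> fst c"
  and f: "Cinf_on dm (snd c ` W) (%y. f (chart_inv c y))"
 shows "smooth_fun X W f" unfolding smooth_fun_def
proof
 fix e assume e: "e \<in> atlas X"
 have We: "W \<inter> fst e \<subseteq> fst e" "openin (mtop X) (W \<inter> fst e)" using W chart_props(1)[OF e] by auto
 have o: "eopen dm (snd e ` (W \<inter> fst e))" by (rule chart_open_image[OF e We(2,1)])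
 have "Cinf_on dm (snd e ` (W \<inter> fst e)) (%y. f (chart_inv c (snd c (chart_inv e y))))"
 proof (rule Cinf_on_compose[OF o chart_open_image[OF c W] _ _ f])
  show "snd c (chart_inv e y) \<in> snd c ` W" if "y \<in> snd e ` (W \<inter> fst e)" for y using that mem_chart_image[OF e We(1)] by auto
  show "Cinf_on dm (snd e ` (W \<inter> fst e)) (%y. snd c (chart_inv e y) j)" if "j<dm" for j
   by (rule Cinf_on_subset[OF _ smooth_fun_D[OF chart_props(4)[OF c that] e]]) (use W in auto)
 qed
 then show "Cinf_on dm (snd e ` (W \<inter> fst e)) (%y. f (chart_inv e y))"
 proof (rule Cinf_on_cong[OF o, rotated])
  fix y assume "y \<in> snd e ` (W \<inter> fst e)"
  then have "chart_inv e y \<in> fst c" using mem_chart_image[OF e We(1)] W by auto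
  then show "f (chart_inv c (snd c (chart_inv e y))) = f (chart_inv e y)" by (simp add: chart_inv_left[OF c])
 qed
qed

lemma smooth_fun_subset: "W' \<subseteq> W ==> smooth_fun X W f ==> smooth_fun X W' f" unfolding smooth_fun_def by (auto elim!: ballE Cinf_on_subset[rotated])

lemma smooth_fun_cong:
 assumes W: "openin (mtop X) W" and fg: "!!p. p \<in> W ==> f p = g p" and f: "smooth_fun X W f"
 shows "smooth_fun X W g" unfolding smooth_fun_def
proof
 fix c assume c: "c \<in> atlas X"
 have o: "eopen dm (snd c ` (W \<inter> fst c))" using W chart_props(1)[OF c] by (intro chart_open_image[OF c]) auto
 show "Cinf_on dm (snd c ` (W \<inter> fst c)) (%y. g (chart_inv c y))"
  by (rule Cinf_on_cong[OF o _ smooth_fun_D[OF f c]]) (auto simp: mem_chart_image[OF c] fg chart_inv_left[OF c])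
qed

lemma smooth_at_I: "openin (mtop X) W ==> p \<in> W ==> smooth_fun X W f ==> smooth_at X p f" unfolding smooth_at_def by blast

lemma smooth_at_chart_I:
 assumes c: "c \<in> atlas X" and p: "p \<in> fst c" and T: "eopen dm T" "snd c p \<in> T"
  and f: "Cinf_on dm (T \<inter> cimg c) (%y. f (chart_inv c y))"
 shows "smooth_at X p f"
proof (rule smooth_at_I)
 show "openin (mtop X) {p \<in> fst c. snd c p \<in> T}" by (rule chart_open_preimage[OF c T(1)])
 show "p \<in> {p \<in> fst c. snd c p \<in> T}" using p T by simp
 show "smooth_fun X {p \<in> fst c. snd c p \<in> T} f" by (rule smooth_fun_chart_I[OF c chart_open_preimage[OF c T(1)]])
   (auto intro: Cinf_on_subset[OF _ f] simp: cimg_def)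
qed

lemma smooth_at_chart_D:
 assumes c: "c \<in> atlas X" and p: "p \<in> fst c" and f: "smooth_at X p f"
 obtains T where "eopen dm T" "snd c p \<in> T" "T \<subseteq> cimg c" "Cinf_on dm T (%y. f (chart_inv c y))"
proof -
 obtain W where W: "openin (mtop X) W" "p \<in> W" "smooth_fun X W f" using f smooth_at_def by metis
 show ?thesis
 proof (rule that[of "snd c ` (W \<inter> fst c)"])
  show "eopen dm (snd c ` (W \<inter> fst c))" using W chart_props(1)[OF c] by (intro chart_open_image[OF c]) auto
 qed (use W p smooth_fun_D[OF W(3) c] in "auto simp: cimg_def")
qed

lemma smooth_at_cong:
 assumes "openin (mtop X) W" "p \<in> W" "!!q. q \<in> W ==> f q = g q" "smooth_at X p f"
 shows "smooth_at X p g"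
proof -
 obtain V where V: "openin (mtop X) V" "p \<in> V" "smooth_fun X V f" using assms(4) smooth_at_def by metis
 have "smooth_fun X (V \<inter> W) g" by (rule smooth_fun_cong[OF _ _ smooth_fun_subset[OF _ V(3)]]) (use V assms in auto)
 then show ?thesis using V assms by (intro smooth_at_I[of "V \<inter> W"]) auto
qed

lemma smooth_at_pts: "smooth_at X p f ==> p \<in> pts X" unfolding smooth_at_def using openin_subset by blast

lemma smooth_at_combine:
 assumes p: "p \<in> pts X" and f: "smooth_at X p f" and g: "smooth_at X p g"
 shows "smooth_at X p (%q. f q + g q)" "smooth_at X p (%q. f q*g q)"
proof -
 obtain c where c: "c \<in> atlas X" "p \<in> fst c" using ex_chart[OF p] by blast
 obtain T where T: "eopen dm T" "snd c p \<in> T" "T \<subseteq> cimg c" "Cinf_on dm T (%y. f (chart_inv c y))" by (rule smooth_at_chart_D[OF c f])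
 obtain T' where T': "eopen dm T'" "snd c p \<in> T'" "T' \<subseteq> cimg c" "Cinf_on dm T' (%y. g (chart_inv c y))" by (rule smooth_at_chart_D[OF c g])
 have o: "eopen dm (T \<inter> T')" using T T' by auto
 have fg: "Cinf_on dm (T \<inter> T' \<inter> cimg c) (%y. f (chart_inv c y))" "Cinf_on dm (T \<inter> T' \<inter> cimg c) (%y. g (chart_inv c y))"
  by (rule Cinf_on_subset[OF _ T(4)] Cinf_on_subset[OF _ T'(4)], auto)+
 have o': "eopen dm (T \<inter> T' \<inter> cimg c)" using o chart_props(2)[OF c(1)] by auto
 show "smooth_at X p (%q. f q + g q)" "smooth_at X p (%q. f q*g q)" using T(2) T'(2) fg
  by (auto intro!: smooth_at_chart_I[OF c o] Cinf_on_add[OF o'] Cinf_on_mult[OF o'])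
qed

lemma smooth_at_const: "p \<in> pts X ==> smooth_at X p (%q. r)"
proof -
 assume "p \<in> pts X"
 then obtain c where c: "c \<in> atlas X" "p \<in> fst c" using ex_chart by blast
 have "eopen dm (cimg c \<inter> cimg c)" using chart_props(2)[OF c(1)] by simp
 then show ?thesis by (intro smooth_at_chart_I[OF c chart_props(2)[OF c(1)] chart_in[OF c]]) (rule Cinf_on_const)
qed

lemma smooth_at_sum: "p \<in> pts X ==> (!!i. i \<in> I ==> smooth_at X p (f i)) ==> smooth_at X p (%q. \<Sum>i\<in>I. f i q)"
 by (induction I rule: infinite_finite_induct) (simp_all add: smooth_at_const smooth_at_combine)

lemma smooth_at_coord: "c \<in> atlas X ==> p \<in> fst c ==> k<dm ==> smooth_at X p (%q. snd c q k)"
 using smooth_at_I[OF chart_props(1) _ chart_props(4)] .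

lemma smooth_at_chart_fun:
 assumes c: "c \<in> atlas X" "p \<in> fst c" and T: "eopen dm T" "snd c p \<in> T" and g: "Cinf_on dm T g"
 shows "smooth_at X p (%q. g (snd c q))"
proof (rule smooth_at_chart_I[OF c T])
 have o: "eopen dm (T \<inter> cimg c)" using T chart_props(2)[OF c(1)] by auto
 show "Cinf_on dm (T \<inter> cimg c) (%y. g (snd c (chart_inv c y)))"
  by (rule Cinf_on_cong[OF o _ Cinf_on_subset[OF _ g]]) (auto simp: chart_inv_right[OF c(1)])
qed

context
 fixes p v assumes v: "v \<in> tangent X p"
begin

lemma tangent_add: "smooth_at X p f ==> smooth_at X p g ==> v (%q. f q + g q) = v f + v g"
 and tangent_mult: "smooth_at X p f ==> smooth_at X p g ==> v (%q. f q*g q) = v f*g p + f p * v g"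
 and tangent_scale: "smooth_at X p f ==> v (%q. r*f q) = r * v f"
 and tangent_nonsmooth: "\<not> smooth_at X p f ==> v f = 0" using v unfolding tangent_def by auto

text \<open>The indicator of the complement of a neighbourhood is smooth at \<open>p\<close> and serves as cut-off.\<close>

lemma tangent_local:
 assumes W: "openin (mtop X) W" "p \<in> W" and fg: "!!q. q \<in> W ==> f q = g q"
 shows "v f = v g"
proof (cases "smooth_at X p f")
 case True
 have g: "smooth_at X p g" by (rule smooth_at_cong[OF W fg True])
 have p: "p \<in> pts X" using True by (rule smooth_at_pts)
 define u where "u q = f q + (-1)*g q" for q
 define cut where "cut q = (if q \<in> W then 0 else 1 :: real)" for q
 have mg: "smooth_at X p (%q. (-1)*g q)" by (rule smooth_at_combine(2)[OF p smooth_at_const[OF p] g])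
 have us: "smooth_at X p u" unfolding u_def by (rule smooth_at_combine(1)[OF p True mg])
 have cut: "smooth_at X p cut" by (rule smooth_at_cong[OF W _ smooth_at_const[OF p, of 0]]) (simp add: cut_def)
 have "u = (%q. u q*cut q)" using fg by (auto simp: u_def cut_def)
 then have "v u = v (%q. u q*cut q)" by simp
 also have "... = 0" using tangent_mult[OF us cut] W(2) fg[OF W(2)] by (simp add: u_def cut_def)
 finally have "v u = 0" .
 moreover have "v u = v f + (-1) * v g" unfolding u_def using tangent_add[OF True mg] tangent_scale[OF g, of "-1"] by simp
 ultimately show ?thesis by simp
next
 case False
 then have "\<not> smooth_at X p g" using smooth_at_cong[OF W, of g f] fg by auto
 then show ?thesis using False tangent_nonsmooth by simp
qed

lemma tangent_const: "v (%q. r) = 0"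
proof (cases "p \<in> pts X")
 case True
 have "v (%q. 1*1) = v (%q. 1)*1 + 1 * v (%q. 1)" by (rule tangent_mult) (rule smooth_at_const[OF True])+
 then have "v (%q. 1) = 0" by simp
 then show ?thesis using tangent_scale[OF smooth_at_const[OF True], of r 1] by simp
qed (use tangent_nonsmooth smooth_at_pts in blast)

lemma tangent_sum:
 assumes "p \<in> pts X" "!!i. i \<in> I ==> smooth_at X p (f i)"
 shows "v (%q. \<Sum>i\<in>I. f i q) = (\<Sum>i\<in>I. v (f i))" using assms(2)
proof (induction I rule: infinite_finite_induct)
 case (insert i I)
 then show ?case using tangent_add[of "f i" "%q. \<Sum>i\<in>I. f i q"] smooth_at_sum[OF assms(1), of I f] by simp
qed (simp_all add: tangent_const)

end

lemma coord_vect_eq: "smooth_at X p f ==> coord_vect X c i p f = pd i (%y. f (chart_inv c y)) (snd c p)" by (simp add: coord_vect_def)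

context
 fixes c p assumes c: "c \<in> atlas X" and p: "p \<in> fst c"
begin

lemma p_pts: "p \<in> pts X" using chart_pts[OF c] p by blast

lemma coord_vect_tangent:
 assumes i: "i<dm"
 shows "coord_vect X c i p \<in> tangent X p" unfolding tangent_def
proof (intro CollectI conjI allI impI)
 fix f g assume fg: "smooth_at X p f" "smooth_at X p g"
 obtain T where T: "eopen dm T" "snd c p \<in> T" "T \<subseteq> cimg c" "Cinf_on dm T (%y. f (chart_inv c y))" by (rule smooth_at_chart_D[OF c p fg(1)])
 obtain T' where T': "eopen dm T'" "snd c p \<in> T'" "T' \<subseteq> cimg c" "Cinf_on dm T' (%y. g (chart_inv c y))" by (rule smooth_at_chart_D[OF c p fg(2)])
 have o: "eopen dm (T \<inter> T')" and y: "snd c p \<in> T \<inter> T'" using T T' by auto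
 have F: "Cinf_on dm (T \<inter> T') (%y. f (chart_inv c y))" and G: "Cinf_on dm (T \<inter> T') (%y. g (chart_inv c y))"
  by (rule Cinf_on_subset[OF _ T(4)] Cinf_on_subset[OF _ T'(4)], auto)+
 show "coord_vect X c i p (%q. f q + g q) = coord_vect X c i p f + coord_vect X c i p g"
  using fg smooth_at_combine[OF p_pts fg] partial_deriv_add[OF o i y F G] by (simp add: coord_vect_eq)
 show "coord_vect X c i p (%q. f q*g q) = coord_vect X c i p f*g p + f p*coord_vect X c i p g"
  using fg smooth_at_combine[OF p_pts fg] partial_deriv_mult[OF o i y F G] by (simp add: coord_vect_eq chart_inv_left[OF c p])
next
 fix f r assume f: "smooth_at X p f"
 obtain T where T: "eopen dm T" "snd c p \<in> T" "T \<subseteq> cimg c" "Cinf_on dm T (%y. f (chart_inv c y))" by (rule smooth_at_chart_D[OF c p f])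
 have "smooth_at X p (%q. r*f q)" by (rule smooth_at_combine(2)[OF p_pts smooth_at_const[OF p_pts] f])
 then show "coord_vect X c i p (%q. r*f q) = r*coord_vect X c i p f" using f partial_deriv_cmult[OF T(1) i T(2,4)] by (simp add: coord_vect_eq)
qed (simp add: coord_vect_def)

lemma vcoord_coord_vect:
 assumes "i<dm" "k<dm"
 shows "vcoord c k (coord_vect X c i p) = (if i = k then 1 else 0)"
proof -
 have "vcoord c k (coord_vect X c i p) = pd i (%y. snd c (chart_inv c y) k) (snd c p)"
  using smooth_at_coord[OF c p assms(2)] by (simp add: vcoord_def coord_vect_eq)
 also have "... = pd i (%y. y k) (snd c p)"
  by (rule partial_deriv_cong[OF chart_props(2)[OF c] _ chart_in[OF c p] assms(1)]) (simp add: chart_inv_right[OF c])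
 finally show ?thesis by (simp add: partial_deriv_coord)
qed

text \<open>Derivations are of first order: by Hadamard's expansion \<open>f\<close> is f p plus a
  sum of products of coordinate differences, which vanish at \<open>p\<close>, with smooth functions
  whose values at \<open>p\<close> are the partials.\<close>

lemma tangent_apply:
 assumes v: "v \<in> tangent X p" and f: "smooth_at X p f"
 shows "v f = (\<Sum>k<dm. vcoord c k v * pd k (%y. f (chart_inv c y)) (snd c p))"
proof -
 let ?F = "%y. f (chart_inv c y)" and ?y = "snd c p"
 obtain T where T: "eopen dm T" "?y \<in> T" "T \<subseteq> cimg c" "Cinf_on dm T ?F" by (rule smooth_at_chart_D[OF c p f])
 obtain e where e: "e > 0" "!!z. z \<in> topspace (Euclidean_space dm) ==> (!!i. i<dm ==> \<bar>z i - ?y i\<bar><e) ==> z \<in> T"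
  using eopen_box[OF T(1,2)] by blast
 \<comment> \<open>A box is star-shaped about its centre, as the expansion requires.\<close>
 define B where "B = {z \<in> topspace (Euclidean_space dm). \<forall>i\<in>{..<dm}. \<bar>z i - ?y i\<bar><e}"
 have B: "eopen dm B" unfolding B_def by (rule eopen_box_open)
 have yt: "?y \<in> topspace (Euclidean_space dm)" using T(1,2) eopen_subset by blast
 have yB: "?y \<in> B" using e yt by (simp add: B_def)
 have BT: "B \<subseteq> T" using e by (auto simp: B_def)
 have FB: "Cinf_on dm B ?F" by (rule Cinf_on_subset[OF BT T(4)])
 have star: "(%i. ?y i + t*(z i - ?y i)) \<in> B" if "z \<in> B" "t \<in> {0..1}" for z t
 proof -
  have "\<bar>t*(z i - ?y i)\<bar><e" if "i<dm" for i
  proof -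
   have "\<bar>t*(z i - ?y i)\<bar> <= \<bar>z i - ?y i\<bar>" using `t \<in> {0..1}` by (auto simp: abs_mult intro: mult_left_le_one_le)
   moreover have "\<bar>z i - ?y i\<bar><e" using `z \<in> B` that by (simp add: B_def)
   ultimately show ?thesis by linarith
  qed
  then show ?thesis using `z \<in> B` yt by (auto simp: B_def topspace_Euclidean_space)
 qed
 obtain g where g: "!!i. i<dm ==> Cinf_on dm B (g i)" "!!y. y \<in> B ==> ?F y = ?F ?y + (\<Sum>i<dm. (y i - ?y i)*g i y)"
  using Hadamard_expansion[OF B star FB] by blast
 have lin: "Cinf_on dm B (%y. y i - ?y i)" for i by (intro Cinf_on_diff[OF B] Cinf_on_coord[OF B] Cinf_on_const[OF B])
 have gk: "pd k ?F ?y = g k ?y" if k: "k<dm" for k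
 proof -
  have "pd k ?F ?y = pd k (%y. ?F ?y + (\<Sum>i<dm. (y i - ?y i)*g i y)) ?y" by (rule partial_deriv_cong[OF B g(2) yB k])
  also have "... = pd k (%y. ?F ?y) ?y + pd k (%y. \<Sum>i<dm. (y i - ?y i)*g i y) ?y"
   by (intro partial_deriv_add[OF B k yB] Cinf_on_const[OF B] Cinf_on_sum[OF B] Cinf_on_mult[OF B] lin g) auto
  also have "... = (\<Sum>i<dm. pd k (%y. (y i - ?y i)*g i y) ?y)"
   by (subst partial_deriv_sum[OF B k yB]) (auto intro: Cinf_on_mult[OF B] lin g simp: partial_deriv_const)
  also have "... = (\<Sum>i<dm. (if k = i then 1 else 0)*g i ?y)"
  proof (intro sum.cong refl)
   fix i assume i: "i \<in> {..<dm}"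
   have "pd k (%y. y i - ?y i) ?y = (if k = i then 1 else 0)" by (subst partial_deriv_diff[OF B k yB Cinf_on_coord[OF B] Cinf_on_const[OF B]])
     (simp add: partial_deriv_coord partial_deriv_const)
   then show "pd k (%y. (y i - ?y i)*g i y) ?y = (if k = i then 1 else 0)*g i ?y" using i by (subst partial_deriv_mult[OF B k yB lin g(1)]) auto
  qed
  also have "... = g k ?y" using k by (intro sum_delta_left) auto
  finally show ?thesis .
 qed
 let ?a = "%i q. snd c q i + - ?y i" and ?b = "%i q. g i (snd c q)"
 have sa: "smooth_at X p (?a i)" if "i<dm" for i by (rule smooth_at_combine(1)[OF p_pts smooth_at_coord[OF c p that] smooth_at_const[OF p_pts]])
 have sb: "smooth_at X p (?b i)" if "i<dm" for i by (rule smooth_at_chart_fun[OF c p B yB g(1)[OF that]])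
 have sab: "smooth_at X p (%q. ?a i q*?b i q)" if "i<dm" for i by (rule smooth_at_combine(2)[OF p_pts sa[OF that] sb[OF that]])
 have "v f = v (%q. f p + (\<Sum>i<dm. ?a i q*?b i q))"
 proof (rule tangent_local[OF v chart_open_preimage[OF c B]])
  show "p \<in> {p \<in> fst c. snd c p \<in> B}" using p yB by simp
  fix q assume "q \<in> {p \<in> fst c. snd c p \<in> B}"
  then show "f q = f p + (\<Sum>i<dm. ?a i q*?b i q)" using g(2)[of "snd c q"] by (simp add: chart_inv_left[OF c] p)
 qed
 also have "... = v (%q. f p) + v (%q. \<Sum>i<dm. ?a i q*?b i q)"
  by (rule tangent_add[OF v smooth_at_const[OF p_pts] smooth_at_sum[OF p_pts]]) (use sab in blast)
 also have "... = (\<Sum>i<dm. v (%q. ?a i q*?b i q))"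
  using tangent_sum[OF v p_pts, of "{..<dm}" "%i q. ?a i q*?b i q"] sab by (simp add: tangent_const[OF v])
 also have "... = (\<Sum>i<dm. vcoord c i v * pd i ?F ?y)"
 proof (intro sum.cong refl)
  fix i assume "i \<in> {..<dm}"
  then have i: "i<dm" by simp
  have "v (?a i) = vcoord c i v" unfolding vcoord_def
   by (simp only: tangent_add[OF v smooth_at_coord[OF c p i] smooth_at_const[OF p_pts]] tangent_const[OF v] add_0_right)
  then show "v (%q. ?a i q*?b i q) = vcoord c i v * pd i ?F ?y" using tangent_mult[OF v sa[OF i] sb[OF i]] by (simp add: gk[OF i])
 qed
 finally show ?thesis .
qed

lemma tangent_expand:
 assumes "v \<in> tangent X p"
 shows "v = vsum dm (%k. vscale (vcoord c k v) (coord_vect X c k p))"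
proof
 fix f show "v f = vsum dm (%k. vscale (vcoord c k v) (coord_vect X c k p)) f" using tangent_apply[OF assms, of f] tangent_nonsmooth[OF assms, of f]
  by (cases "smooth_at X p f") (simp_all add: vsum_def vscale_def coord_vect_def)
qed

lemma tangent_eq_iff:
 assumes "v \<in> tangent X p" "w \<in> tangent X p"
 shows "v = w \<longleftrightarrow> (\<forall>k<dm. vcoord c k v = vcoord c k w)"
proof
 assume "\<forall>k<dm. vcoord c k v = vcoord c k w"
 then have "vsum dm (%k. vscale (vcoord c k v) (coord_vect X c k p)) = vsum dm (%k. vscale (vcoord c k w) (coord_vect X c k p))"
  by (simp add: vsum_def vscale_def)
 then show "v = w" using tangent_expand[OF assms(1)] tangent_expand[OF assms(2)] by simp
qed simp

end

lemma vadd_tangent: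
 assumes "v \<in> tangent X p" "w \<in> tangent X p"
 shows "vadd v w \<in> tangent X p" using assms by (auto simp: tangent_def vadd_def algebra_simps)

lemma vscale_tangent: "v \<in> tangent X p ==> vscale r v \<in> tangent X p" by (auto simp: tangent_def vscale_def algebra_simps)

lemma vzero_tangent: "vzero \<in> tangent X p" by (auto simp: tangent_def vzero_def)

lemma vsum_Suc: "vsum (Suc m) w = vadd (vsum m w) (w m)" "vsum 0 w = vzero" by (auto simp: vsum_def vadd_def vzero_def)

lemma vsum_tangent: "(!!k. k<m ==> w k \<in> tangent X p) ==> vsum m w \<in> tangent X p"
 by (induction m) (simp_all add: vsum_Suc vadd_tangent vzero_tangent)

lemma linear_fun_zero: "linear_fun (tangent X p) L ==> L vzero = 0"
proof -
 assume "linear_fun (tangent X p) L"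
 then have "L (vscale 0 vzero) = 0*L vzero" using vzero_tangent unfolding linear_fun_def by blast
 moreover have "vscale 0 vzero = (vzero :: 'a vect)" by (simp add: vscale_def vzero_def)
 ultimately show ?thesis by simp
qed

lemma linear_fun_vsum:
 assumes L: "linear_fun (tangent X p) L"
 shows "(!!k. k<m ==> w k \<in> tangent X p) ==> L (vsum m (%k. vscale (a k) (w k))) = (\<Sum>k<m. a k*L (w k))"
proof (induction m)
 case 0 then show ?case by (simp add: vsum_Suc linear_fun_zero[OF L])
next
 case (Suc m)
 have "vsum m (%k. vscale (a k) (w k)) \<in> tangent X p" using Suc.prems by (intro vsum_tangent vscale_tangent) auto
 moreover have "vscale (a m) (w m) \<in> tangent X p" using Suc.prems by (intro vscale_tangent) auto
 ultimately show ?case using L Suc unfolding vsum_Suc linear_fun_def by simp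
qed

lemma linear_fun_expand:
 assumes "linear_fun (tangent X p) L" "c \<in> atlas X" "p \<in> fst c" "v \<in> tangent X p"
 shows "L v = (\<Sum>k<dm. vcoord c k v * L (coord_vect X c k p))" using linear_fun_vsum[OF assms(1), of dm "%k. coord_vect X c k p" "%k. vcoord c k v"]
  tangent_expand[OF assms(2-4)] coord_vect_tangent[OF assms(2,3)] by simp

lemma vcoord_linear: "vcoord c k (vadd v w) = vcoord c k v + vcoord c k w" "vcoord c k (vscale r v) = r * vcoord c k v"
 "vcoord c k vzero = 0" "vcoord c k (vsum m u) = (\<Sum>i<m. vcoord c k (u i))" by (simp_all add: vcoord_def vadd_def vscale_def vzero_def vsum_def)

end

section \<open>Smooth maps and their differentials\<close>

lemma smooth_map_continuous: "smooth_map X Y F ==> continuous_map (mtop X) (mtop Y) F" by (simp add: smooth_map_def)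

lemma smooth_map_pts: "smooth_map X Y F ==> p \<in> pts X ==> F p \<in> pts Y" using smooth_map_continuous continuous_map_funspace by fastforce

lemma smooth_map_coord:
 assumes "smooth_map X Y F" "e \<in> atlas Y" "k<mdim Y"
 shows "smooth_fun X {p \<in> pts X. F p \<in> fst e} (%p. snd e (F p) k)"
proof -
 have "\<forall>(V, \<psi>)\<in>atlas Y. \<forall>i<mdim Y. smooth_fun X {p \<in> pts X. F p \<in> V} (%p. \<psi> (F p) i)" using assms(1) unfolding smooth_map_def by (elim conjE)
 then show ?thesis using assms(2,3) by (cases e) (auto dest!: bspec)
qed

context smooth_mfd
begin

text \<open>The vector with components \<open>v\<close> in the chart. With \<open>v\<close> fixed
  and \<open>p\<close> varying it extends a single tangent vector over the chart domain, as the
  density arguments need.\<close>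

definition comb :: "'a chart => (nat => real) => 'a => 'a vect" where "comb c v p = vsum dm (%k. vscale (v k) (coord_vect X c k p))"

lemma comb:
 assumes c: "c \<in> atlas X" and p: "p \<in> fst c"
 shows "comb c v p \<in> tangent X p" "k<dm ==> vcoord c k (comb c v p) = v k" "u \<in> tangent X p ==> comb c (%k. vcoord c k u) p = u"
proof -
 show "comb c v p \<in> tangent X p" unfolding comb_def by (intro vsum_tangent vscale_tangent coord_vect_tangent[OF c p])
 assume k: "k<dm"
 have "(\<Sum>i<dm. v i * vcoord c k (coord_vect X c i p)) = (\<Sum>i<dm. v i*(if i = k then 1 else 0))"
  using k by (intro sum.cong) (auto simp: vcoord_coord_vect[OF c p])
 also have "... = v k" using k by (intro sum_delta_right) auto
 finally show "vcoord c k (comb c v p) = v k" unfolding comb_def vcoord_linear .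
qed (use tangent_expand[OF c p] in "unfold comb_def, simp")

context
 fixes Y :: "'b mfd" and F assumes Y: "smooth_mfd Y" and F: "smooth_map X Y F"
begin

interpretation Y: smooth_mfd Y by (rule Y)

lemma map_preimage_open: "openin (mtop Y) V ==> openin (mtop X) {p \<in> pts X. F p \<in> V}"
 using openin_continuous_map_preimage[OF smooth_map_continuous[OF F]] .

lemma smooth_at_map:
 assumes p: "p \<in> pts X" and f: "smooth_at Y (F p) f"
 shows "smooth_at X p (%q. f (F q))"
proof -
 obtain c where c: "c \<in> atlas X" "p \<in> fst c" using ex_chart[OF p] by blast
 obtain e where e: "e \<in> atlas Y" "F p \<in> fst e" using Y.ex_chart[OF smooth_map_pts[OF F p]] by blast
 obtain T where T: "openin (Euclidean_space Y.dm) T" "snd e (F p) \<in> T" "T \<subseteq> Y.cimg e" "Cinf_on Y.dm T (%y. f (chart_inv e y))"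
  by (rule Y.smooth_at_chart_D[OF e f])
 define W where "W = {q \<in> pts X. F q \<in> {r \<in> fst e. snd e r \<in> T}} \<inter> fst c"
 have W: "openin (mtop X) W" "p \<in> W" "W \<subseteq> fst c" using map_preimage_open[OF Y.chart_open_preimage[OF e(1) T(1)]] chart_props(1)[OF c(1)] p e c T
  by (auto simp: W_def)
 have o: "eopen dm (snd c ` W)" by (rule chart_open_image[OF c(1) W(1,3)])
 have "Cinf_on dm (snd c ` W) (%y. f (chart_inv e (snd e (F (chart_inv c y)))))"
 proof (rule Cinf_on_compose[OF o T(1) _ _ T(4)])
  show "snd e (F (chart_inv c y)) \<in> T" if "y \<in> snd c ` W" for y using that by (auto simp: W_def chart_inv_left[OF c(1)])
  show "Cinf_on dm (snd c ` W) (%y. snd e (F (chart_inv c y)) j)" if "j<Y.dm" for j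
   by (rule Cinf_on_subset[OF _ smooth_fun_D[OF smooth_map_coord[OF F e(1) that] c(1)]]) (auto simp: W_def)
 qed
 then have "Cinf_on dm (snd c ` W) (%y. f (F (chart_inv c y)))"
 proof (rule Cinf_on_cong[OF o, rotated])
  fix y assume "y \<in> snd c ` W"
  then have "F (chart_inv c y) \<in> fst e" by (auto simp: W_def chart_inv_left[OF c(1)])
  then show "f (chart_inv e (snd e (F (chart_inv c y)))) = f (F (chart_inv c y))" by (simp add: Y.chart_inv_left[OF e(1)])
 qed
 then show ?thesis by (intro smooth_at_I[OF W(1,2)] smooth_fun_chart_I[OF c(1) W(1,3)])
qed

lemma push_tangent:
 assumes p: "p \<in> pts X" and v: "v \<in> tangent X p"
 shows "push Y F p v \<in> tangent Y (F p)" unfolding tangent_def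
proof (intro CollectI conjI allI impI)
 fix f g assume fg: "smooth_at Y (F p) f" "smooth_at Y (F p) g"
 note s = smooth_at_map[OF p fg(1)] smooth_at_map[OF p fg(2)]
 show "push Y F p v (%q. f q + g q) = push Y F p v f + push Y F p v g"
  using fg Y.smooth_at_combine[OF smooth_map_pts[OF F p] fg] tangent_add[OF v s] by (simp add: push_def)
 show "push Y F p v (%q. f q*g q) = push Y F p v f*g (F p) + f (F p)*push Y F p v g"
  using fg Y.smooth_at_combine[OF smooth_map_pts[OF F p] fg] tangent_mult[OF v s] by (simp add: push_def)
next
 fix f r assume f: "smooth_at Y (F p) f"
 have "smooth_at Y (F p) (%q. r*f q)" by (rule Y.smooth_at_combine(2)[OF smooth_map_pts[OF F p] Y.smooth_at_const[OF smooth_map_pts[OF F p]] f])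
 then show "push Y F p v (%q. r*f q) = r*push Y F p v f" using f tangent_scale[OF v smooth_at_map[OF p f]] by (simp add: push_def)
qed (simp add: push_def)

lemma vcoord_push:
 assumes e: "e \<in> atlas Y" "F p \<in> fst e" "k<mdim Y"
 shows "vcoord e k (push Y F p v) = v (%q. snd e (F q) k)" using Y.smooth_at_coord[OF e] by (simp add: vcoord_def push_def)

lemma vcoord_push_coord_vect:
 assumes c: "c \<in> atlas X" "p \<in> fst c" and e: "e \<in> atlas Y" "F p \<in> fst e" "k<mdim Y"
 shows "vcoord e k (push Y F p (coord_vect X c i p)) = pd i (%y. snd e (F (chart_inv c y)) k) (snd c p)"
proof -
 have "p \<in> pts X" using chart_pts c by blast
 then show ?thesis using smooth_at_map[OF _ Y.smooth_at_coord[OF e]] by (simp add: vcoord_push[OF e] coord_vect_eq)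
qed

lemma chart_map_smooth:
 assumes c: "c \<in> atlas X" and e: "e \<in> atlas Y" "k<mdim Y"
 shows "Cinf_on dm (snd c ` ({p \<in> pts X. F p \<in> fst e} \<inter> fst c)) (%y. snd e (F (chart_inv c y)) k)"
 by (rule smooth_fun_D[OF smooth_map_coord[OF F e] c])

end

lemma smooth_fun_smooth_at: "smooth_fun X (pts X) f ==> p \<in> pts X ==> smooth_at X p f" by (rule smooth_at_I[of "pts X"]) auto

end

lemma push_linear: "push Y F p (vadd v w) = vadd (push Y F p v) (push Y F p w)" "push Y F p (vscale r v) = vscale r (push Y F p v)"
 "push Y F p vzero = vzero" "push Y F p (vsum m u) = vsum m (%k. push Y F p (u k))" by (auto simp: push_def vadd_def vscale_def vzero_def vsum_def)

lemma (in smooth_mfd) bilinear_expand: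
 assumes w: "bilinear_tensor X w" and c: "c \<in> atlas X" "p \<in> fst c"
  and uv: "u \<in> tangent X p" "v \<in> tangent X p"
 shows "w p u v = (\<Sum>i<dm. \<Sum>j<dm. comp2 X w c i j (snd c p)*(vcoord c i u * vcoord c j v))"
proof -
 have p: "p \<in> pts X" using chart_pts c by blast
 have lin: "linear_fun (tangent X p) (w p u)" "linear_fun (tangent X p) (%v. w p v u)" if "u \<in> tangent X p" for u
  using w p that unfolding bilinear_tensor_def by auto
 have "w p u v = (\<Sum>i<dm. vcoord c i u*w p (coord_vect X c i p) v)" by (rule linear_fun_expand[OF lin(2)[OF uv(2)] c uv(1)])
 also have "... = (\<Sum>i<dm. vcoord c i u*(\<Sum>j<dm. vcoord c j v * w p (coord_vect X c i p) (coord_vect X c j p)))"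
  by (intro sum.cong refl arg_cong2[of _ _ _ _ "(*)"] linear_fun_expand[OF lin(1) c uv(2)] coord_vect_tangent[OF c]) simp
 finally show ?thesis by (simp add: comp2_def Let_def chart_inv_left[OF c] sum_distrib_left mult_ac)
qed

lemma (in smooth_mfd) comp2_at: "c \<in> atlas X ==> p \<in> fst c ==>  comp2 X w c i j (snd c p) = w p (coord_vect X c i p) (coord_vect X c j p)"
 by (simp add: comp2_def chart_inv_left)

lemma (in smooth_mfd) endo_at: "c \<in> atlas X ==> p \<in> fst c ==>  endo_comp X E c k i (snd c p) = vcoord c k (E p (coord_vect X c i p))"
 by (simp add: endo_comp_def chart_inv_left)

lemma (in smooth_mfd) cimg_E: "c \<in> atlas X ==> y \<in> cimg c ==> \<exists>p\<in>fst c. y = snd c p" by (auto simp: cimg_def)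

text \<open>Along v + t u the form is affine in \<open>t\<close> and nonnegative, hence
  constant.\<close>

lemma (in smooth_mfd) psd_kernel:
 assumes w: "symmetric_psd X w" and p: "p \<in> pts X" and uv: "u \<in> tangent X p" "v \<in> tangent X p" and z: "w p u u = 0"
 shows "w p u v = 0" "w p v u = 0"
proof -
 have lin: "linear_fun (tangent X p) (w p u)" "linear_fun (tangent X p) (%v. w p v u)" if "u \<in> tangent X p" for u
  using w p that unfolding symmetric_psd_def bilinear_tensor_def by auto
 have sym: "w p u v = w p v u" using w p uv unfolding symmetric_psd_def by blast
 have q: "0 <= w p v v + 2*t*w p u v" for t
 proof -
  have t: "vscale t u \<in> tangent X p" "vadd v (vscale t u) \<in> tangent X p" using uv by (auto intro: vadd_tangent vscale_tangent)
  have "0 <= w p (vadd v (vscale t u)) (vadd v (vscale t u))" using w p t unfolding symmetric_psd_def by blast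
  also have "... = w p v v + 2*t*w p u v" using lin uv t z sym unfolding linear_fun_def by (simp add: algebra_simps)
  finally show ?thesis .
 qed
 show "w p u v = 0"
 proof (rule ccontr)
  assume nz: "w p u v ~= 0"
  \<comment> \<open>For this value of t the right-hand side is -1.\<close>
  have "0 <= w p v v + 2*(- (w p v v + 1)/(2*w p u v))*w p u v" by (rule q)
  then show False using nz by (simp add: field_simps)
 qed
 then show "w p v u = 0" using sym by simp
qed

section \<open>The base\<close>

text \<open>Insert the decomposition of the identity into the \<open>q j\<close> behind
  \<open>b i\<close>; only the term with \<open>q i\<close> survives.\<close>

lemma block_complement:
 fixes b q :: "nat => nat => nat => real"
 assumes "!!k l. k<d ==> l<d ==> (\<Sum>i<m. q i k l) = (if k = l then 1 else 0)"
  and "!!i j k l. i<m ==> j<m ==> k<d ==> l<d ==> i ~= j ==> (\<Sum>s<d. b j k s*q i s l) = 0" and that: "i<m" "k<d" "l<d"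
 shows "(\<Sum>s<d. b i k s*q i s l) = b i k l"
proof -
 have "b i k l = (\<Sum>s<d. b i k s*(if s = l then 1 else 0))" using that by (intro sum_delta_right[symmetric]) auto
 also have "... = (\<Sum>s<d. b i k s*(\<Sum>j<m. q j s l))" using assms by (intro sum.cong) auto
 also have "... = (\<Sum>j<m. \<Sum>s<d. b i k s*q j s l)" unfolding sum_distrib_left by (rule sum.swap)
 also have "... = (\<Sum>j<m. (if i = j then 1 else 0)*(\<Sum>s<d. b i k s*q i s l))" using assms by (intro sum.cong) auto
 also have "... = (\<Sum>s<d. b i k s*q i s l)" using that by (intro sum_delta_left) auto
 finally show ?thesis by simp
qed

text \<open>Chart components of a family of commuting semidefinite forms \<open>b i\<close> and a complex structure \<open>J\<close>; the
 \<open>p i\<close> are the projectors onto the summand of the tangent space that supports \<open>b i\<close>.\<close>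

locale split_metric =
 fixes d m :: nat and T :: "(nat => real) set"
  and b :: "nat => nat => nat => rfun" and J :: "nat => nat => rfun"
  and r :: "nat => nat"
 assumes T: "eopen d T"
  and b: "!!i k l. i<m ==> k<d ==> l<d ==> Cinf_on d T (b i k l)"
  and J: "!!k l. k<d ==> l<d ==> Cinf_on d T (J k l)"
  and b_sym: "!!i k l z. i<m ==> k<d ==> l<d ==> z \<in> T ==> b i k l z = b i l k z"
  and b_J: "!!i k l z. i<m ==> k<d ==> l<d ==> z \<in> T ==>  (\<Sum>s<d. J s k z*b i s l z) = - (\<Sum>s<d. J s l z*b i s k z)"
  and JJ: "!!k l z. k<d ==> l<d ==> z \<in> T ==> (\<Sum>s<d. J k s z*J s l z) = (if k = l then -1 else 0)"
  and b_psd: "!!i z v. i<m ==> z \<in> T ==> 0 <= (\<Sum>k<d. \<Sum>l<d. b i k l z*(v k * v l))"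
  and b_def: "!!z v. z \<in> T ==> (!!i. i<m ==> (\<Sum>k<d. \<Sum>l<d. b i k l z*(v k * v l)) = 0) ==> (\<forall>k<d. v k = 0)"
  and split: "!!z. z \<in> T ==> \<exists>p :: nat => nat => nat => real. (\<forall>k<d. \<forall>l<d. (\<Sum>i<m. p i k l) = (if k = l then 1 else 0)) &
   (\<forall>i<m. \<forall>j<m. \<forall>k<d. \<forall>l<d. i ~= j --> (\<Sum>s<d. b j k s z*p i s l) = 0) & (\<forall>i<m. (\<Sum>k<d. p i k k) = real (r i))"
begin

definition G :: "(nat => real) => nat => nat => rfun" where "G A k l z = (\<Sum>i<m. A i*b i k l z)"

abbreviation Gi :: "(nat => real) => nat => nat => rfun" where "Gi A k l z \<equiv> mat_inverse d (%k l. G A k l z) k l"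

definition pos :: "(nat => real) => bool" where "pos A \<longleftrightarrow> (\<forall>i<m. 0<A i)"

lemma Cinf_G: "k<d ==> l<d ==> Cinf_on d T (G A k l)"
 unfolding G_def[abs_def] by (intro Cinf_on_sum[OF T] Cinf_on_mult[OF T] Cinf_on_const[OF T] b) auto

lemma G_sym: "k<d ==> l<d ==> z \<in> T ==> G A k l z = G A l k z" unfolding G_def by (intro sum.cong) (auto simp: b_sym)

lemma G_J: "k<d ==> l<d ==> z \<in> T ==> (\<Sum>s<d. J s k z*G A s l z) = - (\<Sum>s<d. J s l z*G A s k z)"
proof -
 assume a: "k<d" "l<d" "z \<in> T"
 have "(\<Sum>s<d. J s k z*G A s l z) = (\<Sum>i<m. A i*(\<Sum>s<d. J s k z*b i s l z))" for k l
  unfolding G_def sum_distrib_left by (subst sum.swap) (simp add: mult_ac)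
 moreover have "(\<Sum>i<m. A i*(\<Sum>s<d. J s k z*b i s l z)) = (\<Sum>i<m. - (A i*(\<Sum>s<d. J s l z*b i s k z)))" using b_J[OF _ a] by (intro sum.cong) auto
 ultimately show ?thesis by (simp add: sum_negf)
qed

text \<open>On a null vector the nonnegative terms A_i b_i(v, v) add up to zero, so each
  \<open>b i\<close> vanishes on it.\<close>

lemma G_nd:
 assumes A: "pos A" and z: "z \<in> T"
 shows "nondegenerate d (%k l. G A k l z)" unfolding nondegenerate_def
proof (intro allI impI)
 fix v k assume v: "\<forall>i<d. (\<Sum>k<d. G A i k z * v k) = 0" and k: "k<d"
 let ?q = "%i. \<Sum>k<d. \<Sum>l<d. b i k l z*(v k * v l)"
 have "(\<Sum>i<m. A i*?q i) = (\<Sum>k<d. v k*(\<Sum>l<d. G A k l z * v l))"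
 proof -
  have "(\<Sum>i<m. A i*?q i) = (\<Sum>i<m. \<Sum>k<d. \<Sum>l<d. A i*b i k l z*(v k * v l))" by (simp add: sum_distrib_left mult.assoc)
  also have "... = (\<Sum>k<d. \<Sum>l<d. \<Sum>i<m. A i*b i k l z*(v k * v l))" by (rule sum_rotate)
  finally show ?thesis by (simp add: G_def sum_distrib_left sum_distrib_right mult_ac)
 qed
 then have s: "(\<Sum>i<m. A i*?q i) = 0" using v by simp
 have zero: "\<forall>i\<in>{..<m}. A i*?q i = 0"
 proof -
  have "0 <= A i*?q i" if "i \<in> {..<m}" for i using that A z by (intro mult_nonneg_nonneg b_psd) (auto simp: pos_def intro: less_imp_le)
  then show ?thesis using s by (subst (asm) sum_nonneg_eq_0_iff) auto
 qed
 have "?q i = 0" if "i<m" for i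
 proof -
  have "A i ~= 0" using A that by (auto simp: pos_def)
  moreover have "A i*?q i = 0" by (rule bspec[OF zero]) (use that in simp)
  ultimately show ?thesis by (simp only: mult_eq_0_iff) blast
 qed
 then show "v k = 0" using b_def[OF z, of v] k by blast
qed

lemma Gi_smooth: "pos A ==> k<d ==> l<d ==> Cinf_on d T (Gi A k l)" by (rule mat_inverse_Cinf[OF T Cinf_G G_nd])

lemma Gi_sym: "pos A ==> z \<in> T ==> k<d ==> l<d ==> Gi A k l z = Gi A l k z" by (rule mat_inverse_symmetric[OF G_nd]) (auto intro: G_sym)

lemma Gi_inv:
 assumes "pos A" "z \<in> T" "k<d" "l<d"
 shows "(\<Sum>s<d. G A k s z*Gi A s l z) = (if k = l then 1 else 0)"
  and "(\<Sum>s<d. Gi A k s z*G A s l z) = (if k = l then 1 else 0)"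
 using mat_inverse_nondegenerate(1,2)[OF G_nd[OF assms(1,2)]] assms(3,4) by (simp_all add: is_inverse_def)

text \<open>A formula for the projectors that \<open>split\<close> provides only pointwise; it makes
  them smooth in \<open>z\<close>.\<close>

definition p :: "nat => nat => nat => rfun" where "p i k l z = (\<Sum>s<d. Gi (%_. 1) k s z*b i s l z)"

lemma pos_1: "pos (%_. 1)" by (simp add: pos_def)

text \<open>All rests on G(A) q_i = A_i b_i: multiplying by the inverse metric shows that A_i
  G(A)^{-1} b_i is the given projector q_i whatever the weights \<open>A\<close>, and unit weights
  identify it with \<open>p i\<close>.\<close>

lemma projectors:
 assumes z: "z \<in> T"
 shows "!!k l. k<d ==> l<d ==> (\<Sum>i<m. p i k l z) = (if k = l then 1 else 0)"
  and "!!i j k l. i<m ==> j<m ==> k<d ==> l<d ==> i ~= j ==> (\<Sum>s<d. b j k s z*p i s l z) = 0"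
  and "!!i k l. i<m ==> k<d ==> l<d ==> (\<Sum>s<d. b i k s z*p i s l z) = b i k l z"
  and "!!i A k l. pos A ==> i<m ==> k<d ==> l<d ==> A i*(\<Sum>s<d. Gi A k s z*b i s l z) = p i k l z"
  and "!!i j k l. i<m ==> j<m ==> k<d ==> l<d ==>  (\<Sum>s<d. p j k s z*p i s l z) = (if i = j then p i k l z else 0)"
  and "!!i. i<m ==> (\<Sum>k<d. p i k k z) = real (r i)"
proof -
 obtain q :: "nat => nat => nat => real" where q: "(\<forall>k<d. \<forall>l<d. (\<Sum>i<m. q i k l) = (if k = l then 1 else 0)) &
   (\<forall>i<m. \<forall>j<m. \<forall>k<d. \<forall>l<d. i ~= j --> (\<Sum>s<d. b j k s z*q i s l) = 0) & (\<forall>i<m. (\<Sum>k<d. q i k k) = real (r i))" using split[OF z] ..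
 note q = q[THEN conjunct1, rule_format] q[THEN conjunct2, THEN conjunct1, rule_format] q[THEN conjunct2, THEN conjunct2, rule_format]
 have bq: "(\<Sum>s<d. b i k s z*q i s l) = b i k l z" if "i<m" "k<d" "l<d" for i k l
  by (rule block_complement[where b = "%i k l. b i k l z" and q = q and m = m]) (use q that in auto)
 have Aq: "A i*(\<Sum>s<d. Gi A k s z*b i s l z) = q i k l" if A: "pos A" and ikl: "i<m" "k<d" "l<d" for A i k l
 proof -
  have Gq: "(\<Sum>s<d. G A t s z*q i s l) = A i*b i t l z" if t: "t<d" for t
  proof -
   have "(\<Sum>s<d. G A t s z*q i s l) = (\<Sum>j<m. A j*(\<Sum>s<d. b j t s z*q i s l))" unfolding G_def by (simp add: sum_mult_assoc)
   also have "... = (\<Sum>j<m. (if i = j then 1 else 0)*(A i*b i t l z))" using t ikl q(2) bq by (intro sum.cong) auto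
   also have "... = A i*b i t l z" using ikl by (intro sum_delta_left) auto
   finally show ?thesis .
  qed
  have "q i k l = (\<Sum>s<d. (if k = s then 1 else 0)*q i s l)" using ikl by (intro sum_delta_left[symmetric]) auto
  also have "... = (\<Sum>s<d. (\<Sum>t<d. Gi A k t z*G A t s z)*q i s l)" using Gi_inv(2)[OF A z] ikl by (intro sum.cong) auto
  also have "... = (\<Sum>t<d. Gi A k t z*(A i*b i t l z))" by (simp add: sum_mult_assoc Gq)
  finally show ?thesis by (simp add: sum_distrib_left mult_ac)
 qed
 have pq: "p i k l z = q i k l" if "i<m" "k<d" "l<d" for i k l using Aq[OF pos_1 that] by (simp add: p_def)
 show "(\<Sum>i<m. p i k l z) = (if k = l then 1 else 0)" if "k<d" "l<d" for k l using q(1) that by (simp add: pq)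
 show p2: "(\<Sum>s<d. b j k s z*p i s l z) = 0" if "i<m" "j<m" "k<d" "l<d" "i ~= j" for i j k l using q(2) that by (simp add: pq)
 show p3: "(\<Sum>s<d. b i k s z*p i s l z) = b i k l z" if "i<m" "k<d" "l<d" for i k l using bq that by (simp add: pq)
 show "A i*(\<Sum>s<d. Gi A k s z*b i s l z) = p i k l z" if "pos A" "i<m" "k<d" "l<d" for i A k l using Aq[OF that] that by (simp add: pq)
 show "(\<Sum>k<d. p i k k z) = real (r i)" if "i<m" for i using q(3) that by (simp add: pq)
 show "(\<Sum>s<d. p j k s z*p i s l z) = (if i = j then p i k l z else 0)" if "i<m" "j<m" "k<d" "l<d" for i j k l
 proof -
  have "(\<Sum>s<d. p j k s z*p i s l z) = (\<Sum>t<d. Gi (%_. 1) k t z*(\<Sum>s<d. b j t s z*p i s l z))" by (subst (1) p_def) (rule sum_mult_assoc)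
  also have "... = (\<Sum>t<d. Gi (%_. 1) k t z*(if i = j then b i t l z else 0))" using that p2 p3 by (intro sum.cong) auto
  finally show ?thesis by (auto simp: p_def)
 qed
qed

lemma trace_b:
 assumes A: "pos A" and z: "z \<in> T" and i: "i<m"
 shows "(\<Sum>k<d. \<Sum>l<d. Gi A k l z*b i l k z) = real (r i)/A i"
proof -
 have "A i*(\<Sum>k<d. \<Sum>l<d. Gi A k l z*b i l k z) = real (r i)" using projectors(4)[OF z A i] projectors(6)[OF z i] by (simp add: sum_distrib_left)
 moreover have "A i ~= 0" using A i by (auto simp: pos_def)
 ultimately show ?thesis by (simp add: field_simps)
qed

lemma trace_G:
 assumes A: "pos A" and z: "z \<in> T"
 shows "(\<Sum>k<d. \<Sum>l<d. Gi A k l z*G c l k z) = (\<Sum>i<m. c i*real (r i)/A i)"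
proof -
 have "(\<Sum>k<d. \<Sum>l<d. Gi A k l z*G c l k z) = (\<Sum>k<d. \<Sum>l<d. \<Sum>i<m. c i*(Gi A k l z*b i l k z))"
  unfolding G_def[of c] by (simp add: sum_distrib_left sum_distrib_right mult_ac)
 also have "... = (\<Sum>i<m. \<Sum>k<d. \<Sum>l<d. c i*(Gi A k l z*b i l k z))" by (rule sum_rotate[symmetric])
 also have "... = (\<Sum>i<m. c i*real (r i)/A i)" using trace_b[OF A z] by (simp flip: sum_distrib_left)
 finally show ?thesis .
qed

text \<open>\<open>p i\<close> is self-adjoint, so the inverse metric is block diagonal.\<close>

lemma p_self:
 assumes A: "pos A" and z: "z \<in> T" and i: "i<m" and s: "s<d" and l: "l<d"
 shows "(\<Sum>t<d. Gi A s t z*p i l t z) = (\<Sum>t<d. p i s t z*Gi A t l z)"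
proof -
 have "(\<Sum>t<d. Gi A s t z*p i l t z) = (\<Sum>t<d. A i*(\<Sum>u<d. Gi A l u z*b i u t z)*Gi A t s z)"
  using projectors(4)[OF z A i l] s by (intro sum.cong) (auto simp: Gi_sym[OF A z, of s])
 also have "... = A i*(\<Sum>u<d. Gi A l u z*(\<Sum>t<d. b i u t z*Gi A t s z))" by (simp add: mult.assoc sum_mult_assoc flip: sum_distrib_left)
 also have "(\<Sum>u<d. Gi A l u z*(\<Sum>t<d. b i u t z*Gi A t s z)) = (\<Sum>u<d. \<Sum>t<d. Gi A s t z*b i t u z*Gi A u l z)" unfolding sum_distrib_left
 proof (intro sum.cong refl)
  fix u t assume "u \<in> {..<d}" "t \<in> {..<d}"
  then show "Gi A l u z*(b i u t z*Gi A t s z) = Gi A s t z*b i t u z*Gi A u l z"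
   using Gi_sym[OF A z, of l u] Gi_sym[OF A z, of t s] b_sym[OF i, of u t z] l s z by simp
 qed
 also have "A i*... = (\<Sum>u<d. (A i*(\<Sum>t<d. Gi A s t z*b i t u z))*Gi A u l z)" by (simp add: sum_distrib_left sum_distrib_right mult.assoc)
 also have "... = (\<Sum>u<d. p i s u z*Gi A u l z)" using projectors(4)[OF z A i s] by (intro sum.cong) auto
 finally show ?thesis .
qed

lemma p_Gi_p:
 assumes A: "pos A" and z: "z \<in> T" and i: "i<m" and kl: "k<d" "l<d"
 shows "(\<Sum>s<d. \<Sum>t<d. p i k s z*(Gi A s t z*p i l t z)) = (\<Sum>t<d. p i k t z*Gi A t l z)"
proof -
 have "(\<Sum>s<d. \<Sum>t<d. p i k s z*(Gi A s t z*p i l t z)) = (\<Sum>s<d. p i k s z*(\<Sum>t<d. p i s t z*Gi A t l z))"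
  using p_self[OF A z i _ kl(2)] by (simp flip: sum_distrib_left)
 also have "... = (\<Sum>t<d. (\<Sum>s<d. p i k s z*p i s t z)*Gi A t l z)" by (rule sum_mult_assoc[symmetric])
 also have "... = (\<Sum>t<d. p i k t z*Gi A t l z)" using projectors(5)[OF z i i kl(1)] by (intro sum.cong) auto
 finally show ?thesis .
qed

lemma Gi_blocks:
 assumes A: "pos A" and z: "z \<in> T" and kl: "k<d" "l<d"
 shows "Gi A k l z = (\<Sum>i<m. \<Sum>s<d. \<Sum>t<d. p i k s z*(Gi A s t z*p i l t z))"
proof -
 have "(\<Sum>i<m. \<Sum>s<d. \<Sum>t<d. p i k s z*(Gi A s t z*p i l t z)) = (\<Sum>i<m. \<Sum>t<d. p i k t z*Gi A t l z)"
  by (rule sum.cong[OF refl], rule p_Gi_p[OF A z _ kl]) simp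
 also have "... = (\<Sum>t<d. (\<Sum>i<m. p i k t z)*Gi A t l z)" unfolding sum_distrib_right by (rule sum.swap)
 also have "... = (\<Sum>t<d. (if k = t then 1 else 0)*Gi A t l z)" using projectors(1)[OF z kl(1)] by (intro sum.cong) auto
 also have "... = Gi A k l z" using kl by (intro sum_delta_left) auto
 finally show ?thesis by simp
qed

text \<open>On the image of \<open>p i\<close> the metric is \<open>A i\<close> times the one for
  unit weights, so the factor \<open>A i\<close> undoes the scaling of this block of the
  inverse.\<close>

lemma p_scale:
 assumes A: "pos A" and z: "z \<in> T" and i: "i<m" and kl: "k<d" "l<d"
 shows "A i*(\<Sum>t<d. p i k t z*Gi A t l z) = (\<Sum>t<d. p i k t z*Gi (%_. 1) t l z)"
proof -
 have "(\<Sum>t<d. p i k t z*Gi (%_. 1) t l z) = A i*(\<Sum>t<d. (\<Sum>s<d. Gi A k s z*b i s t z)*Gi (%_. 1) t l z)"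
  using projectors(4)[OF z A i kl(1)] by (simp add: sum_distrib_left mult.assoc[symmetric])
 also have "... = A i*(\<Sum>s<d. Gi A k s z*(\<Sum>t<d. b i s t z*Gi (%_. 1) t l z))" by (simp add: sum_mult_assoc)
 also have "... = A i*(\<Sum>s<d. Gi A k s z*p i l s z)"
 proof -
  have "(\<Sum>t<d. b i s t z*Gi (%_. 1) t l z) = p i l s z" if s: "s<d" for s unfolding p_def
  proof (rule sum.cong[OF refl])
   fix t assume "t \<in> {..<d}"
   then show "b i s t z*Gi (%_. 1) t l z = Gi (%_. 1) l t z*b i t s z" using Gi_sym[OF pos_1 z _ kl(2), of t] b_sym[OF i s _ z, of t] by simp
  qed
  then show ?thesis by simp
 qed
 finally show ?thesis using p_self[OF A z i kl] by simp
qed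

text \<open>The normalisation in Construction One gives the Ricci form only as a quadratic form on
  each summand, and nothing between different summands. This is enough for the trace: the inverse
  metric is block diagonal, and being symmetric it sees only the symmetric part of each diagonal
  block, which the quadratic form determines.\<close>

lemma trace_block_form:
 assumes A: "pos A" and z: "z \<in> T"
  and R: "!!i v. i<m ==> (!!j k. j<m ==> j ~= i ==> k<d ==> (\<Sum>l<d. b j k l z * v l) = 0) ==> 
   (\<Sum>k<d. \<Sum>l<d. R k l*(v k * v l)) = (\<Sum>k<d. \<Sum>l<d. b i k l z*(v k * v l))"
 shows "(\<Sum>k<d. \<Sum>l<d. Gi A k l z*R k l) = (\<Sum>i<m. real (r i)/A i)"
proof -
 define U where "U i s t = (\<Sum>k<d. \<Sum>l<d. R k l*(p i k s z*p i l t z))" for i s t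
 have quad: "(\<Sum>s<d. \<Sum>t<d. U i s t*(v s * v t)) = (\<Sum>k<d. \<Sum>l<d. b i k l z*(v k * v l))" if i: "i<m" for i v
 proof -
  define u where "u k = (\<Sum>s<d. p i k s z * v s)" for k
  have "(\<Sum>k<d. \<Sum>l<d. M k l*(u k*u l)) = (\<Sum>s<d. \<Sum>t<d. (\<Sum>k<d. \<Sum>l<d. M k l*(p i k s z*p i l t z))*(v s * v t))" for M
  proof -
   have "(\<Sum>k<d. \<Sum>l<d. M k l*(u k*u l)) = (\<Sum>k<d. \<Sum>l<d. \<Sum>s<d. \<Sum>t<d. M k l*(p i k s z*p i l t z)*(v s * v t))"
    unfolding u_def sum_product by (simp add: sum_distrib_left mult_ac)
   also have "... = (\<Sum>s<d. \<Sum>t<d. \<Sum>k<d. \<Sum>l<d. M k l*(p i k s z*p i l t z)*(v s * v t))" by (rule sum_swap22)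
   finally show ?thesis by (simp add: sum_distrib_right)
  qed
  note sub = this
  have bu: "(\<Sum>l<d. b j k l z*u l) = (if j = i then (\<Sum>l<d. b i k l z * v l) else 0)" if "j<m" "k<d" for j k
  proof -
   have "(\<Sum>l<d. b j k l z*u l) = (\<Sum>s<d. (\<Sum>l<d. b j k l z*p i l s z) * v s)" unfolding u_def by (rule sum_mult_assoc[symmetric])
   then show ?thesis using projectors(2)[OF z i that(1,2)] projectors(3)[OF z i that(2)] by auto
  qed
  have "(\<Sum>s<d. \<Sum>t<d. U i s t*(v s * v t)) = (\<Sum>k<d. \<Sum>l<d. R k l*(u k*u l))" unfolding U_def sub ..
  also have "... = (\<Sum>k<d. \<Sum>l<d. b i k l z*(u k*u l))" by (rule R[OF i]) (simp add: bu)
  also have "... = (\<Sum>k<d. u k*(\<Sum>l<d. b i k l z*u l))" by (simp add: sum_distrib_left mult_ac)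
  also have "... = (\<Sum>k<d. u k*(\<Sum>l<d. b i k l z * v l))" using bu[OF i] by simp
  also have "... = (\<Sum>k<d. \<Sum>l<d. v l*(b i l k z*u k))" unfolding sum_distrib_left using b_sym[OF i _ _ z] by (intro sum.cong refl) auto
  also have "... = (\<Sum>l<d. v l*(\<Sum>k<d. b i l k z*u k))" unfolding sum_distrib_left by (rule sum.swap)
  also have "... = (\<Sum>l<d. v l*(\<Sum>k<d. b i l k z * v k))" using bu[OF i] by simp
  finally show ?thesis by (simp add: sum_distrib_left mult_ac)
 qed
 \<comment> \<open>Polarisation on the vector e_s + e_t, the case s = t included.\<close>
 have polar: "U i s t + U i t s = 2*b i s t z" if i: "i<m" and st: "s<d" "t<d" for i s t
 proof -
  have e: "(\<Sum>k<d. \<Sum>l<d. M k l*(v k * v l)) = M s s + M s t + M t s + M t t"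
   if "s<d" "t<d" "v = (%k. (if k = s then 1 else 0) + (if k = t then 1 else 0))" for M :: "nat => nat => real" and v s t
  proof -
   have "(\<Sum>k<d. f k * v k) = f s + f t" for f using that by (simp add: distrib_left sum.distrib sum_delta_right)
   then have "(\<Sum>k<d. (\<Sum>l<d. M k l * v l) * v k) = M s s + M s t + M t s + M t t" by simp
   then show ?thesis by (simp add: sum_distrib_right sum_distrib_left mult_ac)
  qed
  have q: "U i s s + U i s t + U i t s + U i t t = b i s s z + b i s t z + b i t s z + b i t t z" if "s<d" "t<d" for s t
   using quad[OF i, of "%k. (if k = s then 1 else 0) + (if k = t then 1 else 0)"] by (simp only: e[OF that refl])
  show ?thesis using q[OF st] q[OF st(1,1)] q[OF st(2,2)] b_sym[OF i st z] by simp
 qed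
 have "(\<Sum>k<d. \<Sum>l<d. Gi A k l z*R k l) = (\<Sum>k<d. \<Sum>l<d. \<Sum>i<m. \<Sum>s<d. \<Sum>t<d. Gi A s t z*(R k l*(p i k s z*p i l t z)))"
  using Gi_blocks[OF A z] by (intro sum.cong refl) (simp add: sum_distrib_right sum_distrib_left mult_ac)
 also have "... = (\<Sum>i<m. \<Sum>s<d. \<Sum>t<d. \<Sum>k<d. \<Sum>l<d. Gi A s t z*(R k l*(p i k s z*p i l t z)))" by (rule trans[OF sum_rotate[symmetric] sum.cong[OF refl sum_swap22]])
 also have "... = (\<Sum>i<m. \<Sum>s<d. \<Sum>t<d. Gi A s t z*U i s t)" by (simp add: U_def sum_distrib_left)
 also have "... = (\<Sum>i<m. \<Sum>s<d. \<Sum>t<d. Gi A s t z*b i t s z)"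
 proof (rule sum.cong[OF refl])
  fix i assume "i \<in> {..<m}" then have i: "i<m" by simp
  have "(\<Sum>s<d. \<Sum>t<d. Gi A s t z*U i s t) = (\<Sum>s<d. \<Sum>t<d. Gi A t s z*U i t s)" by (rule sum.swap)
  also have "... = (\<Sum>s<d. \<Sum>t<d. Gi A s t z*U i t s)" by (intro sum.cong refl) (auto simp: Gi_sym[OF A z])
  finally have "2*(\<Sum>s<d. \<Sum>t<d. Gi A s t z*U i s t) = (\<Sum>s<d. \<Sum>t<d. Gi A s t z*(U i s t + U i t s))" by (simp add: distrib_left sum.distrib)
  also have "... = (\<Sum>s<d. \<Sum>t<d. 2*(Gi A s t z*b i t s z))" using polar[OF i] b_sym[OF i _ _ z] by (intro sum.cong refl) auto
  finally show "(\<Sum>s<d. \<Sum>t<d. Gi A s t z*U i s t) = (\<Sum>s<d. \<Sum>t<d. Gi A s t z*b i t s z)" by (simp flip: sum_distrib_left)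
 qed
 also have "... = (\<Sum>i<m. real (r i)/A i)" using trace_b[OF A z] by simp
 finally show ?thesis .
qed

end

text \<open>Here \<open>T i\<close> stands for the derivative in direction i of a metric Hermitian
  for \<open>J\<close>, taken with a symmetric connection preserving \<open>J\<close>, and
  \<open>cyc\<close> for closedness of its Kaehler form. The conclusion is the algebra by which the
  difference to the Levi-Civita connection of that metric commutes with \<open>J\<close>.\<close>

lemma hermitian_cyclic:
 fixes J :: "nat => nat => real" and T :: "nat => nat => nat => real" and d :: nat
 defines "Jd \<equiv> %f j. \<Sum>s<d. J s j*f s"
 assumes JJ: "!!k l. k<d ==> l<d ==> (\<Sum>s<d. J k s * J s l) = (if k = l then -1 else 0)"
  and sym: "!!i j k. i<d ==> j<d ==> k<d ==> T i j k = T i k j"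
  and herm: "!!i j k. i<d ==> j<d ==> k<d ==> Jd (%j. T i j k) j = - Jd (%k. T i j k) k"
  and cyc: "!!i j k. i<d ==> j<d ==> k<d ==>  Jd (%j. T i j k) j + Jd (%k. T j k i) k + Jd (%i. T k i j) i = 0"
  and ijk: "i<d" "j<d" "k<d"
 shows "Jd (%s. T s i k) j - Jd (%s. T k i s) j + Jd (%t. T j i t) k - Jd (%t. T t i j) k = 0"
proof -
 have JdJd: "Jd (%s. Jd f s) j = - f j" if "j<d" for f j
 proof -
  have "Jd (%s. Jd f s) j = (\<Sum>s<d. (\<Sum>t<d. f t*J t s)*J s j)" unfolding Jd_def by (simp add: mult_ac)
  also have "... = (\<Sum>t<d. f t*(\<Sum>s<d. J t s * J s j))" by (rule sum_mult_assoc)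
  also have "... = (\<Sum>t<d. - f t*(if t = j then 1 else 0))" using JJ that by (intro sum.cong) auto
  also have "... = - f j" using that by (intro sum_delta_right) auto
  finally show ?thesis .
 qed
 have Jcong: "Jd f j = Jd f' j" if "!!s. s<d ==> f s = f' s" for f f' j unfolding Jd_def using that by (intro sum.cong) auto
 have Jadd: "Jd (%s. f s + f' s) j = Jd f j + Jd f' j" and Jdiff: "Jd (%s. f s - f' s) j = Jd f j - Jd f' j" and Jneg: "Jd (%s. - f s) j = - Jd f j" and J0: "Jd (%s. 0) j = 0" for f f' j
  unfolding Jd_def by (simp_all add: distrib_left right_diff_distrib sum.distrib sum_subtractf sum_negf)
 have Jswap: "Jd (%t. Jd (%s. f s t) j) k = Jd (%s. Jd (%t. f s t) k) j" for f j k
  unfolding Jd_def sum_distrib_left by (subst sum.swap) (simp add: mult_ac)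
 \<comment> \<open>The cyclic identity, contracted with \<open>J\<close> in its second and third
   slots; \<open>JdJd\<close> then removes the double applications.\<close>
 have "Jd (%t. Jd (%s. Jd (%j. T i j t) s + Jd (%k. T s k i) t + - Jd (%j. T t i j) s) j) k = Jd (%t. Jd (%s. 0) j) k"
  using cyc[OF ijk(1)] herm ijk by (intro Jcong) simp
 then have "Jd (%t. - T i j t) k + Jd (%s. - T s k i) j + Jd (%t. T t i j) k = 0"
  using ijk by (simp add: Jadd Jneg Jdiff J0 JdJd Jswap[of "%s t. Jd (%k. T s k i) t"])
 moreover have "Jd (%s. T s k i) j = Jd (%s. T s i k) j" using sym ijk by (intro Jcong) auto
 moreover have "Jd (%k. T j k i) k = Jd (%t. T j i t) k" using sym ijk by (intro Jcong) auto
 ultimately show ?thesis using cyc[OF ijk] herm[OF ijk] herm[of k i j] ijk by (simp add: Jneg)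
qed

lemma sum_mult_swap: "(\<Sum>k\<in>K. a k*(\<Sum>l\<in>L. b l*f l k)) = (\<Sum>l\<in>L. b l*(\<Sum>k\<in>K. f l k*(a k :: real)))"
 unfolding sum_distrib_left by (subst sum.swap) (simp add: mult_ac)

lemma nondegenerateD:
 assumes "nondegenerate n A" "!!i. i<n ==> (\<Sum>k<n. A i k * v k) = 0" "k<n"
 shows "v k = 0" using assms unfolding nondegenerate_def by (elim allE[of _ v]) simp

section \<open>Closed Kaehler forms and parallel complex structures\<close>

context split_metric
begin

abbreviation \<Gamma> :: "(nat => real) => nat => nat => nat => rfun" where "\<Gamma> A k i j \<equiv> christoffel_loc d (G A) k i j"

text \<open>The components of the Kaehler form of \<open>G A\<close>, with the convention of
  \<open>kahler_form\<close>.\<close>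

definition w :: "(nat => real) => nat => nat => rfun" where "w A k l z = (\<Sum>s<d. J s k z*G A s l z)"

definition closed :: "(nat => real) => bool" where "closed A \<longleftrightarrow> (\<forall>z\<in>T. \<forall>i<d. \<forall>j<d. \<forall>k<d. pd i (w A j k) z + pd j (w A k i) z + pd k (w A i j) z = 0)"

definition parallel :: "(nat => real) => bool" where "parallel A \<longleftrightarrow> (\<forall>z\<in>T. \<forall>i<d. \<forall>j<d. \<forall>k<d. parallel_loc d (\<Gamma> A) J i k j z = 0)"

lemma w_antisym: "k<d ==> l<d ==> z \<in> T ==> w A k l z = - w A l k z" unfolding w_def by (rule G_J)

lemma Cinf_w: "k<d ==> l<d ==> Cinf_on d T (w A k l)" unfolding w_def[abs_def] by (intro Cinf_on_sum[OF T] Cinf_on_mult[OF T] J Cinf_G) auto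

lemma G_affine: "G (%i. \<alpha>*A i + \<beta>*B i) k l z = \<alpha>*G A k l z + \<beta>*G B k l z"
 by (simp add: G_def sum.distrib distrib_right sum_distrib_left mult.assoc)

lemma w_affine: "w (%i. \<alpha>*A i + \<beta>*B i) k l z = \<alpha>*w A k l z + \<beta>*w B k l z"
 by (simp add: w_def G_affine sum.distrib distrib_left sum_distrib_left mult_ac)

text \<open>The Kaehler form is linear in the weights, whereas the Christoffel symbols in
  \<open>parallel\<close> are not; this is the reason for passing through closedness.\<close>

lemma closed_affine:
 assumes "closed A" "closed B"
 shows "closed (%i. \<alpha>*A i + \<beta>*B i)"
proof -
 have "pd i (w (%i. \<alpha>*A i + \<beta>*B i) k l) z = \<alpha>*pd i (w A k l) z + \<beta>*pd i (w B k l) z" if "z \<in> T" "i<d" "k<d" "l<d" for i k l z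
 proof -
  have "w (%i. \<alpha>*A i + \<beta>*B i) k l = (%z. \<alpha>*w A k l z + \<beta>*w B k l z)" by (intro ext w_affine)
  then show ?thesis using that by (simp add: partial_deriv_add[OF T] partial_deriv_cmult[OF T] Cinf_w Cinf_on_mult[OF T] Cinf_on_const[OF T])
 qed
 moreover have "\<alpha>*a + \<beta>*b + (\<alpha>*a' + \<beta>*b') + (\<alpha>*a'' + \<beta>*b'') = \<alpha>*(a + a' + a'') + \<beta>*(b + b' + b'')"
  for a a' a'' b b' b'' by (simp add: algebra_simps)
 ultimately show ?thesis using assms unfolding closed_def by simp
qed

lemma parallel_deriv:
 assumes "parallel A" "z \<in> T" "i<d" "j<d" "k<d"
 shows "pd i (J k j) z = (\<Sum>l<d. \<Gamma> A l i j z*J k l z) - (\<Sum>l<d. \<Gamma> A k i l z*J l j z)"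
proof -
 have "parallel_loc d (\<Gamma> A) J i k j z = 0" using assms by (simp add: parallel_def)
 then show ?thesis by (simp add: parallel_loc_def sum_subtractf)
qed

lemma metric_deriv:
 assumes "pos A" "z \<in> T" "i<d" "j<d" "k<d"
 shows "pd i (G A j k) z = (\<Sum>l<d. \<Gamma> A l i j z*G A l k z) + (\<Sum>l<d. \<Gamma> A l i k z*G A j l z)"
 using christoffel_loc_compatible[OF T Cinf_G G_sym G_nd[OF assms(1)] assms(4,5,3,2)] by (simp add: sum.distrib)

lemma \<Gamma>_sym:
 assumes "i<d" "j<d" "z \<in> T"
 shows "\<Gamma> A k i j z = \<Gamma> A k j i z"
proof -
 have "pd l (G A i j) z = pd l (G A j i) z" if "l<d" for l by (rule partial_deriv_cong[OF T G_sym assms(3) that]) (use assms in auto)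
 then show ?thesis unfolding christoffel_loc_def by (intro arg_cong2[of _ _ _ _ "(/)"] sum.cong) auto
qed

text \<open>\<open>X\<close> stands for the covariant derivative of \<open>G A\<close> with respect
  to the connection of \<open>B\<close>. Since that connection preserves \<open>J\<close>, the
  covariant derivative of the Kaehler form is \<open>X\<close> composed with
  \<open>J\<close>.\<close>

lemma w_deriv:
 assumes P: "parallel B" and a: "z \<in> T" "i<d" "j<d" "k<d"
  and X: "!!s. s<d ==> pd i (G A s k) z = X s + (\<Sum>l<d. \<Gamma> B l i s z*G A l k z) + (\<Sum>l<d. \<Gamma> B l i k z*G A s l z)"
 shows "pd i (w A j k) z = (\<Sum>s<d. J s j z*X s) + (\<Sum>l<d. \<Gamma> B l i j z*w A l k z) + (\<Sum>l<d. \<Gamma> B l i k z*w A j l z)"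
proof -
 have "pd i (w A j k) z = (\<Sum>s<d. pd i (J s j) z*G A s k z + J s j z*pd i (G A s k) z)"
  unfolding w_def[abs_def] using a by (subst partial_deriv_sum[OF T a(2,1)])
   (auto intro!: Cinf_on_mult[OF T] J Cinf_G sum.cong partial_deriv_mult[OF T a(2,1)])
 also have "... = (\<Sum>s<d. (\<Sum>l<d. \<Gamma> B l i j z*J s l z)*G A s k z) - (\<Sum>s<d. (\<Sum>l<d. \<Gamma> B s i l z*J l j z)*G A s k z)
   + ((\<Sum>s<d. J s j z*X s) + (\<Sum>s<d. J s j z*(\<Sum>l<d. \<Gamma> B l i s z*G A l k z)) + (\<Sum>s<d. J s j z*(\<Sum>l<d. \<Gamma> B l i k z*G A s l z)))"
  using a by (simp add: X parallel_deriv[OF P] sum.distrib sum_subtractf left_diff_distrib distrib_left)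
 also have "(\<Sum>s<d. (\<Sum>l<d. \<Gamma> B l i j z*J s l z)*G A s k z) = (\<Sum>l<d. \<Gamma> B l i j z*w A l k z)" unfolding w_def by (rule sum_mult_assoc)
 also have "(\<Sum>s<d. (\<Sum>l<d. \<Gamma> B s i l z*J l j z)*G A s k z) = (\<Sum>s<d. J s j z*(\<Sum>l<d. \<Gamma> B l i s z*G A l k z))"
  by (subst sum_mult_assoc[symmetric]) (simp add: mult_ac)
 also have "(\<Sum>s<d. J s j z*(\<Sum>l<d. \<Gamma> B l i k z*G A s l z)) = (\<Sum>l<d. \<Gamma> B l i k z*w A j l z)"
  unfolding w_def sum_distrib_left by (subst sum.swap) (simp add: mult_ac)
 finally show ?thesis by simp
qed

text \<open>For a symmetric connection the cyclic sum of partial derivatives of a 2-form is that of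
  its covariant derivatives, and these vanish.\<close>

lemma parallel_imp_closed:
 assumes A: "pos A" and P: "parallel A"
 shows "closed A" unfolding closed_def
proof (intro ballI allI impI)
 fix z i j k assume a: "z \<in> T" "i<d" "j<d" "k<d"
 have D: "pd i (w A j k) z = (\<Sum>l<d. \<Gamma> A l i j z*w A l k z) + (\<Sum>l<d. \<Gamma> A l i k z*w A j l z)" if "i<d" "j<d" "k<d" for i j k
  using w_deriv[OF P a(1) that, of A "%_. 0"] metric_deriv[OF A a(1)] that by simp
 have "(\<Sum>l<d. \<Gamma> A l i j z*w A l k z) = - (\<Sum>l<d. \<Gamma> A l j i z*w A k l z)" if "i<d" "j<d" "k<d" for i j k unfolding sum_negf[symmetric]
 proof (rule sum.cong[OF refl])
  fix l assume "l \<in> {..<d}"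
  then show "\<Gamma> A l i j z*w A l k z = - (\<Gamma> A l j i z*w A k l z)"
   using \<Gamma>_sym[OF that(1,2) a(1), of A l] w_antisym[OF _ that(3) a(1), of l A] by simp
 qed
 then show "pd i (w A j k) z + pd j (w A k i) z + pd k (w A i j) z = 0" using a by (simp add: D)
qed

end

context split_metric
begin

text \<open>A closed Kaehler form alone does not make \<open>J\<close> parallel; integrability of
  \<open>J\<close> is needed as well. It is supplied by the weights \<open>A\<close>, for which
  \<open>J\<close> is parallel, and derivatives are therefore compared with the connection of
  \<open>A\<close>.\<close>

lemma closed_imp_parallel:
 assumes A: "pos A" and PA: "parallel A" and B: "pos B" and cB: "closed B"
 shows "parallel B" unfolding parallel_def
proof (intro ballI allI impI)
 fix z i j k assume z: "z \<in> T" and i: "i<d" and j: "j<d" and k: "k<d"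
 \<comment> \<open>\<open>U\<close> is the covariant derivative of \<open>G B\<close> for the
   connection of \<open>A\<close>, and \<open>C\<close> the difference of the two
   connections.\<close>
 define U where "U i j k = pd i (G B j k) z - (\<Sum>l<d. \<Gamma> A l i j z*G B l k z) - (\<Sum>l<d. \<Gamma> A l i k z*G B j l z)" for i j k
 define C where "C l i j = \<Gamma> B l i j z - \<Gamma> A l i j z" for l i j
 have G_swap: "(\<Sum>l<d. f l*G B k l z) = (\<Sum>l<d. f l*G B l k z)" if "k<d" for f k using that z by (intro sum.cong) (auto simp: G_sym[of k])
 have U_sym: "U i j k = U i k j" if "i<d" "j<d" "k<d" for i j k
 proof -
  have "pd i (G B j k) z = pd i (G B k j) z" by (rule partial_deriv_cong[OF T G_sym z that(1)]) (use that in auto)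
  then show ?thesis using G_swap[OF that(3), of "%l. \<Gamma> A l i j z"] G_swap[OF that(2), of "%l. \<Gamma> A l i k z"] by (simp add: U_def)
 qed
 have dG: "pd i (G B s k) z = U i s k + (\<Sum>l<d. \<Gamma> A l i s z*G B l k z) + (\<Sum>l<d. \<Gamma> A l i k z*G B s l z)" for i s k by (simp add: U_def)
 have dw: "pd i (w B j k) z = (\<Sum>s<d. J s j z*U i s k) +
   (\<Sum>l<d. \<Gamma> A l i j z*w B l k z) + (\<Sum>l<d. \<Gamma> A l i k z*w B j l z)" if "i<d" "j<d" "k<d" for i j k by (rule w_deriv[OF PA z that]) (rule dG)
 have \<Gamma>w: "(\<Sum>l<d. \<Gamma> A l i j z*w B l k z) = - (\<Sum>l<d. \<Gamma> A l j i z*w B k l z)" if "i<d" "j<d" "k<d" for i j k unfolding sum_negf[symmetric]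
 proof (rule sum.cong[OF refl])
  fix l assume "l \<in> {..<d}"
  then show "\<Gamma> A l i j z*w B l k z = - (\<Gamma> A l j i z*w B k l z)" using \<Gamma>_sym[OF that(1,2) z, of A l] w_antisym[OF _ that(3) z, of l B] by simp
 qed
 have cyc: "(\<Sum>s<d. J s j z*U i s k) + (\<Sum>s<d. J s k z*U j s i) + (\<Sum>s<d. J s i z*U k s j) = 0" if "i<d" "j<d" "k<d" for i j k
 proof -
  have "pd i (w B j k) z + pd j (w B k i) z + pd k (w B i j) z = 0" using cB z that by (simp add: closed_def)
  then show ?thesis using that \<Gamma>w[OF that] \<Gamma>w[OF that(2,3,1)] \<Gamma>w[OF that(3,1,2)] by (simp add: dw)
 qed
 have herm: "(\<Sum>s<d. J s j z*U i s k) = - (\<Sum>s<d. J s k z*U i j s)" if ijk: "i<d" "j<d" "k<d" for i j k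
 proof -
  have "pd i (w B j k) z = pd i (%z. - w B k j z) z" by (rule partial_deriv_cong[OF T w_antisym z ijk(1)]) (use ijk in auto)
  also have "... = - pd i (w B k j) z" using ijk by (intro partial_deriv_uminus[OF T _ z]) (auto intro: Cinf_w)
  finally have "(\<Sum>s<d. J s j z*U i s k) = - (\<Sum>s<d. J s k z*U i s j) - (\<Sum>l<d. \<Gamma> A l i k z*w B l j z) - (\<Sum>l<d. \<Gamma> A l i j z*w B k l z)
    - (\<Sum>l<d. \<Gamma> A l i j z*w B l k z) - (\<Sum>l<d. \<Gamma> A l i k z*w B j l z)" using dw ijk by simp
  moreover have "(\<Sum>l<d. f l*w B l k z) = - (\<Sum>l<d. f l*w B k l z)" if "k<d" for f k
   unfolding sum_negf[symmetric] using w_antisym[OF _ that z] by (intro sum.cong) auto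
  moreover have "(\<Sum>s<d. J s k z*U i s j) = (\<Sum>s<d. J s k z*U i j s)" using U_sym ijk by (intro sum.cong) auto
  ultimately show ?thesis using ijk by simp
 qed
 \<comment> \<open>The Koszul formula with covariant derivatives for \<open>A\<close> in place of
   partial derivatives.\<close>
 have low: "2*(\<Sum>l<d. C l i j*G B l k z) = U i j k + U j i k - U k i j" if ijk: "i<d" "j<d" "k<d" for i j k
 proof -
  have "(\<Sum>l<d. \<Gamma> B l i j z*G B l k z) = (\<Sum>l<d. G B k l z*\<Gamma> B l i j z)" using G_swap[OF ijk(3), of "%l. \<Gamma> B l i j z"] by (simp add: mult.commute)
  also have "... = (pd i (G B j k) z + pd j (G B i k) z - pd k (G B i j) z)/2" by (rule christoffel_loc_lower[OF T Cinf_G G_sym G_nd[OF B] ijk z])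
  finally have "2*(\<Sum>l<d. C l i j*G B l k z) = pd i (G B j k) z + pd j (G B i k) z - pd k (G B i j) z - 2*(\<Sum>l<d. \<Gamma> A l i j z*G B l k z)"
   by (simp add: C_def left_diff_distrib sum_subtractf)
  moreover have tf: "(\<Sum>l<d. \<Gamma> A l j i z*f l) = (\<Sum>l<d. \<Gamma> A l i j z*f l)" if "i<d" "j<d" for i j f using \<Gamma>_sym[OF that z, of A] by simp
  ultimately show ?thesis using tf[OF ijk(1,2), of "%l. G B l k z"] tf[OF ijk(1,3), of "%l. G B l j z"] tf[OF ijk(2,3), of "%l. G B i l z"]
    G_swap[OF ijk(2), of "%l. \<Gamma> A l i k z"] by (simp add: U_def)
 qed
 \<comment> \<open>As \<open>J\<close> is parallel for \<open>A\<close>, its covariant derivative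
   for \<open>B\<close> is the commutator of \<open>C\<close> with \<open>J\<close>.\<close>
 let ?N = "%k. (\<Sum>l<d. C k i l*J l j z) - (\<Sum>l<d. C l i j*J k l z)"
 have N: "(\<Sum>q<d. G B m q z*?N q) = 0" if m: "m<d" for m
 proof -
  have "(\<Sum>q<d. G B m q z*(\<Sum>l<d. C q i l*J l j z)) = (\<Sum>l<d. (\<Sum>q<d. C q i l*G B q m z)*J l j z)"
   using G_swap[OF m] by (subst sum_mult_assoc[symmetric]) (simp add: mult.commute)
  moreover have "(\<Sum>q<d. G B m q z*(\<Sum>l<d. C l i j*J q l z)) = - (\<Sum>q<d. J q m z*(\<Sum>l<d. C l i j*G B l q z))"
  proof -
   have "(\<Sum>q<d. G B m q z*(\<Sum>l<d. C l i j*J q l z)) = (\<Sum>l<d. C l i j*(\<Sum>q<d. J q l z*G B m q z))"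
    unfolding sum_distrib_left by (subst sum.swap) (simp add: mult_ac)
   also have "... = (\<Sum>l<d. C l i j*- (\<Sum>q<d. J q m z*G B q l z))" using G_J[OF _ m z] G_swap[OF m] by (intro sum.cong) auto
   also have "... = - (\<Sum>q<d. J q m z*(\<Sum>l<d. C l i j*G B q l z))"
    unfolding mult_minus_right sum_negf unfolding sum_distrib_left by (subst sum.swap) (simp add: mult_ac)
   also have "(\<Sum>q<d. J q m z*(\<Sum>l<d. C l i j*G B q l z)) = (\<Sum>q<d. J q m z*(\<Sum>l<d. C l i j*G B l q z))" using G_swap by (intro sum.cong) auto
   finally show ?thesis .
  qed
  ultimately have "2*(\<Sum>q<d. G B m q z*?N q) =
    (\<Sum>l<d. J l j z*(2*(\<Sum>q<d. C q i l*G B q m z))) + (\<Sum>q<d. J q m z*(2*(\<Sum>l<d. C l i j*G B l q z)))"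
   by (simp add: right_diff_distrib sum_subtractf sum_distrib_left mult_ac)
  also have "... = (\<Sum>l<d. J l j z*(U i l m + U l i m - U m i l)) + (\<Sum>q<d. J q m z*(U i j q + U j i q - U q i j))" using low i j m by simp
  also have "... = ((\<Sum>l<d. J l j z*U i l m) + (\<Sum>q<d. J q m z*U i j q)) + ((\<Sum>l<d. J l j z*U l i m)
    - (\<Sum>l<d. J l j z*U m i l) + (\<Sum>q<d. J q m z*U j i q) - (\<Sum>q<d. J q m z*U q i j))"
   by (simp add: distrib_left right_diff_distrib sum.distrib sum_subtractf)
  also have "(\<Sum>l<d. J l j z*U l i m) - (\<Sum>l<d. J l j z*U m i l) + (\<Sum>q<d. J q m z*U j i q) - (\<Sum>q<d. J q m z*U q i j) = 0"
   by (rule hermitian_cyclic[where J = "%k l. J k l z" and T = U]) (rule JJ[OF _ _ z] U_sym herm cyc i j m; assumption)+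
  also have "(\<Sum>l<d. J l j z*U i l m) + (\<Sum>q<d. J q m z*U i j q) + 0 = 0" using herm[OF i j m] by linarith
  finally show ?thesis by simp
 qed
 have "?N k = 0" by (rule nondegenerateD[OF G_nd[OF B z] N k])
 moreover have "(\<Sum>l<d. C k i l*J l j z) = (\<Sum>l<d. \<Gamma> B k i l z*J l j z) - (\<Sum>l<d. \<Gamma> A k i l z*J l j z)"
  "(\<Sum>l<d. C l i j*J k l z) = (\<Sum>l<d. \<Gamma> B l i j z*J k l z) - (\<Sum>l<d. \<Gamma> A l i j z*J k l z)" by (simp_all add: C_def left_diff_distrib sum_subtractf)
 ultimately show "parallel_loc d (\<Gamma> B) J i k j z = 0" using parallel_deriv[OF PA z i j k] by (simp add: parallel_loc_def sum_subtractf)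
qed

text \<open>G^{-1} J^T is the Kaehler form with both indices raised. Its antisymmetry removes the
  trace of the Ricci difference in \<open>scalar_change\<close>.\<close>

lemma Gi_J:
 assumes A: "pos A" and z: "z \<in> T" and jt: "j<d" "t<d"
 shows "(\<Sum>k<d. Gi A j k z*J t k z) = - (\<Sum>k<d. Gi A t k z*J j k z)"
proof -
 have GJ: "(\<Sum>s<d. G A l s z*J s k z) = - (\<Sum>s<d. J s l z*G A s k z)" if "k<d" "l<d" for k l
 proof -
  have "(\<Sum>s<d. G A l s z*J s k z) = (\<Sum>s<d. J s k z*G A s l z)" using that z by (intro sum.cong) (auto simp: G_sym[of l])
  then show ?thesis using G_J[OF that z] by simp
 qed
 have "J t q z = (\<Sum>l<d. Gi A t l z*(\<Sum>s<d. G A l s z*J s q z))" if "q<d" for q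
 proof -
  have "(\<Sum>l<d. Gi A t l z*(\<Sum>s<d. G A l s z*J s q z)) = (\<Sum>s<d. (\<Sum>l<d. Gi A t l z*G A l s z)*J s q z)" by (rule sum_mult_assoc[symmetric])
  also have "... = (\<Sum>s<d. (if t = s then 1 else 0)*J s q z)" using Gi_inv(2)[OF A z jt(2)] by (intro sum.cong) auto
  also have "... = J t q z" using jt by (intro sum_delta_left) auto
  finally show ?thesis by simp
 qed
 then have "(\<Sum>k<d. Gi A j k z*J t k z) = (\<Sum>k<d. Gi A j k z*(\<Sum>l<d. Gi A t l z*- (\<Sum>s<d. J s l z*G A s k z)))" using GJ by (intro sum.cong) auto
 also have "... = - (\<Sum>l<d. Gi A t l z*(\<Sum>k<d. (\<Sum>s<d. J s l z*G A s k z)*Gi A j k z))"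
  unfolding mult_minus_right sum_negf by (simp add: sum_mult_swap)
 also have "... = - (\<Sum>l<d. Gi A t l z*(\<Sum>s<d. J s l z*(\<Sum>k<d. G A s k z*Gi A k j z)))" using Gi_sym[OF A z jt(1)] by (simp add: sum_mult_assoc)
 also have "... = - (\<Sum>l<d. Gi A t l z*(\<Sum>s<d. J s l z*(if s = j then 1 else 0)))" using Gi_inv(1)[OF A z _ jt(1)] by simp
 also have "... = - (\<Sum>l<d. Gi A t l z*J j l z)" using jt by (subst sum_delta_right) auto
 finally show ?thesis .
qed

text \<open>The logarithmic derivative of the volume density: the other two terms of the Christoffel
  symbols cancel by symmetry of the inverse metric.\<close>

lemma trace_christoffel:
 assumes A: "pos A" and z: "z \<in> T" and i: "i<d"
 shows "(\<Sum>k<d. \<Gamma> A k i k z) = (\<Sum>k<d. \<Sum>l<d. Gi A k l z*pd i (G A l k) z)/2"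
proof -
 have dG: "pd i (G A k l) z = pd i (G A l k) z" if "i<d" "k<d" "l<d" for i k l
  by (rule partial_deriv_cong[OF T G_sym z that(1)]) (use that in auto)
 have "(\<Sum>k<d. \<Gamma> A k i k z) = (\<Sum>k<d. \<Sum>l<d. Gi A k l z*(pd i (G A k l) z + pd k (G A i l) z - pd l (G A i k) z))/2"
  by (simp add: christoffel_loc_def flip: sum_divide_distrib)
 also have "(\<Sum>k<d. \<Sum>l<d. Gi A k l z*(pd i (G A k l) z + pd k (G A i l) z - pd l (G A i k) z))
  = (\<Sum>k<d. \<Sum>l<d. Gi A k l z*pd i (G A k l) z) + (\<Sum>k<d. \<Sum>l<d. Gi A k l z*pd k (G A i l) z) - (\<Sum>k<d. \<Sum>l<d. Gi A k l z*pd l (G A i k) z)"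
  by (simp add: distrib_left right_diff_distrib sum.distrib sum_subtractf)
 also have "(\<Sum>k<d. \<Sum>l<d. Gi A k l z*pd l (G A i k) z) = (\<Sum>k<d. \<Sum>l<d. Gi A k l z*pd k (G A i l) z)"
  by (subst sum.swap) (intro sum.cong refl, simp add: Gi_sym[OF A z])
 also have "(\<Sum>k<d. \<Sum>l<d. Gi A k l z*pd i (G A k l) z) = (\<Sum>k<d. \<Sum>l<d. Gi A k l z*pd i (G A l k) z)" using dG[OF i] by (intro sum.cong refl) auto
 finally show ?thesis by simp
qed

lemma Cinf_p: "i<m ==> k<d ==> l<d ==> Cinf_on d T (p i k l)"
 unfolding p_def[abs_def] by (intro Cinf_on_sum[OF T] Cinf_on_mult[OF T] Gi_smooth[OF pos_1] b) auto

text \<open>Differentiate b_j p_a = 0 and contract with p_a on the left: the other term of the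
  product rule contains b_j p_a again.\<close>

lemma cross_deriv:
 assumes z: "z \<in> T" and i: "i<d" and a: "a<m" and j: "j<m" "a ~= j" and st: "s<d" "t<d"
 shows "(\<Sum>k<d. p a k s z*(\<Sum>l<d. pd i (b j k l) z*p a l t z)) = 0"
proof -
 have d: "(\<Sum>l<d. pd i (b j k l) z*p a l t z) = - (\<Sum>l<d. b j k l z*pd i (p a l t) z)" if k: "k<d" for k
 proof -
  have "pd i (%z. \<Sum>l<d. b j k l z*p a l t z) z = pd i (%z. 0) z"
   by (rule partial_deriv_cong[OF T _ z i]) (rule projectors(2)[OF _ a j(1) k st(2) j(2)])
  moreover have "pd i (%z. \<Sum>l<d. b j k l z*p a l t z) z = (\<Sum>l<d. pd i (b j k l) z*p a l t z + b j k l z*pd i (p a l t) z)"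
   using a j st k by (subst partial_deriv_sum[OF T i z]) (auto intro!: Cinf_on_mult[OF T] b Cinf_p sum.cong partial_deriv_mult[OF T i z])
  ultimately show ?thesis by (simp add: sum.distrib partial_deriv_const add_eq_0_iff)
 qed
 have "(\<Sum>k<d. p a k s z*(\<Sum>l<d. pd i (b j k l) z*p a l t z)) = - (\<Sum>k<d. p a k s z*(\<Sum>l<d. pd i (p a l t) z*b j k l z))"
  using d by (simp add: sum_negf mult.commute)
 also have "... = - (\<Sum>l<d. pd i (p a l t) z*(\<Sum>k<d. b j k l z*p a k s z))" by (simp add: sum_mult_swap)
 also have "(\<Sum>k<d. b j k l z*p a k s z) = (\<Sum>k<d. b j l k z*p a k s z)" if "l<d" for l using b_sym[OF j(1) _ that z] by (intro sum.cong) auto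
 then have "- (\<Sum>l<d. pd i (p a l t) z*(\<Sum>k<d. b j k l z*p a k s z)) = 0" using projectors(2)[OF z a j(1) _ st(1) j(2)] by simp
 finally show ?thesis .
qed

text \<open>The right-hand side does not involve \<open>A\<close>: the derivative of b_j contributes
  only through the j-th block, where the weight A_j cancels against the inverse metric. So the
  volume densities for different weights have the same logarithmic derivatives.\<close>

lemma trace_metric_deriv:
 assumes A: "pos A" and z: "z \<in> T" and i: "i<d"
 shows "(\<Sum>k<d. \<Sum>l<d. Gi A k l z*pd i (G A l k) z) = (\<Sum>j<m. \<Sum>k<d. \<Sum>l<d. (\<Sum>t<d. p j k t z*Gi (%_. 1) t l z)*pd i (b j l k) z)"
proof -
 have dG: "pd i (G A l k) z = (\<Sum>j<m. A j*pd i (b j l k) z)" if "k<d" "l<d" for k l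
  unfolding G_def[abs_def] using that by (subst partial_deriv_sum[OF T i z])
   (auto intro!: Cinf_on_mult[OF T] Cinf_on_const[OF T] b sum.cong partial_deriv_cmult[OF T i z])
 have block: "(\<Sum>k<d. \<Sum>l<d. Gi A k l z*pd i (b j l k) z) = (\<Sum>k<d. \<Sum>l<d. (\<Sum>t<d. p j k t z*Gi A t l z)*pd i (b j l k) z)" if j: "j<m" for j
 proof -
  let ?X = "%a. \<Sum>k<d. \<Sum>l<d. (\<Sum>t<d. p a k t z*Gi A t l z)*pd i (b j l k) z"
  have "(\<Sum>k<d. \<Sum>l<d. Gi A k l z*pd i (b j l k) z) = (\<Sum>k<d. \<Sum>l<d. \<Sum>a<m. (\<Sum>t<d. p a k t z*Gi A t l z)*pd i (b j l k) z)"
  proof (rule sum.cong[OF refl], rule sum.cong[OF refl])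
   fix k l assume kl: "k \<in> {..<d}" "l \<in> {..<d}"
   then have "Gi A k l z = (\<Sum>a<m. \<Sum>t<d. p a k t z*Gi A t l z)" using Gi_blocks[OF A z, of k l] p_Gi_p[OF A z _ , of _ k l] by simp
   then show "Gi A k l z*pd i (b j l k) z = (\<Sum>a<m. (\<Sum>t<d. p a k t z*Gi A t l z)*pd i (b j l k) z)" by (simp add: sum_distrib_right)
  qed
  also have "... = (\<Sum>a<m. ?X a)" by (rule sum_rotate[symmetric])
  also have "... = (\<Sum>a<m. (if j = a then 1 else 0)*?X j)"
  proof (rule sum.cong[OF refl])
   fix a assume "a \<in> {..<m}" then have a: "a<m" by simp
   show "?X a = (if j = a then 1 else 0)*?X j"
   proof (cases "j = a")
    case False
    have "?X a = (\<Sum>k<d. \<Sum>l<d. (\<Sum>s<d. \<Sum>t<d. p a k s z*(Gi A s t z*p a l t z))*pd i (b j l k) z)" using p_Gi_p[OF A z a] by simp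
    also have "... = (\<Sum>k<d. \<Sum>l<d. \<Sum>s<d. \<Sum>t<d. Gi A s t z*(p a l t z*(pd i (b j l k) z*p a k s z)))"
     by (simp add: sum_distrib_left sum_distrib_right mult_ac)
    also have "... = (\<Sum>s<d. \<Sum>t<d. \<Sum>l<d. \<Sum>k<d. Gi A s t z*(p a l t z*(pd i (b j l k) z*p a k s z)))" by (rule trans[OF sum.swap sum_swap22])
    also have "... = (\<Sum>s<d. \<Sum>t<d. Gi A s t z*(\<Sum>l<d. p a l t z*(\<Sum>k<d. pd i (b j l k) z*p a k s z)))" by (simp add: sum_distrib_left)
    also have "... = 0" using cross_deriv[OF z i a j] False by simp
    finally show ?thesis using False by simp
   qed simp
  qed
  also have "... = ?X j" using j by (intro sum_delta_left) auto
  finally show ?thesis .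
 qed
 have "(\<Sum>k<d. \<Sum>l<d. Gi A k l z*pd i (G A l k) z) = (\<Sum>k<d. \<Sum>l<d. \<Sum>j<m. A j*(Gi A k l z*pd i (b j l k) z))"
  using dG by (simp add: sum_distrib_left mult_ac)
 also have "... = (\<Sum>j<m. \<Sum>k<d. \<Sum>l<d. A j*(Gi A k l z*pd i (b j l k) z))" by (rule sum_rotate[symmetric])
 also have "... = (\<Sum>j<m. A j*(\<Sum>k<d. \<Sum>l<d. (\<Sum>t<d. p j k t z*Gi A t l z)*pd i (b j l k) z))" by (simp add: block flip: sum_distrib_left)
 also have "... = (\<Sum>j<m. \<Sum>k<d. \<Sum>l<d. (A j*(\<Sum>t<d. p j k t z*Gi A t l z))*pd i (b j l k) z)"
  by (simp only: mult.assoc) (simp add: sum_distrib_left)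
 also have "... = (\<Sum>j<m. \<Sum>k<d. \<Sum>l<d. (\<Sum>t<d. p j k t z*Gi (%_. 1) t l z)*pd i (b j l k) z)" using p_scale[OF A z] by (intro sum.cong refl) auto
 finally show ?thesis .
qed

end

lemma sum_swap_sym:
 assumes "!!i l. i<d ==> l<d ==> f i l = g l i"
 shows "(\<Sum>i<d::nat. \<Sum>l<d. f i l) = (\<Sum>i<d. \<Sum>l<d. g i l :: real)" by (subst sum.swap) (use assms in "auto intro!: sum.cong")

context split_metric
begin

lemma Cinf_\<Gamma>: "pos A ==> i<d ==> j<d ==> k<d ==> Cinf_on d T (\<Gamma> A k i j)" by (rule Cinf_christoffel_loc[OF T Cinf_G G_sym G_nd])

text \<open>The difference \<open>C\<close> of the two connections has trace zero by
  \<open>trace_metric_deriv\<close> and is complex linear, as both connections preserve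
  \<open>J\<close>. The Ricci tensors then differ by the divergence of \<open>C\<close> and a
  quadratic term, and complex linearity makes this difference symmetric once composed with
  \<open>J\<close>.\<close>

lemma ricci_change:
 assumes A: "pos A" and PA: "parallel A" and B: "pos B" and PB: "parallel B"
 obtains D where "!!j k z. j<d ==> k<d ==> z \<in> T ==> ricci_loc d (\<Gamma> B) j k z = ricci_loc d (\<Gamma> A) j k z + D j k z"
  "!!j k z. j<d ==> k<d ==> z \<in> T ==> (\<Sum>s<d. J s k z*D j s z) = (\<Sum>s<d. J s j z*D k s z)"
proof -
 define C where "C k i j z = \<Gamma> B k i j z - \<Gamma> A k i j z" for k i j z
 define U where "U l j k z = (\<Sum>s<d. C l j s z*J s k z)" for l j k z
 have C: "Cinf_on d T (C k i j)" if "k<d" "i<d" "j<d" for k i j unfolding C_def[abs_def] using that by (intro Cinf_on_diff[OF T] Cinf_\<Gamma> A B)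
 have C_sym: "C k i j z = C k j i z" if "i<d" "j<d" "z \<in> T" for k i j z unfolding C_def using \<Gamma>_sym[OF that] by simp
 have U2: "U k i j z = (\<Sum>s<d. J k s z*C s i j z)" if "k<d" "i<d" "j<d" "z \<in> T" for k i j z
 proof -
  have "(\<Sum>l<d. \<Gamma> A l i j z*J k l z) - (\<Sum>l<d. \<Gamma> A k i l z*J l j z) = (\<Sum>l<d. \<Gamma> B l i j z*J k l z) - (\<Sum>l<d. \<Gamma> B k i l z*J l j z)"
   using parallel_deriv[OF PA that(4,2,3,1)] parallel_deriv[OF PB that(4,2,3,1)] by simp
  then show ?thesis by (simp add: U_def C_def left_diff_distrib right_diff_distrib sum_subtractf mult.commute)
 qed
 have U_sym: "U l j k z = U l k j z" if "l<d" "j<d" "k<d" "z \<in> T" for l j k z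
  using U2[OF that] U2[OF that(1,3,2,4)] C_sym[OF that(2,3,4)] by simp
 have trC: "(\<Sum>i<d. C i i l z) = 0" if "l<d" "z \<in> T" for l z
 proof -
  have "(\<Sum>i<d. C i l i z) = 0" using trace_christoffel[OF A that(2,1)] trace_christoffel[OF B that(2,1)] trace_metric_deriv[OF A that(2,1)]
    trace_metric_deriv[OF B that(2,1)] by (simp add: C_def sum_subtractf)
  moreover have "(\<Sum>i<d. C i i l z) = (\<Sum>i<d. C i l i z)" by (rule sum.cong[OF refl], rule C_sym) (use that in auto)
  ultimately show ?thesis by simp
 qed
 \<comment> \<open>\<open>E\<close> collects the terms that survive contraction; the remaining ones
   contain the trace of \<open>C\<close> or its derivative.\<close>
 define E where "E i j k z = pd i (C i j k) z + (\<Sum>l<d. \<Gamma> A i i l z*C l j k z)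
  - (\<Sum>l<d. \<Gamma> A i j l z*C l i k z) - (\<Sum>l<d. C i j l z*\<Gamma> A l i k z) - (\<Sum>l<d. C i j l z*C l i k z)" for i j k z
 define D where "D j k z = (\<Sum>i<d. E i j k z)" for j k z
 show ?thesis
 proof (rule that[of D])
  fix j k z assume j: "j<d" and k: "k<d" and z: "z \<in> T"
  have dB: "pd q (\<Gamma> B i a b) z = pd q (\<Gamma> A i a b) z + pd q (C i a b) z" if "q<d" "i<d" "a<d" "b<d" for q i a b
   using partial_deriv_diff[OF T that(1) z Cinf_\<Gamma>[OF B that(3,4,2)] Cinf_\<Gamma>[OF A that(3,4,2)]] by (simp add: C_def[abs_def])
  have "(\<Sum>i<d. pd j (C i i k) z) = pd j (%z. \<Sum>i<d. C i i k z) z" by (rule partial_deriv_sum[OF T j z, symmetric]) (use k C in auto)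
  also have "... = pd j (%z. 0) z" by (rule partial_deriv_cong[OF T _ z j]) (use trC k in auto)
  finally have tr: "(\<Sum>i<d. pd j (C i i k) z) = 0" by (simp add: partial_deriv_const)
  have tr0: "(\<Sum>i<d. \<Sum>l<d. C i i l z*f l) = 0" for f by (subst sum.swap) (simp add: trC z flip: sum_distrib_right)
  have R: "riemann_loc d (\<Gamma> B) i j i k z = riemann_loc d (\<Gamma> A) i j i k z + E i j k z - pd j (C i i k) z + (\<Sum>l<d. C i i l z*(\<Gamma> A l j k z + C l j k z))" if i: "i<d" for i
  proof -
   have "\<Gamma> B l a b z = \<Gamma> A l a b z + C l a b z" for l a b by (simp add: C_def)
   then show ?thesis using i j k unfolding riemann_loc_def E_def by (simp add: dB sum.distrib sum_subtractf algebra_simps)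
  qed
  have "ricci_loc d (\<Gamma> B) j k z = ricci_loc d (\<Gamma> A) j k z + D j k z - (\<Sum>i<d. pd j (C i i k) z) + (\<Sum>i<d. \<Sum>l<d. C i i l z*(\<Gamma> A l j k z + C l j k z))"
   unfolding ricci_loc_def D_def sum.distrib[symmetric] sum_subtractf[symmetric] by (intro sum.cong refl) (simp add: R)
  then show "ricci_loc d (\<Gamma> B) j k z = ricci_loc d (\<Gamma> A) j k z + D j k z" by (simp only: tr tr0)
 next
  fix j k z assume j: "j<d" and k: "k<d" and z: "z \<in> T"
  \<comment> \<open>The summands of \<open>D\<close> with \<open>J\<close> applied to the last slot.
    \<open>J\<close> passes under the covariant derivative of \<open>A\<close>, and the symmetry of
    \<open>U\<close> in its lower indices then gives that of the sum.\<close>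
  define N where "N i j k = pd i (U i j k) z - (\<Sum>l<d. \<Gamma> A l i k z*U i j l z) + (\<Sum>l<d. \<Gamma> A i i l z*U l j k z)
   - (\<Sum>l<d. \<Gamma> A i j l z*U l i k z) - (\<Sum>l<d. C i j l z*U l i k z)" for i j k
  have N: "(\<Sum>s<d. J s k z*D j s z) = (\<Sum>i<d. N i j k)" if jk: "j<d" "k<d" for j k
  proof -
   have e: "(\<Sum>s<d. J s k z*(\<Sum>l<d. F l*C (p l) (q l) s z)) = (\<Sum>l<d. F l*U (p l) (q l) k z)" for F p q unfolding U_def by (rule sum_mult_swap)
   have "(\<Sum>s<d. J s k z*D j s z) = (\<Sum>i<d. \<Sum>s<d. J s k z*E i j s z)"
    unfolding D_def sum_distrib_left by (rule sum.swap)
   also have "... = (\<Sum>i<d. N i j k)"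
   proof (rule sum.cong[OF refl])
    fix i assume "i \<in> {..<d}" then have i: "i<d" by simp
    have "pd i (U i j k) z = (\<Sum>s<d. pd i (C i j s) z*J s k z + C i j s z*pd i (J s k) z)"
     unfolding U_def[abs_def] using i jk by (subst partial_deriv_sum[OF T i z])
      (auto intro!: Cinf_on_mult[OF T] J C sum.cong partial_deriv_mult[OF T i z])
    also have "... = (\<Sum>s<d. J s k z*pd i (C i j s) z) + (\<Sum>s<d. C i j s z*(\<Sum>l<d. \<Gamma> A l i k z*J s l z))
      - (\<Sum>s<d. C i j s z*(\<Sum>l<d. \<Gamma> A s i l z*J l k z))"
     using i jk z by (simp add: parallel_deriv[OF PA] sum.distrib sum_subtractf distrib_left right_diff_distrib mult.commute[of "J _ _ _"])
    also have "(\<Sum>s<d. C i j s z*(\<Sum>l<d. \<Gamma> A l i k z*J s l z)) = (\<Sum>l<d. \<Gamma> A l i k z*U i j l z)"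
     unfolding U_def sum_distrib_left by (subst sum.swap) (simp add: mult_ac)
    also have "(\<Sum>s<d. C i j s z*(\<Sum>l<d. \<Gamma> A s i l z*J l k z)) = (\<Sum>s<d. J s k z*(\<Sum>l<d. C i j l z*\<Gamma> A l i s z))"
     unfolding sum_distrib_left by (rule sum_swap_sym) (simp add: mult_ac)
    finally have dU: "(\<Sum>s<d. J s k z*pd i (C i j s) z) = pd i (U i j k) z - (\<Sum>l<d. \<Gamma> A l i k z*U i j l z)
     + (\<Sum>s<d. J s k z*(\<Sum>l<d. C i j l z*\<Gamma> A l i s z))" by simp
    show "(\<Sum>s<d. J s k z*E i j s z) = N i j k"
     unfolding E_def distrib_left right_diff_distrib sum.distrib sum_subtractf dU N_def e[of _ "%l. l" "%l. j"] e[of _ "%l. l" "%l. i"] by simp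
   qed
   finally show ?thesis .
  qed
  have dUs: "pd i (U i j k) z = pd i (U i k j) z" if "i<d" for i by (rule partial_deriv_cong[OF T _ z that]) (use U_sym that j k in auto)
  have s1: "(\<Sum>i<d. \<Sum>l<d. \<Gamma> A i j l z*U l i k z) = (\<Sum>i<d. \<Sum>l<d. \<Gamma> A l i j z*U i k l z)" if "j<d" "k<d" for j k
   by (rule sum_swap_sym) (use that z \<Gamma>_sym U_sym in auto)
  have s2: "(\<Sum>i<d. \<Sum>l<d. C i j l z*U l i k z) = (\<Sum>i<d. \<Sum>l<d. C i k l z*U l i j z)"
  proof -
   have "(\<Sum>i<d. \<Sum>l<d. C i j l z*U l i k z) = (\<Sum>i<d. \<Sum>l<d. C i j l z*(\<Sum>s<d. J l s z*C s i k z))" using U2 k z by simp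
   also have "... = (\<Sum>i<d. \<Sum>s<d. U i j s z*C s i k z)" unfolding U_def by (simp add: sum_mult_assoc)
   also have "... = (\<Sum>i<d. \<Sum>l<d. C i k l z*U l i j z)" by (rule sum_swap_sym) (use z j k in "simp add: C_sym[of _ k] U_sym[of _ j]")
   finally show ?thesis .
  qed
  have "(\<Sum>i<d. N i j k) = (\<Sum>i<d. N i k j)" unfolding N_def sum.distrib sum_subtractf s2 s1[OF j k] s1[OF k j] using dUs U_sym j k z by simp
  then show "(\<Sum>s<d. J s k z*D j s z) = (\<Sum>s<d. J s j z*D k s z)" using N j k by simp
 qed
qed

text \<open>The trace of \<open>D\<close> vanishes: it is a pairing of the symmetric
  \<open>M\<close>, which is \<open>D\<close> composed with \<open>J\<close>, and the antisymmetric
  \<open>K\<close>. The remaining trace needs only the Ricci form for \<open>A\<close> on the single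
  summands.\<close>

theorem scalar_change:
 assumes A: "pos A" and PA: "parallel A" and B: "pos B" and PB: "parallel B" and z: "z \<in> T"
  and R: "!!i v. i<m ==> (!!j k. j<m ==> j ~= i ==> k<d ==> (\<Sum>l<d. b j k l z * v l) = 0) ==> 
   (\<Sum>k<d. \<Sum>l<d. ricci_loc d (\<Gamma> A) k l z*(v k * v l)) = (\<Sum>k<d. \<Sum>l<d. b i k l z*(v k * v l))"
 shows "scalar_loc d (G B) z = (\<Sum>i<m. real (r i)/B i)"
proof -
 obtain D where D: "!!j k z. j<d ==> k<d ==> z \<in> T ==> ricci_loc d (\<Gamma> B) j k z = ricci_loc d (\<Gamma> A) j k z + D j k z"
  and MD: "!!j k z. j<d ==> k<d ==> z \<in> T ==> (\<Sum>s<d. J s k z*D j s z) = (\<Sum>s<d. J s j z*D k s z)"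
  by (rule ricci_change[OF A PA B PB], rule that)
 define M where "M j t = (\<Sum>s<d. J s t z*D j s z)" for j t
 define K where "K j t = (\<Sum>k<d. Gi B j k z*J t k z)" for j t
 have DM: "D j k z = - (\<Sum>t<d. J t k z*M j t)" if "k<d" for j k
 proof -
  have "(\<Sum>t<d. J t k z*M j t) = (\<Sum>s<d. D j s z*(\<Sum>t<d. J s t z*J t k z))"
   unfolding M_def sum_distrib_left by (subst sum.swap) (simp add: mult_ac)
  also have "... = (\<Sum>s<d. - D j s z*(if s = k then 1 else 0))" using JJ[OF _ that z] by (intro sum.cong) auto
  also have "... = - D j k z" using that by (intro sum_delta_right) auto
  finally show ?thesis by simp
 qed
 have "(\<Sum>j<d. \<Sum>k<d. Gi B j k z*D j k z) = - (\<Sum>j<d. \<Sum>t<d. K j t*M j t)" unfolding K_def by (simp add: DM sum_mult_assoc sum_negf)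
 moreover have "(\<Sum>j<d. \<Sum>t<d. K j t*M j t) = (\<Sum>j<d. \<Sum>t<d. - K j t*M j t)"
 proof (rule sum_swap_sym)
  fix j t assume jt: "j<d" "t<d"
  have "K j t = - K t j" unfolding K_def by (rule Gi_J[OF B z jt])
  moreover have "M j t = M t j" unfolding M_def by (rule MD[OF jt z])
  ultimately show "K j t*M j t = - K t j*M t j" by simp
 qed
 ultimately have "(\<Sum>j<d. \<Sum>k<d. Gi B j k z*D j k z) = 0" unfolding mult_minus_left sum_negf by linarith
 moreover have "scalar_loc d (G B) z = (\<Sum>j<d. \<Sum>k<d. Gi B j k z*ricci_loc d (\<Gamma> A) j k z) + (\<Sum>j<d. \<Sum>k<d. Gi B j k z*D j k z)"
  unfolding scalar_loc_def using D z by (simp add: distrib_left sum.distrib)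
 moreover have "(\<Sum>j<d. \<Sum>k<d. Gi B j k z*ricci_loc d (\<Gamma> A) j k z) = (\<Sum>i<m. real (r i)/B i)" by (rule trace_block_form[OF B z]) (rule R)
 ultimately show ?thesis by linarith
qed

text \<open>The Ricci tensor is the metric with unit weights, whose trace \<open>trace_G\<close>
  evaluates.\<close>

theorem scalar_einstein:
 assumes B: "pos B" and z: "z \<in> T"
  and R: "!!k l. k<d ==> l<d ==> ricci_loc d (\<Gamma> B) k l z = (\<Sum>i<m. b i k l z)"
 shows "scalar_loc d (G B) z = (\<Sum>i<m. real (r i)/B i)"
proof -
 have "scalar_loc d (G B) z = (\<Sum>k<d. \<Sum>l<d. Gi B k l z*G (%_. 1) l k z)"
  unfolding scalar_loc_def using R b_sym z by (intro sum.cong refl) (simp add: G_def)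
 then show ?thesis using trace_G[OF B z, of "%_. 1"] by simp
qed

end

section \<open>The base in charts\<close>

locale toric_base =
 fixes D :: "('m, 'b) toric_data"
 assumes base_str: "base_structure D"
begin

sublocale B: smooth_mfd "base D" using base_str by unfold_locales (simp add: base_structure_def)

abbreviation "d \<equiv> mdim (base D)"
abbreviation "m \<equiv> num D"

definition bc :: "'b chart => nat => nat => nat => rfun" where "bc e i = comp2 (base D) (bg D i) e"

definition Jc :: "'b chart => nat => nat => rfun" where "Jc e = endo_comp (base D) (base_J D) e"

lemma base_facts: "d = (\<Sum>i<m. dims D i)" "almost_complex (base D) (base_J D)" "i<m ==> 0<dims D i" "i<m ==> symmetric_psd (base D) (bg D i)"
 "i<m ==> bilinear_tensor (base D) (bg D i)" "i<m ==> orthogonal_endo (base D) (bg D i) (base_J D)"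
 "q \<in> pts (base D) ==> i<m ==> has_dim (base_summand D i q) (dims D i)"
 "q \<in> pts (base D) ==> v \<in> tangent (base D) q ==> (\<forall>i<m. bg D i q v v = 0) ==> v = vzero" "q \<in> pts (base D) ==> v \<in> tangent (base D) q ==> 
  \<exists>w. (\<forall>i<m. w i \<in> base_summand D i q) & v = vsum m w" using base_str by (auto simp: base_structure_def symmetric_psd_def)

lemma J_linear: "q \<in> pts (base D) ==> linear_vmap (tangent (base D) q) (tangent (base D) q) (base_J D q)"
 using base_facts(2) by (auto simp: almost_complex_def endo_tensor_def)

lemma J_tangent: "q \<in> pts (base D) ==> v \<in> tangent (base D) q ==> base_J D q v \<in> tangent (base D) q"
 using J_linear[of q] by (simp add: linear_vmap_def image_subset_iff)

lemma J_J: "q \<in> pts (base D) ==> v \<in> tangent (base D) q ==> base_J D q (base_J D q v) = vscale (-1) v"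
 using base_facts(2) by (auto simp: almost_complex_def)

lemma bg_linear:
 assumes "i<m" "q \<in> pts (base D)" "u \<in> tangent (base D) q"
 shows "linear_fun (tangent (base D) q) (bg D i q u)" "linear_fun (tangent (base D) q) (%v. bg D i q v u)"
 using base_facts(5)[OF assms(1)] assms(2,3) by (auto simp: bilinear_tensor_def)

lemma bg_sym:
 assumes "i<m" "q \<in> pts (base D)" "u \<in> tangent (base D) q" "v \<in> tangent (base D) q"
 shows "bg D i q u v = bg D i q v u" "0 <= bg D i q u u" using base_facts(4)[OF assms(1)] assms(2-4) by (auto simp: symmetric_psd_def)

lemma bg_J:
 assumes "i<m" "q \<in> pts (base D)" "u \<in> tangent (base D) q" "v \<in> tangent (base D) q"
 shows "bg D i q (base_J D q u) v = - bg D i q (base_J D q v) u"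
proof -
 have "bg D i q (base_J D q u) v = bg D i q (base_J D q (base_J D q u)) (base_J D q v)"
  using base_facts(6)[OF assms(1)] assms J_tangent by (simp add: orthogonal_endo_def)
 also have "... = - bg D i q u (base_J D q v)" using bg_linear(2)[OF assms(1,2) J_tangent[OF assms(2,4)]] assms by (simp add: J_J linear_fun_def)
 finally show ?thesis using bg_sym(1)[OF assms(1,2,3) J_tangent[OF assms(2,4)]] by simp
qed

context
 fixes e assumes e: "e \<in> atlas (base D)"
begin

lemma bg_expand:
 assumes "i<m" "q \<in> fst e" "u \<in> tangent (base D) q" "v \<in> tangent (base D) q"
 shows "bg D i q u v = (\<Sum>k<d. \<Sum>l<d. bc e i k l (snd e q)*(vcoord e k u * vcoord e l v))"
 unfolding bc_def by (rule B.bilinear_expand[OF base_facts(5)[OF assms(1)] e assms(2-4)])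

lemma bg_coord:
 assumes "i<m" "q \<in> fst e" "k<d" "v \<in> tangent (base D) q"
 shows "bg D i q (coord_vect (base D) e k q) v = (\<Sum>l<d. bc e i k l (snd e q) * vcoord e l v)"
proof -
 have q: "q \<in> pts (base D)" using B.chart_pts[OF e] assms(2) by blast
 show ?thesis using B.linear_fun_expand[OF bg_linear(1)[OF assms(1) q B.coord_vect_tangent[OF e assms(2,3)]] e assms(2,4)]
  by (simp add: bc_def B.comp2_at[OF e assms(2)] mult.commute)
qed

lemma Jc_at: "q \<in> fst e ==> Jc e k i (snd e q) = vcoord e k (base_J D q (coord_vect (base D) e i q))" unfolding Jc_def by (rule B.endo_at[OF e])

lemma J_coord:
 assumes "q \<in> fst e" "v \<in> tangent (base D) q" "k<d"
 shows "vcoord e k (base_J D q v) = (\<Sum>l<d. Jc e k l (snd e q) * vcoord e l v)"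
proof -
 have q: "q \<in> pts (base D)" using B.chart_pts[OF e] assms(1) by blast
 have "linear_fun (tangent (base D) q) (%v. vcoord e k (base_J D q v))"
  using J_linear[OF q] by (auto simp: linear_fun_def linear_vmap_def B.vcoord_linear)
 from B.linear_fun_expand[OF this e assms(1,2)] show ?thesis by (simp add: Jc_at[OF assms(1)] mult.commute)
qed

lemma comp_base_metric: "comp2 (base D) (base_metric D A) e k l z = (\<Sum>i<m. A i*bc e i k l z)"
 by (simp add: comp2_def base_metric_def bc_def Let_def)

lemma comp_base_form:
 assumes "z \<in> B.cimg e" "k<d" "l<d"
 shows "comp2 (base D) (base_form D A) e k l z = (\<Sum>s<d. Jc e s k z*(\<Sum>i<m. A i*bc e i s l z))"
proof -
 obtain q where q: "q \<in> fst e" "z = snd e q" using B.cimg_E[OF e assms(1)] by blast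
 have p: "q \<in> pts (base D)" using B.chart_pts[OF e] q(1) by blast
 note t = B.coord_vect_tangent[OF e q(1)]
 have "bg D i q (base_J D q (coord_vect (base D) e k q)) (coord_vect (base D) e l q) = (\<Sum>s<d. Jc e s k z*bc e i s l z)" if i: "i<m" for i
  using B.linear_fun_expand[OF bg_linear(2)[OF i p t[OF assms(3)]] e q(1) J_tangent[OF p t[OF assms(2)]]]
  by (simp add: q(2) Jc_at[OF q(1)] bc_def B.comp2_at[OF e q(1)])
 then have "comp2 (base D) (base_form D A) e k l z = (\<Sum>i<m. A i*(\<Sum>s<d. Jc e s k z*bc e i s l z))"
  using B.comp2_at[OF e q(1)] by (simp add: q(2) base_form_def kahler_form_def base_metric_def)
 then show ?thesis unfolding sum_distrib_left by (subst (asm) sum.swap) (simp add: mult_ac)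
qed

lemma kernel_pair:
 assumes "i<m" "q \<in> fst e" "u \<in> tangent (base D) q" "bg D i q u u = 0" "k<d"
 shows "(\<Sum>l<d. bc e i k l (snd e q) * vcoord e l u) = 0"
proof -
 have q: "q \<in> pts (base D)" using B.chart_pts[OF e] assms(2) by blast
 have "bg D i q (coord_vect (base D) e k q) u = 0"
  by (rule B.psd_kernel(2)[OF base_facts(4)[OF assms(1)], OF q assms(3) B.coord_vect_tangent[OF e assms(2,5)] assms(4)])
 then show ?thesis by (rule trans[OF bg_coord[OF assms(1,2,5,3), symmetric]])
qed

theorem split: "split_metric d m (B.cimg e) (bc e) (Jc e) (dims D)"
proof
 show "eopen d (B.cimg e)" by (rule B.chart_props(2)[OF e])
 show "Cinf_on d (B.cimg e) (bc e i k l)" if "i<m" "k<d" "l<d" for i k l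
  using base_facts(5)[OF that(1)] e that unfolding bc_def B.cimg_def by (simp add: bilinear_tensor_def)
 show "Cinf_on d (B.cimg e) (Jc e k l)" if "k<d" "l<d" for k l
  using base_facts(2) e that unfolding Jc_def B.cimg_def by (simp add: almost_complex_def endo_tensor_def)
next
 fix i k l z assume a: "i<m" "k<d" "l<d" "z \<in> B.cimg e"
 obtain q where q: "q \<in> fst e" "z = snd e q" using B.cimg_E[OF e a(4)] by blast
 have p: "q \<in> pts (base D)" using B.chart_pts[OF e] q(1) by blast
 note t = B.coord_vect_tangent[OF e q(1)]
 show "bc e i k l z = bc e i l k z" using bg_sym(1)[OF a(1) p t[OF a(2)] t[OF a(3)]] by (simp add: q(2) bc_def B.comp2_at[OF e q(1)])
 have "bg D i q (base_J D q (coord_vect (base D) e k q)) (coord_vect (base D) e l q) = (\<Sum>s<d. Jc e s k z*bc e i s l z)" if "k<d" "l<d" for k l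
  using B.linear_fun_expand[OF bg_linear(2)[OF a(1) p t[OF that(2)]] e q(1) J_tangent[OF p t[OF that(1)]]]
  by (simp add: q(2) Jc_at[OF q(1)] bc_def B.comp2_at[OF e q(1)])
 then show "(\<Sum>s<d. Jc e s k z*bc e i s l z) = - (\<Sum>s<d. Jc e s l z*bc e i s k z)" using bg_J[OF a(1) p t[OF a(2)] t[OF a(3)]] a by simp
next
 fix k l z assume a: "k<d" "l<d" "z \<in> B.cimg e"
 obtain q where q: "q \<in> fst e" "z = snd e q" using B.cimg_E[OF e a(3)] by blast
 have p: "q \<in> pts (base D)" using B.chart_pts[OF e] q(1) by blast
 note t = B.coord_vect_tangent[OF e q(1) a(2)]
 have "vcoord e k (base_J D q (base_J D q (coord_vect (base D) e l q))) = (if k = l then -1 else 0)"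
  using a by (simp add: J_J[OF p t] B.vcoord_linear B.vcoord_coord_vect[OF e q(1)])
 then show "(\<Sum>s<d. Jc e k s z*Jc e s l z) = (if k = l then -1 else 0)" by (simp add: J_coord[OF q(1) J_tangent[OF p t] a(1)] Jc_at[OF q(1)] q(2))
next
 fix i z and v :: "nat => real" assume a: "i<m" "z \<in> B.cimg e"
 obtain q where q: "q \<in> fst e" "z = snd e q" using B.cimg_E[OF e a(2)] by blast
 have p: "q \<in> pts (base D)" using B.chart_pts[OF e] q(1) by blast
 have "bg D i q (B.comb e v q) (B.comb e v q) = (\<Sum>k<d. \<Sum>l<d. bc e i k l z*(v k * v l))"
  by (simp add: bg_expand[OF a(1) q(1) B.comb(1)[OF e q(1)] B.comb(1)[OF e q(1)]] B.comb(2)[OF e q(1)] q(2))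
 then show "0 <= (\<Sum>k<d. \<Sum>l<d. bc e i k l z*(v k * v l))" using bg_sym(2)[OF a(1) p B.comb(1)[OF e] B.comb(1)[OF e]] q by metis
next
 fix z and v :: "nat => real"
 assume z: "z \<in> B.cimg e" and a: "!!i. i<m ==> (\<Sum>k<d. \<Sum>l<d. bc e i k l z*(v k * v l)) = 0"
 obtain q where q: "q \<in> fst e" "z = snd e q" using B.cimg_E[OF e z] by blast
 have p: "q \<in> pts (base D)" using B.chart_pts[OF e] q(1) by blast
 have "bg D i q (B.comb e v q) (B.comb e v q) = 0" if "i<m" for i
  using a[OF that] by (simp add: bg_expand[OF that q(1) B.comb(1)[OF e q(1)] B.comb(1)[OF e q(1)]] B.comb(2)[OF e q(1)] q(2))
 then have "B.comb e v q = vzero" using base_facts(8)[OF p B.comb(1)[OF e q(1)]] by blast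
 then show "\<forall>k<d. v k = 0" using B.comb(2)[OF e q(1), of _ v] by (simp add: B.vcoord_linear)
next
 fix z assume z: "z \<in> B.cimg e"
 obtain q where q: "q \<in> fst e" "z = snd e q" using B.cimg_E[OF e z] by blast
 have p: "q \<in> pts (base D)" using B.chart_pts[OF e] q(1) by blast
 have "\<forall>l\<in>{..<d}. \<exists>w. (\<forall>i<m. w i \<in> base_summand D i q) & coord_vect (base D) e l q = vsum m w"
  using base_facts(9)[OF p B.coord_vect_tangent[OF e q(1)]] by simp
 then obtain w where w: "!!l i. l<d ==> i<m ==> w l i \<in> base_summand D i q"
  and ws: "!!l. l<d ==> coord_vect (base D) e l q = vsum m (w l)" by (rule bchoice[THEN exE]) auto
 have wt: "w l i \<in> tangent (base D) q" and w0: "!!j. j<m ==> i ~= j ==> bg D j q (w l i) (w l i) = 0"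
  if "l<d" "i<m" for l i using w[OF that] by (auto simp: base_summand_def)
 \<comment> \<open>Column \<open>l\<close> holds the components of the i-th part of the l-th
   coordinate vector.\<close>
 define p where "p i k l = vcoord e k (w l i)" for i k l
 have p1: "(\<Sum>i<m. p i k l) = (if k = l then 1 else 0)" if "k<d" "l<d" for k l
  using B.vcoord_coord_vect[OF e q(1) that(2,1)] by (auto simp: p_def ws[OF that(2)] B.vcoord_linear)
 have p2: "(\<Sum>s<d. bc e j k s z*p i s l) = 0" if "i<m" "j<m" "k<d" "l<d" "i ~= j" for i j k l
  unfolding p_def q(2) by (rule kernel_pair[OF that(2) q(1) wt w0]) (use that in auto)
 have p3: "(\<Sum>s<d. bc e i k s z*p i s l) = bc e i k l z" if "i<m" "k<d" "l<d" for i k l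
  by (rule block_complement[where b = "%i k l. bc e i k l z" and q = p and m = m]) (use p1 p2 that in auto)
 \<comment> \<open>The trace of a projector is its rank, here read off from a basis of the
   summand.\<close>
 have p4: "(\<Sum>k<d. p i k k) = real (dims D i)" if i: "i<m" for i
 proof -
  obtain E where E: "base_summand D i q = {vsum (dims D i) (%a. vscale (c a) (E a)) | c. True}"
   and ind: "!!c. vsum (dims D i) (%a. vscale (c a) (E a)) = vzero ==> (\<forall>a<dims D i. c a = 0)"
   using base_facts(7)[OF `q \<in> pts (base D)` i] unfolding has_dim_def by blast
  have Es: "E a \<in> base_summand D i q" if "a<dims D i" for a
  proof -
   have "E a = vsum (dims D i) (%b. vscale (if b = a then 1 else 0) (E b))"
    using that by (intro ext) (simp add: vsum_def vscale_def if_distrib[of "%x. x*_"] cong: if_cong)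
   then show ?thesis unfolding E by (intro CollectI exI[of _ "%b. if b = a then 1 else 0"] conjI TrueI)
  qed
  then have Et: "E a \<in> tangent (base D) q" and E0: "!!j. j<m ==> i ~= j ==> bg D j q (E a) (E a) = 0"
   if "a<dims D i" for a using that by (auto simp: base_summand_def)
  show ?thesis
  proof (rule trace_projector[where \<pi> = "p i" and E = "%k a. vcoord e k (E a)"])
   fix k a assume k: "k<d" and a: "a<dims D i"
   \<comment> \<open>The defect of \<open>E a\<close> under the projector. Every \<open>bg j\<close>
     annihilates it, so it vanishes by definiteness.\<close>
   define v where "v l = vcoord e l (E a) - (\<Sum>s<d. p i l s * vcoord e s (E a))" for l
   have "(\<Sum>l<d. bc e j k l z * v l) = 0" if j: "j<m" and k: "k<d" for j k
   proof -
    have "(\<Sum>l<d. bc e j k l z * v l) = (\<Sum>l<d. bc e j k l z * vcoord e l (E a)) - (\<Sum>l<d. bc e j k l z*(\<Sum>s<d. p i l s * vcoord e s (E a)))"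
     by (simp add: v_def right_diff_distrib sum_subtractf)
    also have "(\<Sum>l<d. bc e j k l z*(\<Sum>s<d. p i l s * vcoord e s (E a))) = (\<Sum>s<d. (\<Sum>l<d. bc e j k l z*p i l s) * vcoord e s (E a))"
     by (rule sum_mult_assoc[symmetric])
    also have "(\<Sum>l<d. bc e j k l z * vcoord e l (E a)) - ... = 0"
    proof (cases "i = j")
     case True then show ?thesis using p3[OF i k] by simp
    next
     case False
     then show ?thesis using p2[OF i j k _ False] kernel_pair[OF j q(1) Et[OF a] E0[OF a j False] k] by (simp add: q(2))
    qed
    finally show ?thesis .
   qed
   then have "bg D j q (B.comb e v q) (B.comb e v q) = 0" if "j<m" for j
    using that by (simp add: bg_expand[OF that q(1) B.comb(1)[OF e q(1)] B.comb(1)[OF e q(1)]] B.comb(2)[OF e q(1)] q(2)[symmetric]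
     mult.left_commute flip: sum_distrib_left)
   then have "B.comb e v q = vzero" using base_facts(8)[OF `q \<in> pts (base D)` B.comb(1)[OF e q(1)]] by blast
   then have "v k = 0" using B.comb(2)[OF e q(1) k, of v] by (simp add: B.vcoord_linear)
   then show "(\<Sum>l<d. p i k l * vcoord e l (E a)) = vcoord e k (E a)" by (simp add: v_def)
  next
   fix l assume l: "l<d"
   obtain c where "w l i = vsum (dims D i) (%a. vscale (c a) (E a))" using w[OF l i] unfolding E by blast
   then show "\<exists>c. \<forall>k<d. p i k l = (\<Sum>a<dims D i. vcoord e k (E a)*c a)" by (intro exI[of _ c]) (simp add: p_def B.vcoord_linear mult.commute)
  next
   fix c assume c: "!!k. k<d ==> (\<Sum>a<dims D i. vcoord e k (E a)*c a) = 0"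
   have "vsum (dims D i) (%a. vscale (c a) (E a)) = vzero" by (subst B.tangent_eq_iff[OF e q(1)])
     (auto intro!: B.vsum_tangent B.vscale_tangent Et B.vzero_tangent simp: B.vcoord_linear c[simplified mult.commute[of "vcoord _ _ _"]])
   then show "\<forall>a<dims D i. c a = 0" by (rule ind)
  qed
 qed
 show "\<exists>p :: nat => nat => nat => real. (\<forall>k<d. \<forall>l<d. (\<Sum>i<m. p i k l) = (if k = l then 1 else 0)) &
   (\<forall>i<m. \<forall>j<m. \<forall>k<d. \<forall>l<d. i ~= j --> (\<Sum>s<d. bc e j k s z*p i s l) = 0) & (\<forall>i<m. (\<Sum>k<d. p i k k) = real (dims D i))"
  using p1 p2 p4 by (intro exI[of _ p]) auto
qed

end

end

text \<open>\<open>X j\<close> gives the chart coordinates of the j-th projection, so the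
  differentials of all \<open>X j y a\<close> form a coframe indexed by pairs. In it the metric is
  block diagonal, and constant weights leave the connections of the factors unchanged.\<close>

locale product_frame =
 fixes d m :: nat and r :: "nat => nat" and S :: "(nat => real) set" and T :: "nat => (nat => real) set"
  and X :: "nat => (nat => real) => nat => real"
  and gg JN :: "nat => nat => nat => rfun"
  and A :: "nat => real" and G J :: "nat => nat => rfun"
 assumes S: "eopen d S" and T: "!!j. j<m ==> eopen (r j) (T j)"
  and X_T: "!!j y. j<m ==> y \<in> S ==> X j y \<in> T j"
  and X: "!!j a. j<m ==> a<r j ==> Cinf_on d S (%y. X j y a)"
  and d: "d = (\<Sum>j<m. r j)"
  and gg: "!!j a b. j<m ==> a<r j ==> b<r j ==> Cinf_on (r j) (T j) (gg j a b)"
  and gg_sym: "!!j a b z. j<m ==> a<r j ==> b<r j ==> z \<in> T j ==> gg j a b z = gg j b a z"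
  and gg_nd: "!!j z. j<m ==> z \<in> T j ==> nondegenerate (r j) (%a b. gg j a b z)"
  and JN: "!!j a b. j<m ==> a<r j ==> b<r j ==> Cinf_on (r j) (T j) (JN j a b)"
  and JN_parallel: "!!j i a b z. j<m ==> i<r j ==> a<r j ==> b<r j ==> z \<in> T j ==> 
   parallel_loc (r j) (christoffel_loc (r j) (gg j)) (JN j) i a b z = 0"
  and gg_ricci: "!!j a b z. j<m ==> a<r j ==> b<r j ==> z \<in> T j ==>  ricci_loc (r j) (christoffel_loc (r j) (gg j)) a b z = gg j a b z"
  and ker: "!!y v. y \<in> S ==> (!!j a. j<m ==> a<r j ==> (\<Sum>k<d. pd k (%y. X j y a) y * v k) = 0) ==> (\<forall>k<d. v k = 0)"
  and A: "!!j. j<m ==> A j ~= 0"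
  and G: "!!k l y. k<d ==> l<d ==> y \<in> S ==> G k l y = (\<Sum>j<m. A j*(\<Sum>a<r j. \<Sum>b<r j.
   gg j a b (X j y)*(pd k (%y. X j y a) y*pd l (%y. X j y b) y)))"
  and J: "!!k l. k<d ==> l<d ==> Cinf_on d S (J k l)"
  and XJ: "!!j a k y. j<m ==> a<r j ==> k<d ==> y \<in> S ==> 
   (\<Sum>l<d. pd l (%y. X j y a) y*J l k y) = (\<Sum>b<r j. JN j a b (X j y)*pd k (%y. X j y b) y)"
begin

definition I :: "(nat \<times> nat) set" where "I = Sigma {..<m} (%j. {..<r j})"

abbreviation \<Gamma> :: "nat => nat => nat => nat => rfun" where "\<Gamma> j \<equiv> christoffel_loc (r j) (gg j)"

definition P :: "nat \<times> nat => nat => rfun" where "P p k = pd k (%y. X (fst p) y (snd p))"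

definition \<eta> :: "nat \<times> nat => nat \<times> nat => rfun" where "\<eta> p q y = (if fst p = fst q then A (fst p)*gg (fst p) (snd p) (snd q) (X (fst p) y) else 0)"

definition \<eta>' :: "nat \<times> nat => nat \<times> nat => rfun" where "\<eta>' p q y = (if fst p = fst q
  then mat_inverse (r (fst p)) (%a b. gg (fst p) a b (X (fst p) y)) (snd p) (snd q)/A (fst p) else 0)"

definition W :: "nat \<times> nat => nat \<times> nat => nat \<times> nat => rfun" where
 "W c p q y = (if fst c = fst p & fst p = fst q then \<Gamma> (fst p) (snd p) (snd c) (snd q) (X (fst p) y) else 0)"

definition w :: "nat => nat \<times> nat => nat \<times> nat => rfun" where "w i p q y = (\<Sum>c\<in>I. W c p q y*P c i y)"

definition DW :: "nat \<times> nat => nat \<times> nat => nat \<times> nat => nat \<times> nat => rfun" where "DW f c p q y = (if fst f = fst p & fst c = fst p & fst p = fst q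
  then pd (snd f) (\<Gamma> (fst p) (snd p) (snd c) (snd q)) (X (fst p) y) else 0)"

definition F :: "nat \<times> nat => nat \<times> nat => rfun" where "F p q y = (if fst p = fst q then JN (fst p) (snd p) (snd q) (X (fst p) y) else 0)"

lemma I_finite: "finite I" by (simp add: I_def)

lemma I_D: "p \<in> I ==> fst p<m" "p \<in> I ==> snd p<r (fst p)" by (auto simp: I_def)

lemma sum_fibre:
 assumes "j<m" "!!q. q \<in> I ==> fst q ~= j ==> f q = 0"
 shows "(\<Sum>q\<in>I. f q) = (\<Sum>a<r j. f (j, a) :: real)"
proof -
 have "(\<Sum>q\<in>I. f q) = (\<Sum>q\<in>(%a. (j, a)) ` {..<r j}. f q)" by (rule sum.mono_neutral_right) (use assms in "force simp: I_def")+
 then show ?thesis by (simp add: sum.reindex inj_on_def)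
qed

lemma sum_I: "(\<Sum>q\<in>I. f q) = (\<Sum>j<m. \<Sum>a<r j. f (j, a) :: real)" unfolding I_def by (subst sum.Sigma) (auto simp: case_prod_beta)

lemma \<Gamma>_smooth: "j<m ==> a<r j ==> b<r j ==> c<r j ==> Cinf_on (r j) (T j) (\<Gamma> j a b c)" by (rule Cinf_christoffel_loc[OF T gg gg_sym gg_nd])

lemma pull_smooth: "j<m ==> Cinf_on (r j) (T j) f ==> Cinf_on d S (%y. f (X j y))" by (rule Cinf_on_compose[OF S T X_T X])

lemma pull_deriv:
 assumes "j<m" "Cinf_on (r j) (T j) f" "i<d" "y \<in> S"
 shows "pd i (%y. f (X j y)) y = (\<Sum>c<r j. pd c f (X j y)*P (j, c) i y)"
 unfolding P_def using partial_deriv_chain[OF S assms(3,4) T[OF assms(1)] X_T X, OF assms(1) _ assms(1) _ assms(2)] assms(1) by simp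

lemma P_smooth: "p \<in> I ==> k<d ==> Cinf_on d S (P p k)" unfolding P_def using I_D by (intro Cinf_on_partial_deriv[OF S] X) auto

lemma W_smooth: "c \<in> I ==> p \<in> I ==> q \<in> I ==> Cinf_on d S (W c p q)"
proof -
 assume a: "c \<in> I" "p \<in> I" "q \<in> I"
 show ?thesis
 proof (cases "fst c = fst p & fst p = fst q")
  case True
  then show ?thesis unfolding W_def[abs_def] using a I_D[OF a(1)] I_D[OF a(2)] I_D[OF a(3)] by simp (intro pull_smooth \<Gamma>_smooth; simp)
 next
  case False
  then have "W c p q = (%y. 0)" by (auto simp: W_def)
  then show ?thesis by (simp add: Cinf_on_const[OF S])
 qed
qed

lemma w_row:
 assumes "p \<in> I" "fst q = fst p"
 shows "w i p q y = (\<Sum>c<r (fst p). \<Gamma> (fst p) (snd p) c (snd q) (X (fst p) y)*P (fst p, c) i y)"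
 unfolding w_def by (subst sum_fibre[of "fst p"]) (use assms I_D in "auto simp: W_def")

lemma w_off: "fst q ~= fst p ==> w i p q y = 0" unfolding w_def by (intro sum.neutral) (auto simp: W_def)

sublocale moving_frame d S I P w \<eta> \<eta>' G
proof
 show "eopen d S" by (rule S)
 show "finite I" by (rule I_finite)
 show "card I = d" by (simp add: I_def d)
 show "Cinf_on d S (P a k)" if "a \<in> I" "k<d" for a k using that by (rule P_smooth)
 show "Cinf_on d S (w i a b)" if "i<d" "a \<in> I" "b \<in> I" for i a b
  unfolding w_def[abs_def] using that by (intro Cinf_on_sum[OF S] Cinf_on_mult[OF S] W_smooth P_smooth)
 show "Cinf_on d S (\<eta> a b)" if "a \<in> I" "b \<in> I" for a b
 proof (cases "fst a = fst b")
  case True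
  then show ?thesis unfolding \<eta>_def[abs_def] using that I_D[OF that(1)] I_D[OF that(2)]
   by simp (intro Cinf_on_mult[OF S] Cinf_on_const[OF S] pull_smooth gg; simp)
 next
  case False
  then show ?thesis unfolding \<eta>_def[abs_def] by (simp add: Cinf_on_const[OF S])
 qed
 show "\<forall>k<d. v k = 0" if "y \<in> S" "!!a. a \<in> I ==> (\<Sum>k<d. P a k y * v k) = 0" for y v
  by (rule ker[OF that(1)]) (use that(2)[unfolded P_def I_def] in force)
 show "\<eta> a b y = \<eta> b a y" if "a \<in> I" "b \<in> I" "y \<in> S" for a b y
  using gg_sym[OF I_D(1)[OF that(1)] I_D(2)[OF that(1)]] I_D[OF that(2)] that(3) X_T[OF I_D(1)[OF that(1)]] by (auto simp: \<eta>_def)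
 show "\<eta>' a b y = \<eta>' b a y" if "a \<in> I" "b \<in> I" "y \<in> S" for a b y
 proof (cases "fst a = fst b")
  case True
  then show ?thesis using mat_inverse_symmetric[OF gg_nd[OF I_D(1)[OF that(1)] X_T[OF I_D(1)[OF that(1)] that(3)]]
     gg_sym[OF I_D(1)[OF that(1)] _ _ X_T[OF I_D(1)[OF that(1)] that(3)]]] I_D[OF that(1)] I_D[OF that(2)] by (simp add: \<eta>'_def)
 qed (simp add: \<eta>'_def)
 show "(\<Sum>b\<in>I. \<eta> a b y*\<eta>' b c y) = (if a = c then 1 else 0)" if a: "a \<in> I" and c: "c \<in> I" and y: "y \<in> S" for a c y
 proof (cases "fst a = fst c")
  case True
  note ja = I_D[OF a]
  have "(\<Sum>b\<in>I. \<eta> a b y*\<eta>' b c y) = (\<Sum>b<r (fst a). gg (fst a) (snd a) b (X (fst a) y) *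
    mat_inverse (r (fst a)) (%a' b. gg (fst a) a' b (X (fst a) y)) b (snd c))"
   using A[OF ja(1)] True by (subst sum_fibre[OF ja(1)]) (auto simp: \<eta>_def \<eta>'_def)
  also have "... = (if snd a = snd c then 1 else 0)"
   using mat_inverse_nondegenerate(1)[OF gg_nd[OF ja(1) X_T[OF ja(1) y]]] ja(2) I_D(2)[OF c] True by (simp add: is_inverse_def)
  finally show ?thesis using True by (auto simp: prod_eq_iff)
 next
  case False
  then have "(\<Sum>b\<in>I. \<eta> a b y*\<eta>' b c y) = 0" by (intro sum.neutral) (auto simp: \<eta>_def \<eta>'_def)
  then show ?thesis using False by auto
 qed
 show "G i j y = (\<Sum>a\<in>I. P a i y*(\<Sum>b\<in>I. \<eta> a b y*P b j y))" if "i<d" "j<d" "y \<in> S" for i j y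
 proof -
  have "(\<Sum>b\<in>I. \<eta> (q, a) b y*P b j y) = (\<Sum>b<r q. A q*gg q a b (X q y)*P (q, b) j y)" if "q<m" for q a
   by (subst sum_fibre[OF that]) (auto simp: \<eta>_def)
  then have "(\<Sum>a\<in>I. P a i y*(\<Sum>b\<in>I. \<eta> a b y*P b j y)) = (\<Sum>q<m. \<Sum>a<r q. P (q, a) i y*(\<Sum>b<r q. A q*gg q a b (X q y)*P (q, b) j y))"
   by (subst sum_I) simp
  then show ?thesis unfolding G[OF that] by (simp add: P_def sum_distrib_left mult_ac)
 qed
 show "pd i (P a j) y + (\<Sum>b\<in>I. w i a b y*P b j y) = pd j (P a i) y + (\<Sum>b\<in>I. w j a b y*P b i y)"
  if a: "a \<in> I" and ij: "i<d" "j<d" and y: "y \<in> S" for a i j y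
 proof -
  note ja = I_D[OF a]
  have e: "(\<Sum>b\<in>I. w i a b y*P b j y) = (\<Sum>b<r (fst a). \<Sum>c<r (fst a). \<Gamma> (fst a) (snd a) c b (X (fst a) y)*P (fst a, c) i y*P (fst a, b) j y)" for i j
   using w_row[OF a] w_off by (subst sum_fibre[OF ja(1)]) (auto simp: sum_distrib_right)
  have "(\<Sum>b\<in>I. w i a b y*P b j y) = (\<Sum>b\<in>I. w j a b y*P b i y)"
   unfolding e by (rule sum_swap_sym) (use christoffel_loc_sym[OF T gg gg_sym gg_nd, OF ja(1) ja(1) _ _ ja(1) _ _ _ ja(1) _ _ _ X_T] ja y in "simp")
  moreover have "pd i (P a j) y = pd j (P a i) y" unfolding P_def using X[OF ja] by (intro Cinf_on_partial_commute[OF S _ y ij])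
  ultimately show ?thesis by simp
 qed
 show "pd i (\<eta> a b) y = (\<Sum>c\<in>I. w i c a y*\<eta> c b y) + (\<Sum>c\<in>I. \<eta> a c y*w i c b y)"
  if a: "a \<in> I" and b: "b \<in> I" and i: "i<d" and y: "y \<in> S" for a b i y
 proof (cases "fst a = fst b")
  case True
  obtain j s t where ab: "a = (j, s)" "b = (j, t)" using True by (metis prod.collapse)
  have j: "j<m" "s<r j" "t<r j" using I_D[OF a] I_D[OF b] ab by auto
  have "pd i (\<eta> a b) y = pd i (%y. A j*gg j s t (X j y)) y" by (simp add: \<eta>_def[abs_def] ab)
  also have "... = A j*(\<Sum>c<r j. pd c (gg j s t) (X j y)*P (j, c) i y)"
   using j by (subst partial_deriv_cmult[OF S i y]) (auto intro!: pull_smooth gg simp: pull_deriv[OF j(1) gg[OF j] i y])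
  also have "... = A j*(\<Sum>c<r j. (\<Sum>l<r j. \<Gamma> j l c s (X j y)*gg j l t (X j y) + \<Gamma> j l c t (X j y)*gg j s l (X j y))*P (j, c) i y)"
   using christoffel_loc_compatible[OF T[OF j(1)] gg[OF j(1)] gg_sym[OF j(1)] gg_nd[OF j(1)] j(2,3) _ X_T[OF j(1) y]] by simp
  also have "... = (\<Sum>l<r j. (\<Sum>c<r j. \<Gamma> j l c s (X j y)*P (j, c) i y)*(A j*gg j l t (X j y)))
    + (\<Sum>l<r j. A j*gg j s l (X j y)*(\<Sum>c<r j. \<Gamma> j l c t (X j y)*P (j, c) i y))"
   unfolding sum_distrib_left sum_distrib_right sum.distrib[symmetric] by (subst sum.swap) (simp add: algebra_simps sum.distrib)
  also have "(\<Sum>l<r j. (\<Sum>c<r j. \<Gamma> j l c s (X j y)*P (j, c) i y)*(A j*gg j l t (X j y))) = (\<Sum>c\<in>I. w i c a y*\<eta> c b y)"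
   by (subst sum_fibre[OF j(1)]) (use j in "auto simp: \<eta>_def ab w_row I_def")
  also have "(\<Sum>l<r j. A j*gg j s l (X j y)*(\<Sum>c<r j. \<Gamma> j l c t (X j y)*P (j, c) i y)) = (\<Sum>c\<in>I. \<eta> a c y*w i c b y)"
   by (subst sum_fibre[OF j(1)]) (use j in "auto simp: \<eta>_def ab w_row I_def")
  finally show ?thesis .
 next
  case False
  then have "(\<Sum>c\<in>I. w i c a y*\<eta> c b y) = 0" "(\<Sum>c\<in>I. \<eta> a c y*w i c b y) = 0"
   using w_off[of a] w_off[of b] by (intro sum.neutral; auto simp: \<eta>_def)+
  moreover have "\<eta> a b = (%y. 0)" using False by (auto simp: \<eta>_def)
  ultimately show ?thesis by (simp add: partial_deriv_const)
 qed
qed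

lemma W_deriv:
 assumes "i<d" "c \<in> I" "p \<in> I" "q \<in> I" "y \<in> S"
 shows "pd i (W c p q) y = (\<Sum>f\<in>I. DW f c p q y*P f i y)"
proof (cases "fst c = fst p & fst p = fst q")
 case True
 obtain j a b l where e: "p = (j, a)" "q = (j, b)" "c = (j, l)" using True by (metis prod.collapse)
 have j: "j<m" "a<r j" "b<r j" "l<r j" using assms(2-4) e by (auto simp: I_def)
 have "pd i (W c p q) y = pd i (%y. \<Gamma> j a l b (X j y)) y" by (simp add: W_def[abs_def] e)
 also have "... = (\<Sum>f<r j. pd f (\<Gamma> j a l b) (X j y)*P (j, f) i y)" by (rule pull_deriv[OF j(1) \<Gamma>_smooth[OF j(1,2,4,3)] assms(1,5)])
 also have "... = (\<Sum>f\<in>I. DW f c p q y*P f i y)" by (subst sum_fibre[OF j(1)]) (auto simp: DW_def e)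
 finally show ?thesis .
next
 case False
 then have "W c p q = (%y. 0)" "(\<Sum>f\<in>I. DW f c p q y*P f i y) = 0" by (auto simp: W_def DW_def intro!: sum.neutral)
 then show ?thesis by (simp add: partial_deriv_const)
qed

text \<open>The coframe is closed, so there are no structure functions and the curvature splits into
  that of the factors. Ricci tensors ignore constant weights, hence the Einstein constants 1 give
  the unweighted sum.\<close>

theorem product_ricci:
 assumes y: "y \<in> S" and kl: "k<d" "l<d"
 shows "ricci_loc d (christoffel_loc d G) k l y = (\<Sum>j<m. \<Sum>a<r j. \<Sum>b<r j. gg j a b (X j y)*(P (j, a) k y*P (j, b) l y))"
proof -
 define K where "K f b = (\<Sum>a\<in>I. frame_curv W DW (%_ _ _ _. 0) a f a b y)" for f b
 have K: "K f b = (if fst f = fst b then gg (fst f) (snd f) (snd b) (X (fst f) y) else 0)" if f: "f \<in> I" and b: "b \<in> I" for f b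
 proof (cases "fst f = fst b")
  case True
  obtain j s t where e: "f = (j, s)" "b = (j, t)" using True by (metis prod.collapse)
  have j: "j<m" "s<r j" "t<r j" using f b e by (auto simp: I_def)
  let ?g = "%a l c. \<Gamma> j a l c (X j y)"
  have W1: "(\<Sum>c\<in>I. W a a c y*W f c b y) = (if fst a = j then \<Sum>c<r j. ?g (snd a) (snd a) c*?g c s t else 0)"
   "(\<Sum>c\<in>I. W f a c y*W a c b y) = (if fst a = j then \<Sum>c<r j. ?g (snd a) s c*?g c (snd a) t else 0)" for a
   by (subst sum_fibre[OF j(1)]; auto simp: W_def e)+
  have "K f b = (\<Sum>a<r j. pd a (\<Gamma> j a s t) (X j y) - pd s (\<Gamma> j a a t) (X j y) + ((\<Sum>c<r j. ?g a a c*?g c s t) - (\<Sum>c<r j. ?g a s c*?g c a t)))"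
   unfolding K_def frame_curv_def W1 by (subst sum_fibre[OF j(1)]) (auto simp: DW_def e)
  also have "... = ricci_loc (r j) (\<Gamma> j) s t (X j y)" by (simp add: ricci_loc_def riemann_loc_def sum_subtractf)
  also have "... = gg j s t (X j y)" by (rule gg_ricci[OF j X_T[OF j(1) y]])
  finally show ?thesis by (simp add: e)
 next
  case False
  have "frame_curv W DW (%_ _ _ _. 0) a f a b y = 0" for a
  proof -
   have "(\<Sum>c\<in>I. W a a c y*W f c b y) = 0" "(\<Sum>c\<in>I. W f a c y*W a c b y) = 0" using False by (auto simp: W_def intro!: sum.neutral)
   then show ?thesis using False by (auto simp: frame_curv_def DW_def)
  qed
  then show ?thesis using False by (simp add: K_def)
 qed
 have "ricci_loc d (christoffel_loc d G) k l y = (\<Sum>f\<in>I. \<Sum>b\<in>I. K f b*(P f k y*P b l y))" unfolding K_def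
 proof (rule frame_ricci[OF W_smooth _ W_deriv _ y kl])
  show "w i a b y = (\<Sum>c\<in>I. W c a b y*P c i y)" for i a b y by (simp add: w_def)
  show "pd i (P c j) y - pd j (P c i) y = (\<Sum>e\<in>I. \<Sum>f\<in>I. 0*(P e i y*P f j y))" if "c \<in> I" "i<d" "j<d" "y \<in> S" for c i j y
   unfolding P_def using Cinf_on_partial_commute[OF S X that(4,2,3)] I_D[OF that(1)] by simp
 qed
 also have "... = (\<Sum>j<m. \<Sum>a<r j. \<Sum>b\<in>I. K (j, a) b*(P (j, a) k y*P b l y))" by (rule sum_I)
 also have "... = (\<Sum>j<m. \<Sum>a<r j. \<Sum>b<r j. gg j a b (X j y)*(P (j, a) k y*P (j, b) l y))"
 proof (rule sum.cong[OF refl], rule sum.cong[OF refl])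
  fix j a assume "j \<in> {..<m}" "a \<in> {..<r j}"
  then have j: "j<m" "a<r j" by auto
  then show "(\<Sum>b\<in>I. K (j, a) b*(P (j, a) k y*P b l y)) = (\<Sum>b<r j. gg j a b (X j y)*(P (j, a) k y*P (j, b) l y))"
   by (subst sum_fibre[OF j(1)]) (auto simp: K I_def)
 qed
 finally show ?thesis .
qed

theorem product_parallel:
 assumes y: "y \<in> S" and ij: "i<d" "j<d" "k<d"
 shows "parallel_loc d (christoffel_loc d G) J i k j y = 0"
proof (rule frame_parallel[where F = F, OF J _ _ y ij])
 show "Cinf_on d S (F a b)" if "a \<in> I" "b \<in> I" for a b
 proof (cases "fst a = fst b")
  case True
  then show ?thesis unfolding F_def[abs_def] using that I_D[OF that(1)] I_D[OF that(2)] by simp (intro pull_smooth JN; simp)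
 next
  case False
  then show ?thesis unfolding F_def[abs_def] by (simp add: Cinf_on_const[OF S])
 qed
 show "(\<Sum>l<d. P a l y*J l j y) = (\<Sum>b\<in>I. F a b y*P b j y)" if "a \<in> I" "j<d" "y \<in> S" for a j y
  using XJ[OF I_D[OF that(1)] that(2,3)] I_D(1)[OF that(1)] by (subst sum_fibre[of "fst a"]) (auto simp: F_def P_def)
 show "pd i (F a b) y + (\<Sum>c\<in>I. w i a c y*F c b y) - (\<Sum>c\<in>I. F a c y*w i c b y) = 0" if a: "a \<in> I" and b: "b \<in> I" for a b
 proof (cases "fst a = fst b")
  case True
  obtain q s t where ab: "a = (q, s)" "b = (q, t)" using True by (metis prod.collapse)
  have q: "q<m" "s<r q" "t<r q" using I_D[OF a] I_D[OF b] ab by auto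
  let ?g = "%a l c. \<Gamma> q a l c (X q y)"
  have "pd i (F a b) y = pd i (%y. JN q s t (X q y)) y" by (simp add: F_def[abs_def] ab)
  also have "... = (\<Sum>c<r q. pd c (JN q s t) (X q y)*P (q, c) i y)" by (rule pull_deriv[OF q(1) JN[OF q] ij(1) y])
  also have "... = (\<Sum>c<r q. ((\<Sum>l<r q. ?g l c t*JN q s l (X q y)) - (\<Sum>l<r q. ?g s c l*JN q l t (X q y)))*P (q, c) i y)"
  proof (rule sum.cong[OF refl])
   fix c assume "c \<in> {..<r q}"
   then have "parallel_loc (r q) (\<Gamma> q) (JN q) c s t (X q y) = 0" using JN_parallel[OF q(1) _ q(2,3) X_T[OF q(1) y]] by simp
   then have "pd c (JN q s t) (X q y) = (\<Sum>l<r q. ?g l c t*JN q s l (X q y)) - (\<Sum>l<r q. ?g s c l*JN q l t (X q y))"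
    by (simp add: parallel_loc_def sum_subtractf)
   then show "pd c (JN q s t) (X q y)*P (q, c) i y =
     ((\<Sum>l<r q. ?g l c t*JN q s l (X q y)) - (\<Sum>l<r q. ?g s c l*JN q l t (X q y)))*P (q, c) i y" by simp
  qed
  also have "... = (\<Sum>l<r q. JN q s l (X q y)*(\<Sum>c<r q. ?g l c t*P (q, c) i y)) - (\<Sum>l<r q. (\<Sum>c<r q. ?g s c l*P (q, c) i y)*JN q l t (X q y))"
   unfolding left_diff_distrib sum_subtractf unfolding sum_distrib_left sum_distrib_right by (subst (1 2) sum.swap) (simp add: mult_ac)
  also have "(\<Sum>l<r q. JN q s l (X q y)*(\<Sum>c<r q. ?g l c t*P (q, c) i y)) = (\<Sum>c\<in>I. F a c y*w i c b y)"
   by (subst sum_fibre[OF q(1)]) (use q in "auto simp: F_def ab w_row I_def")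
  also have "(\<Sum>l<r q. (\<Sum>c<r q. ?g s c l*P (q, c) i y)*JN q l t (X q y)) = (\<Sum>c\<in>I. w i a c y*F c b y)"
   by (subst sum_fibre[OF q(1)]) (use q in "auto simp: F_def ab w_row I_def")
  finally show ?thesis by simp
 next
  case False
  then have "F a b = (%y. 0)" by (auto simp: F_def)
  moreover have "(\<Sum>c\<in>I. w i a c y*F c b y) = 0" using w_off[of _ a] False by (intro sum.neutral) (auto simp: F_def)
  moreover have "(\<Sum>c\<in>I. F a c y*w i c b y) = 0" using w_off[of b] False by (intro sum.neutral) (auto simp: F_def)
  ultimately show ?thesis by (simp add: partial_deriv_const)
 qed
qed

end

section \<open>Kaehler metrics on the base in both constructions\<close>

context toric_base
begin

text \<open>What the two constructions have to supply about the metric with weights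
  \<open>A\<close>, stated in charts so that \<open>total_frame\<close> can take it over.\<close>

definition base_kahler :: "(nat => real) => bool" where "base_kahler A \<longleftrightarrow> (\<forall>e\<in>atlas (base D). split_metric.parallel d m (B.cimg e) (bc e) (Jc e) A &
  (\<forall>z\<in>B.cimg e. scalar_loc d (split_metric.G m (bc e) A) z = (\<Sum>i<m. real (dims D i)/A i)))"

context
 fixes e assumes e: "e \<in> atlas (base D)"
begin

interpretation S: split_metric d m "B.cimg e" "bc e" "Jc e" "dims D" by (rule split[OF e])

lemma comp_G: "comp2 (base D) (base_metric D A) e = S.G A" by (intro ext) (simp add: comp_base_metric[OF e] S.G_def)

lemma parallel_iff: "S.parallel A \<longleftrightarrow> (\<forall>y\<in>snd e ` fst e. \<forall>i<d. \<forall>j<d. \<forall>k<d.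
  parallel_loc d (christoffel_loc d (comp2 (base D) (base_metric D A) e)) (endo_comp (base D) (base_J D) e) i k j y = 0)"
 unfolding S.parallel_def unfolding comp_G Jc_def B.cimg_def ..

lemma closed_form_chart:
 assumes "closed_2form (base D) (base_form D A)"
 shows "S.closed A" unfolding S.closed_def
proof (intro ballI allI impI)
 fix z i j k assume z: "z \<in> B.cimg e" and ijk: "i<d" "j<d" "k<d"
 have "pd i (S.w A j k) z = pd i (comp2 (base D) (base_form D A) e j k) z" if "i<d" "j<d" "k<d" for i j k
  by (rule partial_deriv_cong[OF S.T _ z that(1)]) (simp add: comp_base_form[OF e _ that(2,3)] S.w_def S.G_def)
 moreover have "pd i (comp2 (base D) (base_form D A) e j k) z + pd j (comp2 (base D) (base_form D A) e k i) z
   + pd k (comp2 (base D) (base_form D A) e i j) z = 0" using assms e z[unfolded B.cimg_def] ijk unfolding closed_2form_def by blast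
 ultimately show "pd i (S.w A j k) z + pd j (S.w A k i) z + pd k (S.w A i j) z = 0" using ijk by simp
qed

text \<open>The metrics for \<open>a0\<close> at x = 1 and x = 2 are Kaehler, so the slope form,
  their difference, is closed. Adding the closed form of \<open>a\<close> gives a closed form for
  every x. The parallel \<open>J\<close> and the scalar curvature then follow by comparison with
  \<open>a0\<close> at x = 1.\<close>

lemma one_chart:
 assumes pos0: "!!s i. 0<s ==> i<m ==> 0<warp D a0 s i"
  and kahler: "!!s. 0<s ==> kahler (base D) (base_metric D (warp D a0 s)) (base_J D)"
  and ricci: "!!q i v. q \<in> fst e ==> i<m ==> v \<in> base_summand D i q ==> bg D i q v v = 1 ==> 
   ricci (base D) (base_metric D (warp D a0 1)) e q v v = 1"
  and closed: "closed_2form (base D) (base_form D a)"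
  and pos: "!!i. i<m ==> 0<warp D a s i"
 shows "S.parallel (warp D a s)"
  and "z \<in> B.cimg e ==> scalar_loc d (S.G (warp D a s)) z = (\<Sum>i<m. real (dims D i)/warp D a s i)"
proof -
 have P: "S.parallel (warp D a0 s)" if "0<s" for s using kahler[OF that] e unfolding kahler_def parallel_iff parallel_endo_loc by blast
 have p0: "S.pos (warp D a0 s)" if "0<s" for s using pos0[OF that] by (simp add: S.pos_def)
 have C: "S.closed (warp D a0 1)" "S.closed (warp D a0 2)" by (rule S.parallel_imp_closed[OF p0 P]; simp)+
 \<comment> \<open>The constants \<open>a0\<close> cancel: warp at 2 minus warp at 1 is the
   slope.\<close>
 have "S.closed (%i. (-1)*warp D a0 1 i + 1*warp D a0 2 i)" by (rule S.closed_affine[OF C])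
 then have "S.closed (slope D)" by (simp add: warp_def)
 then have "S.closed (%i. s * slope D i + 1*a i)" by (rule S.closed_affine) (rule closed_form_chart[OF closed])
 moreover have "warp D a s = (%i. s * slope D i + 1*a i)" by (auto simp: warp_def)
 ultimately have cl: "S.closed (warp D a s)" by simp
 have pa: "S.pos (warp D a s)" using pos by (simp add: S.pos_def)
 show par: "S.parallel (warp D a s)" by (rule S.closed_imp_parallel[of "warp D a0 1"]) (simp_all add: p0 P pa cl)
 assume z: "z \<in> B.cimg e"
 obtain q where q: "q \<in> fst e" "z = snd e q" using B.cimg_E[OF e z] by blast
 have qp: "q \<in> pts (base D)" using B.chart_pts[OF e] q(1) by blast
 show "scalar_loc d (S.G (warp D a s)) z = (\<Sum>i<m. real (dims D i)/warp D a s i)"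
 proof (rule S.scalar_change[OF p0[of 1] P[of 1] pa par z])
  fix i v assume i: "i<m" and v: "!!j k. j<m ==> j ~= i ==> k<d ==> (\<Sum>l<d. bc e j k l z * v l) = 0"
  have lt: "B.comb e v q \<in> tangent (base D) q" by (rule B.comb(1)[OF e q(1)])
  have bgv: "bg D j q (B.comb e v q) (B.comb e v q) = (\<Sum>k<d. \<Sum>l<d. bc e j k l z*(v k * v l))" if "j<m" for j
   by (simp add: bg_expand[OF e that q(1) lt lt] B.comb(2)[OF e q(1)] q(2))
  have "bg D j q (B.comb e v q) (B.comb e v q) = 0" if "j<m" "j ~= i" for j
  proof -
   have "(\<Sum>k<d. \<Sum>l<d. bc e j k l z*(v k * v l)) = (\<Sum>k<d. v k*(\<Sum>l<d. bc e j k l z * v l))" by (simp add: sum_distrib_left mult_ac)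
   then show ?thesis using v[OF that] by (simp add: bgv[OF that(1)])
  qed
  note off = this
  let ?R = "%v. \<Sum>k<d. \<Sum>l<d. ricci_loc d (S.\<Gamma> (warp D a0 1)) k l z*(v k * v l)"
  define \<beta> where "\<beta> = bg D i q (B.comb e v q) (B.comb e v q)"
  show "?R v = (\<Sum>k<d. \<Sum>l<d. bc e i k l z*(v k * v l))"
  proof (cases "\<beta> = 0")
   case True
   then have "B.comb e v q = vzero" using base_facts(8)[OF qp lt] off by (metis \<beta>_def)
   then have "v k = 0" if "k<d" for k using B.comb(2)[OF e q(1) that, of v] by (simp add: B.vcoord_linear)
   then show ?thesis by simp
  next
   case False
   then have \<beta>: "0<\<beta>" using bg_sym(2)[OF i qp lt lt] by (simp add: \<beta>_def)
   \<comment> \<open>The Ricci form is normalised on unit vectors only; \<open>c\<close> rescales to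
     unit length in \<open>bg i\<close>.\<close>
   define c where "c = 1/sqrt \<beta>"
   define u where "u = vscale c (B.comb e v q)"
   have ut: "u \<in> tangent (base D) q" unfolding u_def by (rule B.vscale_tangent[OF lt])
   have uu: "bg D j q u u = c*(c*bg D j q (B.comb e v q) (B.comb e v q))" if "j<m" for j
    using bg_linear[OF that qp lt] bg_linear[OF that qp ut] lt ut by (simp add: u_def linear_fun_def)
   have cc: "c*(c*\<beta>) = 1" using \<beta> by (simp add: c_def field_simps)
   have "u \<in> base_summand D i q" using ut uu off by (simp add: base_summand_def)
   then have "ricci (base D) (base_metric D (warp D a0 1)) e q u u = 1" using ricci[OF q(1) i] uu[OF i] cc by (simp add: \<beta>_def)
   moreover have "ricci (base D) (base_metric D (warp D a0 1)) e q u u = c*(c*?R v)" unfolding ricci_def ricci_comp_eq_loc comp_G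
    by (simp add: u_def B.vcoord_linear B.comb(2)[OF e q(1)] q(2) sum_distrib_left mult_ac)
   ultimately have "c*(c*?R v) = c*(c*\<beta>)" using cc by simp
   moreover have "c ~= 0" using \<beta> by (simp add: c_def)
   ultimately have "?R v = \<beta>" by simp
   then show ?thesis by (simp add: \<beta>_def bgv[OF i])
  qed
 qed simp_all
qed

end

theorem base_kahler_one:
 assumes "construction_one D \<G> a0 g J" and pos0: "!!s i. 0<s ==> i<m ==> 0<warp D a0 s i"
  and closed: "closed_2form (base D) (base_form D a)" and pos: "!!i. i<m ==> 0<warp D a s i"
 shows "base_kahler (warp D a s)"
proof -
 have K: "kahler (base D) (base_metric D (warp D a0 s)) (base_J D)" if "0<s" for s using assms(1) that by (simp add: construction_one_def Let_def)
 have R: "ricci (base D) (base_metric D (warp D a0 1)) e q v v = 1"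
  if "e \<in> atlas (base D)" "q \<in> fst e" "i<m" "v \<in> base_summand D i q" "bg D i q v v = 1" for e q i v
  using assms(1) that by (simp add: construction_one_def Let_def)
 show ?thesis unfolding base_kahler_def
 proof (intro ballI conjI)
  fix e z assume e: "e \<in> atlas (base D)"
  show "split_metric.parallel d m (B.cimg e) (bc e) (Jc e) (warp D a s)" by (rule one_chart(1)[OF e]) (use pos0 K R[OF e] closed pos in blast)+
  assume "z \<in> B.cimg e"
  then show "scalar_loc d (split_metric.G m (bc e) (warp D a s)) z = (\<Sum>i<m. real (dims D i)/warp D a s i)"
   by (rule one_chart(2)[OF e, rotated -1]) (use pos0 K R[OF e] closed pos in blast)+
 qed
qed

end

lemma openin_finite_Int:
 assumes "openin X U" "!!j. j<n ==> openin X (V j)"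
 shows "openin X {q \<in> U. \<forall>j<n::nat. q \<in> V j}" using assms(2)
proof (induction n)
 case (Suc n)
 have "{q \<in> U. \<forall>j<Suc n. q \<in> V j} = {q \<in> U. \<forall>j<n. q \<in> V j} \<inter> V n" by (auto simp: less_Suc_eq)
 then show ?case using Suc by (simp add: openin_Int)
qed (simp add: assms(1))

context smooth_mfd
begin

lemma metric_comp:
 assumes g: "riemannian X g" and c: "c \<in> atlas X"
 shows "i<dm ==> j<dm ==> Cinf_on dm (cimg c) (comp2 X g c i j)"
  and "i<dm ==> j<dm ==> y \<in> cimg c ==> comp2 X g c i j y = comp2 X g c j i y"
  and "y \<in> cimg c ==> nondegenerate dm (%i j. comp2 X g c i j y)"
proof -
 have psd: "symmetric_psd X g" and bil: "bilinear_tensor X g" using g by (auto simp: riemannian_def symmetric_psd_def)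
 show "i<dm ==> j<dm ==> Cinf_on dm (cimg c) (comp2 X g c i j)" using bil c unfolding bilinear_tensor_def cimg_def by blast
 assume y: "y \<in> cimg c"
 then obtain p where p: "p \<in> fst c" "y = snd c p" using cimg_E[OF c] by blast
 have pp: "p \<in> pts X" using chart_pts[OF c] p(1) by blast
 show "i<dm ==> j<dm ==> comp2 X g c i j y = comp2 X g c j i y"
  using psd pp coord_vect_tangent[OF c p(1)] by (simp add: p(2) comp2_at[OF c p(1)] symmetric_psd_def)
 show "nondegenerate dm (%i j. comp2 X g c i j y)" unfolding nondegenerate_def
 proof (intro allI impI)
  fix v k assume v: "\<forall>i<dm. (\<Sum>k<dm. comp2 X g c i k y * v k) = 0" and k: "k<dm"
  define u where "u = comb c v p"
  note u = comb(1)[OF c p(1), of v, folded u_def] and uk = comb(2)[OF c p(1), where v = v, folded u_def]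
  have "g p u u = (\<Sum>i<dm. \<Sum>j<dm. comp2 X g c i j y*(vcoord c i u * vcoord c j u))" unfolding p(2) by (rule bilinear_expand[OF bil c p(1) u u])
  also have "... = (\<Sum>i<dm. v i*(\<Sum>j<dm. comp2 X g c i j y * v j))" by (simp add: uk sum_distrib_left mult_ac)
  finally have "g p u u = 0" using v by simp
  then have "u = vzero" using g pp u unfolding riemannian_def by (metis less_irrefl)
  then show "v k = 0" using uk[OF k] by (simp add: vcoord_linear)
 qed
qed

lemma endo_coord:
 assumes E: "endo_tensor X E" and c: "c \<in> atlas X" "p \<in> fst c" and v: "v \<in> tangent X p"
 shows "vcoord c k (E p v) = (\<Sum>l<dm. endo_comp X E c k l (snd c p) * vcoord c l v)"
proof -
 have p: "p \<in> pts X" using chart_pts[OF c(1)] c(2) by blast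
 have "linear_vmap (tangent X p) (tangent X p) (E p)" using E p by (simp add: endo_tensor_def)
 then have "linear_fun (tangent X p) (%v. vcoord c k (E p v))" by (simp add: linear_fun_def linear_vmap_def vcoord_linear)
 from linear_fun_expand[OF this c v] show ?thesis by (simp add: endo_at[OF c] mult.commute)
qed

lemma einstein_comp:
 assumes "einstein X g lam" and c: "c \<in> atlas X" "y \<in> cimg c" and ij: "i<dm" "j<dm"
 shows "ricci_loc dm (christoffel_loc dm (comp2 X g c)) i j y = lam*comp2 X g c i j y"
proof -
 obtain p where p: "p \<in> fst c" "y = snd c p" using cimg_E[OF c] by blast
 note t = coord_vect_tangent[OF c(1) p(1)]
 let ?R = "%i j. ricci_loc dm (christoffel_loc dm (comp2 X g c)) i j y"
 have "ricci X g c p (coord_vect X c i p) (coord_vect X c j p) = (\<Sum>k<dm. \<Sum>l<dm. ?R k l*(if k = i then 1 else 0)*(if l = j then 1 else 0))"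
  unfolding ricci_def ricci_comp_eq_loc p(2) using ij by (intro sum.cong refl) (auto simp: vcoord_coord_vect[OF c(1) p(1)])
 also have "... = ?R i j" using ij by (simp add: sum_delta_right)
 finally show ?thesis using assms(1) c(1) p t[OF ij(1)] t[OF ij(2)] by (simp add: einstein_def comp2_at)
qed

end

context toric_base
begin

text \<open>Near each point of the base, the coordinates of suitable charts of the factors form a
  \<open>product_frame\<close>. The charts of the base need not be adapted to the product, so its
  structure enters through the differentials of the projections.\<close>

theorem base_kahler_two:
 assumes two: "construction_two D \<P>" and pos: "!!i. i<m ==> 0<A i"
 shows "base_kahler A"
proof -
 define N where "N = factor \<P>"
 define gN where "gN = factor_g \<P>"
 define JN where "JN = factor_J \<P>"
 define pr where "pr = factor_proj \<P>"
 have N: "kahler (N i) (gN i) (JN i)" "einstein (N i) (gN i) 1" "mdim (N i) = dims D i" if "i<m" for i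
  using two that by (auto simp: construction_two_def Let_def N_def gN_def JN_def)
 have prod: "product_manifold m N (base D) pr" using two by (simp add: construction_two_def Let_def N_def pr_def)
 have bgN: "bg D i q v w = gN i (pr i q) (push (N i) (pr i) q v) (push (N i) (pr i) q w)"
  and JNp: "push (N i) (pr i) q (base_J D q v) = JN i (pr i q) (push (N i) (pr i) q v)"
  if "i<m" "q \<in> pts (base D)" "v \<in> tangent (base D) q" "w \<in> tangent (base D) q" for i q v w
  using two that by (auto simp: construction_two_def Let_def N_def gN_def JN_def pr_def)
 have pr: "smooth_map (base D) (N i) (pr i)" if "i<m" for i using prod that by (simp add: product_manifold_def)
 have sN: "smooth_mfd (N i)" if "i<m" for i using N(1)[OF that] by (simp add: smooth_mfd_def kahler_def)
 have rN: "riemannian (N i) (gN i)" "endo_tensor (N i) (JN i)" "parallel_endo (N i) (gN i) (JN i)" if "i<m" for i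
  using N(1)[OF that] by (auto simp: kahler_def almost_complex_def)
 \<comment> \<open>The uniqueness in \<open>product_manifold\<close>, applied to the family of zero
   vectors.\<close>
 have inj: "v = vzero" if q: "q \<in> pts (base D)" and v: "v \<in> tangent (base D) q" and 0: "!!i. i<m ==> push (N i) (pr i) q v = vzero" for q v
 proof -
  have "\<exists>!v. v \<in> tangent (base D) q & (\<forall>i<m. push (N i) (pr i) q v = vzero)"
   using prod q smooth_mfd.vzero_tangent[OF sN] unfolding product_manifold_def by (elim conjE) (drule bspec[of _ _ q], auto)
  then show ?thesis using v 0 B.vzero_tangent push_linear(3) by metis
 qed
 have main: "(\<forall>i<d. \<forall>j<d. \<forall>k<d. parallel_loc d (christoffel_loc d (split_metric.G m (bc e) A)) (Jc e) i k j z = 0) &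
   (\<forall>k<d. \<forall>l<d. ricci_loc d (christoffel_loc d (split_metric.G m (bc e) A)) k l z = (\<Sum>j<m. bc e j k l z))"
  if e: "e \<in> atlas (base D)" and z: "z \<in> B.cimg e" for e z
 proof -
  interpret S: split_metric d m "B.cimg e" "bc e" "Jc e" "dims D" by (rule split[OF e])
  obtain q0 where q0: "q0 \<in> fst e" "z = snd e q0" using B.cimg_E[OF e z] by blast
  have q0p: "q0 \<in> pts (base D)" using B.chart_pts[OF e] q0(1) by blast
  let ?push = "%j. push (N j) (pr j)" and ?e = "coord_vect (base D) e"
  have "\<forall>j\<in>{..<m}. \<exists>c. c \<in> atlas (N j) & pr j q0 \<in> fst c" using smooth_mfd.ex_chart[OF sN] smooth_map_pts[OF pr q0p] by blast
  then obtain ch where ch: "!!j. j<m ==> ch j \<in> atlas (N j)" and q0ch: "!!j. j<m ==> pr j q0 \<in> fst (ch j)" by (rule bchoice[THEN exE]) auto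
  let ?g = "%j. comp2 (N j) (gN j) (ch j)" and ?J = "%j. endo_comp (N j) (JN j) (ch j)" and ?im = "%j. snd (ch j) ` fst (ch j)"
  \<comment> \<open>Every projection has to stay in the chart chosen around the image of
    \<open>q0\<close>; finitely many factors keep this set open.\<close>
  define W where "W = {q \<in> fst e. \<forall>j<m. q \<in> {q \<in> pts (base D). pr j q \<in> fst (ch j)}}"
  have Wo: "openin (mtop (base D)) W" unfolding W_def using B.map_preimage_open[OF sN pr smooth_mfd.chart_props(1)[OF sN ch]] B.chart_props(1)[OF e]
   by (intro openin_finite_Int) auto
  have We: "W \<subseteq> fst e" by (auto simp: W_def)
  define SS where "SS = snd e ` W"
  have SS: "eopen d SS" unfolding SS_def by (rule B.chart_open_image[OF e Wo We])
  have SSe: "SS \<subseteq> B.cimg e" using We by (auto simp: SS_def B.cimg_def)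
  have zS: "z \<in> SS" using q0 q0ch q0p by (auto simp: SS_def W_def)
  define X where "X j y = snd (ch j) (pr j (chart_inv e y))" for j y
  have SSE: "\<exists>q. q \<in> fst e & q \<in> pts (base D) & y = snd e q & chart_inv e y = q & (\<forall>j<m. pr j q \<in> fst (ch j))" if y: "y \<in> SS" for y
  proof -
   obtain q where "q \<in> W" "y = snd e q" using y unfolding SS_def by blast
   moreover have "q \<in> pts (base D)" using B.chart_pts[OF e] We calculation by blast
   ultimately show ?thesis using B.chart_inv_left[OF e] by (auto simp: W_def)
  qed
  have push_c: "vcoord (ch j) a (?push j q (?e k q)) = pd k (%y. X j y a) (snd e q)"
   if "q \<in> fst e" "j<m" "pr j q \<in> fst (ch j)" "a<dims D j" for q j a k
   unfolding X_def by (rule B.vcoord_push_coord_vect[OF sN[OF that(2)] pr[OF that(2)] e that(1) ch[OF that(2)] that(3)]) (use that N(3) in simp)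
  have push_v: "vcoord (ch j) a (?push j q v) = (\<Sum>k<d. pd k (%y. X j y a) (snd e q) * vcoord e k v)"
   if "q \<in> fst e" "j<m" "pr j q \<in> fst (ch j)" "a<dims D j" "v \<in> tangent (base D) q" for q j a v
  proof -
   have "q \<in> pts (base D)" using B.chart_pts[OF e] that(1) by blast
   then have "linear_fun (tangent (base D) q) (%v. vcoord (ch j) a (?push j q v))"
    by (simp add: linear_fun_def push_linear B.vcoord_linear smooth_mfd.vcoord_linear[OF sN[OF that(2)]])
   from B.linear_fun_expand[OF this e that(1,5)] show ?thesis using push_c[OF that(1-4)] by (simp add: mult.commute)
  qed
  have pt: "?push j q v \<in> tangent (N j) (pr j q)" if "j<m" "q \<in> pts (base D)" "v \<in> tangent (base D) q" for j q v
   by (rule B.push_tangent[OF sN[OF that(1)] pr[OF that(1)] that(2,3)])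
  have bcx: "bc e j k l y = (\<Sum>a<dims D j. \<Sum>b<dims D j. ?g j a b (X j y) *
    (pd k (%y. X j y a) y*pd l (%y. X j y b) y))" if j: "j<m" and kl: "k<d" "l<d" and y: "y \<in> SS" for j k l y
  proof -
   obtain q where q: "q \<in> fst e" "q \<in> pts (base D)" "y = snd e q" "\<forall>j<m. pr j q \<in> fst (ch j)" using SSE[OF y] by blast
   note t = B.coord_vect_tangent[OF e q(1)]
   have pj: "pr j q \<in> fst (ch j)" using q(4) j by blast
   have "bc e j k l y = gN j (pr j q) (?push j q (?e k q)) (?push j q (?e l q))"
    using bgN[OF j q(2) t[OF kl(1)] t[OF kl(2)]] by (simp add: bc_def q(3) B.comp2_at[OF e q(1)])
   also have "... = (\<Sum>a<dims D j. \<Sum>b<dims D j. ?g j a b (snd (ch j) (pr j q)) *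
    (vcoord (ch j) a (?push j q (?e k q)) * vcoord (ch j) b (?push j q (?e l q))))"
    using smooth_mfd.bilinear_expand[OF sN[OF j] _ ch[OF j] pj pt[OF j q(2) t[OF kl(1)]] pt[OF j q(2) t[OF kl(2)]], of "gN j"] rN(1)[OF j]
    by (simp add: riemannian_def symmetric_psd_def N(3)[OF j])
   finally show ?thesis by (simp add: push_c[OF q(1) j pj] q(3) X_def B.chart_inv_left[OF e q(1)])
  qed
  interpret F: product_frame d m "dims D" SS ?im X
   ?g ?J A "S.G A" "Jc e"
  proof
   show "eopen d SS" by (rule SS)
   show "d = (\<Sum>j<m. dims D j)" by (rule base_facts(1))
   show "Cinf_on d SS (Jc e k l)" if "k<d" "l<d" for k l by (rule Cinf_on_subset[OF SSe S.J[OF that]])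
  next
   fix j assume j: "j<m"
   note C = smooth_mfd.metric_comp[OF sN[OF j] rN(1)[OF j] ch[OF j], unfolded smooth_mfd.cimg_def[OF sN[OF j]] N(3)[OF j]]
   show "eopen (dims D j) (?im j)"
    using smooth_mfd.chart_props(2)[OF sN[OF j] ch[OF j]] N(3)[OF j] by (simp add: smooth_mfd.cimg_def[OF sN[OF j]])
   show "X j y \<in> ?im j" if "y \<in> SS" for y using SSE[OF that] j by (auto simp: X_def)
   show "A j ~= 0" using pos[OF j] by simp
   show "nondegenerate (dims D j) (%a b. ?g j a b z)" if "z \<in> ?im j" for z using C(3) that by blast
   fix a assume a: "a<dims D j"
   show "Cinf_on d SS (%y. X j y a)" unfolding X_def using B.chart_map_smooth[OF sN[OF j] pr[OF j] e ch[OF j], of a] a N(3)[OF j]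
    by (intro Cinf_on_subset[of SS "snd e ` ({p \<in> pts (base D). pr j p \<in> fst (ch j)} \<inter> fst e)"]) (use j in "auto simp: SS_def W_def intro!: imageI")
   fix b assume b: "b<dims D j"
   show "Cinf_on (dims D j) (?im j) (?g j a b)" using C(1) a b by blast
   show "Cinf_on (dims D j) (?im j) (?J j a b)"
    using rN(2)[OF j] ch[OF j] a b N(3)[OF j] by (simp add: endo_tensor_def)
   fix z assume zj: "z \<in> ?im j"
   show "?g j a b z = ?g j b a z" using C(2) a b zj by blast
   show "ricci_loc (dims D j) (christoffel_loc (dims D j) (?g j)) a b z = ?g j a b z"
    using smooth_mfd.einstein_comp[OF sN[OF j] N(2)[OF j] ch[OF j], of z a b] zj a b N(3)[OF j] by (simp add: smooth_mfd.cimg_def[OF sN[OF j]])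
   fix i assume i: "i<dims D j"
   show "parallel_loc (dims D j) (christoffel_loc (dims D j) (?g j)) (?J j) i a b z = 0"
    using rN(3)[OF j] ch[OF j] zj i a b unfolding parallel_endo_loc N(3)[OF j] by blast
  next
   fix y and v :: "nat => real" assume y: "y \<in> SS" and v: "!!j a. j<m ==> a<dims D j ==> (\<Sum>k<d. pd k (%y. X j y a) y * v k) = 0"
   obtain q where q: "q \<in> fst e" "q \<in> pts (base D)" "y = snd e q" "\<forall>j<m. pr j q \<in> fst (ch j)" using SSE[OF y] by blast
   have lt: "B.comb e v q \<in> tangent (base D) q" by (rule B.comb(1)[OF e q(1)])
   have "?push j q (B.comb e v q) = vzero" if j: "j<m" for j
   proof -
    have "vcoord (ch j) a (?push j q (B.comb e v q)) = 0" if "a<dims D j" for a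
     using v[OF j that] q(4) j by (simp add: push_v[OF q(1) j _ that lt] B.comb(2)[OF e q(1)] q(3))
    then show ?thesis using q(4) j smooth_mfd.tangent_eq_iff[OF sN[OF j] ch[OF j] _ pt[OF j q(2) lt] smooth_mfd.vzero_tangent[OF sN[OF j]]]
     by (simp add: N(3) smooth_mfd.vcoord_linear[OF sN[OF j]])
   qed
   then have "B.comb e v q = vzero" by (rule inj[OF q(2) lt])
   then show "\<forall>k<d. v k = 0" using B.comb(2)[OF e q(1), of _ v] by (simp add: B.vcoord_linear)
  next
   fix k l y assume kl: "k<d" "l<d" and y: "y \<in> SS"
   show "S.G A k l y = (\<Sum>j<m. A j*(\<Sum>a<dims D j. \<Sum>b<dims D j. ?g j a b (X j y) *
     (pd k (%y. X j y a) y*pd l (%y. X j y b) y)))" by (simp add: S.G_def bcx[OF _ kl y])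
  next
   fix j a k y assume j: "j<m" and a: "a<dims D j" and k: "k<d" and y: "y \<in> SS"
   obtain q where q: "q \<in> fst e" "q \<in> pts (base D)" "y = snd e q" "\<forall>j<m. pr j q \<in> fst (ch j)" using SSE[OF y] by blast
   have pj: "pr j q \<in> fst (ch j)" using q(4) j by blast
   note t = B.coord_vect_tangent[OF e q(1) k]
   have "(\<Sum>l<d. pd l (%y. X j y a) y*Jc e l k y) = vcoord (ch j) a (?push j q (base_J D q (?e k q)))"
    by (simp add: push_v[OF q(1) j pj a J_tangent[OF q(2) t]] q(3) Jc_at[OF e q(1)])
   also have "... = vcoord (ch j) a (JN j (pr j q) (?push j q (?e k q)))" by (simp add: JNp[OF j q(2) t t])
   also have "... = (\<Sum>b<dims D j. ?J j a b (snd (ch j) (pr j q)) *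
     vcoord (ch j) b (?push j q (?e k q)))"
    using smooth_mfd.endo_coord[OF sN[OF j] rN(2)[OF j] ch[OF j] pj pt[OF j q(2) t], of a] by (simp add: N(3)[OF j])
   finally show "(\<Sum>l<d. pd l (%y. X j y a) y*Jc e l k y) = (\<Sum>b<dims D j. ?J j a b (X j y)*pd k (%y. X j y b) y)"
    by (simp add: push_c[OF q(1) j pj] q(3) X_def B.chart_inv_left[OF e q(1)])
  qed
  show ?thesis using F.product_parallel[OF zS] F.product_ricci[OF zS] bcx[OF _ _ _ zS] by (simp add: F.P_def)
 qed
 show ?thesis unfolding base_kahler_def
 proof (intro ballI conjI)
  fix e z assume e: "e \<in> atlas (base D)"
  interpret S: split_metric d m "B.cimg e" "bc e" "Jc e" "dims D" by (rule split[OF e])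
  show "S.parallel A" unfolding S.parallel_def using main[OF e] by blast
  assume z: "z \<in> B.cimg e"
  show "scalar_loc d (S.G A) z = (\<Sum>i<m. real (dims D i)/A i)" by (rule S.scalar_einstein[OF _ z]) (use main[OF e z] pos in "auto simp: S.pos_def")
 qed
qed

end

lemma smooth1_exp: "smooth1 UNIV (exp :: real => real)"
proof -
 have "Ck_on 1 k (line_set UNIV) (%y. exp (y 0))" for k
 proof (induction k)
  case 0
  have "continuous_on (line_set UNIV) (%y. exp (y 0) :: real)"
   by (intro continuous_on_exp continuous_on_subset[OF continuous_on_product_coordinates subset_UNIV])
  then show ?case by (simp add: Ck_on_0_iff eopen_line_set del: One_nat_def)
 next
  case (Suc k)
  then show ?case by (rule Ck_on_line_Suc_I[OF open_UNIV, rotated]) (auto intro!: derivative_eq_intros)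
 qed
 then show ?thesis by (simp add: smooth1_def Cinf_on_def)
qed

section \<open>The profile function\<close>

text \<open>\<open>t\<close> is 2 P'/P, so with L' = t and L 0 = 0 the function exp (L/2) is P/P(0).
  This normalisation of P turns the initial condition into q'(0) = 2. The source term
  \<open>\<rho>\<close> is nonnegative because S <= 0; hence q' >= 2 for s >= 0, and positivity
  follows.\<close>

lemma scalar_profile:
 fixes b a :: "nat => real" and r :: "nat => nat" and S :: real
 assumes b: "!!i. i<m ==> 0 <= b i" and a: "!!i. i<m ==> 0<a i" and S: "S <= 0"
 obtains h where "smooth1 UNIV h" "h 0 = 0" "(h has_real_derivative 2) (at 0)" "!!s. 0<s ==> 0<h s"
  "!!s. 0<s ==> (\<Sum>i<m. real (r i)/(b i * s + a i)) - deriv (deriv h) s - deriv h s * (\<Sum>i<m. b i*real (r i)/(b i * s + a i))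
   - h s * ((\<Sum>i<m. b i*real (r i)/(b i * s + a i))\<^sup>2/4 + deriv (%s. \<Sum>i<m. b i*real (r i)/(b i * s + a i)) s/2) = S"
proof -
 \<comment> \<open>Chosen positive with b_i e < a_i; the 1 in the denominators covers b_i = 0, the
   inserted 1 the case m = 0.\<close>
 define e where "e = Min (insert 1 ((%i. a i/(b i + 1)) ` {..<m}))"
 have e: "0<e" using a b by (auto simp: e_def intro!: divide_pos_pos add_nonneg_pos)
 have be: "b i*e<a i" if i: "i<m" for i
 proof -
  have "e <= a i/(b i + 1)" unfolding e_def using i by (intro Min_le) auto
  then have "e*(b i + 1) <= a i" using b[OF i] by (simp add: field_simps)
  then show ?thesis using e by (simp add: algebra_simps)
 qed
 obtain \<tau> where \<tau>: "smooth1 UNIV \<tau>" "!!s. s \<ge> 0 ==> \<tau> s = s" "!!s. \<tau> s \<ge> - e" by (rule smooth_cutoff[OF e], rule that)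
 have pos: "0<b i*\<tau> s + a i" if i: "i<m" for i s using be[OF i] mult_left_mono[OF \<tau>(3)[of s] b[OF i]] by simp
 have nz: "b i*\<tau> s + a i ~= 0" if "i \<in> {..<m}" for i s using pos[of i s] that by auto
 define \<rho> where "\<rho> s = (\<Sum>i<m. real (r i)/(b i*\<tau> s + a i)) - S" for s
 define t where "t s = (\<Sum>i<m. b i*real (r i)/(b i*\<tau> s + a i))" for s
 note sm = smooth1_divide smooth1_add smooth1_mult smooth1_const smooth1_sum smooth1_diff \<tau>(1) open_UNIV
 have \<rho>: "smooth1 UNIV \<rho>" unfolding \<rho>_def[abs_def] by (intro sm nz)
 have t: "smooth1 UNIV t" unfolding t_def[abs_def] by (intro sm nz)
 have \<rho>_nonneg: "0 <= \<rho> s" for s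
 proof -
  have "0 <= (\<Sum>i<m. real (r i)/(b i*\<tau> s + a i))" by (intro sum_nonneg divide_nonneg_pos pos) auto
  then show ?thesis using S by (simp add: \<rho>_def)
 qed
 obtain L where L: "smooth1 UNIV L" "L 0 = 0" "!!s. (L has_real_derivative t s) (at s)" using smooth1_integral[OF t] by blast
 have ex: "smooth1 UNIV (%s. exp (c*L s))" for c by (rule smooth1_compose[OF open_UNIV open_UNIV UNIV_I smooth1_exp]) (intro sm L(1))
 have "smooth1 UNIV (%s. exp (1/2*L s)*\<rho> s)" by (intro smooth1_mult open_UNIV ex \<rho>)
 then obtain q0 where q0: "smooth1 UNIV q0" "q0 0 = 0" "!!s. (q0 has_real_derivative exp (1/2*L s)*\<rho> s) (at s)" using smooth1_integral by blast
 have "smooth1 UNIV (%s. 2 + q0 s)" by (intro sm q0(1))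
 then obtain q where q: "smooth1 UNIV q" "q 0 = 0" "!!s. (q has_real_derivative 2 + q0 s) (at s)" using smooth1_integral by blast
 have q0_nonneg: "0 <= q0 s" if "0 <= s" for s
 proof (cases "s = 0")
  case False
  have "q0 0 <= q0 s"
  proof (rule DERIV_nonneg_imp_nondecreasing[OF that])
   fix x
   show "\<exists>y. (q0 has_real_derivative y) (at x) & 0 <= y" using q0(3)[of x] \<rho>_nonneg[of x] by (intro exI[of _ "exp (1/2*L x)*\<rho> x"]) simp
  qed
  then show ?thesis by (simp add: q0(2))
 qed (simp add: q0(2))
 define h where "h s = q s * exp (- 1/2*L s)" for s
 define h1 where "h1 s = (2 + q0 s - q s * t s/2)*exp (- 1/2*L s)" for s
 have h: "(h has_real_derivative h1 s) (at s)" for s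
  unfolding h_def[abs_def] h1_def by (rule derivative_eq_intros q(3) L(3) refl)+ (simp add: algebra_simps)
 have dt: "(t has_real_derivative deriv t s) (at s)" for s by (rule smooth1_deriv(1)[OF open_UNIV t UNIV_I])
 have h1: "(h1 has_real_derivative (exp (1/2*L s)*\<rho> s - ((2 + q0 s)*t s + q s * deriv t s)/2)*exp (- 1/2*L s)
   - (2 + q0 s - q s * t s/2)*(exp (- 1/2*L s)*t s/2)) (at s)" for s
 proof -
  have "((%s. 2 + q0 s - q s * t s/2) has_real_derivative exp (1/2*L s)*\<rho> s - ((2 + q0 s)*t s + q s * deriv t s)/2) (at s)"
   using DERIV_diff[OF DERIV_add[OF DERIV_const[of 2] q0(3)[of s]] DERIV_cdivide[OF DERIV_mult[OF q(3)[of s] dt], of 2]] by (simp add: mult.commute)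
  from DERIV_mult[OF this, of "%s. exp (- 1/2*L s)" "- (exp (- 1/2*L s)*t s/2)"]
  have "((%s. exp (- 1/2*L s)) has_real_derivative - (exp (- 1/2*L s)*t s/2)) (at s) ==> ?thesis"
   unfolding h1_def[abs_def] by (simp add: algebra_simps)
  moreover have "((%s. exp (- 1/2*L s)) has_real_derivative - (exp (- 1/2*L s)*t s/2)) (at s)"
   using DERIV_fun_exp[OF DERIV_cmult[OF L(3), of "- 1/2" s]] by simp
  ultimately show ?thesis by blast
 qed
 have ode: "deriv (deriv h) s + deriv h s * t s + h s * ((t s)\<^sup>2/4 + deriv t s/2) = \<rho> s" for s
 proof -
  have 1: "deriv h = h1" using h by (auto intro!: DERIV_imp_deriv)
  have 2: "deriv h1 s = (exp (1/2*L s)*\<rho> s - ((2 + q0 s)*t s + q s * deriv t s)/2)*exp (- 1/2*L s)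
   - (2 + q0 s - q s * t s/2)*(exp (- 1/2*L s)*t s/2)" by (rule DERIV_imp_deriv[OF h1])
  have 3: "exp (1/2*L s)*\<rho> s * exp (- 1/2*L s) = \<rho> s" by (simp add: mult.commute mult.left_commute flip: exp_add)
  show ?thesis unfolding 1 2 unfolding h_def h1_def left_diff_distrib 3 by (simp add: field_simps power2_eq_square)
 qed
 show thesis
 proof (rule that[of h])
  show "smooth1 UNIV h" unfolding h_def[abs_def] by (intro smooth1_mult open_UNIV q(1) ex)
  show "h 0 = 0" by (simp add: h_def q(2))
  show "(h has_real_derivative 2) (at 0)" using h[of 0] by (simp add: h1_def q(2) q0(2) L(2))
  fix s :: real assume s: "0<s"
  have "q 0<q s"
  proof (rule DERIV_pos_imp_increasing[OF s])
   fix x :: real assume "0 <= x"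
   then show "\<exists>y. (q has_real_derivative y) (at x) & 0<y" using q(3)[of x] q0_nonneg[of x] by (intro exI[of _ "2 + q0 x"]) simp
  qed
  then show "0<h s" by (simp add: h_def q(2))
  \<comment> \<open>Near a point s > 0 the cut-off is the identity, so derivatives at s agree as
    well.\<close>
  let ?t = "%s. \<Sum>i<m. b i*real (r i)/(b i * s + a i)"
  have ts: "?t u = t u" if "0<u" for u using \<tau>(2)[of u] that by (simp add: t_def)
  have "deriv ?t s = deriv t s"
  proof (rule deriv_cong_ev)
   have "\<forall>\<^sub>F u in nhds s. u \<in> {0<..}" using s by (intro eventually_nhds_in_open) auto
   then show "\<forall>\<^sub>F u in nhds s. ?t u = t u" by (rule eventually_mono) (simp add: ts)
  qed simp
  then show "(\<Sum>i<m. real (r i)/(b i * s + a i)) - deriv (deriv h) s - deriv h s * ?t s - h s * ((?t s)\<^sup>2/4 + deriv ?t s/2) = S"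
   using ode[of s] ts[OF s] \<tau>(2)[of s] s by (simp add: \<rho>_def)
 qed
qed

lemma smooth_fun_real_mfd: "smooth_fun real_mfd UNIV u \<longleftrightarrow> smooth1 UNIV u"
proof -
 let ?c = "%(t::real) (i::nat). if i = 0 then t else 0"
 have inj: "inj ?c" by (auto simp: inj_def fun_eq_iff split: if_splits)
 have im: "range ?c = line_set UNIV"
 proof (intro equalityI subsetI)
  fix y assume y: "y \<in> line_set UNIV"
  have "y i = 0" if "i ~= 0" for i using y that by (simp add: line_set_def topspace_Euclidean_space)
  then have "y = ?c (y 0)" by (auto simp: fun_eq_iff)
  then show "y \<in> range ?c" by blast
 qed (auto simp: line_set_point)
 have inv: "chart_inv (UNIV, ?c) y = y 0" if "y \<in> line_set UNIV" for y
 proof -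
  from that have "y \<in> range ?c" by (simp only: im)
  then obtain t where t: "y = ?c t" by (rule rangeE)
  have "inv_into UNIV ?c (?c t) = t" by (rule inv_into_f_f[OF inj UNIV_I])
  then show ?thesis unfolding chart_inv_def t by simp
 qed
 have "smooth_fun real_mfd UNIV u \<longleftrightarrow> Cinf_on 1 (line_set UNIV) (%y. u (chart_inv (UNIV, ?c) y))" by (simp add: smooth_fun_def real_mfd_def im)
 also have "... \<longleftrightarrow> Cinf_on 1 (line_set UNIV) (%y. u (y 0))"
  using Cinf_on_cong[OF eopen_line_set[OF open_UNIV], of "%y. u (chart_inv (UNIV, ?c) y)" "%y. u (y 0)"]
   Cinf_on_cong[OF eopen_line_set[OF open_UNIV], of "%y. u (y 0)" "%y. u (chart_inv (UNIV, ?c) y)"] inv by auto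
 finally show ?thesis by (simp add: smooth1_def)
qed

text \<open>The quotient h/s extends smoothly with value h'(0) at 0. As smoothness is given through
  the extension \<open>H\<close>, it is \<open>H\<close> that is divided.\<close>

lemma profile_factor:
 fixes h H :: "real => real"
 assumes H: "smooth1 UNIV H" "!!s. 0 <= s ==> H s = h s" and h: "h 0 = 0" "(h has_real_derivative c) (at 0 within {0..})"
 obtains k where "smooth1 UNIV k" "!!s. 0 <= s ==> h s = s * k s" "k 0 = c"
proof -
 have H_0: "H 0 = 0" using H(2)[of 0] h(1) by simp
 obtain k where k: "smooth1 UNIV k" "!!s. H s = s * k s" by (rule smooth1_Hadamard[OF H(1) H_0], rule that)
 have "((%y. (h y - h 0)/(y - 0)) \<longlongrightarrow> c) (at_right 0)" using h(2) unfolding has_field_derivative_iff at_within_Ici_at_right .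
 moreover have "\<forall>\<^sub>F y in at_right 0. (h y - h 0)/(y - 0) = k y"
  unfolding eventually_at_right_field using H(2) k(2) h(1) by (auto intro!: exI[of _ 1] simp flip: H(2))
 ultimately have "(k \<longlongrightarrow> c) (at_right 0)" by (rule Lim_transform_eventually)
 moreover have "(k \<longlongrightarrow> k 0) (at_right 0)" using smooth1_deriv(1)[OF open_UNIV k(1), of 0] DERIV_isCont unfolding isCont_def
  by (meson UNIV_I tendsto_mono at_le subset_UNIV)
 ultimately have "k 0 = c" by (intro tendsto_unique[of "at_right (0::real)"]) auto
 then show thesis using k H(2) by (intro that[of k]) (auto simp flip: H(2))
qed

text \<open>Write h = s k and h0 = s k0. Both k and k0 have the value 2 at 0, so k - k0 = s r; then
  1/h - 1/h0 = - r/(k k0) and (h - h0)/h0^2 = r/k0^2 have no pole. \<open>U\<close> is the set where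
  k and k0 are positive.\<close>

lemma profile_quotients:
 fixes h h0 H H0 :: "real => real"
 assumes H: "smooth1 UNIV H" "!!s. 0 <= s ==> H s = h s" "h 0 = 0" "(h has_real_derivative 2) (at 0 within {0..})" "!!s. 0<s ==> 0<h s"
  and H0: "smooth1 UNIV H0" "!!s. 0 <= s ==> H0 s = h0 s" "h0 0 = 0" "(h0 has_real_derivative 2) (at 0 within {0..})" "!!s. 0<s ==> 0<h0 s"
 obtains U F E where "open U" "{0..} \<subseteq> U" "smooth1 U F" "smooth1 U E"
  "!!s. 0<s ==> F s = 1/h s - 1/h0 s" "!!s. 0<s ==> E s = (h s - h0 s)/(h0 s)\<^sup>2"
proof -
 obtain k where k: "smooth1 UNIV k" "!!s. 0 <= s ==> h s = s * k s" "k 0 = 2" using profile_factor[OF H(1-4)] by blast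
 obtain k0 where k0: "smooth1 UNIV k0" "!!s. 0 <= s ==> h0 s = s * k0 s" "k0 0 = 2" using profile_factor[OF H0(1-4)] by blast
 have kk: "smooth1 UNIV (%s. k s - k0 s)" by (intro smooth1_diff open_UNIV k(1) k0(1))
 obtain r where r: "smooth1 UNIV r" "!!s. k s - k0 s = s * r s" by (rule smooth1_Hadamard[OF kk], simp add: k(3) k0(3), rule that)
 have cont: "continuous_on UNIV u" if "smooth1 UNIV u" for u
  using smooth1_deriv(1)[OF open_UNIV that UNIV_I] by (intro continuous_at_imp_continuous_on) (auto intro: DERIV_isCont)
 define U where "U = {s. 0<k s} \<inter> {s. 0<k0 s}"
 have U: "open U" unfolding U_def by (intro open_Int open_Collect_less cont k(1) k0(1) continuous_on_const)
 have sub: "{0..} \<subseteq> U"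
 proof
  fix s :: real assume "s \<in> {0..}"
  then consider "s = 0" | "0<s" by force
  then show "s \<in> U"
  proof cases
   case 2
   then show ?thesis using H(5)[OF 2] H0(5)[OF 2] k(2)[of s] k0(2)[of s] by (simp add: U_def zero_less_mult_iff)
  qed (simp add: U_def k(3) k0(3))
 qed
 note s = smooth1_subset[OF subset_UNIV[of U]]
 show thesis
 proof (rule that[OF U sub])
  show "smooth1 U (%s. (0 - r s)/(k s * k0 s))" "smooth1 U (%s. r s/(k0 s * k0 s))"
   by (intro smooth1_divide[OF U] smooth1_diff[OF U] smooth1_mult[OF U] smooth1_const[OF U] s[OF r(1)] s[OF k(1)] s[OF k0(1)]; simp add: U_def)+
  fix t :: real assume t: "0<t"
  then have "t \<in> U" using sub by auto
  then have nz: "k t ~= 0" "k0 t ~= 0" by (simp_all add: U_def)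
  have "k t = k0 t + t*r t" using r(2)[of t] by simp
  then show "(0 - r t)/(k t*k0 t) = 1/h t - 1/h0 t" "r t/(k0 t*k0 t) = (h t - h0 t)/(h0 t)\<^sup>2"
   using t nz by (simp_all add: k(2) k0(2) divide_simps power2_eq_square) (simp_all add: algebra_simps)
 qed
qed

section \<open>Smoothness of single group elements\<close>

lemma eopen_prod:
 assumes S1: "eopen a S1" and S2: "eopen b S2"
 shows "eopen (a + b) {y \<in> topspace (Euclidean_space (a + b)). (%i. if i<a then y i else 0) \<in> S1 & (%i. if i<b then y (i + a) else 0) \<in> S2}"
proof -
 obtain T1 where T1: "open T1" "S1 = T1 \<inter> topspace (Euclidean_space a)" using S1 eopen_iff by blast
 obtain T2 where T2: "open T2" "S2 = T2 \<inter> topspace (Euclidean_space b)" using S2 eopen_iff by blast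
 have c: "continuous_on UNIV (%(y::nat => real) i. if i<l then y (i + j) else 0)" for l j :: nat
 proof (rule continuous_on_coordinatewise_then_product)
  fix i show "continuous_on UNIV (%y::nat => real. if i<l then y (i + j) else 0)" by (cases "i<l") (auto intro: continuous_on_product_coordinates)
 qed
 have "open ((%(y::nat => real) i. if i<a then y i else 0) -` T1 \<inter> (%(y::nat => real) i. if i<b then y (i + a) else 0) -` T2)"
  using c[of a 0, unfolded add_0_right] c[of b a] T1(1) T2(1) by (intro open_Int open_vimage)
 moreover have "{y \<in> topspace (Euclidean_space (a + b)). (%i. if i<a then y i else 0) \<in> S1 & (%i. if i<b then y (i + a) else 0) \<in> S2} =
  ((%(y::nat => real) i. if i<a then y i else 0) -` T1 \<inter> (%(y::nat => real) i. if i<b then y (i + a) else 0) -` T2)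
   \<inter> topspace (Euclidean_space (a + b))" by (auto simp: T1(2) T2(2) topspace_Euclidean_space)
 ultimately show ?thesis unfolding eopen_iff by blast
qed

text \<open>Freezing the coordinates of \<open>k\<close> embeds a chart of \<open>Y\<close> into a
  product chart, in which the action is smooth by assumption.\<close>

lemma action_slice:
 assumes X: "manifold X" and Y: "manifold Y" and sm: "smooth_map (prod_mfd X Y) Y (%(k, p). F k p)" and k: "k \<in> pts X"
 shows "smooth_map Y Y (F k)"
proof -
 interpret X: smooth_mfd X by (rule smooth_mfd.intro[OF X])
 interpret Y: smooth_mfd Y by (rule smooth_mfd.intro[OF Y])
 obtain cX where cX: "cX \<in> atlas X" "k \<in> fst cX" using X.ex_chart[OF k] by blast
 have cm: "continuous_map (mtop Y) (mtop Y) (F k)"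
 proof -
  have "continuous_map (mtop Y) (prod_topology (mtop X) (mtop Y)) (%p. (k, p))" using k by (simp add: continuous_map_pairwise o_def)
  from continuous_map_compose[OF this, of "mtop Y" "%(k, p). F k p"] sm show ?thesis by (simp add: smooth_map_def prod_mfd_def o_def)
 qed
 show ?thesis unfolding smooth_map_def
 proof (intro conjI cm ballI, clarify)
  fix V \<psi> i assume e: "(V, \<psi>) \<in> atlas Y" and i: "i<mdim Y"
  let ?W = "{p \<in> pts Y. F k p \<in> V}"
  show "smooth_fun Y ?W (%p. \<psi> (F k p) i)" unfolding smooth_fun_def
  proof
   fix c assume c: "c \<in> atlas Y"
   let ?n = "mdim X + mdim Y"
   define \<phi> where "\<phi> = (%(p, q) i. if i<mdim X then snd cX p i else snd c q (i - mdim X))"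
   define PC where "PC = (fst cX \<times> fst c, \<phi>)"
   define Wp where "Wp = {z \<in> pts (prod_mfd X Y). (case z of (k, p) => F k p) \<in> V}"
   have PC: "PC \<in> atlas (prod_mfd X Y)" unfolding prod_mfd_def PC_def \<phi>_def using cX(1) c by (auto intro!: image_eqI[of _ _ "(cX, c)"])
   have "smooth_fun (prod_mfd X Y) Wp (%z. \<psi> ((case z of (k, p) => F k p)) i)" using sm e i unfolding smooth_map_def Wp_def by blast
   then have big: "Cinf_on ?n (\<phi> ` (Wp \<inter> fst PC)) (%y. \<psi> ((case chart_inv PC y of (k, p) => F k p)) i)"
    using PC unfolding smooth_fun_def by (force simp: PC_def prod_mfd_def)
   have E: "snd cX p \<in> topspace (Euclidean_space (mdim X))" if "p \<in> fst cX" for p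
    using X.chart_in[OF cX(1) that] openin_subset[OF X.chart_props(2)[OF cX(1)]] by blast
   have Ec: "snd c p \<in> topspace (Euclidean_space (mdim Y))" if "p \<in> fst c" for p
    using Y.chart_in[OF c that] openin_subset[OF Y.chart_props(2)[OF c]] by blast
   have inj: "inj_on \<phi> (fst PC)"
   proof (rule inj_onI)
    fix z z' assume z: "z \<in> fst PC" "z' \<in> fst PC" and eq: "\<phi> z = \<phi> z'"
    obtain p q p' q' where pq: "z = (p, q)" "z' = (p', q')" by fastforce
    have m: "p \<in> fst cX" "p' \<in> fst cX" "q \<in> fst c" "q' \<in> fst c" using z pq by (auto simp: PC_def)
    have "snd cX p = snd cX p'"
    proof
     fix i show "snd cX p i = snd cX p' i"
      using fun_cong[OF eq, of i] E[OF m(1)] E[OF m(2)] by (cases "i<mdim X") (auto simp: pq \<phi>_def topspace_Euclidean_space)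
    qed
    moreover have "snd c q = snd c q'"
    proof
     fix i show "snd c q i = snd c q' i" using fun_cong[OF eq, of "i + mdim X"] by (simp add: pq \<phi>_def)
    qed
    ultimately show "z = z'" using X.chart_inj[OF cX(1)] Y.chart_inj[OF c] m pq by (auto simp: inj_on_def)
   qed
   define \<Phi> where "\<Phi> y = (%i. if i<mdim X then snd cX k i else y (i - mdim X))" for y :: "nat => real"
   let ?S = "snd c ` (?W \<inter> fst c)"
   have So: "eopen (mdim Y) ?S"
   proof (rule Y.chart_open_image[OF c])
    have "openin (mtop Y) V" using Y.chart_props(1)[OF e] by simp
    then show "openin (mtop Y) (?W \<inter> fst c)" by (intro openin_Int openin_continuous_map_preimage[OF cm] Y.chart_props(1)[OF c])
   qed simp
   have \<Phi>: "\<Phi> (snd c p) = \<phi> (k, p)" for p by (simp add: \<Phi>_def \<phi>_def)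
   have in_big: "\<Phi> y \<in> \<phi> ` (Wp \<inter> fst PC)" if "y \<in> ?S" for y using that \<Phi> k cX(2) by (auto simp: Wp_def PC_def prod_mfd_def intro!: image_eqI)
   \<comment> \<open>\<open>prod_mfd X Y\<close> is not interpreted as a manifold here, so openness
     of the image is derived from product neighbourhoods.\<close>
   have bo: "eopen ?n (\<phi> ` (Wp \<inter> fst PC))"
   proof (subst openin_subopen, rule ballI)
    have "openin (mtop Y) V" using Y.chart_props(1)[OF e] by simp
    then have "openin (prod_topology (mtop X) (mtop Y)) Wp"
     using sm openin_continuous_map_preimage[of "prod_topology (mtop X) (mtop Y)" "mtop Y" "%(k, p). F k p" V]
     by (simp add: Wp_def smooth_map_def prod_mfd_def)
    then have O: "openin (prod_topology (mtop X) (mtop Y)) (Wp \<inter> fst PC)"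
     using X.chart_props(1)[OF cX(1)] Y.chart_props(1)[OF c] by (simp add: PC_def openin_prod_Times_iff openin_Int)
    fix y assume "y \<in> \<phi> ` (Wp \<inter> fst PC)"
    then obtain p q where pq: "y = \<phi> (p, q)" "(p, q) \<in> Wp \<inter> fst PC" by auto
    obtain U1 U2 where U: "openin (mtop X) U1" "openin (mtop Y) U2" "p \<in> U1" "q \<in> U2" "U1 \<times> U2 \<subseteq> Wp \<inter> fst PC"
     using O[unfolded openin_prod_topology_alt, rule_format, OF pq(2)] by (elim exE conjE) (rule that)
    have sub: "U1 \<subseteq> fst cX" "U2 \<subseteq> fst c" using U(3-5) by (auto simp: PC_def)
    let ?T = "{y \<in> topspace (Euclidean_space ?n). (%i. if i<mdim X then y i else 0) \<in> snd cX ` U1 &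
     (%i. if i<mdim Y then y (i + mdim X) else 0) \<in> snd c ` U2}"
    have To: "eopen ?n ?T" by (rule eopen_prod[OF X.chart_open_image[OF cX(1) U(1) sub(1)] Y.chart_open_image[OF c U(2) sub(2)]])
    have "p \<in> fst cX" "q \<in> fst c" using sub U(3,4) by auto
    note EE = E[OF this(1)] Ec[OF this(2)]
    have "(%i. if i<mdim X then y i else 0) = snd cX p" "(%i. if i<mdim Y then y (i + mdim X) else 0) = snd c q"
     "y \<in> topspace (Euclidean_space ?n)" using EE by (auto simp: pq(1) \<phi>_def topspace_Euclidean_space fun_eq_iff)
    then have yT: "y \<in> ?T" using U(3,4) by simp
    have "?T \<subseteq> \<phi> ` (Wp \<inter> fst PC)"
    proof
     fix y' assume y': "y' \<in> ?T"
     then obtain p' q' where p': "p' \<in> U1" "(%i. if i<mdim X then y' i else 0) = snd cX p'"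
      and q': "q' \<in> U2" "(%i. if i<mdim Y then y' (i + mdim X) else 0) = snd c q'" by auto
     have "y' i = \<phi> (p', q') i" for i
     proof (cases "i<mdim X")
      case True then show ?thesis using fun_cong[OF p'(2), of i] by (simp add: \<phi>_def)
     next
      case False
      then show ?thesis using fun_cong[OF q'(2), of "i - mdim X"] y' by (auto simp: \<phi>_def topspace_Euclidean_space split: if_splits)
     qed
     then have "y' = \<phi> (p', q')" by blast
     then show "y' \<in> \<phi> ` (Wp \<inter> fst PC)" using U(5) p'(1) q'(1) by blast
    qed
    then show "\<exists>T. eopen ?n T & y \<in> T & T \<subseteq> \<phi> ` (Wp \<inter> fst PC)" using To yT by blast
   qed
   have A: "Cinf_on (mdim Y) ?S (%y. \<psi> ((case chart_inv PC (\<Phi> y) of (k, p) => F k p)) i)"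
   proof (rule Cinf_on_compose[OF So bo in_big _ big])
    show "Cinf_on (mdim Y) ?S (%y. \<Phi> y j)" for j by (cases "j<mdim X") (simp_all add: \<Phi>_def Cinf_on_const[OF So] Cinf_on_coord[OF So])
   qed
   have B: "chart_inv PC (\<Phi> y) = (k, chart_inv c y)" if "y \<in> ?S" for y
   proof -
    obtain p where p: "p \<in> ?W" "p \<in> fst c" "y = snd c p" using `y \<in> ?S` by blast
    have "(k, p) \<in> fst PC" using p(2) cX(2) by (simp add: PC_def)
    then have "chart_inv PC (\<phi> (k, p)) = (k, p)" using inv_into_f_f[OF inj] by (simp add: chart_inv_def PC_def)
    then show ?thesis by (simp add: p(3) \<Phi> Y.chart_inv_left[OF c p(2)])
   qed
   show "Cinf_on (mdim Y) ?S (%y. \<psi> (F k (chart_inv c y)) i)" by (rule Cinf_on_cong[OF So _ A]) (simp only: B prod.case)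
  qed
 qed
qed

section \<open>The total space\<close>

locale toric_total = toric_base D for D :: "('m, 'b) toric_data" +
 fixes a0 :: "nat => real" and h0 :: "real => real" and g0 :: "'m tensor2" and J0 :: "'m endo"
 assumes tb: "toric_bundle D" and kahler0: "kahler (total D) g0 J0"
  and form0: "normal_form D a0 h0 g0 J0" and slope: "!!i. i<m ==> 0 <= slope D i"
begin

abbreviation "M \<equiv> total D"
abbreviation "x \<equiv> xcoord D"
abbreviation "PP \<equiv> principal_part D"
abbreviation "\<theta> \<equiv> conn D"
abbreviation "\<pi> \<equiv> proj D"
abbreviation "d\<pi> \<equiv> d_proj D"

sublocale M: smooth_mfd M using kahler0 by unfold_locales (simp add: kahler_def)

lemma fibration: "mdim M = Suc (Suc d)" "smooth_fun M (pts M) x" "x ` pts M = {0..}" "mtop M closure_of PP = pts M" "smooth_map M (base D) \<pi>"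
 using tb by (auto simp: toric_bundle_def circle_fibration_def Let_def base_facts(1))

lemma x_nonneg: "p \<in> pts M ==> 0 <= x p" using fibration(3) by blast

lemma PP_pts: "p \<in> PP ==> p \<in> pts M" "p \<in> PP ==> 0<x p" by (auto simp: principal_part_def)

lemma x_smooth_at: "p \<in> pts M ==> smooth_at M p x" by (rule M.smooth_fun_smooth_at[OF fibration(2)])

lemma \<pi>_pts: "p \<in> pts M ==> \<pi> p \<in> pts (base D)" by (rule smooth_map_pts[OF fibration(5)])

lemma d\<pi>_tangent: "p \<in> pts M ==> v \<in> tangent M p ==> d\<pi> p v \<in> tangent (base D) (\<pi> p)"
 unfolding d_proj_def by (rule M.push_tangent[OF B.smooth_mfd_axioms fibration(5)])

lemma d\<pi>_linear: "d\<pi> p (vadd v w) = vadd (d\<pi> p v) (d\<pi> p w)" "d\<pi> p (vscale r v) = vscale r (d\<pi> p v)" "d\<pi> p vzero = vzero"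
 unfolding d_proj_def by (rule push_linear)+

lemma kahler0_facts: "riemannian M g0" "almost_complex M J0" "orthogonal_endo M g0 J0" "endo_tensor M J0" "bilinear_tensor M g0" "symmetric_psd M g0"
 using kahler0 by (auto simp: kahler_def almost_complex_def riemannian_def symmetric_psd_def)

lemma g0_linear:
 assumes "p \<in> pts M" "u \<in> tangent M p"
 shows "linear_fun (tangent M p) (g0 p u)" "linear_fun (tangent M p) (%v. g0 p v u)" using kahler0_facts(5) assms by (auto simp: bilinear_tensor_def)

lemma g0_sym: "p \<in> pts M ==> u \<in> tangent M p ==> v \<in> tangent M p ==> g0 p u v = g0 p v u" using kahler0_facts(6) by (simp add: symmetric_psd_def)

lemma g0_zero: "p \<in> pts M ==> v \<in> tangent M p ==> g0 p v v = 0 ==> v = vzero" using kahler0_facts(1) by (force simp: riemannian_def)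

lemma J0_linear: "p \<in> pts M ==> linear_vmap (tangent M p) (tangent M p) (J0 p)" using kahler0_facts(4) by (simp add: endo_tensor_def)

lemma J0_tangent: "p \<in> pts M ==> v \<in> tangent M p ==> J0 p v \<in> tangent M p" using J0_linear[of p] by (simp add: linear_vmap_def image_subset_iff)

lemma h0_pos: "0<s ==> 0<h0 s" using form0 by (simp add: normal_form_def)

lemma warp0_pos: "0 <= s ==> i<m ==> 0<warp D a0 s i" using form0 by (simp add: normal_form_def)

lemma warp_pos: "0 <= s ==> i<m ==> 0<a i ==> 0<warp D a s i" using slope[of i] by (simp add: warp_def add_nonneg_pos)

lemma form0_at:
 assumes "p \<in> PP" "v \<in> tangent M p"
 shows "w \<in> tangent M p ==> g0 p v w = v x*w x/h0 (x p) + h0 (x p)*\<theta> p v * \<theta> p w + base_metric D (warp D a0 (x p)) (\<pi> p) (d\<pi> p v) (d\<pi> p w)"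
  and "(J0 p v) x = - h0 (x p)*\<theta> p v" "\<theta> p (J0 p v) = v x/h0 (x p)" "d\<pi> p (J0 p v) = base_J D (\<pi> p) (d\<pi> p v)"
 using form0 assms by (auto simp: normal_form_def Let_def)

lemma \<theta>_linear: "p \<in> PP ==> linear_fun (tangent M p) (\<theta> p)" using tb by (simp add: toric_bundle_def connection_form_def Let_def)

text \<open>The normal form of \<open>g0\<close> expresses the length of \<open>v\<close> through
  these three components, and \<open>g0\<close> is definite.\<close>

lemma vanish:
 assumes p: "p \<in> PP" and v: "v \<in> tangent M p" and "v x = 0" "\<theta> p v = 0" "d\<pi> p v = vzero"
 shows "v = vzero"
proof -
 have "bg D i (\<pi> p) vzero vzero = 0" if "i<m" for i
  using bg_linear(1)[OF that \<pi>_pts[OF PP_pts(1)[OF p]] B.vzero_tangent] by (rule B.linear_fun_zero)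
 then have "g0 p v v = 0" using form0_at(1)[OF p v v] assms by (simp add: base_metric_def)
 then show ?thesis using g0_zero PP_pts(1)[OF p] v by blast
qed

lemma eq_by_parts:
 assumes p: "p \<in> PP" and v: "v \<in> tangent M p" and w: "w \<in> tangent M p"
  and e: "v x = w x" "\<theta> p v = \<theta> p w" "d\<pi> p v = d\<pi> p w"
 shows "v = w"
proof -
 have t: "vadd v (vscale (-1) w) \<in> tangent M p" by (intro M.vadd_tangent M.vscale_tangent v w)
 have "vadd v (vscale (-1) w) = vzero"
 proof (rule vanish[OF p t])
  show "vadd v (vscale (-1) w) x = 0" using e by (simp add: vadd_def vscale_def)
  show "\<theta> p (vadd v (vscale (-1) w)) = 0" using \<theta>_linear[OF p] v w M.vscale_tangent[OF w] e by (simp add: linear_fun_def)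
  show "d\<pi> p (vadd v (vscale (-1) w)) = vzero" by (simp add: d\<pi>_linear e) (simp add: vadd_def vscale_def vzero_def)
 qed
 then show ?thesis by (auto simp: vadd_def vscale_def vzero_def fun_eq_iff)
qed

text \<open>The moment coordinate has its minimum on the special orbit.\<close>

lemma dx_zero:
 assumes p: "p \<in> pts M" "x p = 0" and v: "v \<in> tangent M p"
 shows "v x = 0"
proof -
 obtain c where c: "c \<in> atlas M" "p \<in> fst c" using M.ex_chart[OF p(1)] by blast
 let ?X = "%y. x (chart_inv c y)"
 note co = M.chart_props(2)[OF c(1)]
 have sm: "Cinf_on (mdim M) (M.cimg c) ?X" using M.smooth_fun_D[OF fibration(2) c(1)] M.chart_pts[OF c(1)] by (simp add: M.cimg_def Int_absorb1)
 have "pd k ?X (snd c p) = 0" if k: "k<mdim M" for k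
 proof -
  let ?l = "%t. (snd c p)(k := snd c p k + t)"
  have ev: "\<forall>\<^sub>F t in at 0. ?l t \<in> M.cimg c"
   using eventually_line_in[OF co M.chart_in[OF c(1,2)] k] by (rule eventually_nhds_conv_at[THEN iffD1, THEN conjunct1])
  have D: "((%t. ?X (?l t)) has_real_derivative pd k ?X (snd c p)) (at 0)" by (rule Cinf_on_has_partial[OF co sm M.chart_in[OF c(1,2)] k])
  obtain e where e: "e > 0" "!!t. \<bar>t\<bar><e ==> ?l t \<in> M.cimg c"
  proof -
   obtain e where "e > 0" "!!t. t ~= 0 & dist t 0<e ==> ?l t \<in> M.cimg c" using ev unfolding eventually_at by blast
   then show thesis using M.chart_in[OF c(1,2)] by (intro that[of e]) (auto simp: dist_real_def, metis add.right_neutral fun_upd_triv)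
  qed
  show ?thesis
  proof (rule DERIV_local_min[OF D e(1)], intro allI impI)
   fix t assume "\<bar>0 - t\<bar><e"
   then have "chart_inv c (?l t) \<in> pts M" using e(2)[of t] M.chart_inv_right(2)[OF c(1)] M.chart_pts[OF c(1)] by auto
   then show "?X (?l 0) <= ?X (?l t)" using x_nonneg p(2) M.chart_inv_left[OF c] by simp
  qed
 qed
 then show ?thesis using M.tangent_apply[OF c v x_smooth_at[OF p(1)]] by simp
qed

text \<open>\<open>kap\<close> is $h_0\theta$ on the principal part, extended smoothly by $-dx\circ J_0$.\<close>

definition kap :: "'m => 'm vect => real" where "kap p v = - (J0 p v) x"

lemma kap_PP: "p \<in> PP ==> v \<in> tangent M p ==> kap p v = h0 (x p)*\<theta> p v" by (simp add: kap_def form0_at(2))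

lemma kap_zero: "p \<in> pts M ==> x p = 0 ==> v \<in> tangent M p ==> kap p v = 0" by (simp add: kap_def dx_zero J0_tangent)

lemma dx_linear: "linear_fun V (%v. v x)" by (simp add: linear_fun_def vadd_def vscale_def)

lemma kap_linear: "p \<in> pts M ==> linear_fun (tangent M p) (kap p)"
 using J0_linear[of p] by (simp add: linear_fun_def kap_def linear_vmap_def vadd_def vscale_def)

text \<open>The gradient of x for \<open>g0\<close>. On the principal part it is h0 times the vector
  dual to dx, but unlike that vector it is smooth on the special orbit.\<close>

definition grad :: "'m => 'm vect" where "grad p = (SOME u. u \<in> tangent M p & (\<forall>v\<in>tangent M p. g0 p u v = v x))"

definition gcomp :: "'m chart => nat => nat => rfun" where "gcomp c i j y = mat_inverse (mdim M) (%i j. comp2 M g0 c i j y) i j"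

context
 fixes c assumes c: "c \<in> atlas M"
begin

lemma x_chart: "Cinf_on (mdim M) (M.cimg c) (%y. x (chart_inv c y))"
 using M.smooth_fun_D[OF fibration(2) c] M.chart_pts[OF c] by (simp add: M.cimg_def Int_absorb1)

lemma dx_coord: "p \<in> fst c ==> coord_vect M c i p x = pd i (%y. x (chart_inv c y)) (snd c p)"
 by (rule M.coord_vect_eq[OF x_smooth_at]) (use M.chart_pts[OF c] in blast)

text \<open>Nondegeneracy gives a vector with components g^{kl} d_l x that represents dx, and
  definiteness makes it the only one, hence the chosen one.\<close>

lemma grad:
 assumes p: "p \<in> fst c"
 shows "grad p \<in> tangent M p" "!!v. v \<in> tangent M p ==> g0 p (grad p) v = v x"
  "!!k. k<mdim M ==> vcoord c k (grad p) = (\<Sum>l<mdim M. gcomp c k l (snd c p)*pd l (%y. x (chart_inv c y)) (snd c p))"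
proof -
 let ?n = "mdim M"
 have pp: "p \<in> pts M" using M.chart_pts[OF c] p by blast
 note t = M.coord_vect_tangent[OF c p]
 define gc where "gc k = (\<Sum>l<?n. gcomp c k l (snd c p)*pd l (%y. x (chart_inv c y)) (snd c p))" for k
 obtain u where u: "u \<in> tangent M p" and uk: "!!k. k<?n ==> vcoord c k u = gc k" by (rule that, rule M.comb(1)[OF c p], rule M.comb(2)[OF c p])
 have nd: "nondegenerate ?n (%i j. comp2 M g0 c i j (snd c p))" by (rule M.metric_comp(3)[OF kahler0_facts(1) c M.chart_in[OF c p]])
 have gu: "g0 p u v = v x" if v: "v \<in> tangent M p" for v
 proof -
  have "g0 p u (coord_vect M c j p) = coord_vect M c j p x" if j: "j<?n" for j
  proof -
   have "g0 p u (coord_vect M c j p) = (\<Sum>k<?n. vcoord c k u*g0 p (coord_vect M c k p) (coord_vect M c j p))"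
    by (rule M.linear_fun_expand[OF g0_linear(2)[OF pp t[OF j]] c p u])
   also have "... = (\<Sum>k<?n. comp2 M g0 c j k (snd c p)*gc k)" using uk g0_sym[OF pp t t[OF j]] by (simp add: M.comp2_at[OF c p] mult.commute)
   also have "... = (\<Sum>l<?n. (\<Sum>k<?n. comp2 M g0 c j k (snd c p)*gcomp c k l (snd c p))*pd l (%y. x (chart_inv c y)) (snd c p))"
    unfolding gc_def by (rule sum_mult_assoc[symmetric])
   also have "... = (\<Sum>l<?n. (if j = l then 1 else 0)*pd l (%y. x (chart_inv c y)) (snd c p))"
    using mat_inverse_nondegenerate(1)[OF nd] j by (intro sum.cong) (auto simp: is_inverse_def gcomp_def)
   also have "... = coord_vect M c j p x" using j by (subst sum_delta_left) (auto simp: dx_coord[OF p])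
   finally show ?thesis .
  qed
  then show ?thesis using M.linear_fun_expand[OF g0_linear(1)[OF pp u] c p v] M.linear_fun_expand[OF dx_linear c p v] by simp
 qed
 have sel: "grad p \<in> tangent M p & (\<forall>v\<in>tangent M p. g0 p (grad p) v = v x)" unfolding grad_def
  by (rule someI[of "%u. u \<in> tangent M p & (\<forall>v\<in>tangent M p. g0 p u v = v x)" u]) (use u gu in blast)
 then show G: "grad p \<in> tangent M p" "!!v. v \<in> tangent M p ==> g0 p (grad p) v = v x" by auto
 have w: "vadd (grad p) (vscale (-1) u) \<in> tangent M p" (is "?w \<in> _") by (intro M.vadd_tangent M.vscale_tangent G(1) u)
 have "g0 p ?w ?w = g0 p (grad p) ?w - g0 p u ?w" using g0_linear(2)[OF pp w] G(1) u M.vscale_tangent[OF u] by (simp add: linear_fun_def)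
 then have "?w = vzero" using G(2)[OF w] gu[OF w] g0_zero[OF pp w] by simp
 then have "grad p = u" by (auto simp: vadd_def vscale_def vzero_def fun_eq_iff)
 then show "!!k. k<?n ==> vcoord c k (grad p) = (\<Sum>l<?n. gcomp c k l (snd c p)*pd l (%y. x (chart_inv c y)) (snd c p))"
  using uk by (simp add: gc_def)
qed

end

text \<open>dx, \<theta> and the differential of the projection are jointly injective by
  \<open>vanish\<close>; equality of dimensions makes them jointly surjective.\<close>

lemma lift_PP:
 assumes p: "p \<in> PP" and w: "w \<in> tangent (base D) (\<pi> p)"
 obtains v where "v \<in> tangent M p" "v x = \<alpha>" "\<theta> p v = \<beta>" "d\<pi> p v = w"
proof -
 have pp: "p \<in> pts M" by (rule PP_pts(1)[OF p])
 obtain c where c: "c \<in> atlas M" "p \<in> fst c" using M.ex_chart[OF pp] by blast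
 obtain e where e: "e \<in> atlas (base D)" "\<pi> p \<in> fst e" using B.ex_chart[OF \<pi>_pts[OF pp]] by blast
 define L where "L a v = (case a of 0 => v x | Suc 0 => \<theta> p v | Suc (Suc j) => vcoord e j (d\<pi> p v))" for a v
 have L: "linear_fun (tangent M p) (L a)" for a using dx_linear[of "tangent M p"] \<theta>_linear[OF p]
  by (auto simp: L_def[abs_def] linear_fun_def d\<pi>_linear B.vcoord_linear split: nat.split)
 define P where "P a k = L a (coord_vect M c k p)" for a k
 have LP: "L a v = (\<Sum>k<mdim M. P a k * vcoord c k v)" if "v \<in> tangent M p" for a v
  using M.linear_fun_expand[OF L c that] by (simp add: P_def mult.commute)
 have ext: "v = v'" if "v \<in> tangent (base D) (\<pi> p)" "v' \<in> tangent (base D) (\<pi> p)" "!!k. k<d ==> vcoord e k v = vcoord e k v'" for v v'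
  using that B.tangent_eq_iff[OF e that(1,2)] by blast
 obtain V where V: "!!a b. a \<in> {..<mdim M} ==> b \<in> {..<mdim M} ==> (\<Sum>k<mdim M. P a k*V k b) = (if a = b then 1 else 0)"
 proof (rule square_frame_inverse[of "{..<mdim M}" "mdim M" P])
  fix v assume v: "!!a. a \<in> {..<mdim M} ==> (\<Sum>k<mdim M. P a k * v k) = 0"
  obtain u where u: "u \<in> tangent M p" and uk: "!!k. k<mdim M ==> vcoord c k u = v k" by (rule that, rule M.comb(1)[OF c], rule M.comb(2)[OF c])
  have Lu: "L a u = 0" if "a<mdim M" for a using v[of a] that by (simp add: LP[OF u] uk)
  have "u = vzero"
  proof (rule vanish[OF p u])
   show "u x = 0" using Lu[of 0] by (simp add: L_def fibration(1))
   show "\<theta> p u = 0" using Lu[of "Suc 0"] by (simp add: L_def fibration(1))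
   show "d\<pi> p u = vzero" by (rule ext[OF d\<pi>_tangent[OF pp u] B.vzero_tangent])
     (use Lu[of "Suc (Suc _)"] in "simp add: L_def fibration(1) B.vcoord_linear")
  qed
  then show "\<forall>k<mdim M. v k = 0" using uk by (simp add: M.vcoord_linear)
 qed (use that in auto)
 define t where "t b = (case b of 0 => \<alpha> | Suc 0 => \<beta> | Suc (Suc j) => vcoord e j w)" for b
 obtain v where v: "v \<in> tangent M p" and vk: "!!k. k<mdim M ==> vcoord c k v = (\<Sum>b<mdim M. V k b*t b)"
  by (rule that, rule M.comb(1)[OF c, of "%k. \<Sum>b<mdim M. V k b*t b"], rule M.comb(2)[OF c])
 have Lv: "L a v = t a" if a: "a<mdim M" for a
 proof -
  have "L a v = (\<Sum>k<mdim M. P a k*(\<Sum>b<mdim M. V k b*t b))" by (simp add: LP[OF v] vk)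
  also have "... = (\<Sum>b<mdim M. (\<Sum>k<mdim M. P a k*V k b)*t b)" by (rule sum_mult_assoc[symmetric])
  also have "... = (\<Sum>b<mdim M. (if a = b then 1 else 0)*t b)" using V a by (intro sum.cong) auto
  also have "... = t a" using a by (intro sum_delta_left) auto
  finally show ?thesis .
 qed
 show thesis
 proof (rule that[OF v])
  show "v x = \<alpha>" "\<theta> p v = \<beta>" using Lv[of 0] Lv[of "Suc 0"] by (simp_all add: L_def t_def fibration(1))
  show "d\<pi> p v = w" by (rule ext[OF d\<pi>_tangent[OF pp v] w]) (use Lv[of "Suc (Suc _)"] in "simp add: L_def t_def fibration(1)")
 qed
qed

lemma base_metric_zero: "q \<in> pts (base D) ==> v \<in> tangent (base D) q ==> base_metric D A q vzero v = 0"
 "q \<in> pts (base D) ==> v \<in> tangent (base D) q ==> base_metric D A q v vzero = 0"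
 unfolding base_metric_def using B.linear_fun_zero[OF bg_linear(2)] B.linear_fun_zero[OF bg_linear(1)] by simp_all

lemma grad_PP:
 assumes p: "p \<in> PP"
 shows "grad p x = h0 (x p)" "\<theta> p (grad p) = 0" "d\<pi> p (grad p) = vzero"
proof -
 have pp: "p \<in> pts M" and xp: "0<x p" using PP_pts[OF p] by auto
 obtain c where c: "c \<in> atlas M" "p \<in> fst c" using M.ex_chart[OF pp] by blast
 note G = grad(1,2)[OF c]
 obtain u where u: "u \<in> tangent M p" "u x = h0 (x p)" "\<theta> p u = 0" "d\<pi> p u = vzero" by (rule lift_PP[OF p B.vzero_tangent], rule that)
 have gu: "g0 p u v = v x" if "v \<in> tangent M p" for v
  using h0_pos[OF xp] by (simp add: form0_at(1)[OF p u(1) that] u base_metric_zero[OF \<pi>_pts[OF pp] d\<pi>_tangent[OF pp that]])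
 have w: "vadd (grad p) (vscale (-1) u) \<in> tangent M p" (is "?w \<in> _") by (intro M.vadd_tangent M.vscale_tangent G(1) u(1))
 have "g0 p ?w ?w = g0 p (grad p) ?w - g0 p u ?w" using g0_linear(2)[OF pp w] G(1) u(1) M.vscale_tangent[OF u(1)] by (simp add: linear_fun_def)
 then have "?w = vzero" using G(2)[OF w] gu[OF w] g0_zero[OF pp w] by simp
 then have "grad p = u" by (auto simp: vadd_def vscale_def vzero_def fun_eq_iff)
 then show "grad p x = h0 (x p)" "\<theta> p (grad p) = 0" "d\<pi> p (grad p) = vzero" using u by auto
qed

end

text \<open>\<open>F\<close> and \<open>E\<close> are the quotients of
  \<open>profile_quotients\<close>. They are smooth on an open set containing the closed half line,
  so their composites with x are smooth on all of the total space.\<close>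

locale toric_metric = toric_total D a0 h0 g0 J0
 for D :: "('m, 'b) toric_data" and a0 h0 and g0 :: "'m tensor2" and J0 +
 fixes a :: "nat => real" and h :: "real => real" and U :: "real set" and F E :: "real => real" and S :: real
 assumes a_pos: "!!i. i<m ==> 0<a i"
  and h_smooth: "smooth1 UNIV h" and h_0: "h 0 = 0" and h_D: "(h has_real_derivative 2) (at 0)" and h_pos: "!!s. 0<s ==> 0<h s"
  and U: "open U" "{0..} \<subseteq> U" and F: "smooth1 U F" "!!s. 0<s ==> F s = 1/h s - 1/h0 s"
  and E: "smooth1 U E" "!!s. 0<s ==> E s = (h s - h0 s)/(h0 s)\<^sup>2"
  and bk: "!!s. 0<s ==> base_kahler (warp D a s)"
  and ode: "!!s. 0<s ==> (\<Sum>i<m. real (dims D i)/(slope D i * s + a i)) - deriv (deriv h) s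
   - deriv h s * (\<Sum>i<m. slope D i*real (dims D i)/(slope D i * s + a i))
   - h s * ((\<Sum>i<m. slope D i*real (dims D i)/(slope D i * s + a i))\<^sup>2/4
       + deriv (%s. \<Sum>i<m. slope D i*real (dims D i)/(slope D i * s + a i)) s/2) = S"
begin

text \<open>Since \<open>kap\<close> is h0 \<theta>, the term with \<open>E\<close> changes h0
  \<theta>^2 into h \<theta>^2, while the term with \<open>F\<close> changes dx^2/h0 into dx^2/h.
  The last term replaces the constants \<open>a0\<close> by \<open>a\<close>.\<close>

definition gA :: "'m tensor2" where "gA p v w = g0 p v w + F (x p) * v x*w x + E (x p)*kap p v * kap p w
  + (\<Sum>i<m. (a i - a0 i)*bg D i (\<pi> p) (d\<pi> p v) (d\<pi> p w))"

text \<open>Since dx(grad) = h0 and \<theta>(J0 grad) = 1, the first correction moves the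
  dx-component from - h0 \<theta> to - h \<theta>, and the second moves the \<theta>-component from
  dx/h0 to dx/h.\<close>

definition JA :: "'m endo" where "JA p v = vadd (J0 p v) (vadd (vscale (- E (x p)*kap p v) (grad p)) (vscale (F (x p) * v x) (J0 p (grad p))))"

lemma grad_tangent: "p \<in> pts M ==> grad p \<in> tangent M p" using M.ex_chart grad(1) by blast

lemma gA_PP:
 assumes p: "p \<in> PP" and vw: "v \<in> tangent M p" "w \<in> tangent M p"
 shows "gA p v w = v x*w x/h (x p) + h (x p)*\<theta> p v * \<theta> p w + base_metric D (warp D a (x p)) (\<pi> p) (d\<pi> p v) (d\<pi> p w)"
proof -
 have xp: "0<x p" by (rule PP_pts(2)[OF p])
 have "base_metric D (warp D a0 (x p)) (\<pi> p) (d\<pi> p v) (d\<pi> p w) + (\<Sum>i<m. (a i - a0 i)*bg D i (\<pi> p) (d\<pi> p v) (d\<pi> p w))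
   = base_metric D (warp D a (x p)) (\<pi> p) (d\<pi> p v) (d\<pi> p w)"
  unfolding base_metric_def sum.distrib[symmetric] by (intro sum.cong) (auto simp: warp_def algebra_simps)
 moreover have "E (x p)*kap p v * kap p w = (h (x p) - h0 (x p))*\<theta> p v * \<theta> p w"
  using h0_pos[OF xp] by (simp add: E(2)[OF xp] kap_PP[OF p vw(1)] kap_PP[OF p vw(2)] power2_eq_square)
 ultimately show ?thesis by (simp add: gA_def form0_at(1)[OF p vw] F(2)[OF xp] algebra_simps)
qed

lemma JA_tangent: "p \<in> pts M ==> v \<in> tangent M p ==> JA p v \<in> tangent M p"
 unfolding JA_def by (intro M.vadd_tangent M.vscale_tangent J0_tangent grad_tangent)

lemma JA_linear: "p \<in> pts M ==> linear_vmap (tangent M p) (tangent M p) (JA p)"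
proof -
 assume p: "p \<in> pts M"
 have "JA p ` tangent M p \<subseteq> tangent M p" using JA_tangent[OF p] by blast
 moreover have "JA p (vadd v w) = vadd (JA p v) (JA p w)" "JA p (vscale r v) = vscale r (JA p v)" if "v \<in> tangent M p" "w \<in> tangent M p" for v w r
  using kap_linear[OF p] J0_linear[OF p] that by (auto simp: JA_def linear_fun_def linear_vmap_def vadd_def vscale_def algebra_simps)
 ultimately show ?thesis by (auto simp: linear_vmap_def)
qed

lemma JA_PP:
 assumes p: "p \<in> PP" and v: "v \<in> tangent M p"
 shows "(JA p v) x = - h (x p)*\<theta> p v" "\<theta> p (JA p v) = v x/h (x p)" "d\<pi> p (JA p v) = base_J D (\<pi> p) (d\<pi> p v)"
proof -
 have pp: "p \<in> pts M" and xp: "0<x p" using PP_pts[OF p] by auto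
 note hp = h0_pos[OF xp] h_pos[OF xp]
 note gt = grad_tangent[OF pp] and Jv = J0_tangent[OF pp v]
 note Jg = J0_tangent[OF pp gt]
 note K = form0_at(2-4)[OF p gt, unfolded grad_PP[OF p]]
 have J0v: "base_J D (\<pi> p) vzero = vzero"
 proof -
  have "base_J D (\<pi> p) (vscale 0 vzero) = vscale 0 (base_J D (\<pi> p) vzero)"
   using J_linear[OF \<pi>_pts[OF pp]] B.vzero_tangent by (simp add: linear_vmap_def)
  then show ?thesis by (simp add: vscale_def vzero_def)
 qed
 show "(JA p v) x = - h (x p)*\<theta> p v" using hp K(1) form0_at(2)[OF p v] grad_PP(1)[OF p]
  by (simp add: JA_def vadd_def vscale_def E(2)[OF xp] kap_PP[OF p v] power2_eq_square) (simp add: field_simps)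
 have "\<theta> p (JA p v) = \<theta> p (J0 p v) + ((- E (x p)*kap p v)*\<theta> p (grad p) + (F (x p) * v x)*\<theta> p (J0 p (grad p)))"
  unfolding JA_def using \<theta>_linear[OF p] gt Jv Jg M.vscale_tangent M.vadd_tangent by (simp add: linear_fun_def)
 then show "\<theta> p (JA p v) = v x/h (x p)" using hp K(2) form0_at(3)[OF p v] grad_PP(2)[OF p] by (simp add: F(2)[OF xp] field_simps)
 show "d\<pi> p (JA p v) = base_J D (\<pi> p) (d\<pi> p v)"
  using K(3) form0_at(4)[OF p v] by (simp add: JA_def d\<pi>_linear grad_PP(3)[OF p] J0v) (simp add: vadd_def vscale_def vzero_def)
qed

text \<open>The set where a continuous function misses a closed set is open, so if nonempty it would
  meet the principal part, which is dense by the hypotheses on the fibration.\<close>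

lemma dense:
 assumes c: "c \<in> atlas M" and f: "Cinf_on (mdim M) (M.cimg c) f" and C: "closed C"
  and PPf: "!!p. p \<in> fst c ==> p \<in> PP ==> f (snd c p) \<in> C" and p: "p \<in> fst c"
 shows "f (snd c p) \<in> C"
proof (rule ccontr)
 assume n: "f (snd c p) \<notin> C"
 note co = M.chart_props(2)[OF c]
 let ?V = "{y \<in> M.cimg c. f y \<in> - C}"
 have "eopen (mdim M) ?V" by (rule eopen_continuous_preimage[OF co Cinf_on_continuous_on[OF co f]]) (use C in auto)
 then have W: "openin (mtop M) {q \<in> fst c. snd c q \<in> ?V}" (is "openin _ ?W") by (rule M.chart_open_preimage[OF c])
 have "p \<in> mtop M closure_of PP" using fibration(4) M.chart_pts[OF c] p by blast
 then have cl: "\<forall>T. p \<in> T & openin (mtop M) T --> (\<exists>y. y \<in> PP & y \<in> T)" unfolding in_closure_of by (rule conjunct2)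
 have pW: "p \<in> ?W" using p n M.chart_in[OF c p] by simp
 obtain q where q: "q \<in> PP" "q \<in> ?W" using cl[rule_format, OF conjI[OF pW W]] by (elim exE conjE) (rule that)
 have "f (snd c q) \<in> C" by (rule PPf[OF _ q(1)]) (use q(2) in simp)
 then show False using q(2) by simp
qed

context
 fixes c assumes c: "c \<in> atlas M"
begin

abbreviation "xc \<equiv> %y. x (chart_inv c y)"

lemma eo: "eopen (mdim M) (M.cimg c)" by (rule M.chart_props(2)[OF c])

lemma inv_pts: "y \<in> M.cimg c ==> chart_inv c y \<in> fst c" "y \<in> M.cimg c ==> chart_inv c y \<in> pts M" "y \<in> M.cimg c ==> snd c (chart_inv c y) = y"
 using M.chart_inv_right[OF c] M.chart_pts[OF c] by blast+

lemma J0_smooth: "k<mdim M ==> i<mdim M ==> Cinf_on (mdim M) (M.cimg c) (endo_comp M J0 c k i)"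
 using kahler0_facts(4) c unfolding endo_tensor_def M.cimg_def by blast

lemma kap_smooth:
 assumes i: "i<mdim M"
 shows "Cinf_on (mdim M) (M.cimg c) (%y. kap (chart_inv c y) (coord_vect M c i (chart_inv c y)))"
proof (rule Cinf_on_cong[OF eo])
 show "Cinf_on (mdim M) (M.cimg c) (%y. 0 - (\<Sum>k<mdim M. endo_comp M J0 c k i y*pd k xc y))"
  using i by (intro Cinf_on_diff[OF eo] Cinf_on_const[OF eo] Cinf_on_sum[OF eo] Cinf_on_mult[OF eo] J0_smooth
   Cinf_on_partial_deriv[OF eo x_chart[OF c]]) auto
 fix y assume y: "y \<in> M.cimg c"
 note p = inv_pts[OF y]
 have "(J0 (chart_inv c y) (coord_vect M c i (chart_inv c y))) x = (\<Sum>k<mdim M. vcoord c k (J0 (chart_inv c y) (coord_vect M c i (chart_inv c y)))*pd k xc (snd c (chart_inv c y)))"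
  by (rule M.tangent_apply[OF c p(1) J0_tangent[OF p(2) M.coord_vect_tangent[OF c p(1) i]] x_smooth_at[OF p(2)]])
 then show "0 - (\<Sum>k<mdim M. endo_comp M J0 c k i y*pd k xc y) = kap (chart_inv c y) (coord_vect M c i (chart_inv c y))"
  by (simp add: kap_def endo_comp_def p(3) Let_def)
qed

lemma grad_smooth:
 assumes k: "k<mdim M"
 shows "Cinf_on (mdim M) (M.cimg c) (%y. vcoord c k (grad (chart_inv c y)))"
proof (rule Cinf_on_cong[OF eo])
 note g = M.metric_comp[OF kahler0_facts(1) c]
 show "Cinf_on (mdim M) (M.cimg c) (%y. \<Sum>l<mdim M. gcomp c k l y*pd l xc y)"
  unfolding gcomp_def using k by (intro Cinf_on_sum[OF eo] Cinf_on_mult[OF eo] mat_inverse_Cinf[OF eo g(1) g(3)]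
   Cinf_on_partial_deriv[OF eo x_chart[OF c]]) auto
 fix y assume y: "y \<in> M.cimg c"
 then show "(\<Sum>l<mdim M. gcomp c k l y*pd l xc y) = vcoord c k (grad (chart_inv c y))"
  using grad(3)[OF c inv_pts(1)[OF y] k] by (simp add: inv_pts(3)[OF y])
qed

lemma of_x_smooth: "smooth1 U u ==> Cinf_on (mdim M) (M.cimg c) (%y. u (xc y))"
 by (rule Cinf_on_smooth1(1)[OF eo U(1) _ _ x_chart[OF c]]) (use U(2) x_nonneg inv_pts(2) in auto)

lemma dx_smooth: "i<mdim M ==> Cinf_on (mdim M) (M.cimg c) (%y. coord_vect M c i (chart_inv c y) x)"
 by (rule Cinf_on_cong[OF eo _ Cinf_on_partial_deriv[OF eo x_chart[OF c]]]) (auto simp: dx_coord[OF c inv_pts(1)] inv_pts(3))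

context
 fixes e assumes e: "e \<in> atlas (base D)"
begin

lemma Y_open: "eopen (mdim M) (snd c ` ({p \<in> pts M. \<pi> p \<in> fst e} \<inter> fst c))"
 by (rule M.chart_open_image[OF c openin_Int[OF M.map_preimage_open[OF B.smooth_mfd_axioms fibration(5) B.chart_props(1)[OF e]] M.chart_props(1)[OF c]]]) simp

lemma Y_smooth: "k<d ==> Cinf_on (mdim M) (snd c ` ({p \<in> pts M. \<pi> p \<in> fst e} \<inter> fst c)) (%y. snd e (\<pi> (chart_inv c y)) k)"
 by (rule M.chart_map_smooth[OF B.smooth_mfd_axioms fibration(5) c e])

lemma d\<pi>_coord: "p \<in> fst c ==> \<pi> p \<in> fst e ==> k<d ==>  vcoord e k (d\<pi> p (coord_vect M c i p)) = pd i (%y. snd e (\<pi> (chart_inv c y)) k) (snd c p)"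
 unfolding d_proj_def by (rule M.vcoord_push_coord_vect[OF B.smooth_mfd_axioms fibration(5) c _ e])

lemma pull_bg:
 assumes i: "i<m" and p: "p \<in> fst c" "\<pi> p \<in> fst e" and vw: "v \<in> tangent M p" "w \<in> tangent M p"
 shows "bg D i (\<pi> p) (d\<pi> p v) (d\<pi> p w) = (\<Sum>k<d. \<Sum>l<d. bc e i k l (snd e (\<pi> p))*(vcoord e k (d\<pi> p v) * vcoord e l (d\<pi> p w)))"
proof -
 have "p \<in> pts M" using M.chart_pts[OF c] p(1) by blast
 from d\<pi>_tangent[OF this vw(1)] d\<pi>_tangent[OF this vw(2)] show ?thesis by (rule bg_expand[OF e i p(2)])
qed

end

text \<open>The formula for the pullback refers to a chart of the base around the image point, which
  changes with the point; hence the local criterion for smoothness.\<close>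

lemma pull_bg_smooth:
 assumes b: "b<m" and ij: "i<mdim M" "j<mdim M"
 shows "Cinf_on (mdim M) (M.cimg c) (%y. bg D b (\<pi> (chart_inv c y)) (d\<pi> (chart_inv c y) (coord_vect M c i (chart_inv c y)))
  (d\<pi> (chart_inv c y) (coord_vect M c j (chart_inv c y))))" (is "Cinf_on _ _ ?f")
proof (rule Cinf_on_local[OF eo])
 fix y assume y: "y \<in> M.cimg c"
 obtain e where e: "e \<in> atlas (base D)" "\<pi> (chart_inv c y) \<in> fst e" using B.ex_chart[OF \<pi>_pts[OF inv_pts(2)[OF y]]] by blast
 let ?T = "snd c ` ({p \<in> pts M. \<pi> p \<in> fst e} \<inter> fst c)"
 interpret S: split_metric d m "B.cimg e" "bc e" "Jc e" "dims D" by (rule split[OF e(1)])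
 note To = Y_open[OF e(1)]
 let ?Y = "%y. snd e (\<pi> (chart_inv c y))"
 have T: "\<exists>p. p \<in> fst c & p \<in> pts M & \<pi> p \<in> fst e & z = snd c p & chart_inv c z = p" if z: "z \<in> ?T" for z
 proof -
  obtain p where "p \<in> pts M" "\<pi> p \<in> fst e" "p \<in> fst c" "z = snd c p" using z by blast
  then show ?thesis using M.chart_inv_left[OF c] by blast
 qed
 have YT: "?Y z \<in> B.cimg e" if z: "z \<in> ?T" for z
 proof -
  obtain p where "\<pi> p \<in> fst e" "chart_inv c z = p" using T[OF z] by (elim exE conjE) (rule that)
  then show ?thesis using B.chart_in[OF e(1), of "\<pi> p"] by simp
 qed
 have bcY: "Cinf_on (mdim M) ?T (%y. bc e b k l (?Y y))" if kl: "k<d" "l<d" for k l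
  by (rule Cinf_on_compose[OF To S.T YT Y_smooth[OF e(1)] S.b[OF b kl]])
 have "Cinf_on (mdim M) ?T (%y. \<Sum>k<d. \<Sum>l<d. bc e b k l (?Y y)*(pd i (%y. ?Y y k) y*pd j (%y. ?Y y l) y))"
  using b ij by (intro Cinf_on_sum[OF To] Cinf_on_mult[OF To] Cinf_on_partial_deriv[OF To] bcY Y_smooth[OF e(1)]) auto
 then have "Cinf_on (mdim M) ?T ?f"
 proof (rule Cinf_on_cong[OF To, rotated])
  fix z assume z: "z \<in> ?T"
  obtain p where p: "p \<in> fst c" "\<pi> p \<in> fst e" "z = snd c p" "chart_inv c z = p" using T[OF z] by (elim exE conjE) (rule that)
  note t = M.coord_vect_tangent[OF c p(1)]
  show "(\<Sum>k<d. \<Sum>l<d. bc e b k l (?Y z)*(pd i (%y. ?Y y k) z*pd j (%y. ?Y y l) z)) = ?f z"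
   unfolding p(4) pull_bg[OF e(1) b p(1,2) t[OF ij(1)] t[OF ij(2)]] by (simp add: d\<pi>_coord[OF e(1) p(1,2)] p(3))
 qed
 moreover have "snd c (chart_inv c y) \<in> ?T" using e(2) inv_pts(1,2)[OF y] by (intro imageI) simp
 then have "y \<in> ?T" by (simp only: inv_pts(3)[OF y])
 ultimately show "\<exists>T. eopen (mdim M) T & y \<in> T & Cinf_on (mdim M) (T \<inter> M.cimg c) ?f"
  using To by (intro exI[of _ ?T] conjI Cinf_on_subset[OF Int_lower1])
qed

lemma gA_smooth:
 assumes ij: "i<mdim M" "j<mdim M"
 shows "Cinf_on (mdim M) (M.cimg c) (comp2 M gA c i j)"
proof -
 have "Cinf_on (mdim M) (M.cimg c) (comp2 M g0 c i j)" by (rule M.metric_comp(1)[OF kahler0_facts(1) c ij])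
 then show ?thesis unfolding comp2_def[abs_def] gA_def Let_def using ij
  by (intro Cinf_on_add[OF eo] Cinf_on_mult[OF eo] Cinf_on_sum[OF eo] Cinf_on_const[OF eo] of_x_smooth F(1) E(1) dx_smooth kap_smooth pull_bg_smooth) auto
qed

lemma JA_smooth:
 assumes ki: "k<mdim M" "i<mdim M"
 shows "Cinf_on (mdim M) (M.cimg c) (endo_comp M JA c k i)"
proof (rule Cinf_on_cong[OF eo])
 show "Cinf_on (mdim M) (M.cimg c) (%y. endo_comp M J0 c k i y
   + ((0 - E (xc y)*kap (chart_inv c y) (coord_vect M c i (chart_inv c y))) * vcoord c k (grad (chart_inv c y))
   + F (xc y)*coord_vect M c i (chart_inv c y) x*(\<Sum>l<mdim M. endo_comp M J0 c k l y * vcoord c l (grad (chart_inv c y)))))"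
  using ki by (intro Cinf_on_add[OF eo] Cinf_on_diff[OF eo] Cinf_on_mult[OF eo] Cinf_on_sum[OF eo] Cinf_on_const[OF eo] of_x_smooth F(1) E(1) dx_smooth kap_smooth
   J0_smooth grad_smooth) auto
 fix y assume y: "y \<in> M.cimg c"
 note p = inv_pts[OF y]
 show "endo_comp M J0 c k i y + ((0 - E (xc y)*kap (chart_inv c y) (coord_vect M c i (chart_inv c y))) * vcoord c k (grad (chart_inv c y))
   + F (xc y)*coord_vect M c i (chart_inv c y) x*(\<Sum>l<mdim M. endo_comp M J0 c k l y * vcoord c l (grad (chart_inv c y)))) = endo_comp M JA c k i y"
  using M.endo_coord[OF kahler0_facts(4) c p(1) grad_tangent[OF p(2)], of k] by (simp add: endo_comp_def JA_def M.vcoord_linear p(3) Let_def)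
qed

end

end

section \<open>Positivity and the algebraic Kaehler conditions\<close>

context toric_metric
begin

lemma pull_linear:
 assumes "b<m" "p \<in> pts M" "u \<in> tangent M p"
 shows "linear_fun (tangent M p) (%v. bg D b (\<pi> p) (d\<pi> p u) (d\<pi> p v))" "linear_fun (tangent M p) (%v. bg D b (\<pi> p) (d\<pi> p v) (d\<pi> p u))"
 using bg_linear[OF assms(1) \<pi>_pts[OF assms(2)] d\<pi>_tangent[OF assms(2,3)]] d\<pi>_tangent[OF assms(2)] by (simp_all add: linear_fun_def d\<pi>_linear)

lemma linear_fun_add: "linear_fun V f ==> linear_fun V g ==> linear_fun V (%v. f v + g v :: real)"
 and linear_fun_cmult: "linear_fun V f ==> linear_fun V (%v. r*f v)" by (simp_all add: linear_fun_def algebra_simps)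

lemma linear_fun_sum: "(!!i. i \<in> I ==> linear_fun V (f i)) ==> linear_fun V (%v. \<Sum>i\<in>I. f i v :: real)"
 by (simp add: linear_fun_def sum.distrib sum_distrib_left)

lemma gA_bilinear: "bilinear_tensor M gA" unfolding bilinear_tensor_def
proof (intro conjI ballI allI impI)
 fix p u assume p: "p \<in> pts M" and u: "u \<in> tangent M p"
 show "linear_fun (tangent M p) (gA p u)" unfolding gA_def[abs_def] using g0_linear(1)[OF p u] dx_linear kap_linear[OF p] pull_linear(1)[OF _ p u]
  by (intro linear_fun_add linear_fun_sum linear_fun_cmult) auto
 have "gA p v u = g0 p v u + (F (x p)*u x) * v x + (E (x p)*kap p u)*kap p v
  + (\<Sum>i<m. (a i - a0 i)*bg D i (\<pi> p) (d\<pi> p v) (d\<pi> p u))" for v by (simp add: gA_def mult_ac)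
 then show "linear_fun (tangent M p) (%v. gA p v u)" using g0_linear(2)[OF p u] dx_linear kap_linear[OF p] pull_linear(2)[OF _ p u]
  by (simp, intro linear_fun_add linear_fun_sum linear_fun_cmult) auto
next
 fix c i j assume "c \<in> atlas M" "i<mdim M" "j<mdim M"
 then show "Cinf_on (mdim M) (snd c ` fst c) (comp2 M gA c i j)" using gA_smooth unfolding M.cimg_def by blast
qed

lemma JA_endo: "endo_tensor M JA" unfolding endo_tensor_def using JA_linear JA_smooth unfolding M.cimg_def by blast

lemma gA_sym: "p \<in> pts M ==> u \<in> tangent M p ==> v \<in> tangent M p ==> gA p u v = gA p v u"
 using g0_sym bg_sym(1)[OF _ \<pi>_pts d\<pi>_tangent d\<pi>_tangent] by (simp add: gA_def mult_ac)

text \<open>Controls \<open>gA\<close> on the special orbit. On the principal part it equals dx^2/h0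
  + h0 \<theta>^2 plus x times the pullback of the background tensors with weights b_i. This is
  semidefinite as b_i >= 0, and semidefiniteness passes to the closure.\<close>

definition low :: "'m tensor2" where "low p v w = g0 p v w - (\<Sum>i<m. a0 i*bg D i (\<pi> p) (d\<pi> p v) (d\<pi> p w))"

lemma low_bilinear: "bilinear_tensor M low" unfolding bilinear_tensor_def
proof (intro conjI ballI allI impI)
 have e: "low p v w = g0 p v w + (- 1)*(\<Sum>i<m. a0 i*bg D i (\<pi> p) (d\<pi> p v) (d\<pi> p w))" for p v w by (simp add: low_def)
 fix p u assume p: "p \<in> pts M" and u: "u \<in> tangent M p"
 show "linear_fun (tangent M p) (low p u)" "linear_fun (tangent M p) (%v. low p v u)"
  unfolding e[abs_def] using g0_linear[OF p u] pull_linear[OF _ p u] by (intro linear_fun_add linear_fun_sum linear_fun_cmult; auto)+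
next
 fix c i j assume c: "c \<in> atlas M" "i<mdim M" "j<mdim M"
 then have "Cinf_on (mdim M) (M.cimg c) (comp2 M g0 c i j)" using M.metric_comp(1)[OF kahler0_facts(1)] by blast
 then have "Cinf_on (mdim M) (M.cimg c) (comp2 M low c i j)" unfolding comp2_def[abs_def] low_def Let_def using c
  by (intro Cinf_on_diff[OF eo] Cinf_on_mult[OF eo] Cinf_on_sum[OF eo] Cinf_on_const[OF eo] pull_bg_smooth) auto
 then show "Cinf_on (mdim M) (snd c ` fst c) (comp2 M low c i j)" unfolding M.cimg_def .
qed

lemma low_nonneg:
 assumes p: "p \<in> pts M" and u: "u \<in> tangent M p"
 shows "0 <= low p u u"
proof -
 obtain c where c: "c \<in> atlas M" "p \<in> fst c" using M.ex_chart[OF p] by blast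
 define v where "v k = vcoord c k u" for k
 define f where "f y = (\<Sum>i<mdim M. \<Sum>j<mdim M. comp2 M low c i j y*(v i * v j))" for y
 have f: "f (snd c q) = low q (M.comb c v q) (M.comb c v q)" if q: "q \<in> fst c" for q
  unfolding f_def M.bilinear_expand[OF low_bilinear c(1) q M.comb(1)[OF c(1) q] M.comb(1)[OF c(1) q]] by (simp add: M.comb(2)[OF c(1) q])
 have "f (snd c p) \<in> {0..}"
 proof (rule dense[OF c(1) _ _ _ c(2)])
  show "Cinf_on (mdim M) (M.cimg c) f" unfolding f_def[abs_def] using low_bilinear c(1) unfolding bilinear_tensor_def
   by (intro Cinf_on_sum[OF eo[OF c(1)]] Cinf_on_mult[OF eo[OF c(1)]] Cinf_on_const[OF eo[OF c(1)]]) (auto simp: M.cimg_def)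
  show "closed {0::real..}" by (rule closed_atLeast)
  fix q assume q: "q \<in> fst c" "q \<in> PP"
  have qp: "q \<in> pts M" and xq: "0<x q" using PP_pts[OF q(2)] by auto
  let ?w = "M.comb c v q"
  note t = M.comb(1)[OF c(1) q(1), of v]
  have "low q ?w ?w = ?w x*?w x/h0 (x q) + h0 (x q)*\<theta> q ?w*\<theta> q ?w + (\<Sum>i<m. slope D i*x q*bg D i (\<pi> q) (d\<pi> q ?w) (d\<pi> q ?w))"
   by (simp add: low_def form0_at(1)[OF q(2) t t] base_metric_def warp_def algebra_simps sum.distrib)
  moreover have "0 <= (\<Sum>i<m. slope D i*x q*bg D i (\<pi> q) (d\<pi> q ?w) (d\<pi> q ?w))"
   using slope xq bg_sym(2)[OF _ \<pi>_pts[OF qp] d\<pi>_tangent[OF qp t] d\<pi>_tangent[OF qp t]] by (intro sum_nonneg mult_nonneg_nonneg) auto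
  moreover have "0 <= ?w x*?w x/h0 (x q)" "0 <= h0 (x q)*\<theta> q ?w*\<theta> q ?w" using h0_pos[OF xq] by (simp_all add: mult.assoc)
  ultimately show "f (snd c q) \<in> {0..}" by (simp add: f[OF q(1)])
 qed
 then show ?thesis using f[OF c(2)] M.comb(3)[OF c u] by (simp add: v_def[abs_def])
qed

text \<open>Density preserves only semidefiniteness, so x = 0 is treated apart. There dx and
  \<open>kap\<close> vanish and \<open>gA\<close> is \<open>low\<close> plus the background tensors
  with weights a_i; a null vector is null for both parts, hence for \<open>g0\<close>.\<close>

lemma gA_pos:
 assumes p: "p \<in> pts M" and v: "v \<in> tangent M p"
 shows "0 <= gA p v v" "gA p v v = 0 ==> v = vzero"
proof -
 note t = d\<pi>_tangent[OF p v]
 have nn: "0 <= bg D i (\<pi> p) (d\<pi> p v) (d\<pi> p v)" if "i<m" for i by (rule bg_sym(2)[OF that \<pi>_pts[OF p] t t])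
 have bz: "d\<pi> p v = vzero" if "!!i. i<m ==> bg D i (\<pi> p) (d\<pi> p v) (d\<pi> p v) = 0" using base_facts(8)[OF \<pi>_pts[OF p] t] that by blast
 have zero: "!!i. i<m ==> bg D i (\<pi> p) (d\<pi> p v) (d\<pi> p v) = 0" if "(\<Sum>i<m. A i*bg D i (\<pi> p) (d\<pi> p v) (d\<pi> p v)) = 0" "!!i. i<m ==> 0<A i" for A
 proof -
  fix i assume i: "i<m"
  have "0 <= A j*bg D j (\<pi> p) (d\<pi> p v) (d\<pi> p v)" if j: "j \<in> {..<m}" for j
   using less_imp_le[OF `!!i. i<m ==> 0<A i`] nn j by (intro mult_nonneg_nonneg) auto
  then have "\<forall>i\<in>{..<m}. A i*bg D i (\<pi> p) (d\<pi> p v) (d\<pi> p v) = 0" using that(1) by (subst sum_nonneg_eq_0_iff[symmetric]) auto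
  then have "A i*bg D i (\<pi> p) (d\<pi> p v) (d\<pi> p v) = 0" using i by blast
  then show "bg D i (\<pi> p) (d\<pi> p v) (d\<pi> p v) = 0" using that(2)[OF i] by (simp del: mult_less_0_iff)
 qed
 have sn: "0 <= (\<Sum>i<m. A i*bg D i (\<pi> p) (d\<pi> p v) (d\<pi> p v))" if "!!i. i<m ==> 0<A i" for A
  using that nn by (intro sum_nonneg mult_nonneg_nonneg) (auto intro: less_imp_le)
 have "0 <= gA p v v & (gA p v v = 0 --> v = vzero)"
 proof (cases "x p = 0")
  case True
  have e: "gA p v v = low p v v + (\<Sum>i<m. a i*bg D i (\<pi> p) (d\<pi> p v) (d\<pi> p v))"
   by (simp add: gA_def low_def dx_zero[OF p True v] kap_zero[OF p True v] left_diff_distrib sum_subtractf)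
  have sa: "0 <= (\<Sum>i<m. a i*bg D i (\<pi> p) (d\<pi> p v) (d\<pi> p v))" by (rule sn) (rule a_pos)
  have z: "v = vzero" if "gA p v v = 0"
  proof -
   have "low p v v = 0" "(\<Sum>i<m. a i*bg D i (\<pi> p) (d\<pi> p v) (d\<pi> p v)) = 0" using that e low_nonneg[OF p v] sa by linarith+
   then have "g0 p v v = 0" using zero[of a] a_pos by (simp add: low_def)
   then show ?thesis using g0_zero[OF p v] by blast
  qed
  show ?thesis using z e low_nonneg[OF p v] sa by auto
 next
  case False
  then have xp: "0<x p" using x_nonneg[OF p] by simp
  then have P: "p \<in> PP" using p by (simp add: principal_part_def)
  have wp: "0<warp D a (x p) i" if "i<m" for i using warp_pos[of "x p" i a] that a_pos[OF that] xp by simp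
  define Q1 Q2 Q3 where "Q1 = v x * v x/h (x p)" and "Q2 = h (x p)*\<theta> p v * \<theta> p v"
   and "Q3 = (\<Sum>i<m. warp D a (x p) i*bg D i (\<pi> p) (d\<pi> p v) (d\<pi> p v))"
  have Q: "0 <= Q1" "0 <= Q2" "0 <= Q3" using h_pos[OF xp] sn[of "warp D a (x p)"] wp by (simp_all add: Q1_def Q2_def Q3_def mult.assoc)
  have e: "gA p v v = Q1 + Q2 + Q3" by (simp add: gA_PP[OF P v v] Q1_def Q2_def Q3_def base_metric_def)
  have z: "v = vzero" if "gA p v v = 0"
  proof (rule vanish[OF P v])
   have "Q1 = 0" "Q2 = 0" "Q3 = 0" using that e Q by linarith+
   then show "v x = 0" "\<theta> p v = 0" "d\<pi> p v = vzero" using h_pos[OF xp] bz zero[of "warp D a (x p)"] wp by (auto simp: Q1_def Q2_def Q3_def)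
  qed
  then show ?thesis using e Q by auto
 qed
 then show "0 <= gA p v v" "gA p v v = 0 ==> v = vzero" by auto
qed

lemma gA_riemannian: "riemannian M gA" unfolding riemannian_def symmetric_psd_def
proof (intro conjI ballI gA_bilinear impI)
 fix p u v assume p: "p \<in> pts M" and u: "u \<in> tangent M p" and v: "v \<in> tangent M p"
 show "gA p u v = gA p v u" by (rule gA_sym[OF p u v])
 show "0 <= gA p u u" by (rule gA_pos(1)[OF p u])
 show "v ~= vzero ==> 0<gA p v v" using gA_pos[OF p v] by force
qed

text \<open>For fixed components \<open>v\<close> this is an identity between smooth functions in
  the chart; on the principal part it is checked on dx, \<theta> and the projection
  separately.\<close>

lemma JA_sq:
 assumes p: "p \<in> pts M" and u: "u \<in> tangent M p"
 shows "JA p (JA p u) = vscale (-1) u"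
proof -
 obtain c where c: "c \<in> atlas M" "p \<in> fst c" using M.ex_chart[OF p] by blast
 define v where "v k = vcoord c k u" for k
 have "vcoord c k (JA p (JA p u)) = vcoord c k (vscale (-1) u)" if k: "k<mdim M" for k
 proof -
  define f where "f y = (\<Sum>l<mdim M. endo_comp M JA c k l y*(\<Sum>i<mdim M. endo_comp M JA c l i y * v i)) + v k" for y
  have f: "f (snd c q) = vcoord c k (JA q (JA q (M.comb c v q))) + v k" if q: "q \<in> fst c" for q
  proof -
   have qp: "q \<in> pts M" using M.chart_pts[OF c(1)] q by blast
   note t = M.comb(1)[OF c(1) q, of v]
   show ?thesis by (simp add: f_def M.endo_coord[OF JA_endo c(1) q t] M.endo_coord[OF JA_endo c(1) q JA_tangent[OF qp t]] M.comb(2)[OF c(1) q])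
  qed
  have "f (snd c p) \<in> {0}"
  proof (rule dense[OF c(1) _ closed_singleton _ c(2)])
   show "Cinf_on (mdim M) (M.cimg c) f" unfolding f_def[abs_def] using k
    by (intro Cinf_on_add[OF eo[OF c(1)]] Cinf_on_sum[OF eo[OF c(1)]] Cinf_on_mult[OF eo[OF c(1)]] Cinf_on_const[OF eo[OF c(1)]] JA_smooth[OF c(1)]) auto
   fix q assume q: "q \<in> fst c" "q \<in> PP"
   have qp: "q \<in> pts M" and xq: "0<x q" using PP_pts[OF q(2)] by auto
   note t = M.comb(1)[OF c(1) q(1), of v]
   note Jt = JA_tangent[OF qp t]
   have "JA q (JA q (M.comb c v q)) = vscale (-1) (M.comb c v q)"
   proof (rule eq_by_parts[OF q(2) JA_tangent[OF qp Jt] M.vscale_tangent[OF t]])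
    show "JA q (JA q (M.comb c v q)) x = vscale (-1) (M.comb c v q) x" using h_pos[OF xq] by (simp add: JA_PP(1)[OF q(2) Jt] JA_PP(2)[OF q(2) t] vscale_def)
    show "\<theta> q (JA q (JA q (M.comb c v q))) = \<theta> q (vscale (-1) (M.comb c v q))"
     using h_pos[OF xq] \<theta>_linear[OF q(2)] t by (simp add: JA_PP(2)[OF q(2) Jt] JA_PP(1)[OF q(2) t] linear_fun_def)
    show "d\<pi> q (JA q (JA q (M.comb c v q))) = d\<pi> q (vscale (-1) (M.comb c v q))"
     by (simp add: JA_PP(3)[OF q(2) Jt] JA_PP(3)[OF q(2) t] J_J[OF \<pi>_pts[OF qp] d\<pi>_tangent[OF qp t]] d\<pi>_linear)
   qed
   then show "f (snd c q) \<in> {0}" by (simp add: f[OF q(1)] M.vcoord_linear M.comb(2)[OF c(1) q(1) k])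
  qed
  then show ?thesis using f[OF c(2)] M.comb(3)[OF c u] by (simp add: v_def[abs_def] M.vcoord_linear)
 qed
 then show ?thesis using M.tangent_eq_iff[OF c JA_tangent[OF p JA_tangent[OF p u]] M.vscale_tangent[OF u]] by blast
qed

lemma JA_orthogonal: "orthogonal_endo M gA JA" unfolding orthogonal_endo_def
proof (intro ballI)
 fix p u w assume p: "p \<in> pts M" and u: "u \<in> tangent M p" and w: "w \<in> tangent M p"
 obtain c where c: "c \<in> atlas M" "p \<in> fst c" using M.ex_chart[OF p] by blast
 define v where "v k = vcoord c k u" for k
 define v' where "v' k = vcoord c k w" for k
 define f where "f y = (\<Sum>k<mdim M. \<Sum>l<mdim M. comp2 M gA c k l y*((\<Sum>i<mdim M. endo_comp M JA c k i y * v i)*(\<Sum>i<mdim M. endo_comp M JA c l i y * v' i)))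
  - (\<Sum>k<mdim M. \<Sum>l<mdim M. comp2 M gA c k l y*(v k * v' l))" for y
 have f: "f (snd c q) = gA q (JA q (M.comb c v q)) (JA q (M.comb c v' q)) - gA q (M.comb c v q) (M.comb c v' q)" if q: "q \<in> fst c" for q
 proof -
  have qp: "q \<in> pts M" using M.chart_pts[OF c(1)] q by blast
  note t = M.comb(1)[OF c(1) q, of v] M.comb(1)[OF c(1) q, of v']
  show ?thesis
   unfolding M.bilinear_expand[OF gA_bilinear c(1) q t] M.bilinear_expand[OF gA_bilinear c(1) q JA_tangent[OF qp t(1)] JA_tangent[OF qp t(2)]]
   by (simp add: f_def M.endo_coord[OF JA_endo c(1) q t(1)] M.endo_coord[OF JA_endo c(1) q t(2)] M.comb(2)[OF c(1) q])
 qed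
 have "f (snd c p) \<in> {0}"
 proof (rule dense[OF c(1) _ closed_singleton _ c(2)])
  show "Cinf_on (mdim M) (M.cimg c) f" unfolding f_def[abs_def]
   by (intro Cinf_on_diff[OF eo[OF c(1)]] Cinf_on_sum[OF eo[OF c(1)]] Cinf_on_mult[OF eo[OF c(1)]] Cinf_on_const[OF eo[OF c(1)]] JA_smooth[OF c(1)] gA_smooth[OF c(1)]) auto
  fix q assume q: "q \<in> fst c" "q \<in> PP"
  have qp: "q \<in> pts M" and xq: "0<x q" using PP_pts[OF q(2)] by auto
  note t = M.comb(1)[OF c(1) q(1), of v] M.comb(1)[OF c(1) q(1), of v']
  note Jt = JA_tangent[OF qp t(1)] JA_tangent[OF qp t(2)]
  have "bg D i (\<pi> q) (base_J D (\<pi> q) (d\<pi> q (M.comb c v q))) (base_J D (\<pi> q) (d\<pi> q (M.comb c v' q))) = bg D i (\<pi> q) (d\<pi> q (M.comb c v q)) (d\<pi> q (M.comb c v' q))"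
   if "i<m" for i using base_facts(6)[OF that] \<pi>_pts[OF qp] d\<pi>_tangent[OF qp t(1)] d\<pi>_tangent[OF qp t(2)] by (simp add: orthogonal_endo_def)
  then have "gA q (JA q (M.comb c v q)) (JA q (M.comb c v' q)) = gA q (M.comb c v q) (M.comb c v' q)"
   using h_pos[OF xq] by (simp add: gA_PP[OF q(2) Jt] gA_PP[OF q(2) t] JA_PP[OF q(2) t(1)] JA_PP[OF q(2) t(2)] base_metric_def)
  then show "f (snd c q) \<in> {0}" by (simp add: f[OF q(1)])
 qed
 then show "gA p (JA p u) (JA p w) = gA p u w" using f[OF c(2)] M.comb(3)[OF c u] M.comb(3)[OF c w] by (simp add: v_def[abs_def] v'_def[abs_def])
qed

end

context toric_base
begin

lemma form_expand:
 assumes e: "e \<in> atlas (base D)" and q: "q \<in> fst e" and uv: "u \<in> tangent (base D) q" "v \<in> tangent (base D) q"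
 shows "base_form D A q u v = (\<Sum>k<d. \<Sum>l<d. (\<Sum>s<d. Jc e s k (snd e q)*(\<Sum>i<m. A i*bc e i s l (snd e q)))*(vcoord e k u * vcoord e l v))"
proof -
 have qp: "q \<in> pts (base D)" using B.chart_pts[OF e] q by blast
 note t = B.coord_vect_tangent[OF e q]
 have L1: "linear_fun (tangent (base D) q) (%u. base_form D A q u v)" using bg_linear(2)[OF _ qp uv(2)] J_linear[OF qp] J_tangent[OF qp]
  by (auto simp: base_form_def kahler_form_def base_metric_def linear_fun_def linear_vmap_def algebra_simps sum.distrib sum_distrib_left)
 have L2: "linear_fun (tangent (base D) q) (base_form D A q u)" if "u \<in> tangent (base D) q" for u using bg_linear(1)[OF _ qp J_tangent[OF qp that]]
  by (auto simp: base_form_def kahler_form_def base_metric_def linear_fun_def algebra_simps sum.distrib sum_distrib_left)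
 have "base_form D A q u v = (\<Sum>k<d. vcoord e k u*(\<Sum>l<d. vcoord e l v * base_form D A q (coord_vect (base D) e k q) (coord_vect (base D) e l q)))"
  using B.linear_fun_expand[OF L1 e q uv(1)] B.linear_fun_expand[OF L2[OF t] e q uv(2)] by simp
 also have "... = (\<Sum>k<d. \<Sum>l<d. comp2 (base D) (base_form D A) e k l (snd e q)*(vcoord e k u * vcoord e l v))"
  by (simp add: sum_distrib_left B.comp2_at[OF e q] mult_ac)
 also have "... = (\<Sum>k<d. \<Sum>l<d. (\<Sum>s<d. Jc e s k (snd e q)*(\<Sum>i<m. A i*bc e i s l (snd e q)))*(vcoord e k u * vcoord e l v))"
  using comp_base_form[OF e B.chart_in[OF e q]] by (intro sum.cong refl) auto
 finally show ?thesis .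
qed

end

context toric_metric
begin

text \<open>Everything is local around \<open>p0\<close>: together with a chart \<open>e\<close> of
  the base near the projection of \<open>p0\<close>, the chart \<open>c\<close> becomes an instance
  of \<open>total_frame\<close>, with the constant part of the base metric given by \<open>a\<close>
  and the linear part by the slopes.\<close>

lemma principal_calculus:
 assumes c: "c \<in> atlas M" and p0: "p0 \<in> fst c" "p0 \<in> PP"
 shows "scalar_loc (mdim M) (comp2 M gA c) (snd c p0) = S"
  and "i<mdim M ==> k<mdim M ==> j<mdim M ==> 
   parallel_loc (mdim M) (christoffel_loc (mdim M) (comp2 M gA c)) (endo_comp M JA c) i k j (snd c p0) = 0"
proof -
 obtain e where e: "e \<in> atlas (base D)" "\<pi> p0 \<in> fst e" using B.ex_chart[OF \<pi>_pts[OF PP_pts(1)[OF p0(2)]]] by blast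
 interpret S: split_metric d m "B.cimg e" "bc e" "Jc e" "dims D" by (rule split[OF e(1)])
 let ?T = "snd c ` ({p \<in> pts M. \<pi> p \<in> fst e} \<inter> fst c)"
 let ?x = "%y. x (chart_inv c y)"
 let ?n = "mdim M"
 define SS where "SS = ?T \<inter> {y \<in> M.cimg c. ?x y \<in> {0<..}}"
 define Y where "Y k y = snd e (\<pi> (chart_inv c y)) k" for k y
 let ?Y = "%y k. if k<d then Y k y else 0"
 define th where "th i y = \<theta> (chart_inv c y) (coord_vect M c i (chart_inv c y))" for i y
 define t1 where "t1 s = (\<Sum>i<m. slope D i*real (dims D i)/(slope D i * s + a i))" for s
 define SB where "SB s = (\<Sum>i<m. real (dims D i)/(slope D i * s + a i))" for s
 have SSo: "eopen ?n SS"
  unfolding SS_def by (intro openin_Int Y_open[OF c e(1)] eopen_continuous_preimage[OF eo[OF c] Cinf_on_continuous_on[OF eo[OF c] x_chart[OF c]]]) auto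
 have SST: "SS \<subseteq> ?T" "SS \<subseteq> M.cimg c" by (auto simp: SS_def)
 have SSE: "\<exists>p. p \<in> fst c & p \<in> PP & \<pi> p \<in> fst e & y = snd c p & chart_inv c y = p" if y: "y \<in> SS" for y
 proof -
  obtain p where "p \<in> pts M" "\<pi> p \<in> fst e" "p \<in> fst c" "y = snd c p" using y unfolding SS_def by blast
  moreover have "chart_inv c y = p" using M.chart_inv_left[OF c] calculation by simp
  ultimately show ?thesis using y by (auto simp: SS_def principal_part_def)
 qed
 have p0S: "snd c p0 \<in> SS" using p0 e(2) PP_pts[OF p0(2)] M.chart_in[OF c p0(1)] by (auto simp: SS_def M.chart_inv_left[OF c p0(1)])
 \<comment> \<open>Chart coordinates vanish from index \<open>d\<close> on, so truncation at
   \<open>d\<close> changes nothing.\<close>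
 have Yt: "?Y y = snd e (\<pi> p)" if "chart_inv c y = p" "\<pi> p \<in> fst e" for y p
  using eopen_mem_zero[OF B.chart_props(2)[OF e(1)] B.chart_in[OF e(1) that(2)]] that(1) by (auto simp: Y_def fun_eq_iff)
 have dY: "vcoord e k (d\<pi> p (coord_vect M c i p)) = pd i (Y k) (snd c p)" if "p \<in> fst c" "\<pi> p \<in> fst e" "k<d" for p i k
  unfolding Y_def[abs_def] by (rule d\<pi>_coord[OF c e(1) that])
 have Geq: "S.G (warp D a s) k l z = S.G a k l z + s * S.G (slope D) k l z" for s k l z
  by (simp add: S.G_def warp_def sum.distrib algebra_simps sum_distrib_left)
 have Gfun: "(%k l z. S.G a k l z + s * S.G (slope D) k l z) = S.G (warp D a s)" for s by (intro ext) (simp add: Geq)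
 have Gmat: "(%k l. S.G a k l z + s * S.G (slope D) k l z) = (%k l. S.G (warp D a s) k l z)" for s z by (intro ext) (simp add: Geq)
 have wpos: "S.pos (warp D a s)" if "0<s" for s using warp_pos[of s _ a] a_pos that by (simp add: S.pos_def)
 have n: "Suc (Suc d) = ?n" by (simp add: fibration(1))
 have cf: "!!i. i<?n ==> Cinf_on ?n (snd c ` (fst c \<inter> PP)) (th i)"
  "!!y i j. y \<in> snd c ` (fst c \<inter> PP) ==> i<?n ==> j<?n ==> pd i (th j) y - pd j (th i) y =
   base_form D (slope D) (\<pi> (chart_inv c y)) (d\<pi> (chart_inv c y) (coord_vect M c i (chart_inv c y))) (d\<pi> (chart_inv c y) (coord_vect M c j (chart_inv c y)))"
  using tb c unfolding toric_bundle_def connection_form_def Let_def th_def[abs_def] by blast+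
 have SP: "SS \<subseteq> snd c ` (fst c \<inter> PP)" using SSE by blast
 interpret TF: total_frame d SS "B.cimg e" ?x th Y h "S.G a" "S.G (slope D)" "Jc e" t1 SB "comp2 M gA c" "endo_comp M JA c"
 proof (unfold_locales, unfold n Gfun Gmat)
  show "eopen ?n SS" by (rule SSo)
  show "eopen d (B.cimg e)" by (rule S.T)
  show "Cinf_on ?n SS ?x" by (rule Cinf_on_subset[OF SST(2) x_chart[OF c]])
  show "0<?x y" if "y \<in> SS" for y using that by (simp add: SS_def)
  show "Cinf_on ?n SS (th i)" if "i<?n" for i by (rule Cinf_on_subset[OF SP cf(1)[OF that]])
  show "Cinf_on ?n SS (Y k)" if "k<d" for k unfolding Y_def[abs_def] by (rule Cinf_on_subset[OF SST(1) Y_smooth[OF c e(1) that]])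
  show "?Y y \<in> B.cimg e" if "y \<in> SS" for y using SSE[OF that] Yt B.chart_in[OF e(1)] by metis
  show "smooth1 {0<..} h" by (rule smooth1_subset[OF subset_UNIV h_smooth])
  show "0<h s" if "0<s" for s by (rule h_pos[OF that])
  show "Cinf_on d (B.cimg e) (S.G a k l)" "Cinf_on d (B.cimg e) (S.G (slope D) k l)" "Cinf_on d (B.cimg e) (Jc e k l)"
   if "k<d" "l<d" for k l using S.Cinf_G[OF that] S.J[OF that] by blast+
  show "S.G a k l z = S.G a l k z" "S.G (slope D) k l z = S.G (slope D) l k z" if "k<d" "l<d" "z \<in> B.cimg e" for k l z by (rule S.G_sym[OF that])+
  show "(\<Sum>s<d. Jc e s k z*S.G a s l z) = - (\<Sum>s<d. Jc e s l z*S.G a s k z)"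
   "(\<Sum>s<d. Jc e s k z*S.G (slope D) s l z) = - (\<Sum>s<d. Jc e s l z*S.G (slope D) s k z)" if "k<d" "l<d" "z \<in> B.cimg e" for k l z
   by (rule S.G_J[OF that])+
  show "(\<Sum>s<d. Jc e k s z*Jc e s l z) = (if k = l then -1 else 0)" if "k<d" "l<d" "z \<in> B.cimg e" for k l z by (rule S.JJ[OF that])
 next
  fix s :: real and z assume s: "0<s" and z: "z \<in> B.cimg e"
  have K: "S.parallel (warp D a s)" "scalar_loc d (S.G (warp D a s)) z = (\<Sum>i<m. real (dims D i)/warp D a s i)"
   using bk[OF s] e(1) z unfolding base_kahler_def by blast+
  show "nondegenerate d (%k l. S.G (warp D a s) k l z)" by (rule S.G_nd[OF wpos[OF s] z])
  show "parallel_loc d (christoffel_loc d (S.G (warp D a s))) (Jc e) i k j z = 0" if "i<d" "j<d" "k<d" for i j k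
   using K(1) z that by (simp add: S.parallel_def)
  show "scalar_loc d (S.G (warp D a s)) z = SB s" using K(2) by (simp add: SB_def warp_def)
  show "(\<Sum>k<d. \<Sum>l<d. mat_inverse d (%k l. S.G (warp D a s) k l z) k l*S.G (slope D) l k z) = t1 s"
   using S.trace_G[OF wpos[OF s] z, of "slope D"] by (simp add: t1_def warp_def)
 next
  fix i j y assume ij: "i<?n" "j<?n" and y: "y \<in> SS"
  obtain p where p: "p \<in> fst c" "p \<in> PP" "\<pi> p \<in> fst e" "y = snd c p" "chart_inv c y = p" using SSE[OF y] by (elim exE conjE) (rule that)
  note t = M.coord_vect_tangent[OF c p(1)]
  note dt = d\<pi>_tangent[OF PP_pts(1)[OF p(2)] t]
  show "pd i (th j) y - pd j (th i) y =
   (\<Sum>k<d. \<Sum>l<d. (\<Sum>s<d. Jc e s k (?Y y)*S.G (slope D) s l (?Y y)) *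
    (pd i (Y k) y*pd j (Y l) y))" unfolding Yt[OF p(5,3)] S.G_def
   using cf(2)[OF subsetD[OF SP y] ij] form_expand[OF e(1) p(3) dt[OF ij(1)] dt[OF ij(2)], of "slope D"]
   by (simp add: p(5) dY[OF p(1,3)] p(4)[symmetric])
  show "comp2 M gA c i j y = pd i ?x y*pd j ?x y/h (?x y) + h (?x y)*th i y*th j y +
    (\<Sum>k<d. \<Sum>l<d. (S.G a k l (?Y y) + ?x y*S.G (slope D) k l (?Y y)) *
     (pd i (Y k) y*pd j (Y l) y))"
  proof -
   have "base_metric D (warp D a (x p)) (\<pi> p) (d\<pi> p (coord_vect M c i p)) (d\<pi> p (coord_vect M c j p)) =
    (\<Sum>b<m. \<Sum>k<d. \<Sum>l<d. warp D a (x p) b*bc e b k l (snd e (\<pi> p))*(pd i (Y k) y*pd j (Y l) y))"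
    unfolding base_metric_def using pull_bg[OF c e(1) _ p(1,3) t[OF ij(1)] t[OF ij(2)]] by (simp add: dY[OF p(1,3)] p(4) sum_distrib_left mult.assoc)
   also have "... = (\<Sum>k<d. \<Sum>l<d. S.G (warp D a (x p)) k l (snd e (\<pi> p))*(pd i (Y k) y*pd j (Y l) y))"
    by (subst sum_rotate) (simp add: S.G_def sum_distrib_right)
   finally show ?thesis unfolding Yt[OF p(5,3)] p(5) Geq[symmetric] th_def
    by (simp add: p(4) M.comp2_at[OF c p(1)] gA_PP[OF p(2) t[OF ij(1)] t[OF ij(2)]] dx_coord[OF c p(1)] M.chart_inv_left[OF c p(1)])
  qed
 next
  fix i j assume ij: "i<?n" "j<?n"
  show "Cinf_on ?n SS (endo_comp M JA c i j)" by (rule Cinf_on_subset[OF SST(2) JA_smooth[OF c ij]])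
 next
  fix y and v :: "nat => real" assume y: "y \<in> SS"
   and v: "(\<Sum>i<?n. pd i ?x y * v i) = 0" "(\<Sum>i<?n. th i y * v i) = 0" "!!k. k<d ==> (\<Sum>i<?n. pd i (Y k) y * v i) = 0"
  obtain p where p: "p \<in> fst c" "p \<in> PP" "\<pi> p \<in> fst e" "y = snd c p" "chart_inv c y = p" using SSE[OF y] by (elim exE conjE) (rule that)
  have pp: "p \<in> pts M" by (rule PP_pts(1)[OF p(2)])
  note f = M.comb(1)[OF c p(1), of v] M.comb(2)[OF c p(1), where v = v]
  have ex: "L (M.comb c v p) = (\<Sum>i<?n. L (coord_vect M c i p) * v i)" if "linear_fun (tangent M p) L" for L
   using M.linear_fun_expand[OF that c p(1) f(1)] by (simp add: f(2) mult.commute)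
  have "M.comb c v p = vzero"
  proof (rule vanish[OF p(2) f(1)])
   show "M.comb c v p x = 0" using ex[OF dx_linear] v(1) by (simp add: dx_coord[OF c p(1)] p(4))
   show "\<theta> p (M.comb c v p) = 0" using ex[OF \<theta>_linear[OF p(2)]] v(2) by (simp add: th_def p(5))
   have "vcoord e k (d\<pi> p (M.comb c v p)) = 0" if k: "k<d" for k
   proof -
    have "linear_fun (tangent M p) (%v. vcoord e k (d\<pi> p v))" by (simp add: linear_fun_def d\<pi>_linear B.vcoord_linear)
    from ex[OF this] show ?thesis using v(3)[OF k] by (simp add: dY[OF p(1,3) k] p(4))
   qed
   then show "d\<pi> p (M.comb c v p) = vzero" using B.tangent_eq_iff[OF e(1) p(3) d\<pi>_tangent[OF pp f(1)] B.vzero_tangent] by (simp add: B.vcoord_linear)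
  qed
  then show "\<forall>i<?n. v i = 0" using f(2) by (simp add: M.vcoord_linear)
 next
  fix j y assume j: "j<?n" and y: "y \<in> SS"
  obtain p where p: "p \<in> fst c" "p \<in> PP" "\<pi> p \<in> fst e" "y = snd c p" "chart_inv c y = p" using SSE[OF y] by (elim exE conjE) (rule that)
  have pp: "p \<in> pts M" by (rule PP_pts(1)[OF p(2)])
  note t = M.coord_vect_tangent[OF c p(1) j]
  note Jt = JA_tangent[OF pp t]
  have ex: "L (JA p (coord_vect M c j p)) = (\<Sum>i<?n. L (coord_vect M c i p)*endo_comp M JA c i j y)" if "linear_fun (tangent M p) L" for L
   using M.linear_fun_expand[OF that c p(1) Jt] by (simp add: p(4) M.endo_at[OF c p(1)] mult.commute)
  show "(\<Sum>i<?n. pd i ?x y*endo_comp M JA c i j y) = - h (?x y)*th j y"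
   using ex[OF dx_linear] JA_PP(1)[OF p(2) t] by (simp add: dx_coord[OF c p(1)] p(4)[symmetric] th_def p(5))
  show "(\<Sum>i<?n. th i y*endo_comp M JA c i j y) = pd j ?x y/h (?x y)"
   using ex[OF \<theta>_linear[OF p(2)]] JA_PP(2)[OF p(2) t] by (simp add: dx_coord[OF c p(1)] p(4)[symmetric] th_def p(5))
  fix k assume k: "k<d"
  have "linear_fun (tangent M p) (%v. vcoord e k (d\<pi> p v))" by (simp add: linear_fun_def d\<pi>_linear B.vcoord_linear)
  from ex[OF this] have "(\<Sum>i<?n. pd i (Y k) y*endo_comp M JA c i j y) = vcoord e k (base_J D (\<pi> p) (d\<pi> p (coord_vect M c j p)))"
   using JA_PP(3)[OF p(2) t] by (simp add: dY[OF p(1,3) k] p(4)[symmetric])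
  then show "(\<Sum>i<?n. pd i (Y k) y*endo_comp M JA c i j y) = (\<Sum>l<d. Jc e k l (?Y y)*pd j (Y l) y)"
   unfolding Yt[OF p(5,3)] J_coord[OF e(1) p(3) d\<pi>_tangent[OF pp t] k] by (simp add: dY[OF p(1,3)] p(4))
 qed
 have xp: "?x (snd c p0) = x p0" by (simp add: M.chart_inv_left[OF c p0(1)])
 show "scalar_loc (mdim M) (comp2 M gA c) (snd c p0) = S"
  using TF.total_scalar[OF p0S] ode[OF PP_pts(2)[OF p0(2)]] unfolding n xp by (simp add: SB_def t1_def[abs_def])
 show "parallel_loc (mdim M) (christoffel_loc (mdim M) (comp2 M gA c)) (endo_comp M JA c) i k j (snd c p0) = 0"
  if "i<mdim M" "k<mdim M" "j<mdim M" using TF.total_parallel[OF p0S] that unfolding n by blast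
qed

theorem total_kahler: "kahler M gA JA"
proof -
 have "almost_complex M JA" unfolding almost_complex_def using JA_endo JA_sq by blast
 moreover have "parallel_endo M gA JA" unfolding parallel_endo_loc
 proof (intro ballI allI impI)
  fix c y i j k assume c: "c \<in> atlas M" and y: "y \<in> snd c ` fst c" and ijk: "i<mdim M" "j<mdim M" "k<mdim M"
  obtain p where p: "p \<in> fst c" "y = snd c p" using y by blast
  have "parallel_loc (mdim M) (christoffel_loc (mdim M) (comp2 M gA c)) (endo_comp M JA c) i k j (snd c p) \<in> {0}"
  proof (rule dense[OF c _ closed_singleton _ p(1)])
   show "Cinf_on (mdim M) (M.cimg c) (parallel_loc (mdim M) (christoffel_loc (mdim M) (comp2 M gA c)) (endo_comp M JA c) i k j)"
    by (rule Cinf_parallel_loc[OF eo[OF c] M.metric_comp[OF gA_riemannian c] JA_smooth[OF c] ijk])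
  qed (use principal_calculus(2)[OF c] ijk in blast)
  then show "parallel_loc (mdim M) (christoffel_loc (mdim M) (comp2 M gA c)) (endo_comp M JA c) i k j y = 0" by (simp add: p(2))
 qed
 ultimately show ?thesis by (simp add: kahler_def M.manifold gA_riemannian JA_orthogonal)
qed

theorem total_scalar_curvature: "scalar_curvature_is M gA S" unfolding scalar_curvature_is_loc
proof (intro ballI)
 fix c y assume c: "c \<in> atlas M" and y: "y \<in> snd c ` fst c"
 obtain p where p: "p \<in> fst c" "y = snd c p" using y by blast
 have "scalar_loc (mdim M) (comp2 M gA c) (snd c p) \<in> {S}"
 proof (rule dense[OF c _ closed_singleton _ p(1)])
  show "Cinf_on (mdim M) (M.cimg c) (scalar_loc (mdim M) (comp2 M gA c))" by (rule Cinf_scalar_loc[OF eo[OF c] M.metric_comp[OF gA_riemannian c]])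
 qed (use principal_calculus(1)[OF c] in blast)
 then show "scalar_loc (mdim M) (comp2 M gA c) y = S" by (simp add: p(2))
qed

theorem total_normal_form: "normal_form D a h gA JA" unfolding normal_form_def Let_def
proof (intro conjI ballI allI impI)
 show "\<exists>H. smooth_fun real_mfd UNIV H & (\<forall>s\<ge>0. H s = h s)" using h_smooth smooth_fun_real_mfd by blast
 show "(h has_real_derivative 2) (at 0 within {0..})" by (rule has_field_derivative_at_within[OF h_D])
 show "0<warp D a s i" if "0 <= s" "i<m" for s i by (rule warp_pos[of s i a, OF that a_pos[OF that(2)]])
qed (use h_0 h_pos gA_PP JA_PP in auto)

end

section \<open>Invariance under the group\<close>

context toric_metric
begin

text \<open>x, the background tensors and \<open>g0\<close> are invariant. Comparing the normal form
  of \<open>g0\<close> at a point and at its image shows that the remaining term h0 \<theta>^2 is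
  invariant too, and \<open>kap\<close> occurs in \<open>gA\<close> only through products of two of
  its values.\<close>

lemma gA_invariant:
 assumes one: "construction_one D \<G> a0 g0 J0"
 shows "invariant_tensor (grp \<G>) M (act \<G>) gA"
proof -
 note c1 = one[unfolded construction_one_def Let_def]
 have facts: "lie_group (lie_mfd \<G>) (grp \<G>)" "smooth_action (lie_mfd \<G>) (grp \<G>) M (act \<G>)" "invariant_tensor (grp \<G>) M (act \<G>) g0"
  "smooth_action (lie_mfd \<G>) (grp \<G>) (base D) (base_act \<G>)" "\<forall>i<m. invariant_tensor (grp \<G>) (base D) (base_act \<G>) (bg D i)"
  "\<forall>p\<in>pts M. orbit (grp \<G>) (act \<G>) p = {p' \<in> pts M. x p' = x p}" "\<forall>k\<in>carrier (grp \<G>). \<forall>p\<in>pts M. (\<forall>t. act \<G> k (rot D t p) = rot D t (act \<G> k p)) &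
   \<pi> (act \<G> k p) = base_act \<G> k (\<pi> p)" using c1 by - (elim conjE, assumption)+
 show ?thesis unfolding invariant_tensor_def
 proof (intro ballI)
  fix k p v w assume k: "k \<in> carrier (grp \<G>)" and p: "p \<in> pts M" and v: "v \<in> tangent M p" and w: "w \<in> tangent M p"
  define \<sigma> where "\<sigma> = act \<G> k"
  define \<beta> where "\<beta> = base_act \<G> k"
  have kX: "k \<in> pts (lie_mfd \<G>)" and X: "manifold (lie_mfd \<G>)" using facts(1) k by (auto simp: lie_group_def)
  have \<sigma>: "smooth_map M M \<sigma>" unfolding \<sigma>_def using facts(2) by (intro action_slice[OF X M.manifold _ kX]) (simp add: smooth_action_def)
  have \<beta>: "smooth_map (base D) (base D) \<beta>" unfolding \<beta>_def using facts(4) by (intro action_slice[OF X B.manifold _ kX]) (simp add: smooth_action_def)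
  have \<sigma>p: "\<sigma> q \<in> pts M" "x (\<sigma> q) = x q" "\<pi> (\<sigma> q) = \<beta> (\<pi> q)" if q: "q \<in> pts M" for q
  proof -
   have "\<sigma> q \<in> orbit (grp \<G>) (act \<G>) q" using k by (auto simp: orbit_def \<sigma>_def)
   then show "\<sigma> q \<in> pts M" "x (\<sigma> q) = x q" using facts(6) q by auto
   show "\<pi> (\<sigma> q) = \<beta> (\<pi> q)" using facts(7) k q by (simp add: \<sigma>_def \<beta>_def)
  qed
  have pt: "push M \<sigma> p u \<in> tangent M (\<sigma> p)" if "u \<in> tangent M p" for u by (rule M.push_tangent[OF M.smooth_mfd_axioms \<sigma> p that])
  have open_M: "openin (mtop M) (pts M)" by simp
  have px: "push M \<sigma> p u x = u x" if u: "u \<in> tangent M p" for u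
   using x_smooth_at[OF \<sigma>p(1)[OF p]] M.tangent_local[OF u open_M p, of "%q. x (\<sigma> q)" x] \<sigma>p(2) by (simp add: push_def)
  have p\<pi>: "d\<pi> (\<sigma> p) (push M \<sigma> p u) = push (base D) \<beta> (\<pi> p) (d\<pi> p u)" if u: "u \<in> tangent M p" for u
  proof
   fix f
   show "d\<pi> (\<sigma> p) (push M \<sigma> p u) f = push (base D) \<beta> (\<pi> p) (d\<pi> p u) f"
   proof (cases "smooth_at (base D) (\<beta> (\<pi> p)) f")
    case True
    have 1: "smooth_at M (\<sigma> p) (%q. f (\<pi> q))" using M.smooth_at_map[OF B.smooth_mfd_axioms fibration(5) \<sigma>p(1)[OF p]] True by (simp add: \<sigma>p(3)[OF p])
    have 2: "smooth_at (base D) (\<pi> p) (%q. f (\<beta> q))" by (rule B.smooth_at_map[OF B.smooth_mfd_axioms \<beta> \<pi>_pts[OF p] True])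
    have "u (%q. f (\<pi> (\<sigma> q))) = u (%q. f (\<beta> (\<pi> q)))" by (rule M.tangent_local[OF u open_M p]) (simp add: \<sigma>p(3))
    then show ?thesis using True 1 2 by (simp add: d_proj_def push_def \<sigma>p(3)[OF p])
   qed (simp add: d_proj_def push_def \<sigma>p(3)[OF p])
  qed
  have bgi: "bg D i (\<pi> (\<sigma> p)) (d\<pi> (\<sigma> p) (push M \<sigma> p v)) (d\<pi> (\<sigma> p) (push M \<sigma> p w)) = bg D i (\<pi> p) (d\<pi> p v) (d\<pi> p w)" if i: "i<m" for i
   using facts(5)[rule_format, OF i] k \<pi>_pts[OF p] d\<pi>_tangent[OF p v] d\<pi>_tangent[OF p w]
   by (simp add: p\<pi>[OF v] p\<pi>[OF w] \<sigma>p(3)[OF p] invariant_tensor_def \<beta>_def)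
  have g0i: "g0 (\<sigma> p) (push M \<sigma> p v) (push M \<sigma> p w) = g0 p v w" using facts(3) k p v w by (simp add: invariant_tensor_def \<sigma>_def)
  have kk: "kap (\<sigma> p) (push M \<sigma> p v)*kap (\<sigma> p) (push M \<sigma> p w) = kap p v * kap p w"
  \<comment> \<open>The normal form is available only where x > 0; on the special orbit
    \<open>kap\<close> vanishes.\<close>
  proof (cases "x p = 0")
   case True
   then show ?thesis using kap_zero[OF p True v] kap_zero[OF \<sigma>p(1)[OF p] _ pt[OF v]] \<sigma>p(2)[OF p] by simp
  next
   case False
   then have xp: "0<x p" using x_nonneg[OF p] by simp
   then have P: "p \<in> PP" "\<sigma> p \<in> PP" using p \<sigma>p[OF p] by (auto simp: principal_part_def)
   have "h0 (x p)*\<theta> (\<sigma> p) (push M \<sigma> p v)*\<theta> (\<sigma> p) (push M \<sigma> p w) = h0 (x p)*\<theta> p v * \<theta> p w"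
    using g0i bgi by (simp add: form0_at(1)[OF P(1) v w] form0_at(1)[OF P(2) pt[OF v] pt[OF w]] \<sigma>p(2)[OF p] px[OF v] px[OF w] base_metric_def)
   then show ?thesis using h0_pos[OF xp]
    by (simp add: kap_PP[OF P(1) v] kap_PP[OF P(1) w] kap_PP[OF P(2) pt[OF v]] kap_PP[OF P(2) pt[OF w]] \<sigma>p(2)[OF p] mult_ac)
  qed
  have "gA (\<sigma> p) (push M \<sigma> p v) (push M \<sigma> p w) = gA p v w" using g0i bgi kk by (simp add: gA_def \<sigma>p(2)[OF p] px[OF v] px[OF w] mult.assoc)
  then show "gA (act \<G> k p) (push M (act \<G> k) p v) (push M (act \<G> k) p w) = gA p v w" by (simp add: \<sigma>_def)
 qed
qed

end

section \<open>Existence for given constants, and distinctness\<close>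

context toric_total
begin

text \<open>Here the choices are made: the profile solving the equation for \<open>S\<close>, then
  the two quotients that compare it with \<open>h0\<close>.\<close>

lemma ex_metric:
 assumes a: "!!i. i<m ==> 0<a i" and bk: "!!s. 0<s ==> base_kahler (warp D a s)" and S: "S <= 0"
 shows "\<exists>g J h. kahler M g J & normal_form D a h g J &
  (construction_one D \<G> a0 g0 J0 --> invariant_tensor (grp \<G>) M (act \<G>) g) & scalar_curvature_is M g S"
proof -
 obtain h where h: "smooth1 UNIV h" "h 0 = 0" "(h has_real_derivative 2) (at 0)" "!!s. 0<s ==> 0<h s"
  "!!s. 0<s ==> (\<Sum>i<m. real (dims D i)/(slope D i * s + a i)) - deriv (deriv h) s
   - deriv h s * (\<Sum>i<m. slope D i*real (dims D i)/(slope D i * s + a i))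
   - h s * ((\<Sum>i<m. slope D i*real (dims D i)/(slope D i * s + a i))\<^sup>2/4
       + deriv (%s. \<Sum>i<m. slope D i*real (dims D i)/(slope D i * s + a i)) s/2) = S"
  by (rule scalar_profile[of m "slope D" a S "dims D"]) (use slope a S in blast)+
 obtain H0 where H0: "smooth1 UNIV H0" "!!s. 0 <= s ==> H0 s = h0 s" using form0 by (auto simp: normal_form_def smooth_fun_real_mfd)
 have h00: "h0 0 = 0" "(h0 has_real_derivative 2) (at 0 within {0..})" using form0 by (auto simp: normal_form_def)
 obtain U F E where U: "open U" "{0..} \<subseteq> U" "smooth1 U F" "smooth1 U E"
  "!!s. 0<s ==> F s = 1/h s - 1/h0 s" "!!s. 0<s ==> E s = (h s - h0 s)/(h0 s)\<^sup>2"
  by (rule profile_quotients[OF h(1) refl h(2) has_field_derivative_at_within[OF h(3)] h(4) H0 h00 h0_pos]) (use that in blast)+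
 interpret toric_metric D a0 h0 g0 J0 a h U F E S by unfold_locales (use a h U bk in auto)
 show ?thesis using total_kahler total_normal_form gA_invariant total_scalar_curvature by blast
qed

text \<open>At a point with x = 1 both metrics are evaluated on a lift of a nonzero vector of the
  i-th summand. The other background tensors vanish on it, so the values are b_i + a_i and b_i +
  a'_i times the same nonzero number.\<close>

lemma normal_forms_distinct:
 assumes n: "normal_form D a h g J" and n': "normal_form D a' h' g' J'" and i: "i<m" "a i ~= a' i"
 shows "\<exists>p\<in>pts M. \<exists>v\<in>tangent M p. \<exists>w\<in>tangent M p. g p v w ~= g' p v w"
proof -
 have "(1::real) \<in> x ` pts M" unfolding fibration(3) by simp
 then obtain p where p: "p \<in> pts M" "x p = 1" by auto
 then have P: "p \<in> PP" by (simp add: principal_part_def)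
 let ?q = "\<pi> p"
 have q: "?q \<in> pts (base D)" by (rule \<pi>_pts[OF p(1)])
 obtain e where e: "base_summand D i ?q = {vsum (dims D i) (%a. vscale (c a) (e a)) | c. True}"
  "!!c. vsum (dims D i) (%a. vscale (c a) (e a)) = vzero ==> (\<forall>a<dims D i. c a = 0)" using base_facts(7)[OF q i(1)] unfolding has_dim_def by blast
 \<comment> \<open>The sum of the basis vectors, nonzero because the summand has positive
   dimension.\<close>
 define u where "u = vsum (dims D i) (%a. vscale 1 (e a))"
 have u: "u \<in> base_summand D i ?q" unfolding e(1) u_def by (intro CollectI exI[of _ "%_. 1"]) simp
 have un: "u ~= vzero" using e(2)[of "%_. 1"] base_facts(3)[OF i(1)] by (auto simp: u_def)
 have ut: "u \<in> tangent (base D) ?q" and u0: "!!j. j<m ==> j ~= i ==> bg D j ?q u u = 0" using u by (auto simp: base_summand_def)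
 have ui: "bg D i ?q u u ~= 0" using base_facts(8)[OF q ut] un u0 by metis
 obtain v where v: "v \<in> tangent M p" "v x = 0" "\<theta> p v = 0" "d\<pi> p v = u" by (rule lift_PP[OF P ut], rule that)
 have bm: "base_metric D A ?q u u = A i*bg D i ?q u u" for A
 proof -
  have "base_metric D A ?q u u = (\<Sum>j<m. (if i = j then 1 else 0)*(A i*bg D i ?q u u))" unfolding base_metric_def using u0 by (intro sum.cong) auto
  also have "... = A i*bg D i ?q u u" using i(1) by (intro sum_delta_left) auto
  finally show ?thesis .
 qed
 have "g p v v = warp D a 1 i*bg D i ?q u u" "g' p v v = warp D a' 1 i*bg D i ?q u u"
  using n n' P v by (simp_all add: normal_form_def Let_def p(2) bm)
 then have "g p v v ~= g' p v v" using ui i(2) by (simp add: warp_def)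
 then show ?thesis using p(1) v(1) by blast
qed

end

theorem theorem8p7:
  fixes D :: "('m, 'b) toric_data"
    and \<G> :: "('g, 'm, 'b) group_data"
    and \<P> :: "('n, 'b) product_data"
    and a0 :: "nat \<Rightarrow> real" and h0 :: "real \<Rightarrow> real"
    and g0 :: "'m tensor2" and J0 :: "'m endo"
    and S :: real
  assumes "fiberwise_kahler_toric D \<G> \<P> a0 h0 g0 J0"
    and "\<not> compact_space (mtop (total D))"
    and "\<forall>i<num D. 0 \<le> slope D i"
    and "S = 0 \<or> S = -1"
  shows "\<exists>g J h.
    (\<forall>a\<in>metric_parameters D \<P>.
       kahler (total D) (g a) (J a) \<and> normal_form D a (h a) (g a) (J a) \<and>
       (construction_one D \<G> a0 g0 J0 \<longrightarrow>
          invariant_tensor (grp \<G>) (total D) (act \<G>) (g a)) \<and>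
       scalar_curvature_is (total D) (g a) S) \<and>
    (\<forall>a\<in>metric_parameters D \<P>. \<forall>a'\<in>metric_parameters D \<P>. a \<noteq> a' \<longrightarrow>
       (\<exists>p\<in>pts (total D). \<exists>v\<in>tangent (total D) p. \<exists>w\<in>tangent (total D) p. g a p v w \<noteq> g a' p v w))"
proof -
 have tb: "toric_bundle D" and k0: "kahler (total D) g0 J0" and nf: "normal_form D a0 h0 g0 J0"
  and alt: "construction_one D \<G> a0 g0 J0 \<or> construction_two D \<P>" using assms(1) by (auto simp: fiberwise_kahler_toric_def)
 interpret toric_total D a0 h0 g0 J0 using tb k0 nf assms(3) by unfold_locales (auto simp: toric_bundle_def)
 have S: "S <= 0" using assms(4) by auto
 have pos: "0<a i" if "a \<in> metric_parameters D \<P>" "i<num D" for a i using that by (auto simp: metric_parameters_def)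
 have bk: "base_kahler (warp D a s)" if a: "a \<in> metric_parameters D \<P>" and s: "0<s" for a s
 proof -
  have w: "0<warp D a s i" if "i<num D" for i using warp_pos[of s i a] that pos[OF a that] s by simp
  show ?thesis
  proof (cases "construction_two D \<P>")
   case True
   then show ?thesis by (rule base_kahler_two) (rule w)
  next
   case False
   then have "construction_one D \<G> a0 g0 J0" "closed_2form (base D) (base_form D a)" using alt a by (auto simp: metric_parameters_def)
   from base_kahler_one[OF this(1) _ this(2) w] show ?thesis using warp0_pos by simp
  qed
 qed
 let ?P = "%a g J h. kahler (total D) g J & normal_form D a h g J &
  (construction_one D \<G> a0 g0 J0 --> invariant_tensor (grp \<G>) (total D) (act \<G>) g) & scalar_curvature_is (total D) g S"
 \<comment> \<open>Metric, complex structure and profile are packed into one triple, so that a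
   single choice over all \<open>a\<close> suffices.\<close>
 have "\<forall>a\<in>metric_parameters D \<P>. \<exists>z. ?P a (fst z) (fst (snd z)) (snd (snd z))"
 proof
  fix a assume a: "a \<in> metric_parameters D \<P>"
  have "\<exists>g J h. ?P a g J h" by (rule ex_metric[OF _ _ S]) (rule pos[OF a] bk[OF a]; assumption)+
  then obtain g J h where "?P a g J h" by (elim exE) (rule that)
  then show "\<exists>z. ?P a (fst z) (fst (snd z)) (snd (snd z))" by (intro exI[of _ "(g, J, h)"]) simp
 qed
 then obtain z where z: "\<forall>a\<in>metric_parameters D \<P>. ?P a (fst (z a)) (fst (snd (z a))) (snd (snd (z a)))" by (rule bchoice[THEN exE])
 have dist: "\<exists>p\<in>pts (total D). \<exists>v\<in>tangent (total D) p. \<exists>w\<in>tangent (total D) p. fst (z a) p v w ~= fst (z a') p v w"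
  if a: "a \<in> metric_parameters D \<P>" "a' \<in> metric_parameters D \<P>" "a ~= a'" for a a'
 proof -
  \<comment> \<open>Parameters are extensional functions, so two different ones differ at an index
    below \<open>num D\<close>.\<close>
  have "\<exists>i<num D. a i ~= a' i"
  proof (rule ccontr)
   assume "\<not> (\<exists>i<num D. a i ~= a' i)"
   then have eq: "a i = a' i" if "i \<in> {..<num D}" for i using that by simp
   have "a \<in> {..<num D} \<rightarrow>\<^sub>E {0<..}" "a' \<in> {..<num D} \<rightarrow>\<^sub>E {0<..}" using a(1,2) by (simp_all add: metric_parameters_def)
   then have "a = a'" using eq by (rule PiE_ext)
   then show False using a(3) by blast
  qed
  then obtain i where i: "i<num D" "a i ~= a' i" by blast
  have "normal_form D a (snd (snd (z a))) (fst (z a)) (fst (snd (z a)))" "normal_form D a' (snd (snd (z a'))) (fst (z a')) (fst (snd (z a')))"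
   using z[rule_format, OF a(1)] z[rule_format, OF a(2)] by simp_all
  then show ?thesis using i by (rule normal_forms_distinct)
 qed
 show ?thesis by (rule exI[of _ "%a. fst (z a)"], rule exI[of _ "%a. fst (snd (z a))"], rule exI[of _ "%a. snd (snd (z a))"], rule conjI[OF z])
   (use dist in simp)
qed

end
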